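(* For every integer $n\ge 0$ and each of the following six cases, the number of partitions of $n$ satisfying the stated restrictions equals the number of partitions of $n$ all of whose parts are congruent modulo $12$ to one of the listed residues. (Case $I_{5a}$) Restrictions: satisfies Condition (2) and avoids $1+2+2$. Residues: $1,2,5,6,8,9,11$. (Case $I_{6a}$) Restrictions: satisfies Condition (1) and avoids $2$ (no part equals $2$). Residues: $1,4,5,6,7,9,10$. (Case 7) Restrictions: avoids $1+1$, $2+2+2$, $P_2$, $P_3$, $P_4$, $P_5$, $P_9$. Residues: $1,3,4,6,8,9,11$. (Case 7a) Restrictions: each part is $\ge 3$, and avoids $P_2$, $P_3$, $P_4$, $P_5$, $P_9$. Residues: $3,4,5,6,7,8,9$. (Case 8) Restrictions: avoids $1$ (no part equals $1$), $P_1$, $P_2$, $P_7$, $P_8$, $P_{11}$. Residues: $2,3,4,5,8,9,11$. (Case 8a) Restrictions: avoids $1+1$, $1+2+3$, $2+2+3$, $P_1$, $P_3$, $P_6$, $P_8$, $P_{10}$. Residues: $1,3,4,7,8,9,10$.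
   Context: A partition of $n$ is a finite weakly increasing sequence of positive integers $1\le\lambda_1\le\lambda_2\le\cdots\le\lambda_s$ (its parts) with $\sum_{j=1}^s\lambda_j=n$, written $\lambda_1+\lambda_2+\cdots+\lambda_s$ (the empty partition is the unique partition of $0$). For $r\in\{0,1,2\}$, a partition $\lambda_1+\cdots+\lambda_s$ satisfies Condition $(r)$ if $\lambda_{t+3}-\lambda_t\ge 3$ for all $t$ for which these parts exist, and $\lambda_t+\lambda_{t+1}+\lambda_{t+2}\equiv r\pmod 3$ whenever $\lambda_{t+2}-\lambda_t\le 1$. A subpartition is a contiguous block $\lambda_t+\lambda_{t+1}+\cdots+\lambda_{t+m}$ of parts of the partition (in weakly increasing order). A partition avoids a given pattern such as $1+2+2$ if no contiguous block of its parts equals that pattern; it avoids a family $P_m$ if it avoids every pattern in the family. The families are, with $r$ ranging over all positive integers: $P_1: r+r+r$; $P_2: r+r+(r+1)$; $P_3: r+(r+1)+(r+1)$; $P_4: r+r+r+r$; $P_5: r+r+r+(r+2)$; $P_6: r+r+(r+1)+(r+2)$; $P_7: r+(r+1)+(r+2)+(r+2)$; $P_8: r+(r+1)+(r+2)+(r+3)$; $P_9: r+(r+2)+(r+2)+(r+2)$; $P_{10}: r+r+(r+2)+(r+2)+(r+3)$; $P_{11}: r+(r+1)+(r+1)+(r+3)+(r+3)$. *)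

theory Defs
  imports Main "HOL-Library.Sublist" "HOL-Number_Theory.Cong"
begin

text \<open>
  Partitions are lists of positive parts in weakly increasing order. Positions in a list start
  at 0, so that \<open>p ! t\<close> is the part written $\lambda_{t+1}$ with indices starting at 1.
\<close>

definition partitions_of :: "nat \<Rightarrow> nat list set" where
  "partitions_of n = {p. sorted p \<and> (\<forall>x\<in>set p. 1 \<le> x) \<and> sum_list p = n}"

lemma finite_partitions_of: "finite (partitions_of n)"
proof (rule finite_subset)
  have "length p \<le> sum_list p" if "\<forall>x\<in>set p. 1 \<le> x" for p :: "nat list"
    using that by (induction p) auto
  then show "partitions_of n \<subseteq> {p. set p \<subseteq> {..n} \<and> length p \<le> n}"
    by (auto simp: partitions_of_def dest: member_le_sum_list)
  show "finite {p. set p \<subseteq> {..n} \<and> length p \<le> n}"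
    by (rule finite_lists_length_le) simp
qed

text \<open>
  For a sorted list the two inequalities below say that the differences
  \<open>p ! (t + 3) - p ! t\<close> and \<open>p ! (t + 2) - p ! t\<close> are at least 3 and at most 1, respectively;
  they are written without the truncating subtraction on \<^typ>\<open>nat\<close>.
\<close>

definition satisfies_condition :: "nat \<Rightarrow> nat list \<Rightarrow> bool" where
  "satisfies_condition r p \<longleftrightarrow>
     (\<forall>t. t + 3 < length p \<longrightarrow> p ! t + 3 \<le> p ! (t + 3)) \<and>
     (\<forall>t. t + 2 < length p \<longrightarrow> p ! (t + 2) \<le> p ! t + 1 \<longrightarrow>
            [p ! t + p ! (t + 1) + p ! (t + 2) = r] (mod 3))"

text \<open>\<^const>\<open>sublist\<close> is the relation of being a contiguous block.\<close>

definition avoids :: "nat list \<Rightarrow> nat list \<Rightarrow> bool" where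
  "avoids p w \<longleftrightarrow> \<not> sublist w p"

definition avoids_family :: "nat list \<Rightarrow> nat list set \<Rightarrow> bool" where
  "avoids_family p W \<longleftrightarrow> (\<forall>w\<in>W. avoids p w)"

definition P1 :: "nat list set" where "P1 = {[r, r, r] | r. 1 \<le> r}"
definition P2 :: "nat list set" where "P2 = {[r, r, r + 1] | r. 1 \<le> r}"
definition P3 :: "nat list set" where "P3 = {[r, r + 1, r + 1] | r. 1 \<le> r}"
definition P4 :: "nat list set" where "P4 = {[r, r, r, r] | r. 1 \<le> r}"
definition P5 :: "nat list set" where "P5 = {[r, r, r, r + 2] | r. 1 \<le> r}"
definition P6 :: "nat list set" where "P6 = {[r, r, r + 1, r + 2] | r. 1 \<le> r}"
definition P7 :: "nat list set" where "P7 = {[r, r + 1, r + 2, r + 2] | r. 1 \<le> r}"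
definition P8 :: "nat list set" where "P8 = {[r, r + 1, r + 2, r + 3] | r. 1 \<le> r}"
definition P9 :: "nat list set" where "P9 = {[r, r + 2, r + 2, r + 2] | r. 1 \<le> r}"
definition P10 :: "nat list set" where "P10 = {[r, r, r + 2, r + 2, r + 3] | r. 1 \<le> r}"
definition P11 :: "nat list set" where "P11 = {[r, r + 1, r + 1, r + 3, r + 3] | r. 1 \<le> r}"

definition count_restricted :: "(nat list \<Rightarrow> bool) \<Rightarrow> nat \<Rightarrow> nat" where
  "count_restricted R n = card {p \<in> partitions_of n. R p}"

definition count_residues_mod12 :: "nat set \<Rightarrow> nat \<Rightarrow> nat" where
  "count_residues_mod12 S n =
     card {p \<in> partitions_of n. \<forall>x\<in>set p. \<exists>s\<in>S. [x = s] (mod 12)}"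

end

theory Submission
  imports Defs "HOL-Analysis.Analysis" "HOL-Computational_Algebra.Formal_Power_Series"
begin

text \<open>
  Removing the copies of 1 from a partition and subtracting 1 from the other parts turns the
  pattern conditions into a finite system of \<open>q\<close>-difference equations. Each solution is the
  value of the functional \<open>z\<^sup>n \<mapsto> q\<^bsup>n(n+1)/2\<^esup>\<close> on a product of \<open>q\<close>-exponentials times a polynomial.
  For \<open>0 < q < 1/2\<close> these values are evaluated as infinite products: by a first
  order recurrence (8, 8a), by creative telescoping and a Bailey-type sum (5a, 6a), and by a second
  order recurrence whose recessive solution is a difference of two triple products, made
  explicit by the quintuple product identity (7, 7a). Equality of the two power series
  on an interval then gives equality of the coefficients.
\<close>

section \<open>q-products\<close>

text \<open>The normalization is what makes the systems solvable. The coefficient of z^n is the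
  weight of the partitions with n parts, divided by q^(n(n+1)/2). Removing i ones then acts as z^i
  times the dilation z \<mapsto> q^(1-i) z, so exactly one removed 1 acts without any dilation.
  Elimination therefore ends in an equation of first order, whose solution is a product, and the
  functional undoes the normalization. Dilations by 1/q, divisions by powers of q and several limits
  occur on the way, so q is a real number and not a formal variable. The bound 1/2 lets the sum over
  all compositions converge, a crude majorant for every class of partitions, and it gives 1/(q;q)_n
  \<le> 2^n. The square root of 3 in the cases 7 and 7a comes from 1 - y^2 + y^4 = (1 + sqrt 3 y +
  y^2)(1 - sqrt 3 y + y^2), a coefficient of their recurrence whose zeros are the primitive twelfth
  roots of unity. The two solutions attached to the two factors grow; only their difference stays
  bounded.\<close>

lemma has_sum_fibres:
  fixes f :: "'a \<Rightarrow> real" and \<phi> :: "'a \<Rightarrow> 'b"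
  assumes "(f has_sum s) A" "\<And>n. (f has_sum g n) {x \<in> A. \<phi> x = n}"
  shows "(g has_sum s) UNIV"
proof -
  let ?S = "Sigma UNIV (\<lambda>n. {x \<in> A. \<phi> x = n})"
  have b: "bij_betw snd ?S A"
    by (rule bij_betwI[where g = "\<lambda>x. (\<phi> x, x)"]) auto
  have "((\<lambda>p. f (snd p)) has_sum s) ?S"
    using assms(1) has_sum_reindex_bij_betw[OF b, of f s] by simp
  then have "((\<lambda>(n, x). f x) has_sum s) ?S"
    by (simp add: case_prod_beta')
  from has_sum_Sigma'[OF this] show ?thesis
    using assms(2) by auto
qed

lemma summable_on_pairs_geometric:
  fixes F :: "nat \<times> nat \<Rightarrow> real"
  assumes "\<And>i j. \<bar>F (i, j)\<bar> \<le> C * r ^ i * r ^ j" "0 \<le> r" "r < 1" "0 \<le> C"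
  shows "F summable_on UNIV"
proof -
  have g: "summable (\<lambda>i. r ^ i)" using assms by (simp add: summable_geometric)
  have "(\<lambda>(i, j). C * r ^ i * r ^ j) summable_on UNIV \<times> UNIV"
  proof (rule summable_on_SigmaI[where g = "\<lambda>i. C * r ^ i * (1 / (1 - r))"])
    fix i :: nat
    have "(\<lambda>j. C * r ^ i * r ^ j) sums (C * r ^ i * (1 / (1 - r)))"
      using assms by (intro sums_mult geometric_sums) auto
    then show "((\<lambda>j. case (i, j) of (i, j) \<Rightarrow> C * r ^ i * r ^ j) has_sum C * r ^ i * (1 / (1 - r))) UNIV"
      using assms by (auto intro!: sums_nonneg_imp_has_sum)
    have "summable (\<lambda>i. C * r ^ i * (1 / (1 - r)))"
      by (intro summable_mult2 summable_mult g)
    then show "(\<lambda>i. C * r ^ i * (1 / (1 - r))) summable_on UNIV"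
      using assms by (intro norm_summable_imp_summable_on) (auto simp: abs_mult)
  qed (use assms in auto)
  then have "(\<lambda>x. norm (F x)) summable_on UNIV"
    unfolding UNIV_Times_UNIV by (rule summable_on_comparison_test) (use assms(1) in auto)
  then show ?thesis by (rule abs_summable_summable)
qed

subsection \<open>Infinite q-shifted factorials\<close>

definition qpoch :: "'a::field \<Rightarrow> 'a \<Rightarrow> nat \<Rightarrow> 'a" where
  "qpoch a b n = (\<Prod>i<n. 1 - a * b ^ i)"

definition qinf :: "'a::{real_normed_field,banach,heine_borel} \<Rightarrow> 'a \<Rightarrow> 'a" where
  "qinf a b = prodinf (\<lambda>i. 1 - a * b ^ i)"

lemma qpoch_0 [simp]: "qpoch a b 0 = 1"
  and qpoch_Suc: "qpoch a b (Suc n) = qpoch a b n * (1 - a * b ^ n)"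
  by (simp_all add: qpoch_def)

lemma qpoch_shift: "qpoch a b (Suc n) = (1 - a) * qpoch (a * b) b n"
  unfolding qpoch_def prod.lessThan_Suc_shift by (simp add: mult.assoc)

lemma convergent_prod_q:
  fixes a b :: "'a::{real_normed_field,banach,heine_borel}"
  assumes "norm b < 1"
  shows "convergent_prod (\<lambda>i. 1 - a * b ^ i)"
proof -
  have "summable (\<lambda>i. norm ((1 - a * b ^ i) - 1))"
    using assms by (simp add: norm_mult norm_power summable_mult summable_geometric)
  then show ?thesis
    by (intro abs_convergent_prod_imp_convergent_prod summable_imp_abs_convergent_prod)
qed

lemma qpoch_LIMSEQ:
  fixes a b :: "'a::{real_normed_field,banach,heine_borel}"
  assumes "norm b < 1"
  shows "qpoch a b \<longlonglongrightarrow> qinf a b"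
  using convergent_prod_LIMSEQ[OF convergent_prod_q[OF assms, of a]]
  unfolding qpoch_def [abs_def] qinf_def by (simp add: LIMSEQ_lessThan_iff_atMost)

lemma qinf_eqI:
  fixes a b :: "'a::{real_normed_field,banach,heine_borel}"
  assumes "norm b < 1" "qpoch a b \<longlonglongrightarrow> L"
  shows "qinf a b = L"
  using LIMSEQ_unique qpoch_LIMSEQ assms by blast

lemma qinf_rec:
  fixes a b :: "'a::{real_normed_field,banach,heine_borel}"
  assumes "norm b < 1"
  shows "qinf a b = (1 - a) * qinf (a * b) b"
proof -
  have "(\<lambda>n. qpoch a b (Suc n)) \<longlonglongrightarrow> (1 - a) * qinf (a * b) b"
    unfolding qpoch_shift by (intro tendsto_intros qpoch_LIMSEQ assms)
  then show ?thesis by (intro qinf_eqI assms) (rule LIMSEQ_imp_Suc)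
qed

lemma qinf_iterate:
  fixes a b :: "'a::{real_normed_field,banach,heine_borel}"
  assumes "norm b < 1"
  shows "qinf a b = qpoch a b n * qinf (a * b ^ n) b"
proof (induction n)
  case (Suc n)
  show ?case
    using Suc qinf_rec[OF assms, of "a * b ^ n"] by (simp add: qpoch_Suc mult_ac)
qed simp

lemma qinf_nonzero:
  fixes a b :: "'a::{real_normed_field,banach,heine_borel}"
  assumes "norm b < 1" "\<And>i. a * b ^ i \<noteq> 1"
  shows "qinf a b \<noteq> 0"
  unfolding qinf_def using prodinf_nonzero[OF convergent_prod_q[OF assms(1)]] assms(2) by force

text \<open>Sorting the exponents by their residue modulo \<open>r\<close> splits the product into
  \<open>r\<close> products in base \<open>b ^ r\<close>. In this way all answers are finally
  written in base \<open>q ^ 12\<close>.\<close>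

lemma qinf_dissect:
  fixes a b :: "'a::{real_normed_field,banach,heine_borel}"
  assumes "norm b < 1" "0 < r"
  shows "qinf a b = (\<Prod>j<r. qinf (a * b ^ j) (b ^ r))"
proof -
  have eq: "qpoch a b (r * n) = (\<Prod>j<r. qpoch (a * b ^ j) (b ^ r) n)" for n
  proof (induction n)
    case (Suc n)
    have "qpoch a b (r * n + k) = qpoch a b (r * n) * (\<Prod>j<k. 1 - a * b ^ (r * n + j))" for k
      by (induction k) (simp_all add: qpoch_Suc mult.assoc)
    from this[of r] have "qpoch a b (r * Suc n) = qpoch a b (r * n) * (\<Prod>j<r. 1 - a * b ^ (r * n + j))"
      by (simp add: add.commute)
    moreover have "a * b ^ (r * n + j) = a * b ^ j * (b ^ r) ^ n" for j
      by (metis power_add power_mult mult.assoc mult.commute)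
    ultimately show ?case
      by (simp only: Suc qpoch_Suc prod.distrib)
  qed simp
  have b: "norm (b ^ r) < 1"
    using assms by (simp add: norm_power power_less_one_iff)
  have "(\<lambda>n. qpoch a b (r * n)) \<longlonglongrightarrow> (\<Prod>j<r. qinf (a * b ^ j) (b ^ r))"
    unfolding eq by (intro tendsto_prod qpoch_LIMSEQ b)
  moreover have "(\<lambda>n. qpoch a b (r * n)) \<longlonglongrightarrow> qinf a b"
    using LIMSEQ_subseq_LIMSEQ[OF qpoch_LIMSEQ[OF assms(1), of a], of "\<lambda>n. r * n"] assms(2)
    by (simp add: o_def strict_mono_def)
  ultimately show ?thesis by (rule LIMSEQ_unique[rotated])
qed

text \<open>Factorwise (1 - x)(1 + x) = 1 - x^2; this later removes the negative arguments that
  Euler's expansion leaves behind.\<close>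

lemma qinf_mult_minus:
  fixes a b :: "'a::{real_normed_field,banach,heine_borel}"
  assumes "norm b < 1"
  shows "qinf a b * qinf (- a) b = qinf (a\<^sup>2) (b\<^sup>2)"
proof -
  have "qpoch a b n * qpoch (- a) b n = qpoch (a\<^sup>2) (b\<^sup>2) n" for n
    by (simp add: qpoch_def flip: prod.distrib)
       (intro prod.cong refl, simp add: algebra_simps power2_eq_square flip: power_mult_distrib)
  moreover have "(\<lambda>n. qpoch a b n * qpoch (- a) b n) \<longlonglongrightarrow> qinf a b * qinf (- a) b"
    by (intro tendsto_intros qpoch_LIMSEQ assms)
  ultimately have "qpoch (a\<^sup>2) (b\<^sup>2) \<longlonglongrightarrow> qinf a b * qinf (- a) b" by simp
  moreover have "norm (b\<^sup>2) < 1" using assms by (simp add: norm_power abs_square_less_1)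
  ultimately show ?thesis using qinf_eqI by metis
qed

lemma qinf_real_pos:
  fixes a b :: real
  assumes "0 \<le> b" "b < 1" "a < 1"
  shows "0 < qinf a b"
proof -
  have "a * b ^ i < 1" for i
  proof (cases "a \<le> 0")
    case True
    then show ?thesis using assms by (smt (verit) mult_nonpos_nonneg zero_le_power)
  next
    case False
    then have "a * b ^ i \<le> a * 1" using assms by (intro mult_left_mono power_le_one) auto
    then show ?thesis using assms by simp
  qed
  then have pos: "0 < 1 - a * b ^ i" for i by (simp add: algebra_simps)
  have "qinf a b \<noteq> 0" using assms pos by (intro qinf_nonzero) (simp_all add: less_imp_neq)
  moreover have "0 \<le> qpoch a b n" for n
    unfolding qpoch_def using pos by (intro prod_nonneg) (auto intro: less_imp_le)
  then have "0 \<le> qinf a b"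
    by (intro LIMSEQ_le_const[OF qpoch_LIMSEQ]) (use assms in auto)
  ultimately show ?thesis by simp
qed

lemma qpoch_self_nonzero:
  fixes b :: "'a::{real_normed_field,banach,heine_borel}"
  assumes "norm b < 1"
  shows "qpoch b b n \<noteq> 0"
proof -
  have "b ^ Suc i \<noteq> 1" for i
    using assms by (metis norm_one norm_power power_less_one_iff norm_ge_zero less_irrefl zero_less_Suc)
  then show ?thesis by (auto simp: qpoch_def)
qed


section \<open>Triangular numbers and Euler's expansion\<close>

primrec tri :: "nat \<Rightarrow> nat" where
  "tri 0 = 0"
| "tri (Suc n) = tri n + Suc n"

lemma tri_add: "tri (m + n) = tri m + tri n + m * n"
  by (induction n) auto

text \<open>Euler's expansion of (ab;b)_inf. The coefficient recurrence \<open>c_Suc\<close> says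
  that the power series satisfies E(x) = (1 - x b) E(x b); iterating towards 0 produces the finite
  products, and continuity at 0 leaves E(0) = 1.\<close>

lemma euler_sums:
  fixes a b :: "'a::{real_normed_field,banach,heine_borel}"
  assumes b: "norm b < 1"
  shows "(\<lambda>n. (- a) ^ n * b ^ tri n / qpoch b b n) sums qinf (a * b) b"
    and "summable (\<lambda>n. norm ((- a) ^ n * b ^ tri n / qpoch b b n))"
    and "((\<lambda>a. qinf (a * b) b) has_field_derivative (- b / (1 - b))) (at 0)"
proof -
  define c where "c n = (- 1) ^ n * b ^ tri n / qpoch b b n" for n
  have nz: "1 - b ^ Suc n \<noteq> 0" for n
    using qpoch_self_nonzero[OF b, of "Suc n"] by (auto simp: qpoch_Suc)
  have c_Suc: "c (Suc n) * (1 - b ^ Suc n) = - c n * b ^ Suc n" for n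
  proof -
    have "qpoch b b (Suc n) = qpoch b b n * (1 - b ^ Suc n)" by (simp add: qpoch_Suc)
    then show ?thesis using nz[of n] unfolding c_def tri.simps power_add by simp
  qed
  have summ: "summable (\<lambda>n. norm (c n * x ^ n))" for x
  proof -
    have "(\<lambda>n. norm x * norm b ^ Suc n / (1 - norm b)) \<longlonglongrightarrow> norm x * 0 / (1 - norm b)"
      using b by (intro tendsto_intros LIMSEQ_Suc[OF LIMSEQ_power_zero]) auto
    then have "eventually (\<lambda>n. norm x * norm b ^ Suc n / (1 - norm b) < 1 / 2) sequentially"
      by (rule order_tendstoD) simp
    then obtain N where N: "\<And>n. n \<ge> N \<Longrightarrow> norm x * norm b ^ Suc n / (1 - norm b) < 1 / 2"
      by (auto simp: eventually_sequentially)
    show ?thesis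
    proof (rule summable_ratio_test[where c = "1 / 2" and N = N])
      fix n assume "n \<ge> N"
      have "1 - norm b \<le> norm (1 - b ^ Suc n)"
      proof -
        have "norm (b ^ Suc n) \<le> norm b"
          using b by (simp add: norm_mult norm_power mult_left_le power_le_one)
        then show ?thesis using norm_triangle_ineq2[of 1 "b ^ Suc n"] by simp
      qed
      then have *: "norm b ^ Suc n / norm (1 - b ^ Suc n) \<le> norm b ^ Suc n / (1 - norm b)"
        using b by (intro divide_left_mono mult_pos_pos) auto
      have "c (Suc n) = - c n * b ^ Suc n / (1 - b ^ Suc n)"
        using c_Suc[of n] nz[of n] by (simp add: field_simps)
      then have "norm (c (Suc n) * x ^ Suc n) = norm (c n * x ^ n) * (norm x * (norm b ^ Suc n / norm (1 - b ^ Suc n)))"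
        by (simp add: norm_mult norm_divide norm_power mult_ac del: power_Suc) simp
      also have "\<dots> \<le> norm (c n * x ^ n) * (norm x * (norm b ^ Suc n / (1 - norm b)))"
        using * by (intro mult_left_mono) auto
      also have "\<dots> \<le> norm (c n * x ^ n) * (1 / 2)"
        using N[OF \<open>n \<ge> N\<close>] by (intro mult_left_mono) auto
      finally show "norm (norm (c (Suc n) * x ^ Suc n)) \<le> 1 / 2 * norm (norm (c n * x ^ n))" by simp
    qed simp
  qed
  define E where "E x = (\<Sum>n. c n * x ^ n)" for x
  have sm: "summable (\<lambda>n. c n * x ^ n)" for x by (rule summable_norm_cancel[OF summ])
  have step: "E x = (1 - x * b) * E (x * b)" for x
  proof -
    have "E x - E (x * b) = (\<Sum>n. c n * x ^ n * (1 - b ^ n))"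
      unfolding E_def by (subst suminf_diff[OF sm sm]) (simp add: algebra_simps power_mult_distrib)
    also have "\<dots> = (\<Sum>n. c (Suc n) * x ^ Suc n * (1 - b ^ Suc n)) + c 0 * x ^ 0 * (1 - b ^ 0)"
    proof -
      have "summable (\<lambda>n. c n * x ^ n * (1 - b ^ n))"
        using summable_diff[OF sm[of x] sm[of "x * b"]] by (simp add: algebra_simps power_mult_distrib)
      from suminf_split_head[OF this] show ?thesis by simp
    qed
    also have "(\<lambda>n. c (Suc n) * x ^ Suc n * (1 - b ^ Suc n)) = (\<lambda>n. - (x * b) * (c n * (x * b) ^ n))"
    proof
      fix n show "c (Suc n) * x ^ Suc n * (1 - b ^ Suc n) = - (x * b) * (c n * (x * b) ^ n)"
        using arg_cong[OF c_Suc[of n], of "\<lambda>y. y * x ^ Suc n"] by (simp add: power_mult_distrib mult_ac)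
    qed
    also have "(\<Sum>n. - (x * b) * (c n * (x * b) ^ n)) = - (x * b) * E (x * b)"
      unfolding E_def by (rule suminf_mult[OF sm])
    finally show ?thesis by (simp add: algebra_simps)
  qed
  have it: "E x = qpoch (x * b) b n * E (x * b ^ n)" for x n
    by (induction n) (simp_all add: qpoch_Suc step[of "x * b ^ _"] mult_ac)
  have "isCont E 0"
    unfolding E_def [abs_def] by (rule isCont_powser[OF sm[of 1]]) simp
  moreover have "(\<lambda>n. a * b ^ n) \<longlonglongrightarrow> 0" for a
    using tendsto_mult[OF tendsto_const LIMSEQ_power_zero[OF b]] by simp
  ultimately have "(\<lambda>n. E (a * b ^ n)) \<longlonglongrightarrow> E 0" for a by (rule isCont_tendsto_compose)
  then have "(\<lambda>n. qpoch (a * b) b n * E (a * b ^ n)) \<longlonglongrightarrow> qinf (a * b) b * E 0" for a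
    by (intro tendsto_intros qpoch_LIMSEQ b)
  then have "E a = qinf (a * b) b * E 0" for a
    unfolding it[symmetric] by (rule LIMSEQ_unique[OF tendsto_const])
  moreover have "E 0 = 1"
    unfolding E_def by (subst powser_zero) (simp add: c_def)
  ultimately have E: "E a = qinf (a * b) b" for a by simp
  have eq: "c n * a ^ n = (- a) ^ n * b ^ tri n / qpoch b b n" for n
    by (simp add: c_def power_minus[of a] mult_ac)
  show "(\<lambda>n. (- a) ^ n * b ^ tri n / qpoch b b n) sums qinf (a * b) b"
    using summable_sums[OF sm[of a]] E[of a] unfolding E_def eq by simp
  show "summable (\<lambda>n. norm ((- a) ^ n * b ^ tri n / qpoch b b n))"
    using summ[of a] by (simp only: eq)
  have "(E has_field_derivative (\<Sum>n. diffs c n * 0 ^ n)) (at 0)"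
    unfolding E_def [abs_def] by (rule termdiffs_strong[OF sm[of 1]]) simp
  moreover have "(\<Sum>n. diffs c n * 0 ^ n) = - b / (1 - b)"
    unfolding powser_zero by (simp add: diffs_def c_def qpoch_Suc)
  ultimately show "((\<lambda>a. qinf (a * b) b) has_field_derivative (- b / (1 - b))) (at 0)"
    using E by (metis (no_types, lifting) DERIV_cong_ev eventually_sequentiallyI E ext)
qed

unbundle no vec_syntax
unbundle fps_syntax

section \<open>Partitions with forbidden patterns\<close>

definition sc :: "real \<Rightarrow> real fps \<Rightarrow> real fps" where
  "sc b f = Abs_fps (\<lambda>n. b ^ n * f $ n)"

lemma sc_nth [simp]: "sc b f $ n = b ^ n * f $ n"
  by (simp add: sc_def)

lemma sc_add: "sc b (f + g) = sc b f + sc b g"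
  and sc_diff: "sc b (f - g) = sc b f - sc b g"
  and sc_minus: "sc b (- f) = - sc b f"
  by (simp_all add: fps_eq_iff algebra_simps)

lemma sc_const [simp]: "sc b (fps_const c) = fps_const c"
  by (simp add: fps_eq_iff)

lemma sc_0 [simp]: "sc b 0 = 0" by (simp add: fps_eq_iff)

lemma sc_1 [simp]: "sc b 1 = 1"
  by (simp add: fps_eq_iff)

lemma sc_X [simp]: "sc b fps_X = fps_const b * fps_X"
  by (auto simp: fps_eq_iff le_Suc_eq)

lemma sc_mult: "sc b (f * g) = sc b f * sc b g"
  by (simp add: fps_eq_iff fps_mult_nth sum_distrib_left mult_ac flip: power_add)

lemma sc_power: "sc b (f ^ n) = sc b f ^ n"
  by (induction n) (simp_all add: sc_mult)

lemma sc_sc [simp]: "sc a (sc b f) = sc (a * b) f"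
  by (simp add: fps_eq_iff power_mult_distrib mult.assoc)

lemma sc_one [simp]: "sc 1 f = f"
  by (simp add: fps_eq_iff)

section \<open>Transitions between sets of forbidden initial segments when the ones are
  removed\<close>

definition Par :: "nat list set" where
  "Par = {p. sorted p \<and> (\<forall>x\<in>set p. 1 \<le> x)}"

text \<open>A family indexed by r is encoded by the offsets from its first part, so
  \<open>[0,0,1]\<close> stands for r + r + (r + 1). The recursion tests every suffix with r equal
  to its head.\<close>

fun good :: "nat list list \<Rightarrow> nat list \<Rightarrow> bool" where
  "good P [] = True"
| "good P (x # p) = ((\<forall>w\<in>set P. \<not> prefix (map ((+) x) w) (x # p)) \<and> good P p)"

text \<open>The unknowns of the finite system. The patterns in \<open>P\<close> are translation
  invariant and survive the removal of the ones; \<open>W\<close> holds forbidden initial segments,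
  the only place where the removed ones leave a trace.\<close>

definition St :: "nat list list \<Rightarrow> nat list list \<Rightarrow> nat list set" where
  "St P W = {p \<in> Par. good P p \<and> (\<forall>w\<in>set W. \<not> prefix w p)}"

text \<open>What a forbidden initial segment \<open>w\<close> of a partition with exactly
  \<open>i\<close> ones means for the partition that remains after deleting the ones and subtracting
  1. The result \<open>[]\<close> is no condition at all; \<open>[[]]\<close> forbids even the empty
  prefix, a contradiction. If \<open>w\<close> goes beyond its ones, their number must be exactly
  \<open>i\<close>, since the next part is at least 2.\<close>

definition strip :: "nat \<Rightarrow> nat list \<Rightarrow> nat list list" where
  "strip i w = (let v = dropWhile (\<lambda>x. x = 1) w in
     if v = [] then (if length w \<le> i then [[]] else [])
     else if length w = i + length v then [map (\<lambda>x. x - 1) v] else [])"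

text \<open>The second group comes from patterns that start at a part equal to 1: from there on the
  list has \<open>j\<close> ones, with \<open>1 \<le> j \<le> i\<close>. Patterns that start later
  are unaffected, being translation invariant.\<close>

definition nxt :: "nat list list \<Rightarrow> nat list list \<Rightarrow> nat \<Rightarrow> nat list list" where
  "nxt P W i = concat (map (strip i) W) @
     concat (map (\<lambda>j. concat (map (\<lambda>w. strip j (map Suc w)) P)) [1..<Suc i])"

lemma prefix_map_Suc:
  "prefix w (map Suc p) \<longleftrightarrow> (\<forall>x\<in>set w. 1 \<le> x) \<and> prefix (map (\<lambda>x. x - 1) w) p"
proof (induction w arbitrary: p)
  case (Cons x w)
  show ?case by (cases p; cases x) (auto simp: Cons)
qed simp

text \<open>All parts of \<open>map Suc p\<close> are at least 2, so the leading ones can only be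
  matched by ones of \<open>w\<close>.\<close>

lemma prefix_strip:
  assumes "\<forall>x\<in>set w. 1 \<le> x" "\<forall>x\<in>set p. 1 \<le> x"
  shows "prefix w (replicate i 1 @ map Suc p) \<longleftrightarrow> (\<exists>v\<in>set (strip i w). prefix v p)"
  using assms
proof (induction i arbitrary: w)
  case 0
  show ?case
  proof (cases w)
    case (Cons x w')
    show ?thesis
    proof (cases "x = 1")
      case True
      have "length (dropWhile (\<lambda>x. x = 1) w') \<le> length w'" by (rule length_dropWhile_le)
      moreover have "\<not> prefix w (map Suc p)" using True Cons 0 by (cases p) auto
      ultimately show ?thesis using True Cons by (auto simp: strip_def Let_def)
    next
      case False
      then show ?thesis using Cons 0(1) prefix_map_Suc[of w p] by (auto simp: strip_def)
    qed
  qed (simp add: strip_def)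
next
  case (Suc i)
  show ?case
  proof (cases w)
    case (Cons x w')
    show ?thesis
    proof (cases "x = 1")
      case True
      have "strip (Suc i) (1 # w') = strip i w'"
        by (simp only: strip_def dropWhile.simps length_Cons if_True simp_thms add_Suc Suc_le_mono nat.inject)
      moreover have "\<forall>x\<in>set w'. 1 \<le> x" using Suc.prems(1) Cons by simp
      note Suc.IH[OF this Suc.prems(2)]
      moreover have "prefix (1 # w') (replicate (Suc i) 1 @ map Suc p) \<longleftrightarrow> prefix w' (replicate i 1 @ map Suc p)"
        by (simp only: replicate_Suc append_Cons Cons_prefix_Cons simp_thms)
      ultimately show ?thesis unfolding Cons True by (simp only:)
    next
      case False
      then show ?thesis using Cons by (auto simp: strip_def)
    qed
  qed (simp add: strip_def)
qed

lemma good_map_Suc: "good P (map Suc p) \<longleftrightarrow> good P p"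
proof (induction p)
  case (Cons x p)
  have "prefix (map ((+) (Suc x)) w) (map Suc (x # p)) \<longleftrightarrow> prefix (map ((+) x) w) (x # p)" for w
    unfolding prefix_map_Suc by (auto simp: comp_def)
  then show ?case using Cons by simp
qed simp

lemma good_replicate:
  "good P (replicate i 1 @ map Suc p) \<longleftrightarrow>
     good P p \<and> (\<forall>j\<in>{1..i}. \<forall>w\<in>set P. \<not> prefix (map Suc w) (replicate j 1 @ map Suc p))"
proof (induction i)
  case (Suc i)
  have "{1..Suc i} = insert (Suc i) {1..i}" by auto
  moreover have "(+) (Suc 0) = Suc" by auto
  ultimately show ?case using Suc by auto
qed (simp add: good_map_Suc)

lemma good_prefix: "prefix w p \<Longrightarrow> good P p \<Longrightarrow> good P w"
proof (induction w arbitrary: p)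
  case (Cons x w)
  then obtain p' where p: "p = x # p'" "prefix w p'" by (cases p) auto
  then have "good P w" using Cons by auto
  moreover have "\<not> prefix (map ((+) x) v) (x # w)" if "v \<in> set P" for v
    using that Cons.prems p by (metis good.simps(2) prefix_order.trans)
  ultimately show ?case by auto
qed simp

lemma Par_append_iff: "replicate i 1 @ map Suc p \<in> Par \<longleftrightarrow> p \<in> Par \<or> sorted p"
  by (auto simp: Par_def sorted_append sorted_map)

lemma St_append_iff:
  assumes "p \<in> Par" "\<forall>w\<in>set W. \<forall>x\<in>set w. 1 \<le> x"
  shows "replicate i 1 @ map Suc p \<in> St P W \<longleftrightarrow> p \<in> St P (nxt P W i)"
proof -
  have p: "\<forall>x\<in>set p. 1 \<le> x" using assms by (auto simp: Par_def)
  have 1: "prefix (map Suc w) (replicate j 1 @ map Suc p) \<longleftrightarrow> (\<exists>v\<in>set (strip j (map Suc w)). prefix v p)" for w j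
    by (rule prefix_strip) (use p in auto)
  have 2: "prefix w (replicate i 1 @ map Suc p) \<longleftrightarrow> (\<exists>v\<in>set (strip i w). prefix v p)" if "w \<in> set W" for w
    by (rule prefix_strip) (use p assms that in auto)
  have 3: "replicate i 1 @ map Suc p \<in> Par" using assms Par_append_iff by blast
  show ?thesis
    unfolding St_def nxt_def using assms(1) 1 2 3 good_replicate[of P i p] by (auto simp: atLeastLessThanSuc_atLeastAtMost simp del: replicate_Suc upt_Suc)
qed

lemma Par_cases:
  assumes "p \<in> Par"
  obtains i p' where "p = replicate i 1 @ map Suc p'" "p' \<in> Par"
proof -
  have "\<exists>i p'. p = replicate i 1 @ map Suc p' \<and> p' \<in> Par"
    using assms
  proof (induction p)
    case Nil
    then show ?case by (intro exI[of _ 0] exI[of _ "[]"]) auto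
  next
    case (Cons x p)
    then have "p \<in> Par" by (auto simp: Par_def)
    then obtain i p' where p: "p = replicate i 1 @ map Suc p'" "p' \<in> Par" using Cons by blast
    show ?case
    proof (cases "x = 1")
      case True
      then show ?thesis using p by (intro exI[of _ "Suc i"] exI[of _ p']) auto
    next
      case False
      then have x: "\<forall>y\<in>set (x # p). 2 \<le> y" using Cons.prems by (fastforce simp: Par_def)
      have m: "x # p = map Suc (map (\<lambda>y. y - 1) (x # p))"
      proof -
        have "l = map Suc (map (\<lambda>y. y - 1) l)" if "\<forall>y\<in>set l. 2 \<le> y" for l
          using that by (induction l) auto
        then show ?thesis using x by blast
      qed
      moreover have "map (\<lambda>y. y - 1) (x # p) \<in> Par"
      proof -
        have "sorted (map (\<lambda>y. y - 1) l)" if "sorted l" for l :: "nat list"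
          using that by (induction l) (auto intro: diff_le_mono)
        moreover have "sorted (x # p)" using Cons.prems by (simp add: Par_def)
        moreover have "\<forall>y\<in>set (map (\<lambda>y. y - 1) (x # p)). 1 \<le> y" using x by fastforce
        ultimately show ?thesis unfolding Par_def by blast
      qed
      ultimately show ?thesis by (intro exI[of _ 0] exI[of _ "map (\<lambda>y. y - 1) (x # p)"]) simp
    qed
  qed
  then show thesis using that by blast
qed

text \<open>A sufficient condition for \<open>St P V \<subseteq> St P W\<close>: every segment of
  \<open>W\<close> violates a pattern of \<open>P\<close> by itself or extends a segment of
  \<open>V\<close>. Being a finite check, it lets the raw output of \<open>nxt\<close> be replaced
  by one of a few named states.\<close>

definition cover :: "nat list list \<Rightarrow> nat list list \<Rightarrow> nat list list \<Rightarrow> bool" where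
  "cover P V W \<longleftrightarrow> (\<forall>w\<in>set W. \<not> good P w \<or> (\<exists>v\<in>set V. prefix v w))"

lemma cover_St: "cover P V W \<Longrightarrow> St P V \<subseteq> St P W"
  unfolding St_def cover_def using good_prefix prefix_order.trans by blast

text \<open>A certificate for one row of the system: \<open>Ws ! i\<close> describes what may follow
  exactly \<open>i\<close> ones, and \<open>length Ws\<close> ones are impossible because then even
  the empty list is forbidden. In each use it is evaluated by \<open>code_simp\<close>.\<close>

definition step_ok :: "nat list list \<Rightarrow> nat list list \<Rightarrow> nat list list list \<Rightarrow> bool" where
  "step_ok P W Ws \<longleftrightarrow> (\<forall>w\<in>set W. \<forall>x\<in>set w. 1 \<le> x) \<and> [] \<in> set (nxt P W (length Ws)) \<and>
     (\<forall>i\<in>set [0..<length Ws]. cover P (nxt P W i) (Ws ! i) \<and> cover P (Ws ! i) (nxt P W i))"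

lemma nxt_Nil_mono:
  assumes "[] \<in> set (nxt P W i)" "i \<le> j"
  shows "[] \<in> set (nxt P W j)"
proof -
  have strip_Nil: "[] \<in> set (strip k w) \<longleftrightarrow> dropWhile (\<lambda>x. x = 1) w = [] \<and> length w \<le> k" for k w
    by (cases "dropWhile (\<lambda>x. x = 1) w = []") (simp_all add: strip_def Let_def del: dropWhile_eq_Nil_conv)
  have "[] \<in> set (strip j w)" if "[] \<in> set (strip i w)" for w
    using that assms(2) unfolding strip_Nil by simp
  then show ?thesis using assms by (fastforce simp: nxt_def simp del: upt_Suc)
qed

section \<open>Convergence, and the normalized generating functions\<close>

lemma sum_composition_bound:
  fixes q :: real
  assumes "0 < q" "finite A" "\<forall>x\<in>A. 1 \<le> x" "q < 1"
  shows "(\<Sum>p | set p \<subseteq> A \<and> length p = n. q ^ sum_list p) \<le> (q / (1 - q)) ^ n"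
proof (induction n)
  case 0
  have "{p. set p \<subseteq> A \<and> length p = 0} = {[]}" by auto
  then show ?case by simp
next
  case (Suc n)
  have "(\<Sum>p | set p \<subseteq> A \<and> length p = Suc n. q ^ sum_list p)
      = (\<Sum>(p, x)\<in>{p. set p \<subseteq> A \<and> length p = n} \<times> A. q ^ sum_list p * q ^ x)"
    unfolding lists_length_Suc_eq by (subst sum.reindex) (auto simp: inj_on_def case_prod_beta' power_add mult_ac)
  also have "\<dots> = (\<Sum>p | set p \<subseteq> A \<and> length p = n. q ^ sum_list p) * (\<Sum>x\<in>A. q ^ x)"
    by (simp add: sum_product sum.cartesian_product)
  also have "\<dots> \<le> (q / (1 - q)) ^ n * (q / (1 - q))"
  proof (intro mult_mono)
    have "(\<Sum>x\<in>A. q ^ x) \<le> (\<Sum>x\<in>Suc ` (\<lambda>x. x - 1) ` A. q ^ x)"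
      using assms by (intro sum_mono2) (auto simp: image_image intro!: rev_image_eqI)
    also have "\<dots> = (\<Sum>x\<in>(\<lambda>x. x - 1) ` A. q ^ Suc x)" by (subst sum.reindex) auto
    also have "\<dots> \<le> (\<Sum>x. q ^ Suc x)"
      using assms by (intro sum_le_suminf) (auto simp: summable_Suc_iff[of "\<lambda>n. q ^ n", simplified] summable_geometric intro!: summable_mult)
    also have "\<dots> = q / (1 - q)"
      using suminf_mult[of "\<lambda>n. q ^ n" q] suminf_geometric[of q] assms by (simp add: summable_geometric)
    finally show "(\<Sum>x\<in>A. q ^ x) \<le> q / (1 - q)" .
  qed (use Suc assms in \<open>auto intro!: sum_nonneg\<close>)
  finally show ?case by (simp only: power_Suc2)
qed

locale small_q =
  fixes q :: real
  assumes q_pos: "0 < q" and q_half: "q < 1 / 2"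
begin

lemma q_lt_1: "q < 1" using q_half by simp

lemma Par_summable:
  assumes "S \<subseteq> Par"
  shows "(\<lambda>p. q ^ sum_list p) summable_on S"
proof -
  have r: "0 < q / (1 - q)" "q / (1 - q) < 1" using q_pos q_half by (auto simp: field_simps)
  \<comment> \<open>Partitions are bounded by all compositions with parts in a finite set. Those of
    length n weigh at most (q/(1-q))^n, the terms of a convergent geometric series because q <
    1/2.\<close>
  have "(\<lambda>p. q ^ sum_list p) summable_on Par"
  proof (rule nonneg_bdd_above_summable_on)
    show "bdd_above (sum (\<lambda>p. q ^ sum_list p) ` {F. F \<subseteq> Par \<and> finite F})"
    proof (rule bdd_aboveI2)
      fix F assume "F \<in> {F. F \<subseteq> Par \<and> finite F}"
      then have F: "F \<subseteq> Par" "finite F" by auto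
      define A where "A = (\<Union>p\<in>F. set p)"
      define N where "N = Max (insert 0 (length ` F))"
      have A: "finite A" "\<forall>x\<in>A. 1 \<le> x" using F by (auto simp: A_def Par_def)
      have "sum (\<lambda>p. q ^ sum_list p) F \<le> sum (\<lambda>p. q ^ sum_list p) (\<Union>n\<in>{..N}. {p. set p \<subseteq> A \<and> length p = n})"
        using F q_pos by (intro sum_mono2) (auto simp: A_def N_def intro!: finite_lists_length_eq)
      also have "\<dots> = (\<Sum>n\<le>N. \<Sum>p | set p \<subseteq> A \<and> length p = n. q ^ sum_list p)"
        by (rule sum.UNION_disjoint) (use A in \<open>auto intro!: finite_lists_length_eq\<close>)
      also have "\<dots> \<le> (\<Sum>n\<le>N. (q / (1 - q)) ^ n)"
        using A q_pos q_lt_1 by (intro sum_mono sum_composition_bound) auto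
      also have "\<dots> \<le> (\<Sum>n. (q / (1 - q)) ^ n)"
        using r q_pos q_lt_1 by (intro sum_le_suminf) (auto simp: summable_geometric)
      finally show "sum (\<lambda>p. q ^ sum_list p) F \<le> (\<Sum>n. (q / (1 - q)) ^ n)" .
    qed
  qed (use q_pos in auto)
  then show ?thesis using assms by (rule summable_on_subset_banach)
qed

definition total :: "nat list set \<Rightarrow> real" where
  "total S = infsum (\<lambda>p. q ^ sum_list p) S"

text \<open>The weight of the lists of length n is divided by \<open>q ^ tri n\<close> so that
  deleting a single 1 causes no dilation in \<open>hgf_step\<close>; \<open>Lam\<close> restores the
  factor.\<close>

definition hgf :: "nat list set \<Rightarrow> real fps" where
  "hgf S = Abs_fps (\<lambda>n. infsum (\<lambda>p. q ^ sum_list p) {p \<in> S. length p = n} / q ^ tri n)"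

definition Lam :: "real fps \<Rightarrow> real" where
  "Lam f = (\<Sum>n. q ^ tri n * f $ n)"

lemma total_Lam:
  assumes "S \<subseteq> Par"
  shows "total S = Lam (hgf S)"
proof -
  have "((\<lambda>n. infsum (\<lambda>p. q ^ sum_list p) {p \<in> S. length p = n}) has_sum total S) UNIV"
    unfolding total_def
    by (rule has_sum_fibres[OF has_sum_infsum[OF Par_summable[OF assms]]])
       (use assms in \<open>auto intro!: has_sum_infsum Par_summable\<close>)
  from has_sum_imp_sums[OF this] show ?thesis
    using q_pos by (simp add: Lam_def hgf_def sums_iff)
qed

lemma total_card:
  assumes "S \<subseteq> Par"
  shows "(\<lambda>N. real (card {p \<in> S. sum_list p = N}) * q ^ N) sums total S"
proof -
  have fin: "finite {p \<in> S. sum_list p = N}" for N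
    using assms by (intro finite_subset[OF _ finite_partitions_of[of N]]) (auto simp: Par_def partitions_of_def)
  have "((\<lambda>N. real (card {p \<in> S. sum_list p = N}) * q ^ N) has_sum total S) UNIV"
    unfolding total_def
  proof (rule has_sum_fibres[OF has_sum_infsum[OF Par_summable[OF assms]]])
    fix N
    have "(\<Sum>p | p \<in> S \<and> sum_list p = N. q ^ sum_list p) = real (card {p \<in> S. sum_list p = N}) * q ^ N"
      by simp
    then show "((\<lambda>p. q ^ sum_list p) has_sum real (card {p \<in> S. sum_list p = N}) * q ^ N) {p \<in> S. sum_list p = N}"
      using has_sum_finite[OF fin[of N], of "\<lambda>p. q ^ sum_list p"] by simp
  qed
  then show ?thesis by (rule has_sum_imp_sums)
qed

text \<open>A partition with n parts and exactly i ones arises from one with m = n - i parts: each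
  of these is raised by 1 and i ones are put in front, which multiplies the weight by q^n. After the
  normalization \<open>tri_add\<close> turns this factor into the dilation by q/q^i and the constant
  q^i/q^tri i.\<close>

lemma hgf_step:
  assumes "step_ok P W Ws"
  shows "hgf (St P W) = (\<Sum>i<length Ws. fps_X ^ i * sc (q / q ^ i) (hgf (St P (Ws ! i))) * fps_const (q ^ i / q ^ tri i))"
proof (rule fps_ext)
  fix n
  let ?f = "\<lambda>p :: nat list. q ^ sum_list p"
  let ?m = "length Ws"
  have W: "\<forall>w\<in>set W. \<forall>x\<in>set w. 1 \<le> x" using assms by (auto simp: step_ok_def)
  have Stsub: "St P V \<subseteq> Par" for V by (auto simp: St_def)
  have Steq: "St P (nxt P W i) = St P (Ws ! i)" if "i < ?m" for i
    using assms that by (auto simp: step_ok_def intro!: equalityI cover_St)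
  \<comment> \<open>From \<open>length Ws\<close> ones on, the next state forbids the empty list,
    which is a prefix of everything.\<close>
  have Stempty: "St P (nxt P W i) = {}" if "i \<ge> ?m" for i
    using nxt_Nil_mono[of P W ?m i] assms that by (auto simp: step_ok_def St_def intro: bexI[of _ "[]"])
  define ones where "ones p = length (takeWhile (\<lambda>x. x = 1) p)" for p :: "nat list"
  have ones: "ones (replicate i 1 @ map Suc p) = i" if "p \<in> Par" for i p
  proof -
    have "takeWhile (\<lambda>x. x = 1) (map Suc p) = []" using that by (cases p) (auto simp: Par_def)
    then show ?thesis unfolding ones_def by (subst takeWhile_append2) auto
  qed
  define g where "g i = (if i < ?m \<and> i \<le> n then q ^ n * infsum ?f {p \<in> St P (Ws ! i). length p = n - i} else 0)" for i
  have "(g has_sum infsum ?f {p \<in> St P W. length p = n}) UNIV"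
  proof (rule has_sum_fibres[OF has_sum_infsum])
    show "?f summable_on {p \<in> St P W. length p = n}" by (rule Par_summable) (use Stsub in blast)
    fix i
    let ?B = "{p \<in> {p \<in> St P W. length p = n}. ones p = i}"
    have mem: "p \<in> ?B \<longleftrightarrow> (\<exists>p'. p = replicate i 1 @ map Suc p' \<and> p' \<in> St P (nxt P W i) \<and> length p' + i = n)" for p
    proof
      assume p: "p \<in> ?B"
      then have "p \<in> Par" using Stsub by auto
      then obtain j p' where p': "p = replicate j 1 @ map Suc p'" "p' \<in> Par" by (rule Par_cases)
      then have "j = i" using ones[of p' j] p by auto
      then show "\<exists>p'. p = replicate i 1 @ map Suc p' \<and> p' \<in> St P (nxt P W i) \<and> length p' + i = n"
        using p p' St_append_iff[OF p'(2) W, of i P] by auto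
    next
      assume "\<exists>p'. p = replicate i 1 @ map Suc p' \<and> p' \<in> St P (nxt P W i) \<and> length p' + i = n"
      then obtain p' where p': "p = replicate i 1 @ map Suc p'" "p' \<in> St P (nxt P W i)" "length p' + i = n" by blast
      then have "p' \<in> Par" using Stsub by blast
      then show "p \<in> ?B" using p' St_append_iff[OF _ W, of p' i P] ones[of p' i] by auto
    qed
    show "(?f has_sum g i) ?B"
    proof (cases "i < ?m \<and> i \<le> n")
      case False
      then have "?B = {}" using mem Stempty[of i] by (fastforce simp: not_less)
      then show ?thesis using False by (simp only: g_def) simp
    next
      case True
      let ?C = "{p \<in> St P (Ws ! i). length p = n - i}"
      have B: "bij_betw (\<lambda>p. replicate i 1 @ map Suc p) ?C ?B"
        unfolding bij_betw_def
      proof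
        show "inj_on (\<lambda>p. replicate i 1 @ map Suc p) ?C" by (auto simp: inj_on_def)
        show "(\<lambda>p. replicate i 1 @ map Suc p) ` ?C = ?B"
          unfolding set_eq_iff mem using True Steq[of i] by (auto simp: image_iff)
      qed
      have s: "?f (replicate i 1 @ map Suc p) = q ^ n * ?f p" if "p \<in> ?C" for p
      proof -
        have "sum_list (map Suc p) = length p + sum_list p" by (induction p) auto
        then show ?thesis using that True by (simp add: sum_list_replicate flip: power_add)
      qed
      have "(?f has_sum infsum ?f ?C) ?C" by (intro has_sum_infsum Par_summable) (use Stsub in blast)
      then have "((\<lambda>p. q ^ n * ?f p) has_sum g i) ?C"
        using True by (auto simp: g_def intro: has_sum_cmult_right)
      then have "((\<lambda>p. ?f (replicate i 1 @ map Suc p)) has_sum g i) ?C"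
        using s by (subst has_sum_cong) auto
      then show ?thesis using has_sum_reindex_bij_betw[OF B, of ?f] by simp
    qed
  qed
  moreover have "(g has_sum (\<Sum>i<?m. g i)) UNIV"
    by (rule has_sum_finite_neutralI[of "{..<?m}"]) (auto simp: g_def)
  ultimately have "infsum ?f {p \<in> St P W. length p = n} = (\<Sum>i<?m. g i)" by (rule has_sum_unique)
  then have "hgf (St P W) $ n = (\<Sum>i<?m. g i / q ^ tri n)"
    by (simp add: hgf_def sum_divide_distrib)
  also have "\<dots> = (\<Sum>i<?m. (fps_X ^ i * sc (q / q ^ i) (hgf (St P (Ws ! i))) * fps_const (q ^ i / q ^ tri i)) $ n)"
  proof (rule sum.cong)
    fix i assume i: "i \<in> {..<?m}"
    show "g i / q ^ tri n = (fps_X ^ i * sc (q / q ^ i) (hgf (St P (Ws ! i))) * fps_const (q ^ i / q ^ tri i)) $ n"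
    proof (cases "i \<le> n")
      case False
      then show ?thesis by (simp add: g_def fps_mult_right_const_nth fps_X_power_mult_nth)
    next
      case True
      then obtain m where n: "n = m + i" using le_iff_add add.commute by metis
      have "q ^ n / q ^ tri n = (q / q ^ i) ^ m / q ^ tri m * (q ^ i / q ^ tri i)"
        using q_pos by (simp add: n tri_add power_add power_divide power_mult mult.commute[of i m] divide_simps)
          (simp add: mult_ac flip: power_mult)
      then have "q ^ n * I / q ^ tri n = (q / q ^ i) ^ m * (I / q ^ tri m) * (q ^ i / q ^ tri i)" for I
        by (simp only: times_divide_eq_left[symmetric]) simp
      moreover have "n - i = m" "i < ?m" "i \<le> n" using i n by auto
      ultimately show ?thesis
        by (simp only: g_def hgf_def fps_mult_right_const_nth fps_X_power_mult_nth sc_nth fps_nth_Abs_fps if_True simp_thms not_less[symmetric] if_False)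
    qed
  qed simp
  finally show "hgf (St P W) $ n = (\<Sum>i<?m. fps_X ^ i * sc (q / q ^ i) (hgf (St P (Ws ! i))) * fps_const (q ^ i / q ^ tri i)) $ n"
    by (simp add: fps_sum_nth)
qed

end

section \<open>The linear functional\<close>

definition geo_bounded :: "(nat \<Rightarrow> real) \<Rightarrow> bool" where
  "geo_bounded f \<longleftrightarrow> (\<exists>M K. 0 < M \<and> 1 \<le> K \<and> (\<forall>n. \<bar>f n\<bar> \<le> M * K ^ n))"

lemma geo_boundedI:
  assumes "\<And>n. \<bar>f n\<bar> \<le> M * K ^ n"
  shows "geo_bounded f"
proof -
  have "\<bar>f n\<bar> \<le> max 1 \<bar>M\<bar> * (max 1 \<bar>K\<bar>) ^ n" for n
  proof -
    have "M * K ^ n \<le> \<bar>M\<bar> * \<bar>K\<bar> ^ n" by (metis abs_ge_self abs_mult power_abs)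
    also have "\<dots> \<le> max 1 \<bar>M\<bar> * (max 1 \<bar>K\<bar>) ^ n"
      by (intro mult_mono power_mono) auto
    finally show ?thesis using assms[of n] by simp
  qed
  then show ?thesis unfolding geo_bounded_def
    by (intro exI[of _ "max 1 \<bar>M\<bar>"] exI[of _ "max 1 \<bar>K\<bar>"]) auto
qed

lemma geo_boundedE:
  assumes "geo_bounded f"
  obtains M K where "0 < M" "1 \<le> K" "\<And>n. \<bar>f n\<bar> \<le> M * K ^ n"
  using assms unfolding geo_bounded_def by blast

text \<open>The class on which \<open>Lam\<close> converges and is linear. A positive radius of
  convergence is enough, because \<open>q ^ tri n\<close> decays faster than any geometric
  sequence.\<close>

definition gb :: "real fps \<Rightarrow> bool" where
  "gb f \<longleftrightarrow> geo_bounded (fps_nth f)"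

lemma gb_add: assumes "gb f" "gb g" shows "gb (f + g)"
proof -
  obtain M K where f: "0 < M" "1 \<le> K" "\<And>n. \<bar>f $ n\<bar> \<le> M * K ^ n"
    using assms(1) unfolding gb_def by (rule geo_boundedE) blast
  obtain M' K' where g: "0 < M'" "1 \<le> K'" "\<And>n. \<bar>g $ n\<bar> \<le> M' * K' ^ n"
    using assms(2) unfolding gb_def by (rule geo_boundedE) blast
  have "\<bar>(f + g) $ n\<bar> \<le> (M + M') * (max K K') ^ n" for n
  proof -
    have "M * K ^ n \<le> M * (max K K') ^ n" "M' * K' ^ n \<le> M' * (max K K') ^ n"
      using f g by (auto intro!: mult_left_mono power_mono)
    then show ?thesis using f(3)[of n] g(3)[of n] by (auto simp: algebra_simps)
  qed
  then show ?thesis unfolding gb_def by (rule geo_boundedI)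
qed

lemma gb_const [simp]: "gb (fps_const c)"
  unfolding gb_def by (rule geo_boundedI[of _ "\<bar>c\<bar>" 1]) auto

lemma gb_1 [simp]: "gb 1" using gb_const[of 1] by simp

lemma gb_numeral [simp]: "gb (numeral k)" using gb_const[of "numeral k"] by (simp add: numeral_fps_const)

lemma gb_X [simp]: "gb fps_X"
  unfolding gb_def by (rule geo_boundedI[of _ 1 1]) (auto simp: fps_X_def)

lemma gb_mult: assumes "gb f" "gb g" shows "gb (f * g)"
proof -
  obtain M K where f: "0 < M" "1 \<le> K" "\<And>n. \<bar>f $ n\<bar> \<le> M * K ^ n"
    using assms(1) unfolding gb_def by (rule geo_boundedE) blast
  obtain M' K' where g: "0 < M'" "1 \<le> K'" "\<And>n. \<bar>g $ n\<bar> \<le> M' * K' ^ n"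
    using assms(2) unfolding gb_def by (rule geo_boundedE) blast
  have "\<bar>(f * g) $ n\<bar> \<le> M * M' * (2 * (max K K')) ^ n" for n
  proof -
    have "\<bar>(f * g) $ n\<bar> \<le> (\<Sum>i=0..n. \<bar>f $ i * g $ (n - i)\<bar>)"
      unfolding fps_mult_nth by (rule sum_abs)
    also have "\<dots> \<le> (\<Sum>i=0..n. M * M' * max K K' ^ n)"
    proof (rule sum_mono)
      fix i assume i: "i \<in> {0..n}"
      have "\<bar>f $ i * g $ (n - i)\<bar> \<le> (M * max K K' ^ i) * (M' * max K K' ^ (n - i))"
      proof -
        have "\<bar>f $ i\<bar> \<le> M * max K K' ^ i"
          by (rule order_trans[OF f(3)]) (use f in \<open>auto intro!: mult_left_mono power_mono\<close>)
        moreover have "\<bar>g $ (n - i)\<bar> \<le> M' * max K K' ^ (n - i)"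
          by (rule order_trans[OF g(3)]) (use g in \<open>auto intro!: mult_left_mono power_mono\<close>)
        ultimately show ?thesis using f(1,2) unfolding abs_mult by (intro mult_mono) auto
      qed
      also have "\<dots> = M * M' * (max K K' ^ i * max K K' ^ (n - i))" by simp
      also have "max K K' ^ i * max K K' ^ (n - i) = max K K' ^ n" using i by (simp flip: power_add)
      finally show "\<bar>f $ i * g $ (n - i)\<bar> \<le> M * M' * max K K' ^ n" .
    qed
    also have "\<dots> = M * M' * (real (Suc n) * max K K' ^ n)" by simp
    also have "\<dots> \<le> M * M' * (2 ^ n * max K K' ^ n)"
    proof -
      have "Suc n \<le> 2 ^ n" by (simp add: Suc_leI less_exp)
      then have "real (Suc n) \<le> 2 ^ n" by (metis of_nat_le_iff of_nat_numeral of_nat_power)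
      then show ?thesis using f g by (intro mult_left_mono mult_right_mono) auto
    qed
    finally show ?thesis by (simp add: power_mult_distrib)
  qed
  then show ?thesis unfolding gb_def by (rule geo_boundedI)
qed

lemma gb_minus: "gb f \<Longrightarrow> gb (- f)"
  unfolding gb_def geo_bounded_def by simp

lemma gb_diff: "gb f \<Longrightarrow> gb g \<Longrightarrow> gb (f - g)"
  using gb_add[OF _ gb_minus, of f g] by simp

lemma gb_power: "gb f \<Longrightarrow> gb (f ^ n)"
  by (induction n) (auto intro: gb_mult)

lemma gb_sc: assumes "gb f" shows "gb (sc b f)"
proof -
  obtain M K where f: "0 < M" "1 \<le> K" "\<And>n. \<bar>f $ n\<bar> \<le> M * K ^ n"
    using assms unfolding gb_def by (rule geo_boundedE) blast
  have "\<bar>sc b f $ n\<bar> \<le> M * (\<bar>b\<bar> * K) ^ n" for n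
    using mult_left_mono[OF f(3)[of n], of "\<bar>b\<bar> ^ n"] by (simp add: abs_mult power_abs power_mult_distrib mult_ac)
  then show ?thesis unfolding gb_def by (rule geo_boundedI)
qed

lemmas gb_intros = gb_add gb_mult gb_diff gb_minus gb_power gb_sc gb_const gb_1 gb_X gb_numeral

section \<open>Superexponential decay and rearrangement of double sums\<close>

definition rapid :: "(nat \<Rightarrow> real) \<Rightarrow> bool" where
  "rapid \<mu> \<longleftrightarrow> (\<forall>K>0. \<exists>C>0. \<forall>m. \<bar>\<mu> m\<bar> \<le> C * K ^ m)"

lemma rapidE:
  assumes "rapid \<mu>" "0 < K"
  obtains C where "0 < C" "\<And>m. \<bar>\<mu> m\<bar> \<le> C * K ^ m"
  using assms unfolding rapid_def by blast

text \<open>The shape of a bivariate sum which is superexponentially convergent in both indices.\<close>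

lemma rapid_pairs_summable:
  assumes "rapid \<mu>" "geo_bounded \<alpha>" "geo_bounded \<beta>" "1 \<le> s" "1 \<le> t"
  shows "(\<lambda>(i, j). \<alpha> i * \<beta> j * \<mu> (s * i + t * j)) summable_on UNIV"
proof -
  obtain M K where a: "0 < M" "1 \<le> K" "\<And>n. \<bar>\<alpha> n\<bar> \<le> M * K ^ n"
    using assms(2) by (rule geo_boundedE) blast
  obtain M' K' where b: "0 < M'" "1 \<le> K'" "\<And>n. \<bar>\<beta> n\<bar> \<le> M' * K' ^ n"
    using assms(3) by (rule geo_boundedE) blast
  define L where "L = 1 / (2 * max K K')"
  have L: "0 < L" "L \<le> 1" "L * K \<le> 1 / 2" "L * K' \<le> 1 / 2" using a b by (auto simp: L_def field_simps)
  obtain C where C: "0 < C" "\<And>m. \<bar>\<mu> m\<bar> \<le> C * L ^ m" by (rule rapidE[OF assms(1) L(1)]) blast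
  show ?thesis
  proof (rule summable_on_pairs_geometric[of _ "M * M' * C" "1 / 2"])
    fix i j
    have "\<bar>\<mu> (s * i + t * j)\<bar> \<le> C * L ^ (s * i + t * j)" by (rule C)
    also have "\<dots> \<le> C * L ^ (i + j)"
    proof -
      have "i \<le> s * i" "j \<le> t * j" using mult_le_mono1[OF assms(4), of i] mult_le_mono1[OF assms(5), of j] by simp_all
      then have "i + j \<le> s * i + t * j" by linarith
      then show ?thesis using C L by (intro mult_left_mono power_decreasing) auto
    qed
    finally have "\<bar>\<alpha> i * \<beta> j * \<mu> (s * i + t * j)\<bar> \<le> (M * K ^ i) * (M' * K' ^ j) * (C * L ^ (i + j))"
      unfolding abs_mult using a b by (intro mult_mono mult_nonneg_nonneg) auto
    also have "\<dots> = M * M' * C * (L * K) ^ i * (L * K') ^ j"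
      by (simp add: power_add power_mult_distrib)
    also have "\<dots> \<le> M * M' * C * (1 / 2) ^ i * (1 / 2) ^ j"
      using a b C L by (intro mult_mono power_mono) auto
    finally show "\<bar>case (i, j) of (i, j) \<Rightarrow> \<alpha> i * \<beta> j * \<mu> (s * i + t * j)\<bar> \<le> M * M' * C * (1 / 2) ^ i * (1 / 2) ^ j"
      by simp
  qed (use a b C in auto)
qed

lemma has_sum_pairs_diagonal:
  assumes "((\<lambda>(i, j). f i j) has_sum (s :: real)) (UNIV :: (nat \<times> nat) set)"
  shows "(\<lambda>n. \<Sum>i\<le>n. f i (n - i)) sums s"
proof -
  have "((\<lambda>n. \<Sum>i\<le>n. f i (n - i)) has_sum s) UNIV"
  proof (rule has_sum_fibres[OF assms, where \<phi> = "\<lambda>(i, j). i + j"])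
    fix n :: nat
    have B: "bij_betw (\<lambda>i. (i, n - i)) {..n} {x \<in> UNIV. (case x of (i, j) \<Rightarrow> i + j) = n}"
      by (rule bij_betwI[where g = fst]) auto
    have "((\<lambda>i. (\<lambda>(i, j). f i j) (i, n - i)) has_sum (\<Sum>i\<le>n. f i (n - i))) {..n}"
      by (rule has_sum_finiteI) auto
    then show "((\<lambda>(i, j). f i j) has_sum (\<Sum>i\<le>n. f i (n - i))) {x \<in> UNIV. (case x of (i, j) \<Rightarrow> i + j) = n}"
      using has_sum_reindex_bij_betw[OF B] by blast
  qed
  then show ?thesis by (rule has_sum_imp_sums)
qed

lemma has_sum_pairs_rows:
  assumes "((\<lambda>(i, j). f i j) has_sum (s :: real)) (UNIV :: (nat \<times> nat) set)" "\<And>i. (\<lambda>j. f i j) sums g i"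
  shows "g sums s"
proof -
  have "(f i has_sum g i) UNIV" for i
  proof -
    have "(\<lambda>(i, j). f i j) summable_on UNIV \<times> UNIV"
      using assms(1) by (auto simp: summable_on_def)
    then have "f i summable_on UNIV"
      using summable_on_SigmaD1[of f UNIV "\<lambda>_. UNIV" i] by simp
    then have "(f i has_sum infsum (f i) UNIV) UNIV" by (rule has_sum_infsum)
    with has_sum_imp_sums[OF this] assms(2)[of i] show ?thesis by (simp add: sums_iff)
  qed
  note g = this
  have "((\<lambda>(i, j). f i j) has_sum s) (Sigma UNIV (\<lambda>_. UNIV))" using assms(1) by simp
  from has_sum_Sigma'[OF this] have "(g has_sum s) UNIV" using g by auto
  then show ?thesis by (rule has_sum_imp_sums)
qed

text \<open>The substitution z \<mapsto> z^s, which turns the q-exponentials in base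
  \<open>q ^ s\<close> into functions of z with a first-order equation for the dilation by
  q.\<close>

definition dil :: "nat \<Rightarrow> real fps \<Rightarrow> real fps" where
  "dil s f = Abs_fps (\<lambda>n. if s dvd n then f $ (n div s) else 0)"

lemma dil_1 [simp]: "dil (Suc 0) f = f"
  by (simp add: dil_def fps_eq_iff)

lemma dil_nth_0 [simp]: "dil s f $ 0 = f $ 0"
  by (simp add: dil_def)

lemma sc_dil: "0 < s \<Longrightarrow> sc b (dil s f) = dil s (sc (b ^ s) f)"
  by (auto simp: dil_def fps_eq_iff power_mult[symmetric])

lemma dil_add: "dil s (f + g) = dil s f + dil s g"
  and dil_diff: "dil s (f - g) = dil s f - dil s g"
  by (simp_all add: dil_def fps_eq_iff)

lemma dil_const_mult: "dil s (fps_const c * f) = fps_const c * dil s f"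
  by (simp add: dil_def fps_eq_iff)

lemma dil_X_mult: assumes "0 < s" shows "dil s (fps_X * f) = fps_X ^ s * dil s f"
proof (rule fps_ext)
  fix n
  show "dil s (fps_X * f) $ n = (fps_X ^ s * dil s f) $ n"
  proof (cases "s dvd n")
    case True
    then obtain k where "n = s * k" by blast
    then show ?thesis using assms
      by (cases k) (auto simp: dil_def fps_X_power_mult_nth)
  next
    case False
    then have "\<not> (s dvd (n - s) \<and> s \<le> n)" by (metis dvd_diffD1 dvd_refl dvd_diff_nat less_imp_le_nat le_add_diff_inverse dvd_add_right_iff)
    then show ?thesis using False by (auto simp: dil_def fps_X_power_mult_nth)
  qed
qed

lemma gb_dil: assumes "gb f" shows "gb (dil s f)"
proof -
  obtain M K where f: "0 < M" "1 \<le> K" "\<And>n. \<bar>f $ n\<bar> \<le> M * K ^ n"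
    using assms unfolding gb_def by (rule geo_boundedE) blast
  have "\<bar>dil s f $ n\<bar> \<le> M * K ^ n" for n
  proof -
    have "\<bar>dil s f $ n\<bar> \<le> M * K ^ (n div s)" using f by (auto simp: dil_def)
    also have "\<dots> \<le> M * K ^ n" using f by (intro mult_left_mono power_increasing) auto
    finally show ?thesis .
  qed
  then show ?thesis unfolding gb_def by (rule geo_boundedI)
qed

text \<open>The pairing of f(z^s) g(z^t) with a moment sequence, summed once by powers of z and once
  by the total index n = j + k. In the second order a common parameter power c^n splits off, and the
  inner sums satisfy recurrences in n.\<close>

lemma pairing_diagonal:
  assumes "rapid \<mu>" "gb f" "gb g" "1 \<le> s" "1 \<le> t"
  shows "\<exists>S. (\<lambda>m. (dil s f * dil t g) $ m * \<mu> m) sums S \<and>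
             (\<lambda>n. \<Sum>j\<le>n. f $ j * g $ (n - j) * \<mu> (s * j + t * (n - j))) sums S"
proof -
  define F where "F = (\<lambda>(i, j). f $ i * g $ j * \<mu> (s * i + t * j))"
  have "F summable_on UNIV"
    unfolding F_def using assms by (intro rapid_pairs_summable) (auto simp: gb_def)
  then obtain S where S: "(F has_sum S) UNIV" by (auto simp: summable_on_def)
  have "((\<lambda>m. (dil s f * dil t g) $ m * \<mu> m) has_sum S) UNIV"
  proof (rule has_sum_fibres[OF S, where \<phi> = "\<lambda>(i, j). s * i + t * j"])
    fix m
    let ?A = "{x \<in> UNIV. (case x of (i, j) \<Rightarrow> s * i + t * j) = m}"
    have sub: "?A \<subseteq> {..m} \<times> {..m}"
    proof
      fix x assume "x \<in> ?A"
      moreover obtain i j where "x = (i, j)" by force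
      moreover have "i \<le> s * i + t * j" "j \<le> s * i + t * j"
        using mult_le_mono1[OF assms(4), of i] mult_le_mono1[OF assms(5), of j] by linarith+
      ultimately show "x \<in> {..m} \<times> {..m}" by simp
    qed
    then have fin: "finite ?A" by (rule finite_subset) auto
    have "(dil s f * dil t g) $ m = (\<Sum>i=0..m. (if s dvd i then f $ (i div s) else 0) * (if t dvd m - i then g $ ((m - i) div t) else 0))"
      by (simp add: fps_mult_nth dil_def)
    also have "\<dots> = (\<Sum>i | i \<le> m \<and> s dvd i \<and> t dvd m - i. f $ (i div s) * g $ ((m - i) div t))"
      by (rule sum.mono_neutral_cong_right) auto
    also have "\<dots> = (\<Sum>(i, j)\<in>?A. f $ i * g $ j)"
    proof (rule sum.reindex_bij_witness[where i = "\<lambda>(i, j). s * i" and j = "\<lambda>i. (i div s, (m - i) div t)"])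
      show "(\<lambda>(i, j). s * i) ((\<lambda>i. (i div s, (m - i) div t)) a) = a" if "a \<in> {i. i \<le> m \<and> s dvd i \<and> t dvd m - i}" for a
        using that by auto
      show "(\<lambda>i. (i div s, (m - i) div t)) a \<in> ?A" if "a \<in> {i. i \<le> m \<and> s dvd i \<and> t dvd m - i}" for a
        using that by auto
      show "(\<lambda>i. (i div s, (m - i) div t)) ((\<lambda>(i, j). s * i) b) = b" if "b \<in> ?A" for b
        using that assms(4,5) by (cases b) auto
      show "(\<lambda>(i, j). s * i) b \<in> {i. i \<le> m \<and> s dvd i \<and> t dvd m - i}" if "b \<in> ?A" for b
        using that by (cases b) auto
    qed auto
    finally have "(dil s f * dil t g) $ m * \<mu> m = (\<Sum>x\<in>?A. F x)"
      by (simp add: sum_distrib_right F_def case_prod_beta')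
    then show "(F has_sum (dil s f * dil t g) $ m * \<mu> m) ?A"
      using has_sum_finite[OF fin, of F] by simp
  qed
  then have "(\<lambda>m. (dil s f * dil t g) $ m * \<mu> m) sums S" by (rule has_sum_imp_sums)
  moreover have "(\<lambda>n. \<Sum>j\<le>n. f $ j * g $ (n - j) * \<mu> (s * j + t * (n - j))) sums S"
    by (rule has_sum_pairs_diagonal) (use S in \<open>simp add: F_def\<close>)
  ultimately show ?thesis by blast
qed

section \<open>The functional \<open>Lam\<close> and the q-exponentials\<close>

context small_q
begin

lemma rapid_tri: "rapid (\<lambda>m. q ^ tri m)"
  unfolding rapid_def
proof (intro allI impI)
  fix K :: real assume K: "0 < K"
  obtain N where N: "q ^ N < K" using real_arch_pow_inv[OF K q_lt_1] by blast
  \<comment> \<open>With c K \<ge> 1 the factor c^N pays for the first N steps; afterwards each step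
    contributes q^(m+1) < K.\<close>
  define c where "c = max 1 (1 / K)"
  have c: "1 \<le> c" "1 \<le> c * K" using K by (auto simp: c_def field_simps max_def)
  have "q ^ tri m \<le> c ^ N * K ^ m" for m
  proof (induction m)
    case 0
    then show ?case using c by (simp add: one_le_power)
  next
    case (Suc m)
    show ?case
    proof (cases "Suc m \<le> N")
      case True
      have "q ^ tri (Suc m) \<le> 1" using q_pos q_lt_1 by (intro power_le_one) auto
      also have "1 \<le> (c * K) ^ Suc m" using c by (intro one_le_power)
      also have "\<dots> = c ^ Suc m * K ^ Suc m" by (rule power_mult_distrib)
      also have "\<dots> \<le> c ^ N * K ^ Suc m" using c True K by (intro mult_right_mono power_increasing) auto
      finally show ?thesis .
    next
      case False
      have "q ^ Suc m \<le> q ^ N" using False q_pos q_lt_1 by (intro power_decreasing) auto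
      then have "q ^ tri m * q ^ Suc m \<le> (c ^ N * K ^ m) * K"
        using Suc N q_pos c K by (intro mult_mono) auto
      then show ?thesis unfolding tri.simps power_add by (simp add: mult_ac)
    qed
  qed
  then show "\<exists>C>0. \<forall>m. \<bar>q ^ tri m\<bar> \<le> C * K ^ m"
    using q_pos c by (intro exI[of _ "c ^ N"]) auto
qed

lemma Lam_summable: assumes "gb f" shows "summable (\<lambda>n. q ^ tri n * f $ n)"
proof -
  obtain M K where f: "0 < M" "1 \<le> K" "\<And>n. \<bar>f $ n\<bar> \<le> M * K ^ n"
    using assms unfolding gb_def by (rule geo_boundedE) blast
  obtain C where C: "0 < C" "\<And>m. \<bar>q ^ tri m\<bar> \<le> C * (1 / (2 * K)) ^ m"
    using rapidE[OF rapid_tri, of "1 / (2 * K)"] f by auto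
  show ?thesis
  proof (rule summable_comparison_test[of _ "\<lambda>n. C * M * (1 / 2) ^ n"])
    have "norm (q ^ tri n * f $ n) \<le> C * M * (1 / 2) ^ n" for n
    proof -
      have "norm (q ^ tri n * f $ n) \<le> (C * (1 / (2 * K)) ^ n) * (M * K ^ n)"
        unfolding real_norm_def abs_mult using C f by (intro mult_mono) auto
      also have "\<dots> = C * M * (1 / 2) ^ n" using f by (simp add: power_divide power_mult_distrib)
      finally show ?thesis .
    qed
    then show "\<exists>N. \<forall>n\<ge>N. norm (q ^ tri n * f $ n) \<le> C * M * (1 / 2) ^ n" by blast
  qed (simp add: summable_geometric summable_mult)
qed

lemma Lam_sums: "gb f \<Longrightarrow> (\<lambda>n. q ^ tri n * f $ n) sums Lam f"
  unfolding Lam_def by (rule summable_sums[OF Lam_summable])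

lemma Lam_add: "gb f \<Longrightarrow> gb g \<Longrightarrow> Lam (f + g) = Lam f + Lam g"
  using sums_add[OF Lam_sums[of f] Lam_sums[of g]] Lam_sums[OF gb_add[of f g]]
  by (simp add: sums_iff algebra_simps)

lemma Lam_const: "gb f \<Longrightarrow> Lam (fps_const c * f) = c * Lam f"
  using sums_mult[OF Lam_sums[of f], of c] Lam_sums[OF gb_mult[OF gb_const, of f c]]
  by (simp add: sums_iff mult_ac)

lemma Lam_minus: "gb f \<Longrightarrow> Lam (- f) = - Lam f"
  using Lam_const[of f "-1"] by (simp flip: fps_const_neg)

lemma Lam_diff: "gb f \<Longrightarrow> gb g \<Longrightarrow> Lam (f - g) = Lam f - Lam g"
  using Lam_add[of f "- g"] Lam_minus[of g] gb_minus[of g] by simp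

text \<open>q^tri (n+1) = q q^n q^tri n, so under \<open>Lam\<close> multiplication by z becomes q
  times the dilation by q. Every relation proved by a certificate rests on this rule.\<close>

lemma Lam_X: assumes "gb f" shows "Lam (fps_X * f) = q * Lam (sc q f)"
proof -
  have "(\<lambda>n. q ^ tri n * (fps_X * f) $ n) sums Lam (fps_X * f)"
    by (intro Lam_sums gb_intros assms)
  then have "(\<lambda>n. q ^ tri (Suc n) * (fps_X * f) $ Suc n) sums Lam (fps_X * f)"
    using sums_Suc_iff[of "\<lambda>n. q ^ tri n * (fps_X * f) $ n"] by simp
  moreover have "(\<lambda>n. q * (q ^ tri n * sc q f $ n)) sums (q * Lam (sc q f))"
    by (intro sums_mult Lam_sums gb_intros assms)
  then have "(\<lambda>n. q ^ tri (Suc n) * (fps_X * f) $ Suc n) sums (q * Lam (sc q f))"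
    by (simp add: power_add mult_ac)
  ultimately show ?thesis by (rule sums_unique2)
qed

text \<open>The functional \<^const>\<open>small_q.Lam\<close> kills the operators \<open>f \<mapsto> f - q\<^sup>-\<^sup>1 z f(z/q)\<close>.\<close>

lemma Lam_certificate:
  assumes "gb H" "gb p" "gb r" "D * H = N * sc q H" "gb D" "sc q r = N * p"
  shows "Lam ((D * p - fps_const (1 / q) * fps_X * r) * H) = 0"
proof -
  have "Lam (fps_X * (r * H)) = q * Lam (sc q (r * H))"
    by (intro Lam_X gb_intros assms)
  also have "sc q (r * H) = D * p * H"
    unfolding sc_mult assms(6) using assms(4) by (simp add: mult_ac)
  finally have 1: "Lam (fps_X * (r * H)) = q * Lam (D * p * H)" .
  have "(D * p - fps_const (1 / q) * fps_X * r) * H = D * p * H - fps_const (1 / q) * (fps_X * (r * H))"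
    by (simp add: algebra_simps)
  then have "Lam ((D * p - fps_const (1 / q) * fps_X * r) * H) = Lam (D * p * H) - 1 / q * Lam (fps_X * (r * H))"
    using assms by (simp add: Lam_diff Lam_const gb_intros)
  then show ?thesis using 1 q_pos by simp
qed

text \<open>The lowest nonvanishing coefficient e of the difference would satisfy e = q^n e with n >
  0.\<close>

lemma qdiff_unique:
  assumes "D * H = N * sc q H" "D * H' = N * sc q H'" "H $ 0 = H' $ 0" "D $ 0 = 1" "N $ 0 = 1"
  shows "H = H'"
proof (rule fps_ext)
  fix n show "H $ n = H' $ n"
  proof (induction n rule: less_induct)
    case (less n)
    show ?case
    proof (cases n)
      case 0
      then show ?thesis using assms by simp
    next
      case (Suc k)
      define E where "E = H - H'"
      have E: "E $ i = 0" if "i < n" for i using less that by (simp add: E_def)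
      have "D * E = N * sc q E" using assms(1,2) by (simp add: E_def sc_diff right_diff_distrib)
      then have "(D * E) $ n = (N * sc q E) $ n" by simp
      moreover have "(A * F) $ n = F $ n" if "A $ 0 = 1" "\<And>i. i < n \<Longrightarrow> F $ i = 0" for A F :: "real fps"
      proof -
        have "(A * F) $ n = (\<Sum>i\<in>{0}. A $ i * F $ (n - i))"
          unfolding fps_mult_nth using that by (intro sum.mono_neutral_right) auto
        then show ?thesis using that by simp
      qed
      ultimately have "E $ n = q ^ n * E $ n" using assms E by simp
      moreover have "q ^ n < 1" using power_Suc_less_one[of q k] q_pos q_lt_1 Suc by simp
      ultimately show ?thesis by (simp add: E_def)
    qed
  qed
qed

text \<open>Expansions of \<open>1/(c z;b)\<^sub>\<infinity>\<close> and \<open>(-c z;b)\<^sub>\<infinity>\<close> with \<open>b = q\<^sup>s\<close>, and of their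
  analogues in \<open>z\<^sup>s\<close>.\<close>

definition ei0 :: "real \<Rightarrow> nat \<Rightarrow> real fps" where
  "ei0 c s = Abs_fps (\<lambda>n. c ^ n / qpoch (q ^ s) (q ^ s) n)"

definition ep0 :: "real \<Rightarrow> nat \<Rightarrow> real fps" where
  "ep0 c s = Abs_fps (\<lambda>n. (c / q ^ s) ^ n * (q ^ s) ^ tri n / qpoch (q ^ s) (q ^ s) n)"

definition ei :: "real \<Rightarrow> nat \<Rightarrow> real fps" where "ei c s = dil s (ei0 c s)"
definition ep :: "real \<Rightarrow> nat \<Rightarrow> real fps" where "ep c s = dil s (ep0 c s)"

lemma qs: "0 < q ^ s" "1 \<le> s \<Longrightarrow> q ^ s < 1" "1 \<le> s \<Longrightarrow> q ^ s \<le> q"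
proof -
  show "q ^ s \<le> q" if "1 \<le> s" using power_decreasing[OF that, of q] q_pos q_lt_1 by simp
  then show "q ^ s < 1" if "1 \<le> s" using q_lt_1 that by force
qed (use q_pos in auto)

lemma qpoch_pos: assumes "1 \<le> s" shows "0 < qpoch (q ^ s) (q ^ s) n"
proof -
  have "(q ^ s) ^ Suc i < 1" for i using qs[of s] assms by (intro power_Suc_less_one) auto
  then show ?thesis by (auto simp: qpoch_def intro!: prod_pos)
qed

lemma qpoch_self_Suc: "qpoch b b (Suc n) = qpoch b b n * (1 - b ^ Suc n)"
  by (simp add: qpoch_Suc)

text \<open>Coefficientwise, the factor 1 - q^(s n) produced by the dilation cancels the last factor
  of the q-factorial.\<close>

lemma ei_eq: assumes "1 \<le> s" shows "(1 - fps_const c * fps_X ^ s) * ei c s = sc q (ei c s)"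
proof -
  let ?b = "q ^ s"
  have "ei0 c s - fps_const c * (fps_X * ei0 c s) = sc ?b (ei0 c s)"
  proof (rule fps_ext)
    fix n show "(ei0 c s - fps_const c * (fps_X * ei0 c s)) $ n = sc ?b (ei0 c s) $ n"
    proof (cases n)
      case (Suc m)
      have "c ^ n / qpoch ?b ?b n - c * (c ^ m / qpoch ?b ?b m) = ?b ^ n * (c ^ n / qpoch ?b ?b n)"
        using qpoch_pos[OF assms, of n] qpoch_pos[OF assms, of m] unfolding Suc qpoch_self_Suc
        by (simp add: divide_simps del: power_Suc) (simp add: algebra_simps)
      then show ?thesis by (simp add: ei0_def Suc)
    qed (simp add: ei0_def)
  qed
  then have "dil s (ei0 c s) - fps_const c * (fps_X ^ s * dil s (ei0 c s)) = sc q (dil s (ei0 c s))"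
    using assms by (simp add: sc_dil flip: dil_X_mult dil_const_mult dil_diff)
  then show ?thesis by (simp add: ei_def algebra_simps)
qed

text \<open>The quotient \<open>c / q ^ s\<close> in \<open>ep0\<close> lowers the exponent n(n+1)/2
  to Euler's n(n-1)/2; the equation then splits off the first factor of (-c z^s; q^s)_inf.\<close>

lemma ep_eq: assumes "1 \<le> s" shows "ep c s = (1 + fps_const c * fps_X ^ s) * sc q (ep c s)"
proof -
  let ?b = "q ^ s"
  have "ep0 c s = sc ?b (ep0 c s) + fps_const c * (fps_X * sc ?b (ep0 c s))"
  proof (rule fps_ext)
    fix n show "ep0 c s $ n = (sc ?b (ep0 c s) + fps_const c * (fps_X * sc ?b (ep0 c s))) $ n"
    proof (cases n)
      case (Suc m)
      define t p where "t = (c / ?b) ^ m * ?b ^ tri m" and "p = qpoch ?b ?b m"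
      have 1: "(c / ?b) ^ Suc m * ?b ^ tri (Suc m) = c * ?b ^ m * t"
        using q_pos by (simp add: t_def power_add)
      have key: "x / (p * (1 - B)) = B * (x / (p * (1 - B))) + x / p" if "1 - B \<noteq> 0" for x B
        using qpoch_pos[OF assms, of m] that by (simp add: p_def divide_simps) (simp add: algebra_simps)
      have "1 - ?b ^ Suc m \<noteq> 0"
        using qpoch_pos[OF assms, of "Suc m"] unfolding qpoch_self_Suc by auto
      note k = key[OF this, of "c * ?b ^ m * t"]
      have en: "ep0 c s $ Suc m = c * ?b ^ m * t / (p * (1 - ?b ^ Suc m))"
        by (simp only: ep0_def fps_nth_Abs_fps 1 qpoch_self_Suc p_def)
      have em: "ep0 c s $ m = t / p" by (simp add: ep0_def t_def p_def)
      have nth: "(sc ?b f + fps_const c * (fps_X * sc ?b f)) $ Suc m = ?b ^ Suc m * f $ Suc m + c * (?b ^ m * f $ m)" for f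
        by simp
      show ?thesis unfolding Suc nth en em by (rule trans[OF k]) simp
    qed (simp add: ep0_def)
  qed
  then have "dil s (ep0 c s) = sc q (dil s (ep0 c s)) + fps_const c * (fps_X ^ s * sc q (dil s (ep0 c s)))"
    using assms by (simp add: sc_dil flip: dil_X_mult dil_const_mult dil_add)
  then show ?thesis by (simp add: ep_def algebra_simps)
qed

lemma ei_0 [simp]: "ei c s $ 0 = 1" and ep_0 [simp]: "ep c s $ 0 = 1"
  by (simp_all add: ei_def ep_def ei0_def ep0_def)

lemma qpoch_lower: assumes "1 \<le> s" shows "(1 - q) ^ n \<le> qpoch (q ^ s) (q ^ s) n"
proof -
  have "1 - q \<le> 1 - q ^ s * (q ^ s) ^ i" for i
  proof -
    have "q ^ s * (q ^ s) ^ i \<le> q * 1"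
      using qs[of s] assms q_pos by (intro mult_mono power_le_one) (use q_lt_1 in \<open>auto intro: less_imp_le\<close>)
    then show ?thesis by simp
  qed
  then have "(\<Prod>i<n. 1 - q) \<le> (\<Prod>i<n. 1 - q ^ s * (q ^ s) ^ i)"
    using q_lt_1 by (intro prod_mono) auto
  then show ?thesis by (simp add: qpoch_def)
qed

lemma qpoch_inverse_le: assumes "1 \<le> s" shows "1 / qpoch (q ^ s) (q ^ s) n \<le> 2 ^ n"
proof -
  have "(1 / 2) ^ n \<le> (1 - q) ^ n" using q_half by (intro power_mono) auto
  also have "\<dots> \<le> qpoch (q ^ s) (q ^ s) n" by (rule qpoch_lower[OF assms])
  finally show ?thesis using qpoch_pos[OF assms, of n] by (simp add: field_simps power_divide)
qed

lemma gb_ei0: assumes "1 \<le> s" shows "gb (ei0 c s)"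
  unfolding gb_def
proof (rule geo_boundedI[of _ 1 "2 * \<bar>c\<bar>"])
  fix n
  have "\<bar>c\<bar> ^ n * (1 / qpoch (q ^ s) (q ^ s) n) \<le> \<bar>c\<bar> ^ n * 2 ^ n"
    using qpoch_inverse_le[OF assms] by (intro mult_left_mono) auto
  then show "\<bar>ei0 c s $ n\<bar> \<le> 1 * (2 * \<bar>c\<bar>) ^ n"
    using qpoch_pos[OF assms, of n] by (simp add: ei0_def abs_mult power_abs power_mult_distrib mult_ac)
qed

lemma gb_ep0: assumes "1 \<le> s" shows "gb (ep0 c s)"
  unfolding gb_def
proof (rule geo_boundedI[of _ 1 "2 * \<bar>c / q ^ s\<bar>"])
  fix n
  have "\<bar>c / q ^ s\<bar> ^ n * ((q ^ s) ^ tri n * (1 / qpoch (q ^ s) (q ^ s) n)) \<le> \<bar>c / q ^ s\<bar> ^ n * (1 * 2 ^ n)"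
    using qpoch_inverse_le[OF assms] qpoch_pos[OF assms, of n] qs[of s] assms
    by (intro mult_left_mono mult_mono power_le_one) (use q_lt_1 in \<open>auto intro: less_imp_le\<close>)
  then show "\<bar>ep0 c s $ n\<bar> \<le> 1 * (2 * \<bar>c / q ^ s\<bar>) ^ n"
    using qpoch_pos[OF assms, of n] q_pos by (simp add: ep0_def abs_mult power_abs power_mult_distrib power_divide mult_ac)
qed

lemma gb_ei: "1 \<le> s \<Longrightarrow> gb (ei c s)"
  unfolding ei_def by (rule gb_dil[OF gb_ei0])

lemma gb_ep: "1 \<le> s \<Longrightarrow> gb (ep c s)"
  unfolding ep_def by (rule gb_dil[OF gb_ep0])

text \<open>The moments of a series g. They are the rapidly decaying sequence in the later double
  sums, where g is kept and two further q-exponentials are expanded.\<close>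

lemma rapid_Lam_shift:
  assumes "gb g"
  shows "rapid (\<lambda>m. Lam (fps_X ^ m * g))"
    and "(\<lambda>i. q ^ tri (m + i) * g $ i) sums Lam (fps_X ^ m * g)"
proof -
  show s: "(\<lambda>i. q ^ tri (m + i) * g $ i) sums Lam (fps_X ^ m * g)" for m
  proof -
    have "(\<lambda>n. q ^ tri n * (fps_X ^ m * g) $ n) sums Lam (fps_X ^ m * g)"
      by (intro Lam_sums gb_intros assms)
    then have "(\<lambda>i. q ^ tri (i + m) * (fps_X ^ m * g) $ (i + m)) sums (Lam (fps_X ^ m * g) - (\<Sum>i<m. q ^ tri i * (fps_X ^ m * g) $ i))"
      by (rule sums_split_initial_segment)
    then show ?thesis by (simp add: fps_X_power_mult_nth add.commute)
  qed
  obtain M K where g: "0 < M" "1 \<le> K" "\<And>n. \<bar>g $ n\<bar> \<le> M * K ^ n"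
    using assms unfolding gb_def by (rule geo_boundedE) blast
  show "rapid (\<lambda>m. Lam (fps_X ^ m * g))"
    unfolding rapid_def
  proof (intro allI impI)
    fix L :: real assume L: "0 < L"
    define L' where "L' = min L (1 / (2 * K))"
    have L': "0 < L'" "L' \<le> L" "L' * K \<le> 1 / 2" using L g by (auto simp: L'_def field_simps min_def)
    obtain C where C: "0 < C" "\<And>m. \<bar>q ^ tri m\<bar> \<le> C * L' ^ m" by (rule rapidE[OF rapid_tri L'(1)]) blast
    have "\<bar>Lam (fps_X ^ m * g)\<bar> \<le> (2 * C * M) * L ^ m" for m
    proof -
      have b: "norm (q ^ tri (m + i) * g $ i) \<le> C * M * L ^ m * (1 / 2) ^ i" for i
      proof -
        have "norm (q ^ tri (m + i) * g $ i) \<le> (C * L' ^ (m + i)) * (M * K ^ i)"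
          unfolding real_norm_def abs_mult using C g L' by (intro mult_mono) auto
        also have "\<dots> = C * M * L' ^ m * (L' * K) ^ i" by (simp add: power_add power_mult_distrib)
        also have "\<dots> \<le> C * M * L ^ m * (1 / 2) ^ i"
          using C g L' by (intro mult_mono power_mono) auto
        finally show ?thesis .
      qed
      have "norm (Lam (fps_X ^ m * g)) \<le> (\<Sum>i. C * M * L ^ m * (1 / 2) ^ i)"
        unfolding sums_unique[OF s] by (rule norm_suminf_le[OF b]) (simp add: summable_mult summable_geometric)
      also have "\<dots> = C * M * L ^ m * 2"
        by (subst suminf_mult) (simp_all add: summable_geometric suminf_geometric)
      finally show ?thesis by (simp add: mult_ac)
    qed
    then show "\<exists>C>0. \<forall>m. \<bar>Lam (fps_X ^ m * g)\<bar> \<le> C * L ^ m"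
      using C g by (intro exI[of _ "2 * C * M"]) auto
  qed
qed

lemma Lam_mult_sums:
  assumes "gb f" "gb g"
  shows "(\<lambda>m. f $ m * Lam (fps_X ^ m * g)) sums Lam (f * g)"
proof -
  define F where "F = (\<lambda>(i, j). f $ i * g $ j * q ^ tri (1 * i + 1 * j))"
  have "F summable_on UNIV"
    unfolding F_def using assms rapid_tri by (intro rapid_pairs_summable) (auto simp: gb_def)
  then obtain S where S: "(F has_sum S) UNIV" by (auto simp: summable_on_def)
  have "(\<lambda>n. \<Sum>j\<le>n. f $ j * g $ (n - j) * q ^ tri (1 * j + 1 * (n - j))) sums S"
    by (rule has_sum_pairs_diagonal) (use S in \<open>simp add: F_def\<close>)
  then have "(\<lambda>n. q ^ tri n * (f * g) $ n) sums S"
  proof -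
    have "(\<Sum>j\<le>n. f $ j * g $ (n - j) * q ^ tri (1 * j + 1 * (n - j))) = q ^ tri n * (f * g) $ n" for n
      unfolding fps_mult_nth sum_distrib_left atLeast0AtMost by (rule sum.cong) simp_all
    then show ?thesis using \<open>(\<lambda>n. \<Sum>j\<le>n. f $ j * g $ (n - j) * q ^ tri (1 * j + 1 * (n - j))) sums S\<close>
      by (simp only:)
  qed
  then have "S = Lam (f * g)" by (simp add: Lam_def sums_iff)
  moreover have "(\<lambda>m. f $ m * Lam (fps_X ^ m * g)) sums S"
  proof (rule has_sum_pairs_rows)
    show "((\<lambda>(i, j). f $ i * g $ j * q ^ tri (i + j)) has_sum S) UNIV" using S by (simp add: F_def)
    show "(\<lambda>j. f $ i * g $ j * q ^ tri (i + j)) sums (f $ i * Lam (fps_X ^ i * g))" for i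
      using sums_mult[OF rapid_Lam_shift(2)[OF assms(2)], of "f $ i" i] by (simp add: mult_ac)
  qed
  ultimately show ?thesis by simp
qed

lemma Lam_pairing:
  assumes "gb g" "gb f" "gb h" "1 \<le> s" "1 \<le> t"
  shows "(\<lambda>n. \<Sum>j\<le>n. f $ j * h $ (n - j) * Lam (fps_X ^ (s * j + t * (n - j)) * g)) sums Lam (dil s f * dil t h * g)"
proof -
  obtain S where S: "(\<lambda>m. (dil s f * dil t h) $ m * Lam (fps_X ^ m * g)) sums S"
    "(\<lambda>n. \<Sum>j\<le>n. f $ j * h $ (n - j) * Lam (fps_X ^ (s * j + t * (n - j)) * g)) sums S"
    using pairing_diagonal[OF rapid_Lam_shift(1)[OF assms(1)] assms(2-5)] by blast
  have "(\<lambda>m. (dil s f * dil t h) $ m * Lam (fps_X ^ m * g)) sums Lam (dil s f * dil t h * g)"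
    by (intro Lam_mult_sums gb_intros gb_dil assms)
  then have "S = Lam (dil s f * dil t h * g)" using S(1) sums_unique2 by blast
  then show ?thesis using S(2) by simp
qed

end

section \<open>Generating functions of the six families\<close>

text \<open>The ten weakly increasing windows of four parts with spread at most 2; avoiding them is
  the inequality in \<open>satisfies_condition\<close>.\<close>

definition windows :: "nat list list" where
  "windows = [[0,0,0,0], [0,0,0,1], [0,0,0,2], [0,0,1,1], [0,0,1,2], [0,0,2,2],
              [0,1,1,1], [0,1,1,2], [0,1,2,2], [0,2,2,2]]"

text \<open>Three parts with spread at most 1 have offsets 0,0,0 or 0,0,1 or 0,1,1, and their sum is
  0, 1 or 2 modulo 3. Condition (2) forbids the first two shapes; Condition (1), encoded below,
  forbids the first and the third.\<close>

definition pat_cond2 :: "nat list list" where "pat_cond2 = [0,0,0] # [0,0,1] # windows"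
definition pat_cond1 :: "nat list list" where "pat_cond1 = [0,0,0] # [0,1,1] # windows"
definition pat7 :: "nat list list" where "pat7 = [[0,0,1], [0,1,1], [0,0,0,0], [0,0,0,2], [0,2,2,2]]"
definition pat8 :: "nat list list" where "pat8 = [[0,0,0], [0,0,1], [0,1,2,2], [0,1,2,3], [0,1,1,3,3]]"
definition pat8a :: "nat list list" where "pat8a = [[0,0,0], [0,1,1], [0,0,1,2], [0,1,2,3], [0,0,2,2,3]]"

context small_q
begin

lemma hgf_0: "[] \<notin> set W \<Longrightarrow> hgf (St P W) $ 0 = 1"
proof -
  assume "[] \<notin> set W"
  then have "{p \<in> St P W. length p = 0} = {[]}" by (auto simp: St_def Par_def)
  then show ?thesis by (simp add: hgf_def)
qed

abbreviation h :: "nat list list \<Rightarrow> nat list list \<Rightarrow> real fps" where "h P W \<equiv> hgf (St P W)"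
abbreviation Q :: "real fps" where "Q \<equiv> fps_const q"
abbreviation K :: "real fps" where "K \<equiv> fps_const (1 / q)"
abbreviation X :: "real fps" where "X \<equiv> fps_X"

lemma QK: "Q * K = 1" using q_pos by simp

text \<open>Here and in the next three lemmas: rows with at most 0, 1, 2 or 3 ones. The term for
  exactly one 1 is free of dilation and can be eliminated algebraically.\<close>

lemma hgf_step1: "step_ok P W [A] \<Longrightarrow> h P W = sc q (h P A)"
  using hgf_step[of P W "[A]"] by simp

lemma hgf_step2: "step_ok P W [A, B] \<Longrightarrow> h P W = sc q (h P A) + X * h P B"
  using hgf_step[of P W "[A, B]"] q_pos by (simp add: lessThan_Suc)

lemma hgf_step3:
  "step_ok P W [A, B, C] \<Longrightarrow> h P W = sc q (h P A) + X * h P B + K * X\<^sup>2 * sc (1 / q) (h P C)"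
  using hgf_step[of P W "[A, B, C]"] q_pos by (simp add: lessThan_Suc power2_eq_square mult_ac add_ac)

lemma hgf_step4:
  "step_ok P W [A, B, C, D] \<Longrightarrow>
    h P W = sc q (h P A) + X * h P B + K * X\<^sup>2 * sc (1 / q) (h P C) + K ^ 3 * X ^ 3 * sc (1 / q\<^sup>2) (h P D)"
proof -
  have "q / (q * q) = 1 / q" "q * q / (q * (q * q)) = 1 / q" "q / (q * (q * q)) = 1 / q\<^sup>2"
    "q * (q * q) / (q * (q * (q * (q * (q * q))))) = (1 / q) ^ 3"
    using q_pos by (simp_all add: divide_simps power2_eq_square power3_eq_cube)
  then show "step_ok P W [A, B, C, D] \<Longrightarrow> ?thesis"
    using hgf_step[of P W "[A, B, C, D]"] q_pos
    by (simp add: lessThan_Suc power2_eq_square mult_ac add_ac numeral_eq_Suc)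
qed

lemma sc_ei: "1 \<le> s \<Longrightarrow> sc q (ei c s) = ei (c * q ^ s) s"
  unfolding ei_def by (simp add: sc_dil) (rule arg_cong, simp add: fps_eq_iff ei0_def power_mult_distrib)

lemma sc_ep: "1 \<le> s \<Longrightarrow> sc q (ep c s) = ep (c * q ^ s) s"
  unfolding ep_def using q_pos
  by (simp add: sc_dil) (rule arg_cong, simp add: fps_eq_iff ep0_def power_mult_distrib power_divide)

lemmas sc_simps = sc_mult sc_add sc_diff sc_power sc_X sc_const sc_1

lemma qdiff_mult:
  assumes "D * H = N * sc q H" "D' * H' = N' * sc q H'"
  shows "(D * D') * (H * H') = (N * N') * sc q (H * H')"
  using arg_cong2[OF assms, of "(*)"] by (simp add: sc_mult mult_ac)

lemma qdiff_ei: "1 \<le> s \<Longrightarrow> (1 - fps_const c * X ^ s) * ei c s = 1 * sc q (ei c s)"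
  and qdiff_ep: "1 \<le> s \<Longrightarrow> 1 * ep c s = (1 + fps_const c * X ^ s) * sc q (ep c s)"
  using ei_eq ep_eq by auto

lemmas gb_all = gb_intros gb_ei[OF order_refl] gb_ep[OF order_refl] gb_ei gb_ep

section \<open>The six systems, each reduced to one first-order equation\<close>

lemma total_case5:
  "total (St pat_cond2 [[1,2,2]]) = Lam ((1 + K * X\<^sup>2 - K * X ^ 3) * (ei 1 1 * ei (1 / q) 3 * ep q 2))"
proof -
  define a where "a = h pat_cond2 []"
  define b where "b = h pat_cond2 [[1,2,2]]"
  define c where "c = h pat_cond2 [[1,1],[1,2,2]]"
  define d where "d = h pat_cond2 [[1],[2,2]]"
  define e where "e = h pat_cond2 [[1,1]]"
  have a: "a = sc q a + X * b + K * X\<^sup>2 * sc (1 / q) d"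
    unfolding a_def b_def d_def by (rule hgf_step3) code_simp
  have b: "b = sc q a + X * c + K * X\<^sup>2 * sc (1 / q) d"
    unfolding a_def b_def c_def d_def by (rule hgf_step3) code_simp
  have c: "c = sc q a + X * c"
    unfolding a_def c_def by (rule hgf_step2) code_simp
  have d: "d = sc q e"
    unfolding d_def e_def by (rule hgf_step1) code_simp
  have e: "e = sc q a + X * b"
    unfolding a_def b_def e_def by (rule hgf_step2) code_simp
  define s where "s = sc q a"
  \<comment> \<open>The state that follows two ones forbids the part 1 (originally a 2), so its own
    row is a pure dilation, which cancels the dilation by 1/q.\<close>
  have d': "sc (1 / q) d = e" using d q_pos by simp
  have a2: "a = (1 + K * X\<^sup>2) * e" using a d' e by (simp add: algebra_simps)
  have s2: "s = (1 + Q * X\<^sup>2) * sc q e"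
  proof -
    have "K * (Q * X)\<^sup>2 = Q * X\<^sup>2" using QK by algebra
    then show ?thesis unfolding s_def by (subst a2) (simp only: sc_simps)
  qed
  have "b = s + X * c + K * X\<^sup>2 * e" "c = s + X * c" "e = s + X * b"
    using b c e d' by (simp_all add: s_def)
  then have es: "(1 - X) * (1 - K * X ^ 3) * e = s" and "(1 - X) * b = (1 - X) * ((1 + K * X\<^sup>2 - K * X ^ 3) * e)"
    by algebra+
  moreover have "1 - X \<noteq> 0" by (metis diff_0_right fps_X_nth fps_one_nth fps_sub_nth fps_zero_nth one_neq_zero zero_neq_one)
  ultimately have b2: "b = (1 + K * X\<^sup>2 - K * X ^ 3) * e" by simp
  let ?H = "ei 1 1 * ei (1 / q) 3 * ep q 2"
  have "e = ?H"
  proof (rule qdiff_unique)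
    show "(1 - X) * (1 - K * X ^ 3) * e = (1 + Q * X\<^sup>2) * sc q e" using es s2 by simp
    have "((1 - fps_const 1 * X ^ 1) * (1 - K * X ^ 3) * 1) * ?H = (1 * 1 * (1 + Q * X\<^sup>2)) * sc q ?H"
      by (intro qdiff_mult qdiff_ei qdiff_ep) simp_all
    then show "(1 - X) * (1 - K * X ^ 3) * ?H = (1 + Q * X\<^sup>2) * sc q ?H" by simp
    show "e $ 0 = ?H $ 0" unfolding e_def by (simp add: hgf_0)
  qed simp_all
  then show ?thesis using total_Lam[of "St pat_cond2 [[1,2,2]]"] b2 by (auto simp: b_def St_def)
qed

lemma total_case6:
  "total (St pat_cond1 [[2],[1,2],[1,1,2]]) = Lam (X * (1 + K - X) * (ei 1 1 * ei q 3 * ep q 2))"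
proof -
  define a where "a = h pat_cond1 []"
  define b where "b = h pat_cond1 [[1,1]]"
  define g where "g = h pat_cond1 [[1,1],[1,2],[2,2]]"
  define s where "s = h pat_cond1 [[1]]"
  define u where "u = h pat_cond1 [[1],[2,2]]"
  define v where "v = h pat_cond1 [[2],[1,2],[1,1,2]]"
  have a: "a = sc q a + X * b + K * X\<^sup>2 * sc (1 / q) g"
    unfolding a_def b_def g_def by (rule hgf_step3) code_simp
  have b: "b = sc q a + X * b"
    unfolding a_def b_def by (rule hgf_step2) code_simp
  have g: "g = sc q b + X * s"
    unfolding g_def b_def s_def by (rule hgf_step2) code_simp
  have s: "s = sc q a"
    unfolding s_def a_def by (rule hgf_step1) code_simp
  have u: "u = sc q b"
    unfolding u_def b_def by (rule hgf_step1) code_simp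
  have v: "v = sc q s + X * s + K * X\<^sup>2 * sc (1 / q) u"
    unfolding v_def s_def u_def by (rule hgf_step3) code_simp
  have u': "sc (1 / q) u = b" using u q_pos by simp
  have g': "sc (1 / q) g = b + K * X * a" using g s q_pos by (simp add: sc_add sc_mult)
  have a2: "(1 - K\<^sup>2 * X ^ 3) * a = (1 + K * X\<^sup>2) * b" using a b unfolding g' by algebra
  have s2: "(1 - Q * X ^ 3) * s = (1 + Q * X\<^sup>2) * sc q b"
  proof -
    have "K\<^sup>2 * (Q * X) ^ 3 = Q * X ^ 3" "K * (Q * X)\<^sup>2 = Q * X\<^sup>2" using QK by algebra+
    moreover have "(1 - K\<^sup>2 * (Q * X) ^ 3) * sc q a = (1 + K * (Q * X)\<^sup>2) * sc q b"
      using arg_cong[OF a2, of "sc q"] by (simp only: sc_simps)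
    ultimately show ?thesis by (simp only: s)
  qed
  have bs: "(1 - X) * b = s" using b s by algebra
  let ?H = "ei 1 1 * ei q 3 * ep q 2"
  have bH: "b = ?H"
  proof (rule qdiff_unique)
    show "(1 - X) * (1 - Q * X ^ 3) * b = (1 + Q * X\<^sup>2) * sc q b" using s2 unfolding bs[symmetric] by (simp only: mult_ac)
    have "((1 - fps_const 1 * X ^ 1) * (1 - Q * X ^ 3) * 1) * ?H = (1 * 1 * (1 + Q * X\<^sup>2)) * sc q ?H"
      by (intro qdiff_mult qdiff_ei qdiff_ep) simp_all
    then show "(1 - X) * (1 - Q * X ^ 3) * ?H = (1 + Q * X\<^sup>2) * sc q ?H" by simp
    show "b $ 0 = ?H $ 0" unfolding b_def by (simp add: hgf_0)
  qed simp_all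
  then have gb: "gb b" by (auto intro!: gb_all)
  then have gs: "gb s" using bs by (auto intro!: gb_intros simp flip: bs)
  have "Lam v = Lam (sc q s) + Lam (X * s + K * X\<^sup>2 * b)"
    unfolding v u' add.assoc by (rule Lam_add) (intro gb_intros gs gb)+
  \<comment> \<open>\<open>v\<close> contains the further dilation \<open>sc q s\<close>. Under
    \<open>Lam\<close> the rule \<open>Lam_X\<close>, read backwards, trades it for the factor
    X/q.\<close>
  also have "Lam (sc q s) = Lam (K * (X * s))"
    using Lam_X[OF gs] Lam_const[of "X * s" "1 / q"] gs q_pos by (simp add: gb_intros)
  also have "\<dots> + Lam (X * s + K * X\<^sup>2 * b) = Lam (K * (X * s) + (X * s + K * X\<^sup>2 * b))"
    by (rule Lam_add[symmetric]) (intro gb_intros gs gb)+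
  also have "K * (X * s) + (X * s + K * X\<^sup>2 * b) = X * (1 + K - X) * b"
    unfolding bs[symmetric] by algebra
  finally show ?thesis using total_Lam[of "St pat_cond1 [[2],[1,2],[1,1,2]]"] bH by (auto simp: v_def St_def)
qed

text \<open>One parameter covers both cases: T = 1 belongs to 7 and T = q^2 to 7a. The factors
  \<open>ei T 2\<close> and \<open>ei (T * q) 2\<close> together are 1/(T z^2; q)_inf, and
  \<open>ei (q ^ 3) 3\<close> times \<open>ep (- q) 1\<close> is the inverse of the product of all 1
  + q^i z + q^(2i) z^2 with i \<ge> 1.\<close>

definition H7 :: "real \<Rightarrow> real fps" where
  "H7 T = ei T 2 * ei (T * q) 2 * ei (q ^ 3) 3 * ep (- q) 1 * ep q 1 * ep T 1 * ep (T * q\<^sup>2) 2"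

text \<open>The last quadratic factor on the left is (1 - q^3 z^3)/(1 - q z); the factor 1 - q z
  common to both sides of the raw equation is cancelled.\<close>

lemma H7_eq:
  fixes T
  defines "t \<equiv> fps_const T"
  shows "(1 - t * X\<^sup>2) * (1 - t * Q * X\<^sup>2) * (1 + Q * X + Q\<^sup>2 * X\<^sup>2) * H7 T
    = (1 + Q * X) * (1 + t * X) * (1 + t * Q\<^sup>2 * X\<^sup>2) * sc q (H7 T)"
proof -
  have "((1 - t * X\<^sup>2) * (1 - fps_const (T * q) * X\<^sup>2) * (1 - fps_const (q ^ 3) * X ^ 3) * 1 * 1 * 1 * 1) * H7 T
    = (1 * 1 * 1 * (1 + fps_const (- q) * X ^ 1) * (1 + Q * X ^ 1) * (1 + t * X ^ 1) * (1 + fps_const (T * q\<^sup>2) * X\<^sup>2)) * sc q (H7 T)"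
    unfolding H7_def t_def by (intro qdiff_mult qdiff_ei qdiff_ep) simp_all
  moreover have "fps_const (T * q) = t * Q" "fps_const (q ^ 3) = Q ^ 3" "fps_const (- q) = - Q" "fps_const (T * q\<^sup>2) = t * Q\<^sup>2"
    by (simp_all add: t_def)
  ultimately have *: "((1 - t * X\<^sup>2) * (1 - t * Q * X\<^sup>2) * (1 - Q ^ 3 * X ^ 3)) * H7 T
    = ((1 + - Q * X) * (1 + Q * X) * (1 + t * X) * (1 + t * Q\<^sup>2 * X\<^sup>2)) * sc q (H7 T)"
    by (simp only: mult_1 mult_1_right power_one_right)
  have "(1 - Q * X) * ((1 - t * X\<^sup>2) * (1 - t * Q * X\<^sup>2) * (1 + Q * X + Q\<^sup>2 * X\<^sup>2) * H7 T)
    = (1 - Q * X) * ((1 + Q * X) * (1 + t * X) * (1 + t * Q\<^sup>2 * X\<^sup>2) * sc q (H7 T))"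
    using * by algebra
  moreover have "1 - Q * X \<noteq> 0"
  proof
    assume "1 - Q * X = 0"
    then have "(1 - Q * X) $ 0 = 0" by simp
    then show False by simp
  qed
  ultimately show ?thesis by simp
qed

lemma gb_H7: "gb (H7 T)" unfolding H7_def by (intro gb_all) simp_all

lemma total_case7:
  "total (St pat7 [[1,1],[2,2,2],[1,2,2,2]]) = Lam (H7 1)"
  "total (St pat7 [[1],[2]]) = Lam (H7 (q\<^sup>2))"
proof -
  define a where "a = h pat7 []"
  define b where "b = h pat7 [[1,1],[2,2,2]]"
  define d where "d = h pat7 [[1],[2,2,2]]"
  define f where "f = h pat7 [[1],[2]]"
  define e where "e = h pat7 [[1,1,1]]"
  define s where "s = h pat7 [[1]]"
  have a: "a = sc q a + X * b + K * X\<^sup>2 * sc (1 / q) d + K ^ 3 * X ^ 3 * sc (1 / q\<^sup>2) f"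
    unfolding a_def b_def d_def f_def by (rule hgf_step4) code_simp
  have b: "b = sc q e + X * b"
    unfolding b_def e_def by (rule hgf_step2) code_simp
  \<comment> \<open>The segment 1,2,2,2 contains 1,2,2, an instance of the pattern
    \<open>[0,1,1]\<close>; with or without it the row is the same.\<close>
  have b': "h pat7 [[1,1],[2,2,2],[1,2,2,2]] = sc q e + X * b"
    unfolding b_def e_def by (rule hgf_step2) code_simp
  have d: "d = sc q e"
    unfolding d_def e_def by (rule hgf_step1) code_simp
  have f: "f = sc q s"
    unfolding f_def s_def by (rule hgf_step1) code_simp
  have s: "s = sc q a"
    unfolding s_def a_def by (rule hgf_step1) code_simp
  have e: "e = sc q a + X * b + K * X\<^sup>2 * sc (1 / q) d"
    unfolding e_def a_def b_def d_def by (rule hgf_step3) code_simp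
  have 1: "1 - X \<noteq> 0" by (metis diff_0_right fps_X_nth fps_one_nth fps_sub_nth fps_zero_nth one_neq_zero zero_neq_one)
  have d': "sc (1 / q) d = e" and f': "sc (1 / q\<^sup>2) f = a"
    using d f s q_pos by (simp_all add: power2_eq_square)
  have e1: "e = (1 - K ^ 3 * X ^ 3) * a" using a e unfolding d' f' by algebra
  have e2: "sc q e = (1 - X ^ 3) * s"
  proof -
    have "K ^ 3 * (Q * X) ^ 3 = X ^ 3" using QK by algebra
    then show ?thesis unfolding s by (subst e1) (simp only: sc_simps)
  qed
  have b2: "b = (1 + X + X\<^sup>2) * s"
  proof -
    have "(1 - X) * b = (1 - X) * ((1 + X + X\<^sup>2) * s)" using b e2 by algebra
    then show ?thesis using 1 by simp
  qed
  have as: "(1 - K ^ 3 * X ^ 3) * (1 - K * X\<^sup>2) * a = (1 + X) * (1 + X\<^sup>2) * s"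
    using e e1 b2 unfolding d' s by algebra
  have s3: "(1 - X ^ 3) * (1 - Q * X\<^sup>2) * s = (1 + Q * X) * (1 + Q\<^sup>2 * X\<^sup>2) * f"
  proof -
    have "K ^ 3 * (Q * X) ^ 3 = X ^ 3" "K * (Q * X)\<^sup>2 = Q * X\<^sup>2" using QK by algebra+
    moreover have "(1 - K ^ 3 * (Q * X) ^ 3) * (1 - K * (Q * X)\<^sup>2) * sc q a = (1 + Q * X) * (1 + (Q * X)\<^sup>2) * sc q s"
      using arg_cong[OF as, of "sc q"] by (simp only: sc_simps)
    ultimately show ?thesis by (simp only: s[symmetric] f[symmetric] power_mult_distrib[of Q X 2])
  qed
  have f3: "(1 - Q ^ 3 * X ^ 3) * (1 - Q ^ 3 * X\<^sup>2) * f = (1 + Q\<^sup>2 * X) * (1 + Q ^ 4 * X\<^sup>2) * sc q f"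
  proof -
    have "(Q * X) ^ 3 = Q ^ 3 * X ^ 3" "Q * (Q * X)\<^sup>2 = Q ^ 3 * X\<^sup>2" "Q * (Q * X) = Q\<^sup>2 * X" "Q\<^sup>2 * (Q * X)\<^sup>2 = Q ^ 4 * X\<^sup>2" by algebra+
    moreover have "(1 - (Q * X) ^ 3) * (1 - Q * (Q * X)\<^sup>2) * sc q s = (1 + Q * (Q * X)) * (1 + Q\<^sup>2 * (Q * X)\<^sup>2) * sc q f"
      using arg_cong[OF s3, of "sc q"] by (simp only: sc_simps)
    ultimately show ?thesis by (simp only: f[symmetric])
  qed
  have sb: "sc q b = (1 + Q * X + Q\<^sup>2 * X\<^sup>2) * f"
  proof -
    show ?thesis unfolding f by (subst b2) (simp only: sc_simps power_mult_distrib)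
  qed
  have H70: "H7 T $ 0 = 1" for T by (simp add: H7_def)
  have "b = H7 1"
  proof (rule qdiff_unique)
    show "(1 - X\<^sup>2) * (1 - Q * X\<^sup>2) * (1 + Q * X + Q\<^sup>2 * X\<^sup>2) * b = (1 + Q * X) * (1 + X) * (1 + Q\<^sup>2 * X\<^sup>2) * sc q b"
    proof -
      have "(1 - X\<^sup>2) * (1 - Q * X\<^sup>2) * (1 + Q * X + Q\<^sup>2 * X\<^sup>2) * b
        = (1 + X) * (1 + Q * X + Q\<^sup>2 * X\<^sup>2) * ((1 - X ^ 3) * (1 - Q * X\<^sup>2) * s)"
        unfolding b2 by algebra
      also have "\<dots> = (1 + Q * X) * (1 + X) * (1 + Q\<^sup>2 * X\<^sup>2) * sc q b"
        unfolding s3 sb by algebra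
      finally show ?thesis .
    qed
    show "(1 - X\<^sup>2) * (1 - Q * X\<^sup>2) * (1 + Q * X + Q\<^sup>2 * X\<^sup>2) * H7 1 = (1 + Q * X) * (1 + X) * (1 + Q\<^sup>2 * X\<^sup>2) * sc q (H7 1)"
      using H7_eq[of 1] by simp
    show "b $ 0 = H7 1 $ 0" unfolding H70 b_def by (simp add: hgf_0)
  qed simp_all
  then show "total (St pat7 [[1,1],[2,2,2],[1,2,2,2]]) = Lam (H7 1)"
    using total_Lam[of "St pat7 [[1,1],[2,2,2],[1,2,2,2]]"] b' b by (auto simp: St_def)
  have "f = H7 (q\<^sup>2)"
  proof (rule qdiff_unique)
    show "(1 - Q\<^sup>2 * X\<^sup>2) * (1 - Q\<^sup>2 * Q * X\<^sup>2) * (1 + Q * X + Q\<^sup>2 * X\<^sup>2) * f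
      = (1 + Q * X) * (1 + Q\<^sup>2 * X) * (1 + Q\<^sup>2 * Q\<^sup>2 * X\<^sup>2) * sc q f"
    proof -
      have "(1 - Q\<^sup>2 * X\<^sup>2) * (1 - Q\<^sup>2 * Q * X\<^sup>2) * (1 + Q * X + Q\<^sup>2 * X\<^sup>2) * f
        = (1 + Q * X) * ((1 - Q ^ 3 * X ^ 3) * (1 - Q ^ 3 * X\<^sup>2) * f)"
        by algebra
      also have "\<dots> = (1 + Q * X) * (1 + Q\<^sup>2 * X) * (1 + Q\<^sup>2 * Q\<^sup>2 * X\<^sup>2) * sc q f"
        unfolding f3 by algebra
      finally show ?thesis .
    qed
    show "(1 - Q\<^sup>2 * X\<^sup>2) * (1 - Q\<^sup>2 * Q * X\<^sup>2) * (1 + Q * X + Q\<^sup>2 * X\<^sup>2) * H7 (q\<^sup>2)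
      = (1 + Q * X) * (1 + Q\<^sup>2 * X) * (1 + Q\<^sup>2 * Q\<^sup>2 * X\<^sup>2) * sc q (H7 (q\<^sup>2))"
      using H7_eq[of "q\<^sup>2"] by (simp only: fps_const_power)
    show "f $ 0 = H7 (q\<^sup>2) $ 0" unfolding H70 f_def by (simp add: hgf_0)
  qed simp_all
  then show "total (St pat7 [[1],[2]]) = Lam (H7 (q\<^sup>2))"
    using total_Lam[of "St pat7 [[1],[2]]"] by (auto simp: f_def St_def)
qed

text \<open>The two q-exponentials share the parameter t. Case 8 is the value at q^2, and case 8a is
  1 + q times the value at q^4.\<close>

definition F8 :: "real \<Rightarrow> real" where
  "F8 t = Lam (ep t 2 * ei t 3 * (ep q 1 * ei q 2))"

text \<open>Both systems 8 and 8a end in this equation, with c = 1/q and c = 1/q^2.\<close>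

lemma H8_eq:
  fixes H r k :: "real fps"
  assumes "(1 - K * X\<^sup>2) * (1 - fps_const c * X ^ 3) * H = (1 + X) * (1 + X\<^sup>2) * sc q H" "H $ 0 = 1"
  shows "sc q H = ep q 1 * ep (q\<^sup>2) 2 * ei q 2 * ei (c * q ^ 3) 3"
proof -
  let ?H = "ep 1 1 * ep 1 2 * ei (1 / q) 2 * ei c 3"
  have "H = ?H"
  proof (rule qdiff_unique[OF assms(1)])
    have "(1 * 1 * (1 - K * X\<^sup>2) * (1 - fps_const c * X ^ 3)) * ?H
      = ((1 + fps_const 1 * X ^ 1) * (1 + fps_const 1 * X\<^sup>2) * 1 * 1) * sc q ?H"
      by (intro qdiff_mult qdiff_ei qdiff_ep) simp_all
    then show "(1 - K * X\<^sup>2) * (1 - fps_const c * X ^ 3) * ?H = (1 + X) * (1 + X\<^sup>2) * sc q ?H" by simp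
    show "H $ 0 = ?H $ 0" using assms(2) by simp
  qed simp_all
  then show ?thesis using q_pos by (simp add: sc_mult sc_ei sc_ep power2_eq_square)
qed

lemma total_case8: "total (St pat8 [[1]]) = F8 (q\<^sup>2)"
proof -
  define a where "a = h pat8 []"
  define s where "s = h pat8 [[1]]"
  define b where "b = h pat8 [[1,1,3,3],[1,2,2],[1,2,3]]"
  define c where "c = h pat8 [[1,1],[1,2]]"
  define d where "d = h pat8 [[1],[2,2]]"
  define e where "e = h pat8 [[1,1]]"
  have a: "a = sc q a + X * b + K * X\<^sup>2 * sc (1 / q) s"
    unfolding a_def b_def s_def by (rule hgf_step3) code_simp
  have s: "s = sc q a"
    unfolding s_def a_def by (rule hgf_step1) code_simp
  have b: "b = sc q a + X * c + K * X\<^sup>2 * sc (1 / q) d"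
    unfolding a_def b_def c_def d_def by (rule hgf_step3) code_simp
  have c: "c = sc q a + X * s"
    unfolding a_def c_def s_def by (rule hgf_step2) code_simp
  have d: "d = sc q e"
    unfolding d_def e_def by (rule hgf_step1) code_simp
  have e: "e = sc q a + X * b"
    unfolding e_def a_def b_def by (rule hgf_step2) code_simp
  have d': "sc (1 / q) d = e" and s': "sc (1 / q) s = a" using d s q_pos by simp_all
  have "(1 - K * X\<^sup>2) * (1 - K * X ^ 3) * a = (1 + X) * (1 + X\<^sup>2) * sc q a"
    using a b c e s unfolding d' s' by algebra
  then have "s = ep q 1 * ep (q\<^sup>2) 2 * ei q 2 * ei (1 / q * q ^ 3) 3"
    unfolding s by (rule H8_eq) (simp add: a_def hgf_0)
  moreover have "1 / q * q ^ 3 = q\<^sup>2" using q_pos by (simp add: power2_eq_square power3_eq_cube)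
  ultimately show ?thesis using total_Lam[of "St pat8 [[1]]"] by (auto simp: F8_def s_def St_def mult_ac)
qed

lemma total_case8a:
  "total (St pat8a [[1,1],[1,2,3],[2,2,3]])
    = Lam ((1 + X + X\<^sup>2 - Q * X ^ 3) * (ep q 1 * ep (q\<^sup>2) 2 * ei q 2 * ei q 3))"
proof -
  define a where "a = h pat8a []"
  define t where "t = h pat8a [[1,1],[1,2,3],[2,2,3]]"
  define b where "b = h pat8a [[1,1],[1,2,3]]"
  define d where "d = h pat8a [[1,1],[1,2],[2,2,3]]"
  define s where "s = h pat8a [[1,1,2]]"
  define c where "c = h pat8a [[1,1],[1,2]]"
  define u where "u = h pat8a [[1]]"
  define g where "g = h pat8a [[1],[2,2,3]]"
  have a: "a = sc q a + X * b + K * X\<^sup>2 * sc (1 / q) d"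
    unfolding a_def b_def d_def by (rule hgf_step3) code_simp
  have t: "t = sc q s + X * c"
    unfolding t_def s_def c_def by (rule hgf_step2) code_simp
  have b: "b = sc q a + X * c"
    unfolding a_def b_def c_def by (rule hgf_step2) code_simp
  have d: "d = sc q s + X * u"
    unfolding d_def s_def u_def by (rule hgf_step2) code_simp
  have s: "s = sc q a + X * b + K * X\<^sup>2 * sc (1 / q) g"
    unfolding s_def a_def b_def g_def by (rule hgf_step3) code_simp
  have c: "c = sc q a + X * u"
    unfolding a_def c_def u_def by (rule hgf_step2) code_simp
  have u: "u = sc q a"
    unfolding u_def a_def by (rule hgf_step1) code_simp
  have g: "g = sc q s"
    unfolding g_def s_def by (rule hgf_step1) code_simp
  \<comment> \<open>The state \<open>d\<close> still admits one part 1, a term without dilation;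
    undoing the dilation therefore leaves the additional term X/q times \<open>a\<close>.\<close>
  have g': "sc (1 / q) g = s" and d': "sc (1 / q) d = s + K * X * a"
    using g d u q_pos by (simp_all add: sc_add sc_mult)
  have sa: "s = (1 - K\<^sup>2 * X ^ 3) * a" using a s unfolding g' d' by algebra
  have as: "(1 - K * X\<^sup>2) * (1 - K\<^sup>2 * X ^ 3) * a = (1 + X) * (1 + X\<^sup>2) * sc q a"
    using s b c sa u unfolding g' by algebra
  have "K\<^sup>2 * (Q * X) ^ 3 = Q * X ^ 3" using QK by algebra
  then have "sc q s = (1 - Q * X ^ 3) * sc q a"
    by (subst sa) (simp only: sc_simps)
  then have t2: "t = (1 + X + X\<^sup>2 - Q * X ^ 3) * sc q a" using t c u by algebra
  have "sc q a = ep q 1 * ep (q\<^sup>2) 2 * ei q 2 * ei ((1 / q)\<^sup>2 * q ^ 3) 3"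
    by (rule H8_eq) (use as in \<open>simp_all add: a_def hgf_0\<close>)
  moreover have "(1 / q)\<^sup>2 * q ^ 3 = q" using q_pos by (simp add: power2_eq_square power3_eq_cube)
  ultimately show ?thesis
    using total_Lam[of "St pat8a [[1,1],[1,2,3],[2,2,3]]"] t2 by (auto simp: t_def St_def)
qed

end

section \<open>Forbidden patterns and initial segments\<close>

text \<open>Each pattern begins with offset 0, so a match at the head x forces r = x; testing all
  suffixes then finds every contiguous block.\<close>

lemma good_iff:
  assumes "\<forall>w\<in>set P. \<exists>v. w = 0 # v"
  shows "good P p \<longleftrightarrow> (\<forall>w\<in>set P. \<forall>r. \<not> sublist (map ((+) r) w) p)"
proof (induction p)
  case Nil
  show ?case using assms by fastforce
next
  case (Cons x p)
  have "prefix (map ((+) r) w) (x # p) \<Longrightarrow> r = x" if "w \<in> set P" for w r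
    using assms that by fastforce
  then show ?case unfolding good.simps sublist_Cons_right using Cons by blast
qed

text \<open>The first entry of the block is r itself, hence a part; the bound on r in the families
  is automatic.\<close>

lemma Par_sublist_ge: "p \<in> Par \<Longrightarrow> sublist (map ((+) r) (0 # v)) p \<Longrightarrow> 1 \<le> r"
  using set_mono_sublist[of "map ((+) r) (0 # v)" p] by (auto simp: Par_def)

lemma avoids_family_iff:
  assumes "p \<in> Par" "W = {map ((+) r) (0 # v) | r. 1 \<le> r}"
  shows "avoids_family p W \<longleftrightarrow> (\<forall>r. \<not> sublist (map ((+) r) (0 # v)) p)"
  unfolding avoids_family_def avoids_def assms(2) using Par_sublist_ge[OF assms(1)] by blast

lemma good_families:
  assumes "p \<in> Par"
  shows "(\<forall>W\<in>{P2, P3, P4, P5, P9}. avoids_family p W) \<longleftrightarrow> good pat7 p"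
    and "(\<forall>W\<in>{P1, P2, P7, P8, P11}. avoids_family p W) \<longleftrightarrow> good pat8 p"
    and "(\<forall>W\<in>{P1, P3, P6, P8, P10}. avoids_family p W) \<longleftrightarrow> good pat8a p"
proof -
  have P1: "P1 = {map ((+) r) (0 # [0,0]) | r. 1 \<le> r}"
    and P2: "P2 = {map ((+) r) (0 # [0,1]) | r. 1 \<le> r}"
    and P3: "P3 = {map ((+) r) (0 # [1,1]) | r. 1 \<le> r}"
    and P4: "P4 = {map ((+) r) (0 # [0,0,0]) | r. 1 \<le> r}"
    and P5: "P5 = {map ((+) r) (0 # [0,0,2]) | r. 1 \<le> r}"
    and P6: "P6 = {map ((+) r) (0 # [0,1,2]) | r. 1 \<le> r}"
    and P7: "P7 = {map ((+) r) (0 # [1,2,2]) | r. 1 \<le> r}"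
    and P8: "P8 = {map ((+) r) (0 # [1,2,3]) | r. 1 \<le> r}"
    and P9: "P9 = {map ((+) r) (0 # [2,2,2]) | r. 1 \<le> r}"
    and P10: "P10 = {map ((+) r) (0 # [0,2,2,3]) | r. 1 \<le> r}"
    and P11: "P11 = {map ((+) r) (0 # [1,1,3,3]) | r. 1 \<le> r}"
    by (simp_all add: P1_def P2_def P3_def P4_def P5_def P6_def P7_def P8_def P9_def P10_def P11_def)
  note iff = avoids_family_iff[OF assms P1] avoids_family_iff[OF assms P2] avoids_family_iff[OF assms P3]
    avoids_family_iff[OF assms P4] avoids_family_iff[OF assms P5] avoids_family_iff[OF assms P6]
    avoids_family_iff[OF assms P7] avoids_family_iff[OF assms P8] avoids_family_iff[OF assms P9]
    avoids_family_iff[OF assms P10] avoids_family_iff[OF assms P11]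
  show "(\<forall>W\<in>{P2, P3, P4, P5, P9}. avoids_family p W) \<longleftrightarrow> good pat7 p"
    unfolding pat7_def by (subst good_iff) (auto simp del: list.map simp: iff)
  show "(\<forall>W\<in>{P1, P2, P7, P8, P11}. avoids_family p W) \<longleftrightarrow> good pat8 p"
    unfolding pat8_def by (subst good_iff) (auto simp del: list.map simp: iff)
  show "(\<forall>W\<in>{P1, P3, P6, P8, P10}. avoids_family p W) \<longleftrightarrow> good pat8a p"
    unfolding pat8a_def by (subst good_iff) (auto simp del: list.map simp: iff)
qed

lemma satisfies_condition_Cons:
  "satisfies_condition r (x # p) \<longleftrightarrow>
    (3 \<le> length p \<longrightarrow> x + 3 \<le> p ! 2) \<and>
    (2 \<le> length p \<longrightarrow> p ! 1 \<le> x + 1 \<longrightarrow> [x + p ! 0 + p ! 1 = r] (mod 3)) \<and>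
    satisfies_condition r p"
proof -
  have split: "(\<forall>t. R t) \<longleftrightarrow> R 0 \<and> (\<forall>t. R (Suc t))" for R :: "nat \<Rightarrow> bool"
    by (metis not0_implies_Suc)
  show ?thesis
    unfolding satisfies_condition_def
    by (subst (1 2) split) (auto simp: nth_Cons' numeral_eq_Suc less_Suc_eq_le Suc_le_eq)
qed

lemma window_iff:
  assumes "x \<le> a" "a \<le> b" "b \<le> (c :: nat)"
  shows "(\<forall>w\<in>set windows. \<not> prefix (map ((+) x) w) (x # a # b # c # p)) \<longleftrightarrow> x + 3 \<le> c"
proof -
  obtain i j k where "a = x + i" "b = x + i + j" "c = x + i + j + k"
    using assms by (metis le_iff_add)
  then show ?thesis unfolding windows_def by simp presburger
qed

lemma satisfies_condition_iff:
  assumes "sorted p" "\<forall>x\<in>set p. 1 \<le> x"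
  shows "satisfies_condition 2 p \<longleftrightarrow> good pat_cond2 p" and "satisfies_condition 1 p \<longleftrightarrow> good pat_cond1 p"
proof -
  have short: "\<not> prefix (map ((+) x) w) q'" if "w \<in> set windows" "length q' < 4" for w x q'
    using that by (auto simp: windows_def dest!: prefix_length_le)
  have three: "(b \<le> x + 1 \<longrightarrow> [x + a + b = 2] (mod 3)) \<longleftrightarrow> \<not> (a = x \<and> b = x) \<and> \<not> (a = x \<and> b = Suc x)"
     "(b \<le> x + 1 \<longrightarrow> [x + a + b = 1] (mod 3)) \<longleftrightarrow> \<not> (a = x \<and> b = x) \<and> \<not> (a = Suc x \<and> b = Suc x)"
    if "x \<le> a" "a \<le> b" for x a b :: nat
  proof -
    have "(x + x + x) mod 3 = 0" "(x + x + Suc x) mod 3 = 1" "(x + Suc x + Suc x) mod 3 = 2"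
      by presburger+
    moreover have "b \<le> x + 1 \<Longrightarrow> (a = x \<and> b = x) \<or> (a = x \<and> b = Suc x) \<or> (a = Suc x \<and> b = Suc x)"
      using that by arith
    ultimately show "(b \<le> x + 1 \<longrightarrow> [x + a + b = 2] (mod 3)) \<longleftrightarrow> \<not> (a = x \<and> b = x) \<and> \<not> (a = x \<and> b = Suc x)"
      "(b \<le> x + 1 \<longrightarrow> [x + a + b = 1] (mod 3)) \<longleftrightarrow> \<not> (a = x \<and> b = x) \<and> \<not> (a = Suc x \<and> b = Suc x)"
      unfolding Cong.cong_def by (cases "b \<le> x + 1"; auto)+
  qed
  have "(satisfies_condition 2 p \<longleftrightarrow> good pat_cond2 p) \<and> (satisfies_condition 1 p \<longleftrightarrow> good pat_cond1 p)"
    using assms(1)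
  proof (induction p)
    case Nil
    show ?case by (simp add: satisfies_condition_def)
  next
    case (Cons x p)
    then have IH: "satisfies_condition 2 p \<longleftrightarrow> good pat_cond2 p" "satisfies_condition 1 p \<longleftrightarrow> good pat_cond1 p" by auto
    have W: "(\<forall>w\<in>set windows. \<not> prefix (map ((+) x) w) (x # p)) \<longleftrightarrow> (3 \<le> length p \<longrightarrow> x + 3 \<le> p ! 2)"
    proof (cases "3 \<le> length p")
      case True
      then obtain a b c p' where "p = a # b # c # p'" by (auto simp: Suc_le_length_iff numeral_eq_Suc)
      then show ?thesis using window_iff[of x a b c p'] Cons.prems by (simp add: numeral_eq_Suc)
    next
      case False
      then show ?thesis using short[of _ "x # p"] by auto
    qed
    have T: "(2 \<le> length p \<longrightarrow> p ! 1 \<le> x + 1 \<longrightarrow> [x + p ! 0 + p ! 1 = 2] (mod 3)) \<longleftrightarrow>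
        \<not> prefix [x, x, x] (x # p) \<and> \<not> prefix [x, x, Suc x] (x # p)"
      "(2 \<le> length p \<longrightarrow> p ! 1 \<le> x + 1 \<longrightarrow> [x + p ! 0 + p ! 1 = 1] (mod 3)) \<longleftrightarrow>
        \<not> prefix [x, x, x] (x # p) \<and> \<not> prefix [x, Suc x, Suc x] (x # p)"
    proof -
      consider "length p < 2" | a b p' where "p = a # b # p'"
        by (metis One_nat_def Suc_1 not_less length_Cons length_greater_0_conv Suc_le_length_iff)
      then have "((2 \<le> length p \<longrightarrow> p ! 1 \<le> x + 1 \<longrightarrow> [x + p ! 0 + p ! 1 = 2] (mod 3)) \<longleftrightarrow>
        \<not> prefix [x, x, x] (x # p) \<and> \<not> prefix [x, x, Suc x] (x # p)) \<and>
      ((2 \<le> length p \<longrightarrow> p ! 1 \<le> x + 1 \<longrightarrow> [x + p ! 0 + p ! 1 = 1] (mod 3)) \<longleftrightarrow>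
        \<not> prefix [x, x, x] (x # p) \<and> \<not> prefix [x, Suc x, Suc x] (x # p))"
      proof cases
        case 1
        then show ?thesis by (auto dest!: prefix_length_le)
      next
        case 2
        then have "x \<le> a" "a \<le> b" using Cons.prems by auto
        then show ?thesis using three[of x a b] 2 by auto
      qed
      then show "(2 \<le> length p \<longrightarrow> p ! 1 \<le> x + 1 \<longrightarrow> [x + p ! 0 + p ! 1 = 2] (mod 3)) \<longleftrightarrow>
        \<not> prefix [x, x, x] (x # p) \<and> \<not> prefix [x, x, Suc x] (x # p)"
      "(2 \<le> length p \<longrightarrow> p ! 1 \<le> x + 1 \<longrightarrow> [x + p ! 0 + p ! 1 = 1] (mod 3)) \<longleftrightarrow>
        \<not> prefix [x, x, x] (x # p) \<and> \<not> prefix [x, Suc x, Suc x] (x # p)" by blast+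
    qed
    have "good pat_cond2 (x # p) \<longleftrightarrow> (\<not> prefix [x, x, x] (x # p) \<and> \<not> prefix [x, x, Suc x] (x # p)) \<and>
        (\<forall>w\<in>set windows. \<not> prefix (map ((+) x) w) (x # p)) \<and> good pat_cond2 p"
      "good pat_cond1 (x # p) \<longleftrightarrow> (\<not> prefix [x, x, x] (x # p) \<and> \<not> prefix [x, Suc x, Suc x] (x # p)) \<and>
        (\<forall>w\<in>set windows. \<not> prefix (map ((+) x) w) (x # p)) \<and> good pat_cond1 p"
      by (simp_all add: pat_cond2_def pat_cond1_def conj_ac)
    then show ?case unfolding satisfies_condition_Cons IH W T by blast
  qed
  then show "satisfies_condition 2 p \<longleftrightarrow> good pat_cond2 p" "satisfies_condition 1 p \<longleftrightarrow> good pat_cond1 p" by auto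
qed

text \<open>In a sorted list of positive parts only ones can precede a 1. Together with
  \<open>sublist_2_iff\<close> this reduces the small forbidden blocks to initial segments, finitely
  many once the other patterns bound the number of leading ones and twos.\<close>

lemma sublist_1_iff:
  assumes "p \<in> Par"
  shows "sublist (1 # w) p \<longleftrightarrow> (\<exists>i. prefix (replicate i 1 @ 1 # w) p)"
proof
  assume "sublist (1 # w) p"
  then obtain u v where p: "p = u @ 1 # w @ v" by (auto simp: sublist_def)
  then have "sorted (u @ 1 # w @ v)" "\<forall>x\<in>set (u @ 1 # w @ v). 1 \<le> x" using assms by (simp_all add: Par_def)
  then have "\<forall>x\<in>set u. x \<le> 1 \<and> 1 \<le> x" unfolding sorted_append by simp
  then have "\<forall>x\<in>set u. x = 1" by (blast intro: order_antisym)
  then have "u = replicate (length u) 1" by (simp add: replicate_length_same)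
  then have "p = (replicate (length u) 1 @ 1 # w) @ v" using p by simp
  then show "\<exists>i. prefix (replicate i 1 @ 1 # w) p" unfolding prefix_def by blast
qed (auto simp: prefix_def sublist_def)

lemma sublist_2_iff:
  assumes "p \<in> Par"
  shows "sublist (2 # w) p \<longleftrightarrow> (\<exists>i j. prefix (replicate i 1 @ replicate j 2 @ 2 # w) p)"
proof
  have "\<exists>i j. u = replicate i 1 @ replicate j 2" if "sorted u" "\<forall>x\<in>set u. x = 1 \<or> x = 2" for u :: "nat list"
    using that
  proof (induction u)
    case (Cons x u)
    then obtain i j where u: "u = replicate i 1 @ replicate j 2" by auto
    have "x = 1 \<or> x = 2" using Cons.prems by simp
    then show ?case
    proof
      assume "x = 1"
      then show ?thesis using u by (intro exI[of _ "Suc i"] exI[of _ j]) simp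
    next
      assume x: "x = 2"
      have "i = 0" using Cons.prems(1) u x by (cases i) auto
      then show ?thesis using u x by (intro exI[of _ 0] exI[of _ "Suc j"]) simp
    qed
  qed simp
  note * = this
  assume "sublist (2 # w) p"
  then obtain u v where p: "p = u @ 2 # w @ v" by (auto simp: sublist_def)
  then have "sorted (u @ 2 # w @ v)" "\<forall>x\<in>set (u @ 2 # w @ v). 1 \<le> x" using assms by (simp_all add: Par_def)
  then have u: "\<forall>x\<in>set u. x \<le> 2 \<and> 1 \<le> x" "sorted u" unfolding sorted_append by simp_all
  have "x = 1 \<or> x = 2" if "x \<in> set u" for x using u(1) that by force
  then obtain i j where "u = replicate i 1 @ replicate j 2" using * \<open>sorted u\<close> by blast
  then have "p = (replicate i 1 @ replicate j 2 @ 2 # w) @ v" using p by simp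
  then show "\<exists>i j. prefix (replicate i 1 @ replicate j 2 @ 2 # w) p" unfolding prefix_def by blast
next
  assume "\<exists>i j. prefix (replicate i 1 @ replicate j 2 @ 2 # w) p"
  then obtain i j v where "p = (replicate i 1 @ replicate j 2) @ (2 # w) @ v" by (auto simp: prefix_def)
  then show "sublist (2 # w) p" unfolding sublist_def by blast
qed

lemma good_not_sublist:
  "good P p \<Longrightarrow> \<forall>w\<in>set P. \<exists>v. w = 0 # v \<Longrightarrow> w \<in> set P \<Longrightarrow> \<not> sublist (map ((+) r) w) p"
  using good_iff by blast

lemma prefix_replicate_sublist:
  "prefix (replicate i x @ w) p \<Longrightarrow> j \<le> i \<Longrightarrow> sublist (replicate j x @ w) p"
proof -
  assume "prefix (replicate i x @ w) p" "j \<le> i"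
  then have "replicate i x = replicate (i - j) x @ replicate j x" by (simp flip: replicate_add)
  then have "suffix (replicate j x @ w) (replicate i x @ w)" by (simp add: suffix_def)
  then show ?thesis using \<open>prefix (replicate i x @ w) p\<close>
    by (meson prefix_imp_sublist suffix_imp_sublist sublist_order.order_trans)
qed

lemma sublist_trans: "sublist a b \<Longrightarrow> sublist b c \<Longrightarrow> sublist a c"
  by (metis sublist_order.order_trans)

text \<open>A further 1 in front of 1,2,2 would create 1,1,2, an instance of
  \<open>[0,0,1]\<close>.\<close>

lemma restrict5:
  assumes "p \<in> Par"
  shows "satisfies_condition 2 p \<and> avoids p [1,2,2] \<longleftrightarrow> p \<in> St pat_cond2 [[1,2,2]]"
proof -
  have "sublist [1,2,2] p \<longleftrightarrow> prefix [1,2,2] p" if g: "good pat_cond2 p"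
  proof
    assume "sublist [1,2,2] p"
    then obtain i where i: "prefix (replicate i 1 @ [1,2,2]) p" using sublist_1_iff[OF assms] by blast
    have n: "\<not> sublist [1,1,2] p"
      using good_not_sublist[OF g, of "[0,0,1]" 1] by (simp add: pat_cond2_def windows_def numeral_2_eq_2)
    have "i = 0"
    proof (rule ccontr)
      assume "i \<noteq> 0"
      then have "sublist (replicate 1 1 @ [1,2,2]) p" by (intro prefix_replicate_sublist[OF i]) simp
      moreover have "sublist [1,1,2] (replicate 1 1 @ [1,2,2 :: nat])" by (rule prefix_imp_sublist) (simp add: numeral_3_eq_3 numeral_2_eq_2)
      ultimately show False using n by (metis sublist_trans)
    qed
    then show "prefix [1,2,2] p" using i by simp
  qed (rule prefix_imp_sublist)
  then show ?thesis
    using assms satisfies_condition_iff(1)[of p] by (auto simp: St_def avoids_def Par_def)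
qed

text \<open>At most two ones can precede the first 2, since 1,1,1 is an instance of
  \<open>[0,0,0]\<close>; hence the three initial segments.\<close>

lemma restrict6:
  assumes "p \<in> Par"
  shows "satisfies_condition 1 p \<and> 2 \<notin> set p \<longleftrightarrow> p \<in> St pat_cond1 [[2],[1,2],[1,1,2]]"
proof -
  have "2 \<in> set p \<longleftrightarrow> prefix [2] p \<or> prefix [1,2] p \<or> prefix [1,1,2] p" if g: "good pat_cond1 p"
  proof
    assume "2 \<in> set p"
    then have "sublist [2] p" by (metis in_set_conv_decomp append_Cons append_Nil sublist_appendI)
    then obtain i j where "prefix (replicate i 1 @ replicate j 2 @ [2]) p" using sublist_2_iff[OF assms] by blast
    moreover have "prefix (replicate i 1 @ [2]) (replicate i 1 @ replicate j 2 @ [2 :: nat])" by (cases j) auto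
    ultimately have i: "prefix (replicate i 1 @ [2]) p" by (rule prefix_order.trans[rotated])
    have n: "\<not> sublist [1,1,1] p"
      using good_not_sublist[OF g, of "[0,0,0]" 1] by (simp add: pat_cond1_def windows_def)
    have "i < 3"
    proof (rule ccontr)
      assume "\<not> i < 3"
      then have "sublist (replicate 3 1 @ [2]) p" by (intro prefix_replicate_sublist[OF i]) simp
      moreover have "sublist [1,1,1] (replicate 3 1 @ [2 :: nat])" by (rule prefix_imp_sublist) (simp add: numeral_3_eq_3 numeral_2_eq_2)
      ultimately show False using n by (metis sublist_trans)
    qed
    then have "i = 0 \<or> i = 1 \<or> i = 2" by auto
    then show "prefix [2] p \<or> prefix [1,2] p \<or> prefix [1,1,2] p" using i by (auto simp: numeral_2_eq_2)
  qed (auto simp: prefix_def)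
  then show ?thesis
    using assms satisfies_condition_iff(2)[of p] by (auto simp: St_def Par_def)
qed

text \<open>In front of 2,2,2 a further 2 violates \<open>[0,0,0,0]\<close>, and two ones violate
  the avoidance of 1,1. What remains is 2,2,2 at the beginning or after a single 1.\<close>

lemma restrict7:
  assumes "p \<in> Par"
  shows "avoids p [1,1] \<and> avoids p [2,2,2] \<and> (\<forall>W\<in>{P2, P3, P4, P5, P9}. avoids_family p W)
    \<longleftrightarrow> p \<in> St pat7 [[1,1],[2,2,2],[1,2,2,2]]"
proof -
  have 11: "sublist [1,1] p \<longleftrightarrow> prefix [1,1] p"
  proof
    assume "sublist [1,1] p"
    then obtain i where i: "prefix (replicate i 1 @ [1,1]) p" using sublist_1_iff[OF assms] by blast
    moreover have "replicate i 1 @ [1,1] = [1,1] @ replicate i (1 :: nat)"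
      by (induction i) auto
    ultimately have "prefix ([1,1] @ replicate i 1) p" by (simp only:)
    then show "prefix [1,1] p" by (rule append_prefixD)
  qed (rule prefix_imp_sublist)
  have "sublist [2,2,2] p \<longleftrightarrow> prefix [2,2,2] p \<or> prefix [1,2,2,2] p" if g: "good pat7 p" and n: "\<not> sublist [1,1] p"
  proof
    assume "sublist [2,2,2] p"
    then obtain i j where ij: "prefix (replicate i 1 @ replicate j 2 @ [2,2,2]) p" using sublist_2_iff[OF assms] by blast
    then have s: "sublist (replicate j 2 @ [2,2,2]) p" by (auto simp: prefix_def sublist_def)
    have "\<not> sublist [2,2,2,2] p"
      using good_not_sublist[OF g, of "[0,0,0,0]" 2] by (simp add: pat7_def)
    moreover have "sublist [2,2,2,2] (replicate j 2 @ [2,2,2 :: nat])" if "j \<noteq> 0"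
    proof -
      have "\<exists>k. j = Suc k" using that not0_implies_Suc by blast
      then obtain k where "j = Suc k" by blast
      then have "replicate j 2 @ [2,2,2] = replicate k 2 @ [2,2,2,2 :: nat]" by (simp add: replicate_app_Cons_same)
      then show ?thesis by simp
    qed
    ultimately have "j = 0" using s sublist_order.order_trans by blast
    have "i < 2"
    proof (rule ccontr)
      assume "\<not> i < 2"
      then have "sublist (replicate 2 1 @ replicate j 2 @ [2,2,2]) p" by (intro prefix_replicate_sublist[OF ij]) simp
      moreover have "sublist [1,1] (replicate 2 1 @ replicate j 2 @ [2,2,2 :: nat])"
        by (rule prefix_imp_sublist) (simp add: numeral_3_eq_3 numeral_2_eq_2)
      ultimately show False using n by (metis sublist_trans)
    qed
    then have "i = 0 \<or> i = 1" by auto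
    then show "prefix [2,2,2] p \<or> prefix [1,2,2,2] p" using ij \<open>j = 0\<close> by auto
  qed (auto simp: prefix_def sublist_def intro: exI[of _ "[]"] exI[of _ "[1]"])
  then show ?thesis using assms good_families(1)[OF assms] 11 by (auto simp: St_def avoids_def)
qed

lemma restrict7a:
  assumes "p \<in> Par"
  shows "(\<forall>x\<in>set p. 3 \<le> x) \<and> (\<forall>W\<in>{P2, P3, P4, P5, P9}. avoids_family p W) \<longleftrightarrow> p \<in> St pat7 [[1],[2]]"
proof -
  have "(\<forall>x\<in>set p. 3 \<le> x) \<longleftrightarrow> \<not> prefix [1] p \<and> \<not> prefix [2] p"
    using assms by (cases p) (fastforce simp: Par_def)+
  then show ?thesis using assms good_families(1)[OF assms] by (auto simp: St_def)
qed

lemma restrict8: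
  assumes "p \<in> Par"
  shows "1 \<notin> set p \<and> (\<forall>W\<in>{P1, P2, P7, P8, P11}. avoids_family p W) \<longleftrightarrow> p \<in> St pat8 [[1]]"
proof -
  have "1 \<notin> set p \<longleftrightarrow> \<not> prefix [1] p"
    using assms by (cases p) (fastforce simp: Par_def)+
  then show ?thesis using assms good_families(2)[OF assms] by (auto simp: St_def)
qed

text \<open>In front of 2,2,3 a further 2 gives 2,2,2 and a 1 gives 1,2,2, instances of
  \<open>[0,0,0]\<close> and \<open>[0,1,1]\<close>. In front of 1,2,3 a further 1 gives
  1,1.\<close>

lemma restrict8a:
  assumes "p \<in> Par"
  shows "avoids p [1,1] \<and> avoids p [1,2,3] \<and> avoids p [2,2,3]
      \<and> (\<forall>W\<in>{P1, P3, P6, P8, P10}. avoids_family p W)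
    \<longleftrightarrow> p \<in> St pat8a [[1,1],[1,2,3],[2,2,3]]"
proof -
  have 11: "sublist [1,1] p \<longleftrightarrow> prefix [1,1] p"
  proof
    assume "sublist [1,1] p"
    then obtain i where i: "prefix (replicate i 1 @ [1,1]) p" using sublist_1_iff[OF assms] by blast
    moreover have "replicate i 1 @ [1,1] = [1,1] @ replicate i (1 :: nat)"
      by (induction i) auto
    ultimately have "prefix ([1,1] @ replicate i 1) p" by (simp only:)
    then show "prefix [1,1] p" by (rule append_prefixD)
  qed (rule prefix_imp_sublist)
  have 123: "sublist [1,2,3] p \<longleftrightarrow> prefix [1,2,3] p" if n: "\<not> sublist [1,1] p"
  proof
    assume "sublist [1,2,3] p"
    then obtain i where i: "prefix (replicate i 1 @ [1,2,3]) p" using sublist_1_iff[OF assms] by blast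
    have "i = 0"
    proof (rule ccontr)
      assume "i \<noteq> 0"
      then have "sublist (replicate 1 1 @ [1,2,3]) p" by (intro prefix_replicate_sublist[OF i]) simp
      moreover have "sublist [1,1] (replicate 1 1 @ [1,2,3 :: nat])"
        by (rule prefix_imp_sublist) (simp add: numeral_3_eq_3 numeral_2_eq_2)
      ultimately show False using n by (metis sublist_trans)
    qed
    then show "prefix [1,2,3] p" using i by simp
  qed (rule prefix_imp_sublist)
  have 223: "sublist [2,2,3] p \<longleftrightarrow> prefix [2,2,3] p" if g: "good pat8a p"
  proof
    assume "sublist [2,2,3] p"
    then obtain i j where ij: "prefix (replicate i 1 @ replicate j 2 @ [2,2,3]) p" using sublist_2_iff[OF assms] by blast
    then have s: "sublist (replicate j 2 @ [2,2,3]) p" by (auto simp: prefix_def sublist_def)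
    have "\<not> sublist [2,2,2] p"
      using good_not_sublist[OF g, of "[0,0,0]" 2] by (simp add: pat8a_def)
    moreover have "sublist [2,2,2] (replicate j 2 @ [2,2,3 :: nat])" if "j \<noteq> 0"
    proof -
      have "\<exists>k. j = Suc k" using that not0_implies_Suc by blast
      then obtain k where "j = Suc k" by blast
      then have "replicate j 2 @ [2,2,3] = replicate k 2 @ [2,2,2] @ [3 :: nat]" by (simp add: replicate_app_Cons_same)
      then show ?thesis unfolding sublist_def by blast
    qed
    ultimately have j: "j = 0" using s sublist_order.order_trans by blast
    have "i = 0"
    proof (rule ccontr)
      assume "i \<noteq> 0"
      then have "sublist (replicate 1 1 @ replicate j 2 @ [2,2,3]) p" by (intro prefix_replicate_sublist[OF ij]) simp
      moreover have "sublist [1,2,2] (replicate 1 1 @ replicate j 2 @ [2,2,3 :: nat])"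
        by (rule prefix_imp_sublist) (simp add: j)
      moreover have "\<not> sublist [1,2,2] p"
        using good_not_sublist[OF g, of "[0,1,1]" 1] by (simp add: pat8a_def numeral_2_eq_2)
      ultimately show False by (metis sublist_trans)
    qed
    then show "prefix [2,2,3] p" using ij j by simp
  qed (rule prefix_imp_sublist)
  show ?thesis using assms good_families(3)[OF assms] 11 123 223 by (auto simp: St_def avoids_def)
qed

section \<open>Partitions with parts in prescribed residue classes\<close>

definition parts_in :: "nat set \<Rightarrow> nat list set" where
  "parts_in A = {p. sorted p \<and> set p \<subseteq> A}"

context small_q
begin

text \<open>Since m exceeds every element of \<open>A\<close>, its copies form the tail of the list;
  summing over their number gives a geometric series.\<close>

lemma total_parts_insert:
  assumes "\<forall>x\<in>A. 1 \<le> x \<and> x < m" "1 \<le> m"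
  shows "total (parts_in (insert m A)) = total (parts_in A) / (1 - q ^ m)"
proof -
  let ?f = "\<lambda>p :: nat list. q ^ sum_list p"
  have m: "0 \<le> q ^ m" "q ^ m < 1" using qs[of m] assms(2) by auto
  have s: "parts_in (insert m A) \<subseteq> Par" "parts_in A \<subseteq> Par"
    using assms by (auto simp: parts_in_def Par_def)
  have "((\<lambda>k. (q ^ m) ^ k * total (parts_in A)) has_sum total (parts_in (insert m A))) UNIV"
    unfolding total_def
  proof (rule has_sum_fibres[OF has_sum_infsum[OF Par_summable[OF s(1)]], where \<phi> = "\<lambda>p. count_list p m"])
    fix k
    let ?B = "{p \<in> parts_in (insert m A). count_list p m = k}"
    have cnt: "count_list p m = 0" if "p \<in> parts_in A" for p
      using that assms by (auto simp: parts_in_def count_list_0_iff)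
    have B: "bij_betw (\<lambda>p. p @ replicate k m) (parts_in A) ?B"
    proof (rule bij_betw_imageI)
      show "inj_on (\<lambda>p. p @ replicate k m) (parts_in A)" by (auto simp: inj_on_def)
      show "(\<lambda>p. p @ replicate k m) ` parts_in A = ?B"
      proof (intro equalityI subsetI)
        fix p assume "p \<in> (\<lambda>p. p @ replicate k m) ` parts_in A"
        then obtain p' where p': "p = p' @ replicate k m" "p' \<in> parts_in A" by auto
        have "count_list (replicate k m) m = k" by (induction k) auto
        then have "count_list p m = k" using cnt[OF p'(2)] p'(1) by simp
        moreover have "sorted p" using p' assms by (auto simp: parts_in_def sorted_append less_imp_le)
        ultimately show "p \<in> ?B" using p' by (auto simp: parts_in_def)
      next
        fix p assume p: "p \<in> ?B"
        have "p = filter (\<lambda>x. x \<noteq> m) p @ replicate (count_list p m) m" if "sorted p" "set p \<subseteq> insert m A" for p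
          using that
        proof (induction p)
          case (Cons x p)
          show ?case
          proof (cases "x = m")
            case True
            have "\<forall>y\<in>set (x # p). y = m" using Cons.prems True assms by fastforce
            then have "x # p = replicate (length (x # p)) m" by (simp add: replicate_length_same)
            moreover have "count_list (replicate n m) m = n" "filter (\<lambda>x. x \<noteq> m) (replicate n m) = []" for n
              by (induction n) auto
            ultimately show ?thesis by (metis append_Nil)
          next
            case False
            then show ?thesis using Cons by simp
          qed
        qed simp
        then show "p \<in> (\<lambda>p. p @ replicate k m) ` parts_in A"
          using p by (intro image_eqI[where x = "filter (\<lambda>x. x \<noteq> m) p"]) (auto simp: parts_in_def sorted_wrt_filter)
      qed
    qed
    have "(?f has_sum total (parts_in A)) (parts_in A)"
      unfolding total_def by (rule has_sum_infsum[OF Par_summable[OF s(2)]])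
    then have "((\<lambda>p. (q ^ m) ^ k * ?f p) has_sum (q ^ m) ^ k * total (parts_in A)) (parts_in A)"
      by (rule has_sum_cmult_right)
    moreover have "(q ^ m) ^ k * ?f p = ?f (p @ replicate k m)" for p
      by (simp add: sum_list_replicate power_add mult.commute flip: power_mult)
    ultimately have "((\<lambda>p. ?f (p @ replicate k m)) has_sum (q ^ m) ^ k * total (parts_in A)) (parts_in A)"
      by (simp only:)
    then show "(?f has_sum (q ^ m) ^ k * infsum ?f (parts_in A)) ?B"
      using has_sum_reindex_bij_betw[OF B, of ?f] by (simp add: total_def)
  qed
  then have "(\<lambda>k. (q ^ m) ^ k * total (parts_in A)) sums total (parts_in (insert m A))"
    by (rule has_sum_imp_sums)
  moreover have "(\<lambda>k. (q ^ m) ^ k * total (parts_in A)) sums (1 / (1 - q ^ m) * total (parts_in A))"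
    using m by (intro sums_mult2 geometric_sums) auto
  ultimately show ?thesis by (auto dest: sums_unique2)
qed

lemma total_parts_finite:
  "total (parts_in {x \<in> A. 1 \<le> x \<and> x \<le> N}) = (\<Prod>x | x \<in> A \<and> 1 \<le> x \<and> x \<le> N. 1 / (1 - q ^ x))"
proof (induction N)
  case 0
  have "{x \<in> A. 1 \<le> x \<and> x \<le> 0} = {}" by auto
  moreover have "parts_in {} = {[]}" by (auto simp: parts_in_def)
  then have "total (parts_in {}) = 1" by (simp add: total_def)
  ultimately show ?case by (simp only: prod.empty)
next
  case (Suc N)
  show ?case
  proof (cases "Suc N \<in> A")
    case True
    then have eq: "{x \<in> A. 1 \<le> x \<and> x \<le> Suc N} = insert (Suc N) {x \<in> A. 1 \<le> x \<and> x \<le> N}" by auto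
    show ?thesis unfolding eq using Suc by (subst total_parts_insert) auto
  next
    case False
    then have "{x \<in> A. 1 \<le> x \<and> x \<le> Suc N} = {x \<in> A. 1 \<le> x \<and> x \<le> N}" by (auto simp: le_Suc_eq)
    then show ?thesis using Suc by simp
  qed
qed

text \<open>Parts of a partition of n are at most n, so bounding the parts by N leaves the
  coefficients with n < N exact. The truncated totals are squeezed between the partial sums and the
  limit.\<close>

lemma total_parts_LIMSEQ:
  "(\<lambda>N. total (parts_in {x \<in> A. 1 \<le> x \<and> x \<le> N})) \<longlonglongrightarrow> total (parts_in {x \<in> A. 1 \<le> x})"
proof (rule tendsto_sandwich)
  let ?S = "parts_in {x \<in> A. 1 \<le> x}"
  let ?T = "\<lambda>N. parts_in {x \<in> A. 1 \<le> x \<and> x \<le> N}"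
  have S: "?S \<subseteq> Par" "?T N \<subseteq> Par" for N by (auto simp: parts_in_def Par_def)
  have c: "(\<lambda>n. real (card {p \<in> ?S. sum_list p = n}) * q ^ n) sums total ?S" by (rule total_card[OF S(1)])
  then show "(\<lambda>N. \<Sum>n<N. real (card {p \<in> ?S. sum_list p = n}) * q ^ n) \<longlonglongrightarrow> total ?S"
    by (simp add: sums_def)
  show "\<forall>\<^sub>F N in sequentially. (\<Sum>n<N. real (card {p \<in> ?S. sum_list p = n}) * q ^ n) \<le> total (?T N)"
  proof (intro always_eventually allI)
    fix N
    have e: "{p \<in> ?S. sum_list p = n} = {p \<in> ?T N. sum_list p = n}" if "n < N" for n
      using that by (auto simp: parts_in_def dest: member_le_sum_list)
    have "(\<Sum>n<N. real (card {p \<in> ?S. sum_list p = n}) * q ^ n) = (\<Sum>n<N. real (card {p \<in> ?T N. sum_list p = n}) * q ^ n)"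
      using e by (intro sum.cong) auto
    also have "\<dots> \<le> total (?T N)"
      unfolding sums_unique[OF total_card[OF S(2)[of N]]]
      by (rule sum_le_suminf) (use q_pos sums_summable[OF total_card[OF S(2)[of N]]] in auto)
    finally show "(\<Sum>n<N. real (card {p \<in> ?S. sum_list p = n}) * q ^ n) \<le> total (?T N)" .
  qed
  show "\<forall>\<^sub>F N in sequentially. total (?T N) \<le> total ?S"
    unfolding total_def
    by (intro always_eventually allI infsum_mono_neutral Par_summable S) (use q_pos in \<open>auto simp: parts_in_def\<close>)
qed simp

lemma residues_sums:
  assumes "S \<subseteq> {1..12}"
  shows "(\<lambda>n. real (count_residues_mod12 S n) * q ^ n) sums (\<Prod>r\<in>S. 1 / qinf (q ^ r) (q ^ 12))"
proof -
  define A where "A = {x. \<exists>s\<in>S. [x = s] (mod 12)}"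
  have A: "x \<in> A \<longleftrightarrow> (\<exists>s\<in>S. x mod 12 = s mod 12)" for x by (simp add: A_def Cong.cong_def)
  have fin: "finite S" using assms finite_subset by blast
  have set: "{x \<in> A. 1 \<le> x \<and> x \<le> 12 * M} = (\<lambda>(r, i). r + 12 * i) ` (S \<times> {..<M})" for M
  proof (intro equalityI subsetI)
    fix x assume x: "x \<in> {x \<in> A. 1 \<le> x \<and> x \<le> 12 * M}"
    then obtain s where s: "s \<in> S" "x mod 12 = s mod 12" using A by auto
    have s12: "1 \<le> s" "s \<le> 12" using s assms by auto
    \<comment> \<open>Residues are represented in 1..12, with 12 for the class of 0, so that s is
      the smallest positive member of its class.\<close>
    have "s \<le> x"
    proof (rule ccontr)
      assume "\<not> s \<le> x"
      then have "x mod 12 = x" "x < s" using s12 by simp_all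
      then show False using x s s12 by (cases "s = 12") auto
    qed
    then have "12 dvd x - s" using mod_eq_dvd_iff_nat[of s x 12] s(2) by simp
    then obtain i where "x - s = 12 * i" by blast
    then have "x = s + 12 * i" "i < M" using \<open>s \<le> x\<close> s12 x by auto
    then show "x \<in> (\<lambda>(r, i). r + 12 * i) ` (S \<times> {..<M})" using s by force
  qed (use assms A in fastforce)
  have inj: "inj_on (\<lambda>(r, i). r + 12 * i) (S \<times> {..<M})" for M
  proof (rule inj_onI, clarify)
    fix r i s j assume "r \<in> S" "s \<in> S" "r + 12 * i = s + 12 * j"
    moreover then have "1 \<le> r" "r \<le> 12" "1 \<le> s" "s \<le> 12" using assms by auto
    ultimately show "r = s \<and> i = j" by presburger
  qed
  have "(\<Prod>x | x \<in> A \<and> 1 \<le> x \<and> x \<le> 12 * M. 1 / (1 - q ^ x)) = (\<Prod>r\<in>S. 1 / qpoch (q ^ r) (q ^ 12) M)" for M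
    unfolding set by (subst prod.reindex[OF inj])
      (simp add: qpoch_def prod_dividef prod.cartesian_product power_add power_mult case_prod_beta' comp_def)
  then have "total (parts_in {x \<in> A. 1 \<le> x \<and> x \<le> 12 * M}) = (\<Prod>r\<in>S. 1 / qpoch (q ^ r) (q ^ 12) M)" for M
    using total_parts_finite[of A "12 * M"] by simp
  moreover have "(\<lambda>M. total (parts_in {x \<in> A. 1 \<le> x \<and> x \<le> 12 * M})) \<longlonglongrightarrow> total (parts_in {x \<in> A. 1 \<le> x})"
    using LIMSEQ_subseq_LIMSEQ[OF total_parts_LIMSEQ[of A], of "\<lambda>M. 12 * M"] by (simp add: o_def strict_mono_def)
  moreover have "(\<lambda>M. \<Prod>r\<in>S. 1 / qpoch (q ^ r) (q ^ 12) M) \<longlonglongrightarrow> (\<Prod>r\<in>S. 1 / qinf (q ^ r) (q ^ 12))"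
  proof (intro tendsto_prod tendsto_divide tendsto_const qpoch_LIMSEQ)
    show "norm (q ^ 12) < 1" using qs[of 12] by simp
    show "qinf (q ^ r) (q ^ 12) \<noteq> 0" if "r \<in> S" for r
      using qinf_real_pos[of "q ^ 12" "q ^ r"] qs[of 12] qs[of r] that assms by force
  qed
  ultimately have t: "total (parts_in {x \<in> A. 1 \<le> x}) = (\<Prod>r\<in>S. 1 / qinf (q ^ r) (q ^ 12))"
    using LIMSEQ_unique by simp
  have "{p \<in> partitions_of n. \<forall>x\<in>set p. \<exists>s\<in>S. [x = s] (mod 12)} = {p \<in> parts_in {x \<in> A. 1 \<le> x}. sum_list p = n}" for n
    by (auto simp: partitions_of_def parts_in_def A_def)
  then have "count_residues_mod12 S n = card {p \<in> parts_in {x \<in> A. 1 \<le> x}. sum_list p = n}" for n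
    by (simp add: count_residues_mod12_def)
  then show ?thesis
    using total_card[of "parts_in {x \<in> A. 1 \<le> x}"] t by (auto simp: parts_in_def Par_def)
qed

end

section \<open>The cases 8 and 8a\<close>

text \<open>Shift of one index in a convolution. It is applied to factors such as (1 - q^(2j))
  \<open>a2 j\<close>, which vanish at j = 0 and otherwise lose the last factor of the q-factorial,
  so that the index drops by one. \<open>conv_right\<close> does the same for the other
  index.\<close>

lemma conv_left:
  fixes x y :: "nat \<Rightarrow> real"
  assumes "x 0 = 0" "\<And>j. x (Suc j) = y j"
  shows "(\<Sum>j\<le>Suc n. x j * G j (Suc n - j)) = (\<Sum>j\<le>n. y j * G (Suc j) (n - j))"
  unfolding sum.atMost_Suc_shift using assms by simp

lemma conv_right:
  fixes x y :: "nat \<Rightarrow> real"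
  assumes "x 0 = 0" "\<And>k. x (Suc k) = y k"
  shows "(\<Sum>j\<le>Suc n. x (Suc n - j) * G j (Suc n - j)) = (\<Sum>j\<le>n. y (n - j) * G j (Suc (n - j)))"
proof -
  have "(\<Sum>j\<le>n. x (Suc n - j) * G j (Suc n - j)) = (\<Sum>j\<le>n. y (n - j) * G j (Suc (n - j)))"
    by (rule sum.cong) (auto simp: Suc_diff_le assms(2))
  then show ?thesis using assms(1) by simp
qed

lemma qpoch_bounds:
  fixes a b :: real
  assumes "0 \<le> a" "a < 1" "0 \<le> b" "b < 1"
  shows "qpoch a b n \<le> 1" "0 < qpoch a b n" "qinf a b \<le> qpoch a b n" "0 < qinf a b"
proof -
  have ab: "0 \<le> a * b ^ i \<and> a * b ^ i < 1" for i
  proof -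
    have "a * b ^ i \<le> a * 1" using assms by (intro mult_left_mono power_le_one) auto
    then show ?thesis using assms by simp
  qed
  have le1: "qpoch a b n \<le> 1" if "\<And>i. 0 \<le> a * b ^ i \<and> a * b ^ i < 1" for a :: real and n
    unfolding qpoch_def by (rule prod_le_1) (use that in \<open>auto simp: less_imp_le\<close>)
  show "qpoch a b n \<le> 1" using le1 ab by blast
  show p: "0 < qpoch a b n" unfolding qpoch_def using ab by (intro prod_pos) auto
  have "qinf (a * b ^ n) b \<le> 1"
  proof (rule LIMSEQ_le_const2[OF qpoch_LIMSEQ])
    have "0 \<le> a * b ^ n * b ^ i \<and> a * b ^ n * b ^ i < 1" for i
      using ab[of "n + i"] by (simp add: power_add mult.assoc)
    then show "\<exists>N. \<forall>m\<ge>N. qpoch (a * b ^ n) b m \<le> 1" using le1 by blast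
  qed (use assms in auto)
  then have "qpoch a b n * qinf (a * b ^ n) b \<le> qpoch a b n * 1"
    using p by (intro mult_left_mono) auto
  then show "qinf a b \<le> qpoch a b n" using qinf_iterate[of b a n] assms by simp
  show "0 < qinf a b" by (rule qinf_real_pos) (use assms in auto)
qed

context small_q
begin

lemma Lam_shift: "gb g \<Longrightarrow> Lam (X ^ m * g) = q ^ tri m * Lam (sc (q ^ m) g)"
proof -
  assume g: "gb g"
  have "(\<lambda>i. q ^ tri m * (q ^ tri i * sc (q ^ m) g $ i)) sums (q ^ tri m * Lam (sc (q ^ m) g))"
    by (intro sums_mult Lam_sums gb_intros g)
  moreover have "q ^ tri m * (q ^ tri i * sc (q ^ m) g $ i) = q ^ tri (m + i) * g $ i" for i
    by (simp add: tri_add power_add power_mult)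
  ultimately have "(\<lambda>i. q ^ tri (m + i) * g $ i) sums (q ^ tri m * Lam (sc (q ^ m) g))"
    by (simp only:)
  with rapid_Lam_shift(2)[OF g, of m] show ?thesis by (rule sums_unique2)
qed

text \<open>The values are those of a convergent power series at q^m, and this argument tends to
  0.\<close>

lemma Lam_sc_LIMSEQ: assumes "gb g" shows "(\<lambda>m. Lam (sc (q ^ m) g)) \<longlonglongrightarrow> g $ 0"
proof -
  define f where "f x = (\<Sum>n. (q ^ tri n * g $ n) * x ^ n)" for x :: real
  have "isCont f 0"
    unfolding f_def [abs_def]
    by (rule isCont_powser[where K = 1]) (use Lam_summable[OF assms] in simp_all)
  moreover have "(\<lambda>m. q ^ m) \<longlonglongrightarrow> 0" using q_pos q_lt_1 by (intro LIMSEQ_power_zero) simp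
  ultimately have "(\<lambda>m. f (q ^ m)) \<longlonglongrightarrow> f 0" by (rule isCont_tendsto_compose)
  moreover have "f 0 = g $ 0" unfolding f_def powser_zero by simp
  moreover have "f (q ^ m) = Lam (sc (q ^ m) g)" for m
    unfolding f_def Lam_def by (simp add: mult_ac)
  ultimately show ?thesis by simp
qed

definition a2 :: "nat \<Rightarrow> real" where "a2 j = (q\<^sup>2) ^ tri j / (q\<^sup>2) ^ j / qpoch (q\<^sup>2) (q\<^sup>2) j"
definition b3 :: "nat \<Rightarrow> real" where "b3 k = 1 / qpoch (q ^ 3) (q ^ 3) k"

lemma q_power_less: "1 \<le> n \<Longrightarrow> q ^ n < 1" using qs(2) by blast

lemma a2_Suc: "(1 - q ^ (2 * Suc j)) * a2 (Suc j) = q ^ (2 * j) * a2 j"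
proof -
  have "qpoch (q\<^sup>2) (q\<^sup>2) (Suc j) = qpoch (q\<^sup>2) (q\<^sup>2) j * (1 - q ^ (2 * Suc j))"
    unfolding qpoch_self_Suc by (simp only: power_mult)
  moreover have "(q\<^sup>2) ^ tri (Suc j) / (q\<^sup>2) ^ Suc j = q ^ (2 * j) * ((q\<^sup>2) ^ tri j / (q\<^sup>2) ^ j)"
    using q_pos by (simp add: power_add power_mult)
  moreover have "q ^ (2 * Suc j) \<noteq> 1" using q_power_less[of "2 * Suc j"] by simp
  ultimately show ?thesis unfolding a2_def by simp
qed

lemma b3_Suc: "(1 - q ^ (3 * Suc k)) * b3 (Suc k) = b3 k"
proof -
  have "qpoch (q ^ 3) (q ^ 3) (Suc k) = qpoch (q ^ 3) (q ^ 3) k * (1 - q ^ (3 * Suc k))"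
    unfolding qpoch_self_Suc by (simp only: power_mult)
  moreover have "q ^ (3 * Suc k) \<noteq> 1" using q_power_less[of "3 * Suc k"] by simp
  ultimately show ?thesis unfolding b3_def by simp
qed

lemma ep0_2: "ep0 c 2 $ j = c ^ j * a2 j" and ei0_3: "ei0 c 3 $ k = c ^ k * b3 k"
  by (simp_all add: ep0_def ei0_def a2_def b3_def power_divide)

lemma Lam_pairing23:
  assumes "gb g"
  shows "(\<lambda>n. \<Sum>j\<le>n. (s ^ j * a2 j) * (t ^ (n - j) * b3 (n - j)) * Lam (X ^ (2 * j + 3 * (n - j)) * g))
    sums Lam (ep s 2 * ei t 3 * g)"
  using Lam_pairing[OF assms gb_ep0[of 2 s] gb_ei0[of 3 t], of 2 3]
  by (simp add: ep0_2 ei0_3 ep_def ei_def)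

definition g8 :: "real fps" where "g8 = ep q 1 * ei q 2"
definition mu8 :: "nat \<Rightarrow> real" where "mu8 m = Lam (X ^ m * g8)"

lemma gb_g8: "gb g8" unfolding g8_def by (intro gb_all) simp_all

lemma mu8_rec: "q ^ Suc m * mu8 m = mu8 (m + 1) + (1 + q ^ (m + 2)) * mu8 (m + 2)"
proof -
  have D: "(1 * (1 - Q * X\<^sup>2)) * g8 = ((1 + Q * X ^ 1) * 1) * sc q g8"
    unfolding g8_def by (intro qdiff_mult qdiff_ei qdiff_ep) simp_all
  let ?k = "fps_const (1 / q ^ m)"
  have 1: "?k * (Q * X) ^ m = X ^ m" using q_pos by (simp add: power_mult_distrib mult.assoc[symmetric])
  have k: "K * Q = 1" using QK by (simp add: mult.commute)
  \<comment> \<open>The certificate is p = X^m and r = X^m (1 + X)/q^m, which satisfies sc q r = (1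
    + q X) p.\<close>
  have "Lam (((1 * (1 - Q * X\<^sup>2)) * X ^ m - K * X * (?k * X ^ m * (1 + X))) * g8) = 0"
  proof (rule Lam_certificate[OF gb_g8 _ _ D])
    show "sc q (?k * X ^ m * (1 + X)) = (1 + Q * X ^ 1) * 1 * X ^ m"
      unfolding sc_simps sc_add sc_power 1 by (simp add: mult_ac)
  qed (intro gb_intros)+
  also have "(((1 * (1 - Q * X\<^sup>2)) * X ^ m - K * X * (?k * X ^ m * (1 + X))) * g8)
    = X ^ m * g8 - Q * (X ^ (m + 2) * g8) - fps_const (1 / q ^ Suc m) * (X ^ (m + 1) * g8 + X ^ (m + 2) * g8)"
  proof -
    have "K * ?k = fps_const (1 / q ^ Suc m)" by simp
    then have "K * X * (?k * X ^ m * (1 + X)) = fps_const (1 / q ^ Suc m) * (X ^ (m + 1) + X ^ (m + 2))"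
      by (simp add: algebra_simps power_add power2_eq_square del: fps_const_mult)
    then show ?thesis by (simp add: algebra_simps power_add power2_eq_square)
  qed
  also have "Lam \<dots> = mu8 m - q * mu8 (m + 2) - 1 / q ^ Suc m * (mu8 (m + 1) + mu8 (m + 2))"
    unfolding mu8_def by (simp add: Lam_diff Lam_add Lam_const gb_intros gb_g8 del: power_Suc)
  finally show ?thesis using q_pos by (simp add: field_simps)
qed

text \<open>The coefficient of t^n in \<open>F8 t\<close>, as shown in
  \<open>F8_mu8\<close>.\<close>

definition v8 :: "nat \<Rightarrow> real" where
  "v8 n = (\<Sum>j\<le>n. a2 j * b3 (n - j) * mu8 (2 * j + 3 * (n - j)))"

text \<open>Creative telescoping over the pairs j + k = n, written with U = q^(2j) and W =
  q^(3k).\<close>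

lemma v8_Suc: "(1 - q ^ (6 * Suc n)) * v8 (Suc n) = q ^ (6 * n + 3) * v8 n"
proof -
  define U W where "U j = q ^ (2 * j)" and "W k = q ^ (3 * k)" for j k :: nat
  have US: "U (Suc j) = q\<^sup>2 * U j" and WS: "W (Suc k) = q ^ 3 * W k" for j k
    by (simp_all add: U_def W_def power_add power2_eq_square power3_eq_cube)
  have UW: "U j * W k = q ^ (2 * j + 3 * k)" for j k by (simp add: U_def W_def power_add)
  have UW3: "U j ^ 3 * W k ^ 2 = q ^ (6 * (j + k))" for j k
    by (simp add: U_def W_def power_add algebra_simps flip: power_mult)
  have a: "(1 - U 0) * a2 0 = 0" "\<And>j. (1 - U (Suc j)) * a2 (Suc j) = U j * a2 j"
    using a2_Suc by (simp_all add: U_def)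
  have b: "(1 - W 0) * b3 0 = 0" "\<And>k. (1 - W (Suc k)) * b3 (Suc k) = b3 k"
    using b3_Suc by (simp_all add: W_def)
  \<comment> \<open>The cofactors in 1 - U^3 W^2 = (1 - U)(1 + U + U^2) W^2 + (1 - W)(1 + W), where
    U^3 W^2 = q^(6(n+1)). Each summand loses one index, which brings the sum for n + 1 down to pairs
    with j + k = n.\<close>
  define G1 where "G1 j k = b3 k * (1 + U j + U j ^ 2) * W k ^ 2 * mu8 (2 * j + 3 * k)" for j k
  define G2 where "G2 j k = a2 j * (1 + W k) * mu8 (2 * j + 3 * k)" for j k
  have "(1 - q ^ (6 * Suc n)) * v8 (Suc n)
      = (\<Sum>j\<le>Suc n. (1 - q ^ (6 * Suc n)) * (a2 j * b3 (Suc n - j) * mu8 (2 * j + 3 * (Suc n - j))))"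
    by (simp only: v8_def sum_distrib_left)
  also have "\<dots> = (\<Sum>j\<le>Suc n. ((1 - U j) * a2 j) * G1 j (Suc n - j) + ((1 - W (Suc n - j)) * b3 (Suc n - j)) * G2 j (Suc n - j))"
  proof (rule sum.cong[OF refl])
    fix j assume "j \<in> {..Suc n}"
    then have e: "q ^ (6 * Suc n) = U j ^ 3 * W (Suc n - j) ^ 2" using UW3[of j "Suc n - j"] by simp
    show "(1 - q ^ (6 * Suc n)) * (a2 j * b3 (Suc n - j) * mu8 (2 * j + 3 * (Suc n - j)))
      = ((1 - U j) * a2 j) * G1 j (Suc n - j) + ((1 - W (Suc n - j)) * b3 (Suc n - j)) * G2 j (Suc n - j)"
      unfolding e G1_def G2_def by algebra
  qed
  also have "\<dots> = (\<Sum>j\<le>n. U j * a2 j * G1 (Suc j) (n - j)) + (\<Sum>j\<le>n. b3 (n - j) * G2 j (Suc (n - j)))"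
    unfolding sum.distrib conv_left[where x = "\<lambda>j. (1 - U j) * a2 j" and y = "\<lambda>j. U j * a2 j" and G = G1, OF a]
      conv_right[where x = "\<lambda>k. (1 - W k) * b3 k" and y = b3 and G = G2, OF b] ..
  finally have 1: "(1 - q ^ (6 * Suc n)) * v8 (Suc n)
    = (\<Sum>j\<le>n. U j * a2 j * G1 (Suc j) (n - j)) + (\<Sum>j\<le>n. b3 (n - j) * G2 j (Suc (n - j)))" .
  \<comment> \<open>The telescoping certificate. Two uses of \<open>mu8_rec\<close> express
    everything through the moments m + 2 and m + 3; what is left is the difference of two sums that
    coincide after shifting j in one and k in the other.\<close>
  define R1 where "R1 j k = a2 j * U j * (1 + W k + q\<^sup>2 * U j * W k) * mu8 (2 * j + 3 * k + 2)" for j k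
  define R2 where "R2 j k = b3 k * (1 + q ^ 3 * W k * (1 + U j)) * mu8 (2 * j + 3 * k + 3)" for j k
  have "(1 - q ^ (6 * Suc n)) * v8 (Suc n) - q ^ (6 * n + 3) * v8 n
    = (\<Sum>j\<le>n. U j * a2 j * G1 (Suc j) (n - j) + b3 (n - j) * G2 j (Suc (n - j))
        - q ^ (6 * n + 3) * (a2 j * b3 (n - j) * mu8 (2 * j + 3 * (n - j))))"
    unfolding 1 unfolding v8_def sum_distrib_left sum.distrib sum_subtractf by simp
  also have "\<dots> = (\<Sum>j\<le>n. ((1 - U j) * a2 j) * R2 j (n - j) - ((1 - W (n - j)) * b3 (n - j)) * R1 j (n - j))"
  proof (rule sum.cong[OF refl])
    fix j assume "j \<in> {..n}"
    then obtain k where n: "n = j + k" using le_Suc_ex by auto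
    define m where "m = 2 * j + 3 * k"
    have r1: "q * (U j * W k) * mu8 m = mu8 (m + 1) + (1 + q\<^sup>2 * (U j * W k)) * mu8 (m + 2)"
      using mu8_rec[of m] unfolding UW m_def[symmetric] by (simp add: power_add mult_ac power2_eq_square)
    have r2: "q\<^sup>2 * (U j * W k) * mu8 (m + 1) = mu8 (m + 2) + (1 + q ^ 3 * (U j * W k)) * mu8 (m + 3)"
      using mu8_rec[of "m + 1"] unfolding UW m_def[symmetric]
      by (simp add: power_add mult_ac power2_eq_square power3_eq_cube numeral_3_eq_3)
    have p: "q ^ (6 * n + 3) = q ^ 3 * (U j ^ 3 * W k ^ 2)" using UW3[of j k] by (simp add: n power_add)
    have m2: "2 * Suc j + 3 * k = m + 2" "2 * j + 3 * Suc k = m + 3" by (simp_all add: m_def)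
    have "U j * (1 + q\<^sup>2 * U j + (q\<^sup>2 * U j)\<^sup>2) * W k ^ 2 * mu8 (m + 2) + (1 + q ^ 3 * W k) * mu8 (m + 3)
        - q ^ 3 * (U j ^ 3 * W k ^ 2) * mu8 m
      = (1 - U j) * (1 + q ^ 3 * W k * (1 + U j)) * mu8 (m + 3) - (1 - W k) * (U j * (1 + W k + q\<^sup>2 * U j * W k)) * mu8 (m + 2)"
    proof -
      have "q ^ 3 * (U j ^ 3 * W k ^ 2) * mu8 m = q\<^sup>2 * U j ^ 2 * W k * (q * (U j * W k) * mu8 m)" by algebra
      also have "\<dots> = U j * (q\<^sup>2 * (U j * W k) * mu8 (m + 1)) + q\<^sup>2 * U j ^ 2 * W k * (1 + q\<^sup>2 * (U j * W k)) * mu8 (m + 2)"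
        unfolding r1 by algebra
      finally show ?thesis unfolding r2 by algebra
    qed
    then have star: "a2 j * b3 k * (U j * (1 + q\<^sup>2 * U j + (q\<^sup>2 * U j)\<^sup>2) * W k ^ 2 * mu8 (m + 2) + (1 + q ^ 3 * W k) * mu8 (m + 3)
        - q ^ 3 * (U j ^ 3 * W k ^ 2) * mu8 m)
      = a2 j * b3 k * ((1 - U j) * (1 + q ^ 3 * W k * (1 + U j)) * mu8 (m + 3) - (1 - W k) * (U j * (1 + W k + q\<^sup>2 * U j * W k)) * mu8 (m + 2))"
      by (simp only:)
    have nj: "n - j = k" using n by simp
    show "U j * a2 j * G1 (Suc j) (n - j) + b3 (n - j) * G2 j (Suc (n - j))
        - q ^ (6 * n + 3) * (a2 j * b3 (n - j) * mu8 (2 * j + 3 * (n - j)))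
      = ((1 - U j) * a2 j) * R2 j (n - j) - ((1 - W (n - j)) * b3 (n - j)) * R1 j (n - j)"
      unfolding p G1_def G2_def R1_def R2_def US WS nj by (simp only: m2 m_def[symmetric]) (use star in algebra)
  qed
  also have "\<dots> = 0"
  proof (cases n)
    case 0
    then show ?thesis by (simp add: U_def W_def)
  next
    case (Suc l)
    have "(\<Sum>j\<le>n. ((1 - U j) * a2 j) * R2 j (n - j)) = (\<Sum>j\<le>l. U j * a2 j * R2 (Suc j) (l - j))"
      unfolding Suc by (rule conv_left[where x = "\<lambda>j. (1 - U j) * a2 j" and y = "\<lambda>j. U j * a2 j" and G = R2, OF a])
    moreover have "(\<Sum>j\<le>n. ((1 - W (n - j)) * b3 (n - j)) * R1 j (n - j)) = (\<Sum>j\<le>l. b3 (l - j) * R1 j (Suc (l - j)))"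
      unfolding Suc by (rule conv_right[where x = "\<lambda>k. (1 - W k) * b3 k" and y = b3 and G = R1, OF b])
    moreover have "U j * a2 j * R2 (Suc j) k = b3 k * R1 j (Suc k)" for j k
    proof -
      have e: "2 * Suc j + 3 * k + 3 = 2 * j + 3 * Suc k + 2" by simp
      show ?thesis unfolding R1_def R2_def US WS e by algebra
    qed
    ultimately show ?thesis by (simp add: sum_subtractf)
  qed
  finally show ?thesis by simp
qed

lemma v8_eq: "v8 n = mu8 0 * (q ^ 6) ^ tri n / (q ^ 3) ^ n / qpoch (q ^ 6) (q ^ 6) n"
proof (induction n)
  case 0
  show ?case by (simp add: v8_def a2_def b3_def)
next
  case (Suc n)
  have "qpoch (q ^ 6) (q ^ 6) (Suc n) = qpoch (q ^ 6) (q ^ 6) n * (1 - q ^ (6 * Suc n))"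
    unfolding qpoch_self_Suc by (simp only: power_mult)
  moreover have "(q ^ 6) ^ tri (Suc n) / (q ^ 3) ^ Suc n = q ^ (6 * n + 3) * ((q ^ 6) ^ tri n / (q ^ 3) ^ n)"
  proof -
    have q6: "q ^ 6 = q ^ 3 * q ^ 3" by (simp flip: power_add)
    have p: "q ^ (6 * n + 3) = (q ^ 6) ^ n * q ^ 3" by (simp add: power_add power_mult)
    have "(b * b) ^ tri (Suc n) / b ^ Suc n = (b * b) ^ n * b * ((b * b) ^ tri n / b ^ n)" if "b \<noteq> 0" for b :: real
      using that by (simp add: power_add)
    note * = this
    show ?thesis unfolding p q6 by (rule *) (use q_pos in simp)
  qed
  moreover have "q ^ (6 * Suc n) \<noteq> 1" using q_power_less[of "6 * Suc n"] by simp
  moreover have "v8 (Suc n) = q ^ (6 * n + 3) * v8 n / (1 - q ^ (6 * Suc n))"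
    using v8_Suc[of n] calculation(3) by (simp add: field_simps del: power_Suc)
  then have "v8 (Suc n) = mu8 0 * (q ^ (6 * n + 3) * ((q ^ 6) ^ tri n / (q ^ 3) ^ n)) / (qpoch (q ^ 6) (q ^ 6) n * (1 - q ^ (6 * Suc n)))"
    unfolding Suc by (simp add: mult_ac)
  ultimately have "v8 (Suc n) = mu8 0 * ((q ^ 6) ^ tri (Suc n) / (q ^ 3) ^ Suc n) / qpoch (q ^ 6) (q ^ 6) (Suc n)"
    by (simp only:)
  then show ?case by (simp only: times_divide_eq_right)
qed

text \<open>By \<open>v8_eq\<close> the coefficients in t are those of Euler's expansion in base
  q^6, so the whole dependence on t is one product.\<close>

lemma F8_mu8: "F8 t = mu8 0 * qinf (- t * q ^ 3) (q ^ 6)"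
proof -
  have "(\<lambda>n. t ^ n * v8 n) sums F8 t"
  proof -
    have "(\<Sum>j\<le>n. (t ^ j * a2 j) * (t ^ (n - j) * b3 (n - j)) * Lam (X ^ (2 * j + 3 * (n - j)) * g8)) = t ^ n * v8 n" for n
      unfolding v8_def sum_distrib_left
    proof (rule sum.cong[OF refl])
      fix j assume "j \<in> {..n}"
      then have "t ^ n = t ^ j * t ^ (n - j)" by (simp flip: power_add)
      then show "(t ^ j * a2 j) * (t ^ (n - j) * b3 (n - j)) * Lam (X ^ (2 * j + 3 * (n - j)) * g8)
          = t ^ n * (a2 j * b3 (n - j) * mu8 (2 * j + 3 * (n - j)))" by (simp add: mu8_def)
    qed
    then show ?thesis using Lam_pairing23[OF gb_g8, of t t] by (simp add: F8_def g8_def)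
  qed
  moreover have "(\<lambda>n. mu8 0 * ((- (- t / q ^ 3)) ^ n * (q ^ 6) ^ tri n / qpoch (q ^ 6) (q ^ 6) n))
      sums (mu8 0 * qinf (- t / q ^ 3 * q ^ 6) (q ^ 6))"
    using q_power_less[of 6] q_pos by (intro sums_mult euler_sums(1)) auto
  moreover have "mu8 0 * ((- (- t / q ^ 3)) ^ n * (q ^ 6) ^ tri n / qpoch (q ^ 6) (q ^ 6) n) = t ^ n * v8 n" for n
    unfolding v8_eq by (simp add: power_divide)
  moreover have "- t / q ^ 3 * q ^ 6 = - t * q ^ 3"
  proof -
    have q6: "q ^ 6 = q ^ 3 * q ^ 3" by (simp flip: power_add)
    have "a / b * (b * b) = a * b" if "b \<noteq> 0" for a b :: real using that by simp
    note * = this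
    show ?thesis unfolding q6 by (rule *) (use q_pos in simp)
  qed
  ultimately have "(\<lambda>n. t ^ n * v8 n) sums F8 t" "(\<lambda>n. t ^ n * v8 n) sums (mu8 0 * qinf (- t * q ^ 3) (q ^ 6))"
    by (simp_all only:)
  then show ?thesis by (rule sums_unique2)
qed

text \<open>The remaining constant is read off from \<open>v8_eq\<close> as n grows. Multiplied by
  (q^3)^n/(q^6)^tri n, the sum over k = n - j has the limiting terms q^(3 tri k)/(q^3;q^3)_k divided
  by (q^2;q^2)_inf, which Euler sums, while the closed form tends to \<open>mu8 0\<close> divided by
  (q^6;q^6)_inf.\<close>

lemma mu8_0: "mu8 0 = qinf (q ^ 6) (q ^ 6) * qinf (- (q ^ 3)) (q ^ 3) / qinf (q\<^sup>2) (q\<^sup>2)"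
proof -
  define \<gamma> where "\<gamma> m = Lam (sc (q ^ m) g8)" for m
  have \<gamma>: "\<gamma> \<longlonglongrightarrow> 1" using Lam_sc_LIMSEQ[OF gb_g8] by (simp add: \<gamma>_def [abs_def] g8_def)
  have mu: "mu8 m = q ^ tri m * \<gamma> m" for m by (simp add: mu8_def \<gamma>_def Lam_shift[OF gb_g8])
  obtain B where B: "0 < B" "\<And>m. norm (\<gamma> m) \<le> B"
    using convergent_imp_Bseq[OF convergentI[OF \<gamma>]] by (auto elim: BseqE)
  define L where "L = qinf (q\<^sup>2) (q\<^sup>2)"
  have L: "0 < L" and Lp: "L \<le> qpoch (q\<^sup>2) (q\<^sup>2) n" "0 < qpoch (q\<^sup>2) (q\<^sup>2) n" for n
    using qpoch_bounds(2,3)[of "q\<^sup>2" "q\<^sup>2" n] qpoch_bounds(4)[of "q\<^sup>2" "q\<^sup>2"] q_power_less[of 2] by (auto simp: L_def)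
  define h where "h k = (q ^ 3) ^ tri k / qpoch (q ^ 3) (q ^ 3) k" for k
  have h_sums: "h sums qinf (- (q ^ 3)) (q ^ 3)" "summable h" and h0: "0 \<le> h k" for k
  proof -
    have "norm (q ^ 3) < 1" using q_power_less[of 3] q_pos by auto
    from euler_sums(1)[OF this, of "-1"] show "h sums qinf (- (q ^ 3)) (q ^ 3)"
      by (simp add: h_def [abs_def])
    then show "summable h" by (rule sums_summable)
    show "0 \<le> h k" using q_pos qpoch_pos[of 3 k] by (simp add: h_def)
  qed
  \<comment> \<open>Extended by 0 to k > n, so that Tannery's theorem applies to infinite
    sums.\<close>
  define f where "f k n = (if k \<le> n then h k * \<gamma> (2 * n + k) / qpoch (q\<^sup>2) (q\<^sup>2) (n - k) else 0)" for k n
  have "(\<lambda>n. suminf (\<lambda>k. f k n)) \<longlonglongrightarrow> suminf (\<lambda>k. h k * 1 / L)"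
  proof (rule tannerys_theorem[THEN conjunct2, THEN conjunct2])
    show "((\<lambda>n. f k n) \<longlongrightarrow> h k * 1 / L) sequentially" for k
    proof -
      have "(\<lambda>n. h k * \<gamma> (2 * (n + k) + k) / qpoch (q\<^sup>2) (q\<^sup>2) n) \<longlonglongrightarrow> h k * 1 / L"
      proof (intro tendsto_intros)
        have "(\<lambda>n. \<gamma> (2 * (n + k) + k)) = \<gamma> \<circ> (\<lambda>n. 2 * (n + k) + k)" by auto
        then show "(\<lambda>n. \<gamma> (2 * (n + k) + k)) \<longlonglongrightarrow> 1"
          using LIMSEQ_subseq_LIMSEQ[OF \<gamma>, of "\<lambda>n. 2 * (n + k) + k"] by (simp add: strict_mono_def)
        show "qpoch (q\<^sup>2) (q\<^sup>2) \<longlonglongrightarrow> L" unfolding L_def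
          by (rule qpoch_LIMSEQ) (use q_power_less[of 2] in simp)
        show "L \<noteq> 0" using L by simp
      qed
      then have "(\<lambda>n. f k (n + k)) \<longlonglongrightarrow> h k * 1 / L" by (simp add: f_def)
      then show ?thesis by (rule LIMSEQ_offset)
    qed
    have "norm (f k n) \<le> h k * B / L" for k n
    proof (cases "k \<le> n")
      case True
      have "norm (f k n) = h k * norm (\<gamma> (2 * n + k)) / qpoch (q\<^sup>2) (q\<^sup>2) (n - k)"
        using True h0[of k] Lp(2)[of "n - k"] by (simp add: f_def abs_mult)
      also have "\<dots> \<le> h k * B / L"
        using h0 B L Lp by (intro frac_le mult_left_mono mult_nonneg_nonneg) (auto simp: less_imp_le)
      finally show ?thesis .
    qed (use h0 B L in \<open>simp add: f_def\<close>)
    then show "\<forall>\<^sub>F (k, n) in sequentially \<times>\<^sub>F sequentially. norm (f k n) \<le> h k * B / L"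
      by (intro always_eventually) auto
    show "summable (\<lambda>k. h k * B / L)" by (intro summable_divide summable_mult2 h_sums)
  qed simp
  moreover have "suminf (\<lambda>k. h k * 1 / L) = qinf (- (q ^ 3)) (q ^ 3) / L"
    using sums_divide[OF h_sums(1), of L] by (simp add: sums_iff)
  moreover have "suminf (\<lambda>k. f k n) = mu8 0 / qpoch (q ^ 6) (q ^ 6) n" for n
  proof -
    have "suminf (\<lambda>k. f k n) = (\<Sum>k\<le>n. f k n)" by (rule suminf_finite) (auto simp: f_def)
    also have "\<dots> = (\<Sum>j\<le>n. f (n - j) n)" by (rule sum.reindex_bij_witness[of _ "\<lambda>j. n - j" "\<lambda>j. n - j"]) auto
    also have "\<dots> = (\<Sum>j\<le>n. (q ^ 3) ^ n / (q ^ 6) ^ tri n * (a2 j * b3 (n - j) * mu8 (2 * j + 3 * (n - j))))"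
    proof (rule sum.cong[OF refl])
      fix j assume "j \<in> {..n}"
      then obtain k where n: "n = j + k" using le_Suc_ex by auto
      have t: "2 * tri (j + k) = (j + k) * (j + k + 1)" "2 * tri j = j * (j + 1)" "2 * tri k = k * (k + 1)" "2 * tri (2 * j + 3 * k) = (2 * j + 3 * k) * (2 * j + 3 * k + 1)" for j k
      proof -
        have "2 * tri n = n * (n + 1)" for n by (induction n) auto
        then show "2 * tri (j + k) = (j + k) * (j + k + 1)" "2 * tri j = j * (j + 1)" "2 * tri k = k * (k + 1)" "2 * tri (2 * j + 3 * k) = (2 * j + 3 * k) * (2 * j + 3 * k + 1)" by blast+
      qed
      \<comment> \<open>The balance of quadratic exponents behind the normalization, verified after
        doubling so that triangular numbers become polynomials.\<close>
      have "3 * (2 * tri k) + 6 * (2 * tri (j + k)) + 2 * (2 * j)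
          = 3 * (2 * (j + k)) + 2 * (2 * tri j) + 2 * tri (2 * j + 3 * k)"
        unfolding t by (simp add: algebra_simps)
      then have e: "3 * tri k + 6 * tri (j + k) + 2 * j = 3 * (j + k) + 2 * tri j + tri (2 * j + 3 * k)" by linarith
      have "q ^ (3 * tri k) * q ^ (6 * tri (j + k)) * q ^ (2 * j) = q ^ (3 * (j + k)) * q ^ (2 * tri j) * q ^ tri (2 * j + 3 * k)"
        unfolding power_add[symmetric] e ..
      then have "(q ^ 3) ^ tri k = (q ^ 3) ^ n / (q ^ 6) ^ tri n * ((q\<^sup>2) ^ tri j / (q\<^sup>2) ^ j) * q ^ tri (2 * j + 3 * k)"
        using q_pos unfolding n power_mult[symmetric] by (simp add: field_simps)
      note H = this
      have nj: "n - j = k" "n - k = j" "2 * n + k = 2 * j + 3 * k" and kn: "k \<le> n" using n by auto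
      have "f (n - j) n = h k * \<gamma> (2 * j + 3 * k) / qpoch (q\<^sup>2) (q\<^sup>2) j"
        unfolding f_def nj using kn by simp
      then show "f (n - j) n = (q ^ 3) ^ n / (q ^ 6) ^ tri n * (a2 j * b3 (n - j) * mu8 (2 * j + 3 * (n - j)))"
        unfolding nj h_def H a2_def b3_def mu by (simp add: mult_ac)
    qed
    also have "\<dots> = (q ^ 3) ^ n / (q ^ 6) ^ tri n * v8 n" by (simp add: v8_def sum_distrib_left)
    also have "\<dots> = mu8 0 / qpoch (q ^ 6) (q ^ 6) n" unfolding v8_eq using q_pos by simp
    finally show ?thesis .
  qed
  ultimately have "(\<lambda>n. mu8 0 / qpoch (q ^ 6) (q ^ 6) n) \<longlonglongrightarrow> qinf (- (q ^ 3)) (q ^ 3) / L" by simp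
  moreover have Q: "0 < qinf (q ^ 6) (q ^ 6)" using qpoch_bounds(4)[of "q ^ 6" "q ^ 6"] q_power_less[of 6] q_pos by simp
  moreover have "(\<lambda>n. mu8 0 / qpoch (q ^ 6) (q ^ 6) n) \<longlonglongrightarrow> mu8 0 / qinf (q ^ 6) (q ^ 6)"
    by (intro tendsto_intros qpoch_LIMSEQ) (use Q q_power_less[of 6] q_pos in auto)
  ultimately have "mu8 0 / qinf (q ^ 6) (q ^ 6) = qinf (- (q ^ 3)) (q ^ 3) / L" by (metis LIMSEQ_unique)
  then show ?thesis using Q by (simp add: L_def field_simps)
qed

text \<open>The polynomial is reduced modulo the kernel of \<open>Lam\<close>. The series
  \<open>?H\<close> divides both sides: (1 + q^2 X^2) \<open>?H\<close> is the product on the left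
  and (1 - q X^3) \<open>?H\<close> is the one inside \<open>F8 (q ^ 4)\<close>. The certificate is
  p = -q and r = -q (1 + X)(1 + q^2 X^2).\<close>

lemma case8a_F8:
  "Lam ((1 + X + X\<^sup>2 - Q * X ^ 3) * (ep q 1 * ep (q\<^sup>2) 2 * ei q 2 * ei q 3)) = (1 + q) * F8 (q ^ 4)"
proof -
  let ?H = "ep q 1 * ep (q ^ 4) 2 * ei q 2 * ei q 3"
  have D: "(1 * 1 * (1 - Q * X\<^sup>2) * (1 - Q * X ^ 3)) * ?H = ((1 + Q * X ^ 1) * (1 + fps_const (q ^ 4) * X\<^sup>2) * 1 * 1) * sc q ?H"
    by (intro qdiff_mult qdiff_ei qdiff_ep) simp_all
  have gbH: "gb ?H" by (intro gb_all) simp_all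
  have "Lam (((1 * 1 * (1 - Q * X\<^sup>2) * (1 - Q * X ^ 3)) * (- Q) - K * X * (- Q * (1 + X) * (1 + Q\<^sup>2 * X\<^sup>2))) * ?H) = 0"
  proof (rule Lam_certificate[OF gbH _ _ D])
    have e: "Q\<^sup>2 * (Q * X)\<^sup>2 = Q ^ 4 * X\<^sup>2" by algebra
    show "sc q (- Q * (1 + X) * (1 + Q\<^sup>2 * X\<^sup>2)) = (1 + Q * X ^ 1) * (1 + fps_const (q ^ 4) * X\<^sup>2) * 1 * 1 * - Q"
      unfolding sc_simps sc_minus fps_const_power[symmetric] e power_one_right mult_1_right by (simp only: mult_ac)
  qed (intro gb_intros)+
  also have "((1 * 1 * (1 - Q * X\<^sup>2) * (1 - Q * X ^ 3)) * (- Q) - K * X * (- Q * (1 + X) * (1 + Q\<^sup>2 * X\<^sup>2))) * ?H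
    = (1 + X + X\<^sup>2 - Q * X ^ 3) * ((1 + Q\<^sup>2 * X\<^sup>2) * ?H) - (1 + Q) * ((1 - Q * X ^ 3) * ?H)"
  proof -
    have "(1 * 1 * (1 - Q * X\<^sup>2) * (1 - Q * X ^ 3)) * (- Q) - K * X * (- Q * (1 + X) * (1 + Q\<^sup>2 * X\<^sup>2))
      = (1 + X + X\<^sup>2 - Q * X ^ 3) * (1 + Q\<^sup>2 * X\<^sup>2) - (1 + Q) * (1 - Q * X ^ 3)"
      using QK by algebra
    then show ?thesis by (simp only: left_diff_distrib mult.assoc)
  qed
  also have "(1 + Q\<^sup>2 * X\<^sup>2) * ?H = ep q 1 * ep (q\<^sup>2) 2 * ei q 2 * ei q 3"
  proof -
    have "ep (q\<^sup>2) 2 = (1 + Q\<^sup>2 * X\<^sup>2) * ep (q ^ 4) 2"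
      using ep_eq[of 2 "q\<^sup>2"] sc_ep[of 2 "q\<^sup>2"] by (simp flip: power_add)
    then show ?thesis by (simp add: mult_ac)
  qed
  also have "(1 - Q * X ^ 3) * ?H = ep (q ^ 4) 2 * ei (q ^ 4) 3 * (ep q 1 * ei q 2)"
  proof -
    have "ei (q ^ 4) 3 = (1 - Q * X ^ 3) * ei q 3"
      using ei_eq[of 3 q] sc_ei[of 3 q] by (simp add: numeral_eq_Suc)
    then show ?thesis by (simp add: mult_ac)
  qed
  finally have "Lam ((1 + X + X\<^sup>2 - Q * X ^ 3) * (ep q 1 * ep (q\<^sup>2) 2 * ei q 2 * ei q 3)
      - (1 + Q) * (ep (q ^ 4) 2 * ei (q ^ 4) 3 * (ep q 1 * ei q 2))) = 0" .
  moreover have "1 + Q = fps_const (1 + q)" by simp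
  ultimately show ?thesis
    unfolding F8_def by (simp add: Lam_diff Lam_const gb_all)
qed

end

text \<open>Sum of the base \<open>x\<close> q-analogue of Bailey's theorem; the recursion \<open>c \<mapsto> c x\<^sup>2\<close> telescopes.\<close>

lemma q_Bailey:
  fixes x b c :: real
  assumes x: "0 < x" "x < b" "b < 1" and c: "0 < c" "c < 1"
  defines "t \<equiv> \<lambda>c n. qpoch b x n * qpoch (x / b) x n * (c / x) ^ n * x ^ tri n / (qpoch c x n * qpoch (x\<^sup>2) (x\<^sup>2) n)"
  shows "t c sums (qinf (c * x / b) (x\<^sup>2) * qinf (b * c) (x\<^sup>2) / qinf c x)"
proof -
  have b: "0 < b" and x1: "x < 1" and xb: "0 < x / b" "x / b < 1" using x by auto
  have x2: "0 < x\<^sup>2" "x\<^sup>2 < 1" using x x1 by (auto simp: power_less_one_iff)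
  have cx: "c * x / b < 1" "0 < c * x / b" "b * c < 1" "0 < b * c"
  proof -
    have "c * (x / b) < 1 * 1" using c xb by (intro mult_strict_mono) auto
    then show "c * x / b < 1" by simp
    have "b * c < 1 * 1" using c x b by (intro mult_strict_mono) auto
    then show "b * c < 1" by simp
  qed (use c x b in auto)
  have t_pos: "0 < t c n" and t_le: "t c n \<le> c ^ n / (qinf c x * qinf (x\<^sup>2) (x\<^sup>2))" if c: "0 < c" "c < 1" for c n
  proof -
    note B = qpoch_bounds(1-3)[of b x n] qpoch_bounds(1-3)[of "x / b" x n] qpoch_bounds(1-3)[of c x n]
      qpoch_bounds(1-3)[of "x\<^sup>2" "x\<^sup>2" n] qpoch_bounds(4)[of c x] qpoch_bounds(4)[of "x\<^sup>2" "x\<^sup>2"]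
    show "0 < t c n" unfolding t_def using B x b x1 xb c x2 by (intro divide_pos_pos mult_pos_pos) auto
    have "n \<le> tri n" by (induction n) auto
    then have "x ^ tri n \<le> x ^ n" using x x1 by (intro power_decreasing) auto
    then have 1: "(c / x) ^ n * x ^ tri n \<le> c ^ n"
      using x c by (simp add: power_divide field_simps)
    have "qpoch b x n * qpoch (x / b) x n \<le> 1 * 1"
      using B x b x1 xb by (intro mult_mono) auto
    then have "qpoch b x n * qpoch (x / b) x n * ((c / x) ^ n * x ^ tri n) \<le> 1 * c ^ n"
      using 1 x c B b x1 xb by (intro mult_mono) auto
    then show "t c n \<le> c ^ n / (qinf c x * qinf (x\<^sup>2) (x\<^sup>2))"
      unfolding t_def mult.assoc
      using B x b x1 xb c x2 by (intro frac_le mult_mono mult_pos_pos) (auto simp: less_imp_le mult.assoc)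
  qed
  have summ: "summable (t c)" if c: "0 < c" "c < 1" for c
  proof (rule summable_comparison_test[of _ "\<lambda>n. c ^ n / (qinf c x * qinf (x\<^sup>2) (x\<^sup>2))"])
    show "\<exists>N. \<forall>n\<ge>N. norm (t c n) \<le> c ^ n / (qinf c x * qinf (x\<^sup>2) (x\<^sup>2))"
      using t_pos[OF c] t_le[OF c] by (intro exI[of _ 0]) (simp add: less_imp_le)
  qed (use c in \<open>auto intro!: summable_divide summable_geometric\<close>)
  define Z where "Z c = suminf (t c)" for c
  have step: "Z c = (1 - c * x / b) * (1 - b * c) / ((1 - c) * (1 - c * x)) * Z (c * x\<^sup>2)" if c: "0 < c" "c < 1" for c
  proof -
    have cxn: "c * x ^ n < 1" for n
    proof -
      have "c * x ^ n \<le> c * 1" using c x x1 by (intro mult_left_mono power_le_one) auto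
      then show ?thesis using c by linarith
    qed
    have c2: "0 < c * x\<^sup>2" "c * x\<^sup>2 < 1" using c x cxn[of 2] by auto
    \<comment> \<open>The telescoping certificate for the pair c, c x^2: by \<open>id\<close> below,
      the difference of the two summands is \<open>G (Suc n) - G n\<close>.\<close>
    define G where "G n = - t c n * (1 - (x\<^sup>2) ^ n) / (1 - c * x ^ n)" for n
    have tS: "t c (Suc n) * (1 - (x\<^sup>2) ^ Suc n) = t c n * ((1 - b * x ^ n) * (1 - x / b * x ^ n) * (c * x ^ n) / (1 - c * x ^ n))" for n
    proof -
      have "qpoch (x\<^sup>2) (x\<^sup>2) (Suc n) = qpoch (x\<^sup>2) (x\<^sup>2) n * (1 - (x\<^sup>2) ^ Suc n)" by (simp add: qpoch_Suc)
      moreover have "(x\<^sup>2) ^ Suc n < 1" using x2 by (intro power_Suc_less_one) auto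
      moreover have "(c / x) ^ Suc n * x ^ tri (Suc n) = (c / x) ^ n * x ^ tri n * (c * x ^ n)"
        using x by (simp add: power_add)
      ultimately show ?thesis
        unfolding t_def qpoch_Suc[of b] qpoch_Suc[of "x / b"] qpoch_Suc[of c] by (simp add: mult_ac del: power_Suc tri.simps)
    qed
    have tc2: "t (c * x\<^sup>2) n * ((1 - c * x ^ n) * (1 - c * x ^ Suc n)) = t c n * (x\<^sup>2) ^ n * ((1 - c) * (1 - c * x))" for n
    proof -
      have "qpoch c x (Suc (Suc n)) = (1 - c) * ((1 - c * x) * qpoch (c * x * x) x n)"
        by (simp only: qpoch_shift)
      then have "qpoch c x n * (1 - c * x ^ n) * (1 - c * x ^ Suc n) = (1 - c) * (1 - c * x) * qpoch (c * x\<^sup>2) x n"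
        by (simp add: qpoch_Suc power2_eq_square mult_ac)
      moreover have "qpoch c x n \<noteq> 0" "qpoch (c * x\<^sup>2) x n \<noteq> 0"
        using qpoch_bounds(2)[of c x n] qpoch_bounds(2)[of "c * x\<^sup>2" x n] c c2 x x1 by auto
      ultimately have "((1 - c * x ^ n) * (1 - c * x ^ Suc n)) / qpoch (c * x\<^sup>2) x n = (1 - c) * (1 - c * x) / qpoch c x n"
        by (simp add: frac_eq_eq mult_ac)
      note main = this
      have k: "P / (qpoch (c * x\<^sup>2) x n * R) * ((1 - c * x ^ n) * (1 - c * x ^ Suc n))
        = P / (qpoch c x n * R) * ((1 - c) * (1 - c * x))" for P R
      proof -
        have "P / (qpoch (c * x\<^sup>2) x n * R) * ((1 - c * x ^ n) * (1 - c * x ^ Suc n))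
          = P / R * (((1 - c * x ^ n) * (1 - c * x ^ Suc n)) / qpoch (c * x\<^sup>2) x n)" by simp
        also have "\<dots> = P / (qpoch c x n * R) * ((1 - c) * (1 - c * x))" unfolding main by simp
        finally show ?thesis .
      qed
      have e: "(c * x\<^sup>2 / x) ^ n = (c / x) ^ n * (x\<^sup>2) ^ n" by (simp add: power_mult_distrib power_divide)
      show ?thesis unfolding t_def k e by simp
    qed
    have id: "t c n - (1 - c * x / b) * (1 - b * c) / ((1 - c) * (1 - c * x)) * t (c * x\<^sup>2) n = G (Suc n) - G n" for n
    proof -
      let ?y = "x ^ n"
      have nz: "1 - c * ?y \<noteq> 0" "1 - c * (x * ?y) \<noteq> 0" "1 - c \<noteq> 0" "1 - c * x \<noteq> 0" "b \<noteq> 0"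
        using cxn[of n] cxn[of "Suc n"] cxn[of 1] c b by auto
      have 1: "t (c * x\<^sup>2) n = t c n * ?y\<^sup>2 * ((1 - c) * (1 - c * x)) / ((1 - c * ?y) * (1 - c * (x * ?y)))"
        using tc2[of n] nz by (simp add: eq_divide_eq power_mult_distrib mult_ac flip: power_mult)
      have 2: "G (Suc n) = - t c n * ((1 - b * ?y) * (1 - x / b * ?y) * (c * ?y) / (1 - c * ?y)) / (1 - c * (x * ?y))"
        unfolding G_def minus_mult_left[symmetric] tS by simp
      have 3: "G n = - t c n * (1 - ?y\<^sup>2) / (1 - c * ?y)" by (simp add: G_def mult.commute flip: power_mult)
      have "1 - (1 - c * x / b) * (1 - b * c) * ?y\<^sup>2 / ((1 - c * ?y) * (1 - c * (x * ?y)))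
        = - ((1 - b * ?y) * (1 - x / b * ?y) * (c * ?y)) / ((1 - c * ?y) * (1 - c * (x * ?y))) + (1 - ?y\<^sup>2) / (1 - c * ?y)"
        using nz by (simp add: divide_simps) (simp add: algebra_simps power2_eq_square)
      note main = this
      have g1: "t - A / D * (t * y * D / E) = t * (1 - A * y / E)" if "D \<noteq> 0" for t A D y E :: real
        using that by (simp add: right_diff_distrib mult_ac)
      have g2: "- t * (N / a) / b - - t * M / a = t * (- N / (a * b) + M / a)" for t N a b M :: real
        by (simp add: distrib_left right_diff_distrib)
      have "(1 - c) * (1 - c * x) \<noteq> 0" using nz by simp
      then show ?thesis unfolding 1 2 3 g2 by (subst g1) (simp_all only: main not_False_eq_True)
    qed
    have "G \<longlonglongrightarrow> 0"
    proof -
      have "(\<lambda>n. - t c n * (1 - (x\<^sup>2) ^ n) / (1 - c * x ^ n)) \<longlonglongrightarrow> - 0 * (1 - 0) / (1 - c * 0)"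
        by (intro tendsto_intros summable_LIMSEQ_zero[OF summ[OF c]] LIMSEQ_power_zero) (use x x1 x2 in auto)
      then show ?thesis by (simp add: G_def [abs_def])
    qed
    then have "(\<lambda>n. G (Suc n) - G n) sums (0 - G 0)" by (rule telescope_sums)
    then have "(\<lambda>n. t c n - (1 - c * x / b) * (1 - b * c) / ((1 - c) * (1 - c * x)) * t (c * x\<^sup>2) n) sums 0"
      unfolding id by (simp add: G_def)
    moreover have "(\<lambda>n. t c n - (1 - c * x / b) * (1 - b * c) / ((1 - c) * (1 - c * x)) * t (c * x\<^sup>2) n)
        sums (Z c - (1 - c * x / b) * (1 - b * c) / ((1 - c) * (1 - c * x)) * Z (c * x\<^sup>2))"
      unfolding Z_def by (intro sums_diff sums_mult summable_sums summ c c2)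
    ultimately show ?thesis using sums_unique2 by fastforce
  qed
  \<comment> \<open>The denominators of the even and odd positions join to a single product in base
    x, hence the index \<open>2 * N\<close>.\<close>
  have it: "Z c = qpoch (c * x / b) (x\<^sup>2) N * qpoch (b * c) (x\<^sup>2) N / qpoch c x (2 * N) * Z (c * (x\<^sup>2) ^ N)" for N
  proof (induction N)
    case (Suc N)
    have "(x\<^sup>2) ^ N \<le> 1" using power_le_one[of "x\<^sup>2" N] x2 by linarith
    then have "c * (x\<^sup>2) ^ N \<le> c * 1" using c by (intro mult_left_mono) auto
    then have "c * (x\<^sup>2) ^ N < 1" using c by linarith
    moreover have "0 < c * (x\<^sup>2) ^ N" using c x2 by simp
    ultimately have "0 < c * (x\<^sup>2) ^ N" "c * (x\<^sup>2) ^ N < 1" by auto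
    note s = step[OF this]
    have e: "qpoch c x (2 * Suc N) = qpoch c x (2 * N) * ((1 - c * (x\<^sup>2) ^ N) * (1 - c * (x\<^sup>2) ^ N * x))"
    proof -
      have "2 * Suc N = Suc (Suc (2 * N))" by simp
      then show ?thesis by (simp only: qpoch_Suc power_Suc power_mult) (simp only: mult_ac)
    qed
    show ?case unfolding e using Suc unfolding s
      by (simp only: qpoch_Suc[of _ "x\<^sup>2"] power_Suc times_divide_eq_right times_divide_eq_left times_divide_times_eq divide_divide_eq_left mult_ac)
  qed simp
  \<comment> \<open>Squeezed between 1, the term of index 0, and 1 + x^(2N) Z(c): replacing c by c y
    with y \<le> 1 shrinks every term of positive index at least by the factor y.\<close>
  have "(\<lambda>N. Z (c * (x\<^sup>2) ^ N)) \<longlonglongrightarrow> 1"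
  proof (rule tendsto_sandwich)
    have pos: "0 < c * (x\<^sup>2) ^ N" "c * (x\<^sup>2) ^ N \<le> c" for N
      using c x2 x x1 by (auto intro!: mult_left_le power_le_one)
    have t0: "t c 0 = 1" for c by (simp add: t_def)
    have "1 \<le> Z (c * (x\<^sup>2) ^ N)" for N
    proof -
      have lt: "c * (x\<^sup>2) ^ N < 1" using pos(2)[of N] c by linarith
      have "(\<Sum>n<1. t (c * (x\<^sup>2) ^ N) n) \<le> Z (c * (x\<^sup>2) ^ N)"
        unfolding Z_def by (rule sum_le_suminf[OF summ[OF pos(1) lt]]) (use t_pos[OF pos(1) lt] in \<open>auto intro: less_imp_le\<close>)
      then show ?thesis by (simp add: t0)
    qed
    then show "\<forall>\<^sub>F N in sequentially. 1 \<le> Z (c * (x\<^sup>2) ^ N)" by simp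
    have "Z (c * (x\<^sup>2) ^ N) \<le> 1 + (x\<^sup>2) ^ N * Z c" for N
    proof -
      define y where "y = (x\<^sup>2) ^ N"
      have y: "0 < y" "y \<le> 1" using x2 x x1 by (auto simp: y_def intro: power_le_one)
      have cy: "0 < c * y" "c * y < 1" "c * y \<le> c" unfolding y_def using pos[of N] c by linarith+
      have le: "t (c * y) (Suc n) \<le> y * t c (Suc n)" for n
      proof -
        have "qpoch c x (Suc n) \<le> qpoch (c * y) x (Suc n)"
          unfolding qpoch_def
        proof (rule prod_mono, safe)
          fix i
          have "c * x ^ i \<le> c * 1" using c x x1 by (intro mult_left_mono power_le_one) auto
          then show "0 \<le> 1 - c * x ^ i" using c by linarith
          show "1 - c * x ^ i \<le> 1 - c * y * x ^ i" using cy x by (simp add: mult_right_mono)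
        qed
        moreover have "0 < qpoch c x (Suc n)" using qpoch_bounds(2)[of c x "Suc n"] c x x1 by simp
        ultimately have "1 / qpoch (c * y) x (Suc n) \<le> 1 / qpoch c x (Suc n)" by (simp add: frac_le)
        moreover have "(c * y / x) ^ Suc n \<le> y * (c / x) ^ Suc n"
        proof -
          have "y ^ n \<le> 1" using y by (intro power_le_one) auto
          then have "y * y ^ n * (c / x) ^ Suc n \<le> y * 1 * (c / x) ^ Suc n"
            using y c x by (intro mult_right_mono mult_left_mono) auto
          then show ?thesis by (simp add: power_mult_distrib power_divide mult_ac)
        qed
        ultimately have "(c * y / x) ^ Suc n * (1 / qpoch (c * y) x (Suc n)) \<le> y * (c / x) ^ Suc n * (1 / qpoch c x (Suc n))"
          using y c x qpoch_bounds(2)[of "c * y" x "Suc n"] cy x1 by (intro mult_mono) auto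
        then have "qpoch b x (Suc n) * qpoch (x / b) x (Suc n) * x ^ tri (Suc n) / qpoch (x\<^sup>2) (x\<^sup>2) (Suc n) * ((c * y / x) ^ Suc n * (1 / qpoch (c * y) x (Suc n)))
          \<le> qpoch b x (Suc n) * qpoch (x / b) x (Suc n) * x ^ tri (Suc n) / qpoch (x\<^sup>2) (x\<^sup>2) (Suc n) * (y * (c / x) ^ Suc n * (1 / qpoch c x (Suc n)))"
          using qpoch_bounds(2)[of b x "Suc n"] qpoch_bounds(2)[of "x / b" x "Suc n"] qpoch_bounds(2)[of "x\<^sup>2" "x\<^sup>2" "Suc n"] x x1 xb x2 b
          by (intro mult_left_mono) auto
        then show ?thesis unfolding t_def by (simp add: mult_ac del: power_Suc tri.simps)
      qed
      have "Z (c * y) = 1 + (\<Sum>n. t (c * y) (Suc n))"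
        unfolding Z_def using suminf_split_head[OF summ[OF cy(1,2)]] by (simp add: t0)
      also have "(\<Sum>n. t (c * y) (Suc n)) \<le> (\<Sum>n. y * t c (Suc n))"
        by (rule suminf_le[OF le]) (use summ[OF cy(1,2)] summ[OF c] in \<open>auto simp: summable_Suc_iff intro!: summable_mult\<close>)
      also have "\<dots> = y * (Z c - 1)"
        unfolding Z_def using suminf_split_head[OF summ[OF c]] summ[OF c]
        by (subst suminf_mult) (auto simp: summable_Suc_iff t0)
      also have "\<dots> \<le> y * Z c" using y by (simp add: algebra_simps)
      finally show ?thesis by (simp add: y_def)
    qed
    then show "\<forall>\<^sub>F N in sequentially. Z (c * (x\<^sup>2) ^ N) \<le> 1 + (x\<^sup>2) ^ N * Z c" by simp
    have "(\<lambda>N. 1 + (x\<^sup>2) ^ N * Z c) \<longlonglongrightarrow> 1 + 0 * Z c"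
      by (intro tendsto_intros LIMSEQ_power_zero) (use x2 in auto)
    then show "(\<lambda>N. 1 + (x\<^sup>2) ^ N * Z c) \<longlonglongrightarrow> 1" by simp
  qed simp
  moreover have "(\<lambda>N. qpoch c x (2 * N)) \<longlonglongrightarrow> qinf c x"
    using LIMSEQ_subseq_LIMSEQ[OF qpoch_LIMSEQ[of x c], of "\<lambda>N. 2 * N"] x x1 by (simp add: o_def strict_mono_def)
  moreover have "qinf c x \<noteq> 0" using qpoch_bounds(4)[of c x] c x x1 by simp
  ultimately have "(\<lambda>N. qpoch (c * x / b) (x\<^sup>2) N * qpoch (b * c) (x\<^sup>2) N / qpoch c x (2 * N) * Z (c * (x\<^sup>2) ^ N))
      \<longlonglongrightarrow> qinf (c * x / b) (x\<^sup>2) * qinf (b * c) (x\<^sup>2) / qinf c x * 1"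
    by (intro tendsto_intros qpoch_LIMSEQ) (use x2 in auto)
  then have "Z c = qinf (c * x / b) (x\<^sup>2) * qinf (b * c) (x\<^sup>2) / qinf c x"
    unfolding it[symmetric] by (simp add: LIMSEQ_const_iff)
  then show ?thesis using summable_sums[OF summ[OF c]] by (simp add: Z_def)
qed

section \<open>Recurrences for the cases 5a and 6a\<close>

context small_q
begin

lemma rapid_scale: assumes "rapid \<mu>" shows "rapid (\<lambda>n. c ^ n * \<mu> n)"
  unfolding rapid_def
proof (intro allI impI)
  fix L :: real assume "0 < L"
  then have "0 < L / (1 + \<bar>c\<bar>)" by simp
  then obtain C where C: "0 < C" "\<And>m. \<bar>\<mu> m\<bar> \<le> C * (L / (1 + \<bar>c\<bar>)) ^ m" by (rule rapidE[OF assms]) blast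
  have "\<bar>c ^ m * \<mu> m\<bar> \<le> C * L ^ m" for m
  proof -
    have "\<bar>c ^ m * \<mu> m\<bar> \<le> (1 + \<bar>c\<bar>) ^ m * (C * (L / (1 + \<bar>c\<bar>)) ^ m)"
      unfolding abs_mult power_abs using C by (intro mult_mono power_mono) auto
    also have "\<dots> = C * L ^ m" by (simp add: power_divide)
    finally show ?thesis .
  qed
  then show "\<exists>C>0. \<forall>m. \<bar>c ^ m * \<mu> m\<bar> \<le> C * L ^ m" using C by blast
qed

lemma rapid_tri_power: assumes "1 \<le> s" shows "rapid (\<lambda>n. (q ^ s) ^ tri n)"
  unfolding rapid_def
proof (intro allI impI)
  fix L :: real assume "0 < L"
  then obtain C where C: "0 < C" "\<And>m. \<bar>q ^ tri m\<bar> \<le> C * L ^ m" by (rule rapidE[OF rapid_tri]) blast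
  have "\<bar>(q ^ s) ^ tri m\<bar> \<le> \<bar>q ^ tri m\<bar>" for m
    unfolding power_abs using qs[of s] assms q_pos by (intro power_mono) auto
  then show "\<exists>C>0. \<forall>m. \<bar>(q ^ s) ^ tri m\<bar> \<le> C * L ^ m" using C by (meson order_trans)
qed

text \<open>Notation for the summands of both cases. \<open>c2\<close> keeps the q-factorial of
  \<open>a2\<close>, whose quadratic exponent \<open>a2_tri\<close> moves to \<open>T3\<close>;
  \<open>Li m\<close> is 1/(-q;q)_m and comes from the moments of 1/(z;q)_inf in
  \<open>Lam_ei1\<close>.\<close>

definition c2 :: "nat \<Rightarrow> real" where "c2 j = 1 / qpoch (q\<^sup>2) (q\<^sup>2) j"
definition U :: "nat \<Rightarrow> real" where "U j = q ^ (2 * j)"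
definition W :: "nat \<Rightarrow> real" where "W k = q ^ (3 * k)"
definition T3 :: "nat \<Rightarrow> real" where "T3 k = (q ^ 3) ^ tri k"
definition Li :: "nat \<Rightarrow> real" where "Li m = 1 / qpoch (- q) q m"

lemma U_Suc: "U (Suc j) = q\<^sup>2 * U j" and W_Suc: "W (Suc k) = q ^ 3 * W k"
  and UW: "q ^ (2 * j + 3 * k) = U j * W k"
  by (simp_all add: U_def W_def power_add power2_eq_square power3_eq_cube)

lemma T3_Suc: "T3 (Suc k) = T3 k * (q ^ 3 * W k)"
  by (simp add: T3_def W_def power_add power_mult)

lemma Li_Suc: "Li m = Li (Suc m) * (1 + q * q ^ m)"
proof -
  have "1 + q * q ^ m \<noteq> 0" using q_pos by (smt (verit) mult_pos_pos zero_less_power)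
  then show ?thesis by (simp add: Li_def qpoch_Suc)
qed

lemma U_0 [simp]: "U 0 = 1" and W_0 [simp]: "W 0 = 1" by (simp_all add: U_def W_def)

lemma c2_rule: "(1 - U 0) * c2 0 = 0" "\<And>j. (1 - U (Suc j)) * c2 (Suc j) = c2 j"
proof -
  show "(1 - U (Suc j)) * c2 (Suc j) = c2 j" for j
  proof -
    have "qpoch (q\<^sup>2) (q\<^sup>2) (Suc j) = qpoch (q\<^sup>2) (q\<^sup>2) j * (1 - U (Suc j))"
      unfolding qpoch_self_Suc U_def by (simp only: power_mult)
    moreover have "U (Suc j) \<noteq> 1" using q_power_less[of "2 * Suc j"] by (simp add: U_def)
    ultimately show ?thesis unfolding c2_def by simp
  qed
qed simp

lemma b3_rule: "(1 - W 0) * b3 0 = 0" "\<And>k. (1 - W (Suc k)) * b3 (Suc k) = b3 k"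
  using b3_Suc by (simp_all add: W_def)

text \<open>A discrete divergence on the pairs j + k = n: the factors 1 - U and 1 - W lower the
  indices of \<open>c2\<close> and \<open>b3\<close>, and after the shifts both sums run over the
  same terms with j + k = n - 1.\<close>

lemma conv_telescope:
  assumes "\<And>j k. A (Suc j) k = B j (Suc k)"
  shows "(\<Sum>j\<le>n. c2 j * b3 (n - j) * ((1 - U j) * A j (n - j) - (1 - W (n - j)) * B j (n - j))) = 0"
proof (cases n)
  case (Suc l)
  have "(\<Sum>j\<le>n. ((1 - U j) * c2 j) * (b3 (n - j) * A j (n - j))) = (\<Sum>j\<le>l. c2 j * (b3 (l - j) * A (Suc j) (l - j)))"
    unfolding Suc by (rule conv_left[where G = "\<lambda>j k. b3 k * A j k", OF c2_rule])
  moreover have "(\<Sum>j\<le>n. ((1 - W (n - j)) * b3 (n - j)) * (c2 j * B j (n - j))) = (\<Sum>j\<le>l. b3 (l - j) * (c2 j * B j (Suc (l - j))))"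
    unfolding Suc by (rule conv_right[where G = "\<lambda>j k. c2 j * B j k", OF b3_rule])
  ultimately have "(\<Sum>j\<le>n. ((1 - U j) * c2 j) * (b3 (n - j) * A j (n - j))) = (\<Sum>j\<le>n. ((1 - W (n - j)) * b3 (n - j)) * (c2 j * B j (n - j)))"
    by (simp add: assms mult_ac)
  then show ?thesis by (simp add: algebra_simps sum_subtractf sum.distrib)
qed simp

text \<open>Read from right to left, a sum for n - 1 becomes one for n, so that sums for different n
  can be compared term by term; the factor 1 - U kills the term j = 0. \<open>conv_shift2\<close>
  treats n - 2 in the same way.\<close>

lemma conv_shift1:
  assumes "\<And>j k. G (Suc j) k = \<phi> j k"
  shows "(\<Sum>j\<le>n. c2 j * b3 (n - j) * ((1 - U j) * G j (n - j))) = (if n = 0 then 0 else \<Sum>j\<le>n - 1. c2 j * b3 (n - 1 - j) * \<phi> j (n - 1 - j))"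
proof (cases n)
  case (Suc l)
  have "(\<Sum>j\<le>n. ((1 - U j) * c2 j) * (b3 (n - j) * G j (n - j))) = (\<Sum>j\<le>l. c2 j * (b3 (l - j) * G (Suc j) (l - j)))"
    unfolding Suc by (rule conv_left[where G = "\<lambda>j k. b3 k * G j k", OF c2_rule])
  then show ?thesis by (simp add: Suc assms mult_ac)
qed simp

lemma conv_shift2:
  assumes "\<And>j k. G (Suc (Suc j)) k = \<phi> j k"
  shows "(\<Sum>j\<le>n. c2 j * b3 (n - j) * ((1 - U j) * ((1 - U j / q\<^sup>2) * G j (n - j))))
    = (if n \<le> 1 then 0 else \<Sum>j\<le>n - 2. c2 j * b3 (n - 2 - j) * \<phi> j (n - 2 - j))"
proof -
  have "(1 - U (Suc j) / q\<^sup>2) * G (Suc j) k = (1 - U j) * G (Suc j) k" for j k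
    using q_pos by (simp add: U_Suc)
  from conv_shift1[where G = "\<lambda>j k. (1 - U j / q\<^sup>2) * G j k", OF this]
  have "(\<Sum>j\<le>n. c2 j * b3 (n - j) * ((1 - U j) * ((1 - U j / q\<^sup>2) * G j (n - j))))
    = (if n = 0 then 0 else \<Sum>j\<le>n - 1. c2 j * b3 (n - 1 - j) * ((1 - U j) * G (Suc j) (n - 1 - j)))" .
  also have "\<dots> = (if n = 0 then 0 else (if n - 1 = 0 then 0 else \<Sum>j\<le>n - 1 - 1. c2 j * b3 (n - 1 - 1 - j) * \<phi> j (n - 1 - 1 - j)))"
    by (subst conv_shift1[where G = "\<lambda>j. G (Suc j)" and \<phi> = \<phi>, OF assms]) simp
  also have "\<dots> = (if n \<le> 1 then 0 else \<Sum>j\<le>n - 2. c2 j * b3 (n - 2 - j) * \<phi> j (n - 2 - j))"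
    by (auto simp: numeral_2_eq_2)
  finally show ?thesis .
qed

definition S :: "nat \<Rightarrow> (real \<Rightarrow> real \<Rightarrow> real) \<Rightarrow> nat \<Rightarrow> real" where
  "S d w n = (\<Sum>j\<le>n. c2 j * b3 (n - j) * (T3 (n - j) * Li (2 * j + 3 * (n - j) + d) * w (U j) (W (n - j))))"

text \<open>Creative telescoping with certificate \<open>P\<close>; the indices are \<open>u = q\<^bsup>2j\<^esup>\<close>, \<open>w = q\<^bsup>3k\<^esup>\<close>, \<open>j + k = n\<close>.\<close>

lemma S_recurrence:
  assumes id: "\<And>u w. \<alpha> (u ^ 3 * w\<^sup>2) * wt u w
      + \<beta> (u ^ 3 * w\<^sup>2) * ((1 - u) * ((1 + q * q ^ d * (u * w)) * (1 + q ^ d * (u * w)) * wt (u / q\<^sup>2) w))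
      + \<gamma> * ((1 - u) * ((1 - u / q\<^sup>2) * ((1 + q * q ^ d * (u * w)) * (1 + q ^ d * (u * w)) * (1 + q ^ d * (u * w) / q) * (1 + q ^ d * (u * w) / q\<^sup>2) * wt (u / q ^ 4) w)))
    = (1 - u) * (q ^ 3 * w * P (u / q\<^sup>2) (q ^ 3 * w)) - (1 - w) * ((1 + q * q ^ d * (u * w)) * P u w)"
  shows "\<alpha> (q ^ (6 * n)) * S (Suc d) wt n + \<beta> (q ^ (6 * n)) * (if n = 0 then 0 else S (Suc d) wt (n - 1))
    + \<gamma> * (if n \<le> 1 then 0 else S (Suc d) wt (n - 2)) = 0"
proof -
  define \<phi> where "\<phi> j k = T3 k * Li (2 * j + 3 * k + Suc d) * wt (U j) (W k)" for j k
  \<comment> \<open>\<open>G1\<close> and \<open>G2\<close> are the summands for n - 1 and n - 2,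
    read at a pair (j, k) of n. Their additional linear factors undo the steps of \<open>Li\<close>
    when j drops by one or two. \<open>A\<close> and \<open>B\<close> are the two sides of the
    certificate.\<close>
  define G1 where "G1 j k = T3 k * Li (2 * j + 3 * k + Suc d) * ((1 + q * q ^ d * (U j * W k)) * (1 + q ^ d * (U j * W k)) * wt (U j / q\<^sup>2) (W k))" for j k
  define G2 where "G2 j k = T3 k * Li (2 * j + 3 * k + Suc d) * ((1 + q * q ^ d * (U j * W k)) * (1 + q ^ d * (U j * W k)) * (1 + q ^ d * (U j * W k) / q) * (1 + q ^ d * (U j * W k) / q\<^sup>2) * wt (U j / q ^ 4) (W k))" for j k
  define A where "A j k = T3 k * Li (2 * j + 3 * k + Suc d) * (q ^ 3 * W k * P (U j / q\<^sup>2) (q ^ 3 * W k))" for j k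
  define B where "B j k = T3 k * Li (2 * j + 3 * k + Suc d) * ((1 + q * q ^ d * (U j * W k)) * P (U j) (W k))" for j k
  have Li2: "Li (2 * j + 3 * k + Suc d) = Li (2 * Suc j + 3 * k + Suc d) * (1 + q * q ^ d * (U (Suc j) * W k)) * (1 + q ^ d * (U (Suc j) * W k))" for j k
  proof -
    let ?m = "2 * j + 3 * k + Suc d"
    have L: "Li ?m = Li (Suc (Suc ?m)) * (1 + q * (q * q ^ ?m)) * (1 + q * q ^ ?m)"
      using Li_Suc[of ?m] Li_Suc[of "Suc ?m"] by simp
    have y: "q ^ ?m = q * q ^ d * (U j * W k)" by (simp add: power_add flip: UW)
    have s: "Suc (Suc ?m) = 2 * Suc j + 3 * k + Suc d" by simp
    have "Li ?m = Li (2 * Suc j + 3 * k + Suc d) * (1 + q * (q * (q * q ^ d * (U j * W k)))) * (1 + q * (q * q ^ d * (U j * W k)))"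
      using L unfolding s y .
    then show ?thesis unfolding U_Suc power2_eq_square by (simp only: mult_ac)
  qed
  have G1: "G1 (Suc j) k = \<phi> j k" for j k
    unfolding G1_def \<phi>_def Li2[of j k] using q_pos by (simp add: U_Suc mult_ac)
  have G2: "G2 (Suc (Suc j)) k = \<phi> j k" for j k
  proof -
    have "U (Suc (Suc j)) / q ^ 4 = U j" "U (Suc (Suc j)) / q\<^sup>2 = U (Suc j)" "U (Suc (Suc j)) / q = q * U (Suc j)"
      using q_pos by (simp_all add: U_Suc power2_eq_square power4_eq_xxxx)
    note u4 = this
    have h: "q ^ d * (U (Suc (Suc j)) * W k) / q = q * q ^ d * (U (Suc j) * W k)"
      "q ^ d * (U (Suc (Suc j)) * W k) / q\<^sup>2 = q ^ d * (U (Suc j) * W k)"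
      using q_pos by (simp_all add: U_Suc[of "Suc j"] power2_eq_square)
    show ?thesis unfolding G2_def \<phi>_def Li2[of j k] Li2[of "Suc j" k] h u4(1) by (simp only: mult_ac)
  qed
  have AB: "A (Suc j) k = B j (Suc k)" for j k
  proof -
    let ?m = "2 * j + 3 * Suc k + d"
    have s1: "Suc ?m = 2 * j + 3 * Suc k + Suc d" and s2: "?m = 2 * Suc j + 3 * k + Suc d" by simp_all
    have y: "q ^ ?m = q ^ d * (U j * W (Suc k))" 
    proof -
      have "q ^ ?m = q ^ (2 * j + 3 * Suc k) * q ^ d" by (rule power_add)
      then show ?thesis unfolding UW by (simp only: mult_ac)
    qed
    have "Li (Suc ?m) * (1 + q * (q ^ d * (U j * W (Suc k)))) = Li ?m"
      using Li_Suc[of ?m] unfolding y by (rule sym)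
    then have "Li (2 * j + 3 * Suc k + Suc d) * (1 + q * q ^ d * (U j * W (Suc k))) = Li (2 * Suc j + 3 * k + Suc d)"
      unfolding s1[symmetric] s2[symmetric] by (simp only: mult.assoc)
    then have "B j (Suc k) = T3 (Suc k) * Li (2 * Suc j + 3 * k + Suc d) * P (U j) (W (Suc k))"
      unfolding B_def by (metis mult.assoc)
    then show ?thesis unfolding A_def T3_Suc using q_pos by (simp add: U_Suc W_Suc mult_ac)
  qed
  have "\<alpha> (q ^ (6 * n)) * S (Suc d) wt n + \<beta> (q ^ (6 * n)) * (if n = 0 then 0 else S (Suc d) wt (n - 1))
    + \<gamma> * (if n \<le> 1 then 0 else S (Suc d) wt (n - 2))
    = \<alpha> (q ^ (6 * n)) * (\<Sum>j\<le>n. c2 j * b3 (n - j) * \<phi> j (n - j))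
     + \<beta> (q ^ (6 * n)) * (\<Sum>j\<le>n. c2 j * b3 (n - j) * ((1 - U j) * G1 j (n - j)))
     + \<gamma> * (\<Sum>j\<le>n. c2 j * b3 (n - j) * ((1 - U j) * ((1 - U j / q\<^sup>2) * G2 j (n - j))))"
    unfolding conv_shift1[of G1, OF G1] conv_shift2[of G2, OF G2] S_def \<phi>_def by simp
  also have "\<dots> = (\<Sum>j\<le>n. c2 j * b3 (n - j) * ((1 - U j) * A j (n - j) - (1 - W (n - j)) * B j (n - j)))"
    unfolding sum_distrib_left sum.distrib[symmetric]
  proof (rule sum.cong[OF refl])
    fix j assume "j \<in> {..n}"
    then obtain k where n: "n = j + k" using le_Suc_ex by auto
    have Y: "q ^ (6 * n) = U j ^ 3 * W k ^ 2"
      by (simp add: n U_def W_def power_add algebra_simps flip: power_mult)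
    have k: "n - j = k" using n by simp
    let ?L = "T3 k * Li (2 * j + 3 * k + Suc d)"
    have "c2 j * b3 k * ?L * (\<alpha> (U j ^ 3 * W k ^ 2) * wt (U j) (W k)
      + \<beta> (U j ^ 3 * W k ^ 2) * ((1 - U j) * ((1 + q * q ^ d * (U j * W k)) * (1 + q ^ d * (U j * W k)) * wt (U j / q\<^sup>2) (W k)))
      + \<gamma> * ((1 - U j) * ((1 - U j / q\<^sup>2) * ((1 + q * q ^ d * (U j * W k)) * (1 + q ^ d * (U j * W k)) * (1 + q ^ d * (U j * W k) / q) * (1 + q ^ d * (U j * W k) / q\<^sup>2) * wt (U j / q ^ 4) (W k)))))
      = c2 j * b3 k * ?L * ((1 - U j) * (q ^ 3 * W k * P (U j / q\<^sup>2) (q ^ 3 * W k)) - (1 - W k) * ((1 + q * q ^ d * (U j * W k)) * P (U j) (W k)))"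
      unfolding id ..
    then show "\<alpha> (q ^ (6 * n)) * (c2 j * b3 (n - j) * \<phi> j (n - j)) + \<beta> (q ^ (6 * n)) * (c2 j * b3 (n - j) * ((1 - U j) * G1 j (n - j)))
       + \<gamma> * (c2 j * b3 (n - j) * ((1 - U j) * ((1 - U j / q\<^sup>2) * G2 j (n - j))))
      = c2 j * b3 (n - j) * ((1 - U j) * A j (n - j) - (1 - W (n - j)) * B j (n - j))"
      unfolding k Y \<phi>_def G1_def G2_def A_def B_def
      by (simp only: distrib_left right_diff_distrib mult_ac)
  qed
  also have "\<dots> = 0" by (rule conv_telescope[where A = A and B = B, OF AB])
  finally show ?thesis .
qed

text \<open>The certificate P of \<open>S_recurrence\<close> for the weight \<open>wt5\<close>,
  followed by the one for \<open>wt6\<close>. All that is asked of them is the identity in u and w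
  verified in \<open>S5_rec\<close> and \<open>S6_rec\<close>.\<close>

definition cert5 :: "real \<Rightarrow> real \<Rightarrow> real" where
  "cert5 u w = u * (q\<^sup>2 - 1) - u^2 * q^2 + u^2*w*(q + q^2) + u^3*w*(1/q^5 - 1 - q - q^2) + u^3*w^2*q - u^4*w/q^5
     + u^4*w^2*(1/q^6 + 1/q^5 + 1/q^4 - q) - u^5*w^2*(1/q^6 + 1/q^5) + u^5*w^3/q^6 + u^6*w^3*(1/q^4 - 1/q^6)"

definition cert6 :: "real \<Rightarrow> real \<Rightarrow> real" where
  "cert6 u w = u^2*w*(q^2 + q^3 - 1 - q) - u^3*w*(q^2 + q^3) + u^3*w^2*(q^2 + 2*q^3 + q^4) - u^4*w^2*(1 + q + q^2 + q^3 + q^4)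
     + u^4*w^3*(q + q^2 + q^3 + q^4) - u^5*w^3*(q + q^2) + u^5*w^4*q^2 + u^6*w^4*(q^4 - q^2)"

text \<open>\<open>wt5\<close> replaces the weight 1 - u + u w through \<open>S_telescope5\<close>;
  \<open>wt6\<close> comes from the polynomial factor in \<open>Lam6_sums\<close>.\<close>

definition wt5 :: "real \<Rightarrow> real \<Rightarrow> real" where "wt5 u w = 1 + q * u\<^sup>2 * w"
definition wt6 :: "real \<Rightarrow> real \<Rightarrow> real" where "wt6 u w = u * w * (1 + q + q\<^sup>2 * (u * w))"

lemma S5_rec:
  "(1 - q ^ (6 * n)) * (1 - q ^ (6 * n) / q ^ 4) * S 1 wt5 n
    + (- (1 + q ^ 4) + (1 / q + 1 / q ^ 5) * q ^ (6 * n)) * (if n = 0 then 0 else S 1 wt5 (n - 1))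
    + q ^ 4 * (if n \<le> 1 then 0 else S 1 wt5 (n - 2)) = 0"
proof -
  note rec = S_recurrence[where \<alpha> = "\<lambda>Y. (1 - Y) * (1 - Y / q ^ 4)" and \<beta> = "\<lambda>Y. - (1 + q ^ 4) + (1 / q + 1 / q ^ 5) * Y" and \<gamma> = "q ^ 4" and P = cert5 and d = 0 and wt = wt5]
  have "(1 - q ^ (6 * n)) * (1 - q ^ (6 * n) / q ^ 4) * S (Suc 0) wt5 n
    + (- (1 + q ^ 4) + (1 / q + 1 / q ^ 5) * q ^ (6 * n)) * (if n = 0 then 0 else S (Suc 0) wt5 (n - 1))
    + q ^ 4 * (if n \<le> 1 then 0 else S (Suc 0) wt5 (n - 2)) = 0"
  proof (rule rec)
  fix u w :: real
  \<comment> \<open>The arguments u/q^2 and u/q^4 and the negative powers of q in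
    \<open>cert5\<close> all become polynomial in terms of z, as \<open>algebra\<close>
    requires.\<close>
  define z where "z = u / q ^ 6"
  have u: "u = q ^ 6 * z" "u / q\<^sup>2 = q ^ 4 * z" "u / q ^ 4 = q\<^sup>2 * z" using q_pos by (simp_all add: z_def power_numeral_reduce)
  have d: "q ^ 0 * (u * w) / q = q ^ 5 * z * w" "q ^ 0 * (u * w) / q\<^sup>2 = q ^ 4 * z * w" "u ^ 3 * w\<^sup>2 / q ^ 4 = q ^ 14 * z ^ 3 * w\<^sup>2"
    "(1 / q + 1 / q ^ 5) * (u ^ 3 * w\<^sup>2) = (q ^ 17 + q ^ 13) * z ^ 3 * w\<^sup>2"
    using q_pos by (simp_all add: u field_simps power_numeral_reduce)
  have p: "cert5 u w = q ^ 6 * z * (q\<^sup>2 - 1) - q ^ 14 * z^2 + q ^ 12 * z^2*w*(q + q^2) + z^3*w*(q ^ 13 - q ^ 18 * (1 + q + q^2)) + q ^ 19 * z^3*w^2 - q ^ 19 * z^4*w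
     + z^4*w^2*(q ^ 18 + q ^ 19 + q ^ 20 - q ^ 25) - z^5*w^2*(q ^ 24 + q ^ 25) + q ^ 24 * z^5*w^3 + z^6*w^3*(q ^ 32 - q ^ 30)"
    using q_pos unfolding cert5_def u(1) by (simp add: field_simps power_numeral_reduce)
  have p': "cert5 (u / q\<^sup>2) (q ^ 3 * w) = q ^ 4 * z * (q\<^sup>2 - 1) - q ^ 10 * z^2 + q ^ 11 * z^2*w*(q + q^2) + z^3*w*(q ^ 10 - q ^ 15 * (1 + q + q^2)) + q ^ 19 * z^3*w^2 - q ^ 14 * z^4*w
     + z^4*w^2*(q ^ 16 + q ^ 17 + q ^ 18 - q ^ 23) - z^5*w^2*(q ^ 20 + q ^ 21) + q ^ 23 * z^5*w^3 + z^6*w^3*(q ^ 29 - q ^ 27)"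
    using q_pos unfolding cert5_def u(2) by (simp add: field_simps power_numeral_reduce)
  show "(1 - u ^ 3 * w\<^sup>2) * (1 - u ^ 3 * w\<^sup>2 / q ^ 4) * wt5 u w
      + (- (1 + q ^ 4) + (1 / q + 1 / q ^ 5) * (u ^ 3 * w\<^sup>2)) * ((1 - u) * ((1 + q * q ^ 0 * (u * w)) * (1 + q ^ 0 * (u * w)) * wt5 (u / q\<^sup>2) w))
      + q ^ 4 * ((1 - u) * ((1 - u / q\<^sup>2) * ((1 + q * q ^ 0 * (u * w)) * (1 + q ^ 0 * (u * w)) * (1 + q ^ 0 * (u * w) / q) * (1 + q ^ 0 * (u * w) / q\<^sup>2) * wt5 (u / q ^ 4) w)))
    = (1 - u) * (q ^ 3 * w * cert5 (u / q\<^sup>2) (q ^ 3 * w)) - (1 - w) * ((1 + q * q ^ 0 * (u * w)) * cert5 u w)"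
    unfolding d p p' unfolding u(2,3) wt5_def unfolding u(1) by algebra
  qed
  then show ?thesis by (simp only: One_nat_def)
qed

lemma S6_rec:
  "(1 - q ^ (6 * n)) * (1 - q ^ 4 * q ^ (6 * n)) * S 2 wt6 n
    + (- (q\<^sup>2 + q ^ 6) + (q + q ^ 5) * q ^ (6 * n)) * (if n = 0 then 0 else S 2 wt6 (n - 1))
    + q ^ 8 * (if n \<le> 1 then 0 else S 2 wt6 (n - 2)) = 0"
proof -
  have "(1 - q ^ (6 * n)) * (1 - q ^ 4 * q ^ (6 * n)) * S (Suc 1) wt6 n
    + (- (q\<^sup>2 + q ^ 6) + (q + q ^ 5) * q ^ (6 * n)) * (if n = 0 then 0 else S (Suc 1) wt6 (n - 1))
    + q ^ 8 * (if n \<le> 1 then 0 else S (Suc 1) wt6 (n - 2)) = 0"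
  proof (rule S_recurrence[where \<alpha> = "\<lambda>Y. (1 - Y) * (1 - q ^ 4 * Y)" and \<beta> = "\<lambda>Y. - (q\<^sup>2 + q ^ 6) + (q + q ^ 5) * Y" and \<gamma> = "q ^ 8" and d = 1 and wt = wt6 and P = cert6])
    fix u w :: real
    define z where "z = u / q ^ 6"
    have u: "u = q ^ 6 * z" "u / q\<^sup>2 = q ^ 4 * z" "u / q ^ 4 = q\<^sup>2 * z" using q_pos by (simp_all add: z_def power_numeral_reduce)
    have d: "q ^ 1 * (u * w) / q = q ^ 6 * z * w" "q ^ 1 * (u * w) / q\<^sup>2 = q ^ 5 * z * w"
      using q_pos by (simp_all add: u field_simps power_numeral_reduce)
    show "(1 - u ^ 3 * w\<^sup>2) * (1 - q ^ 4 * (u ^ 3 * w\<^sup>2)) * wt6 u w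
      + (- (q\<^sup>2 + q ^ 6) + (q + q ^ 5) * (u ^ 3 * w\<^sup>2)) * ((1 - u) * ((1 + q * q ^ 1 * (u * w)) * (1 + q ^ 1 * (u * w)) * wt6 (u / q\<^sup>2) w))
      + q ^ 8 * ((1 - u) * ((1 - u / q\<^sup>2) * ((1 + q * q ^ 1 * (u * w)) * (1 + q ^ 1 * (u * w)) * (1 + q ^ 1 * (u * w) / q) * (1 + q ^ 1 * (u * w) / q\<^sup>2) * wt6 (u / q ^ 4) w)))
    = (1 - u) * (q ^ 3 * w * cert6 (u / q\<^sup>2) (q ^ 3 * w)) - (1 - w) * ((1 + q * q ^ 1 * (u * w)) * cert6 u w)"
      unfolding d u(2,3) wt6_def cert6_def unfolding u(1) by algebra
  qed
  moreover have "Suc 1 = (2 :: nat)" by simp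
  ultimately show ?thesis by (simp only:)
qed

text \<open>A second order recurrence solved by a \<open>\<^sub>2\<phi>\<^sub>1\<close> generating function times an infinite product.\<close>

lemma recurrence_solution:
  fixes s r :: "nat \<Rightarrow> real" and e h :: real
  assumes rec: "\<And>n. (1 - (q ^ 6) ^ n) * (1 - h * (q ^ 6) ^ n) * s n
      + (- (e + e * h) + (q + q ^ 5) * e * h / q ^ 6 * (q ^ 6) ^ n) * (if n = 0 then 0 else s (n - 1))
      + e * (e * h) * (if n \<le> 1 then 0 else s (n - 2)) = 0"
    and nz: "\<And>n. 1 \<le> n \<Longrightarrow> h * (q ^ 6) ^ n \<noteq> 1"
    and r: "r 0 = s 0" "\<And>k. r (Suc k) * ((1 - (q ^ 6) ^ Suc k) * (1 - h * (q ^ 6) ^ Suc k)) = e * h * ((1 - q * (q ^ 6) ^ k) * (1 - q ^ 5 * (q ^ 6) ^ k)) * r k"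
  shows "s n = (\<Sum>k\<le>n. r k * (e ^ (n - k) / qpoch (q ^ 6) (q ^ 6) (n - k)))"
proof -
  define p where "p = q ^ 6"
  let ?c = fps_const
  define F where "F = Abs_fps s"
  define R where "R = Abs_fps r"
  define E where "E = Abs_fps (\<lambda>n. e ^ n / qpoch p p n)"
  \<comment> \<open>\<open>M H = 0\<close> is the recurrence written as a second-order q-difference
    equation in base p = q^6.\<close>
  define M where "M H = (1 - ?c e * X) * (1 - ?c (e * h) * X) * H - (1 + ?c h - ?c (e * h * (q + q ^ 5)) * X) * sc p H + ?c h * sc (p * p) H" for H
  have Mn: "M H $ n = (1 - p ^ n) * (1 - h * p ^ n) * H $ n
      + (- (e + e * h) + (q + q ^ 5) * e * h / p * p ^ n) * (if n = 0 then 0 else H $ (n - 1))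
      + e * (e * h) * (if n \<le> 1 then 0 else H $ (n - 2))" for H n
  proof -
    have ME: "M H = H - ?c (e + e * h) * (X * H) + ?c (e * (e * h)) * (X * (X * H)) - ?c (1 + h) * sc p H + ?c (e * h * (q + q ^ 5)) * (X * sc p H) + ?c h * sc (p * p) H"
    proof -
      have "?c (e + e * h) = ?c e + ?c (e * h)" "?c (e * (e * h)) = ?c e * ?c (e * h)" "?c (1 + h) = 1 + ?c h" by simp_all
      then show ?thesis unfolding M_def by algebra
    qed
    have "p \<noteq> 0" using q_pos by (simp add: p_def)
    then show ?thesis unfolding ME
      by (cases n; cases "n - 1") (simp_all add: field_simps power_mult_distrib)
  qed
  have MF: "M F = 0"
  proof (rule fps_ext)
    show "M F $ n = 0 $ n" for n
      unfolding Mn F_def p_def fps_nth_Abs_fps fps_zero_nth by (rule rec)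
  qed
  have Eeq: "(1 - ?c e * X) * E = sc p E"
    using ei_eq[of 6 e] unfolding E_def p_def
  proof -
    have "E = ei0 e 6" by (simp add: E_def ei0_def p_def)
    moreover have "(1 - ?c e * X) * ei0 e 6 = sc (q ^ 6) (ei0 e 6)"
    proof (rule fps_ext)
      fix n show "((1 - ?c e * X) * ei0 e 6) $ n = sc (q ^ 6) (ei0 e 6) $ n"
      proof (cases n)
        case (Suc m)
        have "x / (P * (1 - B)) - x / P = B * (x / (P * (1 - B)))" if "1 - B \<noteq> 0" "P \<noteq> 0" for x P B :: real
          using that by (simp add: divide_simps) (simp add: algebra_simps)
        note k = this[of "(q ^ 6) ^ Suc m" "qpoch (q ^ 6) (q ^ 6) m" "e ^ Suc m"]
        have "1 - (q ^ 6) ^ Suc m \<noteq> 0" using q_power_less[of "6 * Suc m"] unfolding power_mult by simp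
        moreover have "qpoch (q ^ 6) (q ^ 6) m \<noteq> 0" using qpoch_pos[of 6 m] by simp
        ultimately have "e ^ Suc m / (qpoch (q ^ 6) (q ^ 6) m * (1 - (q ^ 6) ^ Suc m)) - e ^ Suc m / qpoch (q ^ 6) (q ^ 6) m
          = (q ^ 6) ^ Suc m * (e ^ Suc m / (qpoch (q ^ 6) (q ^ 6) m * (1 - (q ^ 6) ^ Suc m)))" by (rule k)
        then
        show ?thesis
          by (simp add: Suc ei0_def left_diff_distrib mult.assoc qpoch_self_Suc del: power_Suc) (simp add: mult.assoc)
      qed (simp add: ei0_def)
    qed
    ultimately show "(1 - ?c e * X) * Abs_fps (\<lambda>n. e ^ n / qpoch (q ^ 6) (q ^ 6) n) = sc (q ^ 6) (Abs_fps (\<lambda>n. e ^ n / qpoch (q ^ 6) (q ^ 6) n))"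
      by (simp add: E_def p_def)
  qed
  \<comment> \<open>The term ratio of \<open>r\<close> as an equation for its generating function;
    it is the equation of a 2phi1 in base p with numerator parameters q and q^5, whose product is
    p.\<close>
  have Req: "R - ?c (1 + h) * sc p R + ?c h * sc (p * p) R
      = ?c (e * h) * (X * R) - ?c (e * h * (q + q ^ 5)) * (X * sc p R) + ?c (e * h * p) * (X * sc (p * p) R)"
  proof (rule fps_ext)
    fix n
    show "(R - ?c (1 + h) * sc p R + ?c h * sc (p * p) R) $ n
      = (?c (e * h) * (X * R) - ?c (e * h * (q + q ^ 5)) * (X * sc p R) + ?c (e * h * p) * (X * sc (p * p) R)) $ n"
    proof (cases n)
      case (Suc k)
      have "p = q * q ^ 5" by (simp add: p_def power_numeral_reduce)
      note pq = this
      have "(1 - a * Y) * (1 - b * Y) = 1 - (a + b) * Y + (a * b) * (Y * Y)" for a b Y :: real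
        by (simp add: algebra_simps)
      from this[of q "p ^ k" "q ^ 5"]
      have "(1 - q * p ^ k) * (1 - q ^ 5 * p ^ k) = 1 - (q + q ^ 5) * p ^ k + p * (p ^ k * p ^ k)"
        unfolding pq[symmetric] .
      then show ?thesis using r(2)[of k] unfolding p_def[symmetric] Suc
        by (simp add: R_def power_mult_distrib algebra_simps)
    qed (simp add: R_def algebra_simps)
  qed
  have "M (R * E) = 0"
  proof -
    have "sc (p * p) E = sc p (sc p E)" by simp
    also have "\<dots> = sc p ((1 - ?c e * X) * E)" by (simp only: Eeq)
    also have "\<dots> = (1 - ?c e * (?c p * X)) * sc p E" by (simp only: sc_simps)
    also have "\<dots> = (1 - ?c e * (?c p * X)) * ((1 - ?c e * X) * E)" by (simp only: Eeq)
    finally have E2: "sc (p * p) E = (1 - ?c (e * p) * X) * ((1 - ?c e * X) * E)" by (simp add: mult.assoc[symmetric])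
    have c: "?c (1 + h) = 1 + ?c h" "?c (e * h) = ?c e * ?c h" "?c (e * h * (q + q ^ 5)) = ?c e * ?c h * ?c (q + q ^ 5)"
      "?c (e * h * p) = ?c e * ?c h * ?c p" "?c (e * p) = ?c e * ?c p" by simp_all
    \<comment> \<open>The equation of \<open>E\<close> pulls out a common factor and leaves exactly
      the equation of \<open>R\<close>.\<close>
    have "M (R * E) = (1 - ?c e * X) * E * (R - ?c (1 + h) * sc p R + ?c h * sc (p * p) R
        - (?c (e * h) * (X * R) - ?c (e * h * (q + q ^ 5)) * (X * sc p R) + ?c (e * h * p) * (X * sc (p * p) R)))"
      unfolding M_def sc_mult E2 Eeq[symmetric] c by algebra
    also have "\<dots> = 0" unfolding Req by simp
    finally show ?thesis .
  qed
  \<comment> \<open>For n > 0 the equation determines each coefficient from the two before it, since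
    neither 1 - p^n nor 1 - h p^n vanishes.\<close>
  have "F $ n = (R * E) $ n" for n
  proof (induction n rule: less_induct)
    case (less n)
    show ?case
    proof (cases "n = 0")
      case True
      then show ?thesis using r(1) by (simp add: F_def R_def E_def)
    next
      case False
      have "M F $ n = M (R * E) $ n" using MF \<open>M (R * E) = 0\<close> by simp
      then have "(1 - p ^ n) * (1 - h * p ^ n) * F $ n = (1 - p ^ n) * (1 - h * p ^ n) * (R * E) $ n"
        unfolding Mn using less[of "n - 1"] less[of "n - 2"] False by (auto split: if_splits)
      moreover have "p ^ n \<noteq> 1" "h * p ^ n \<noteq> 1"
        using q_power_less[of "6 * n"] nz[of n] False by (simp_all add: p_def flip: power_mult)
      ultimately show ?thesis by simp
    qed
  qed
  from this[of n] show ?thesis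
    by (simp add: F_def R_def E_def fps_mult_nth atLeast0AtMost p_def)
qed

end

section \<open>The triple product\<close>

context small_q
begin

text \<open>For c = -(a + 1/a) this is (a q^k; q)_inf (q^k/a; q)_inf. The real parameter c also
  covers a on the unit circle: c = -1 belongs to the primitive sixth roots of unity, and c = sqrt 3
  and c = - sqrt 3 to the primitive twelfth ones.\<close>

definition Ac :: "real \<Rightarrow> nat \<Rightarrow> real" where
  "Ac c k = prodinf (\<lambda>i. 1 + c * q ^ (k + i) + q ^ (2 * (k + i)))"

lemma Ac_convergent: "convergent_prod (\<lambda>i. 1 + c * q ^ (k + i) + q ^ (2 * (k + i)))"
proof -
  have s: "summable (\<lambda>i. q ^ i)" "summable (\<lambda>i. (q\<^sup>2) ^ i)"
    using q_pos q_lt_1 q_power_less[of 2] by (auto simp: summable_geometric)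
  have "summable (\<lambda>i. \<bar>c\<bar> * q ^ k * q ^ i + q ^ (2 * k) * (q\<^sup>2) ^ i)"
    by (intro summable_add summable_mult s)
  note sg = this
  have le: "norm (norm ((1 + c * q ^ (k + i) + q ^ (2 * (k + i))) - 1)) \<le> \<bar>c\<bar> * q ^ k * q ^ i + q ^ (2 * k) * (q\<^sup>2) ^ i" for i
  proof -
    have "norm (norm ((1 + c * q ^ (k + i) + q ^ (2 * (k + i))) - 1)) \<le> \<bar>c * q ^ (k + i)\<bar> + \<bar>q ^ (2 * (k + i))\<bar>" by simp
    also have "\<dots> = \<bar>c\<bar> * q ^ k * q ^ i + q ^ (2 * k) * (q\<^sup>2) ^ i"
      using q_pos by (simp add: abs_mult power_add distrib_left power_mult)
    finally show ?thesis .
  qed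
  have "summable (\<lambda>i. norm ((1 + c * q ^ (k + i) + q ^ (2 * (k + i))) - 1))"
    by (rule summable_comparison_test'[OF sg, of 0]) (rule le)
  then show ?thesis
    by (intro abs_convergent_prod_imp_convergent_prod summable_imp_abs_convergent_prod)
qed

lemma Ac_LIMSEQ: "(\<lambda>N. \<Prod>i<N. 1 + c * q ^ (k + i) + q ^ (2 * (k + i))) \<longlonglongrightarrow> Ac c k"
  using convergent_prod_LIMSEQ[OF Ac_convergent, of c k] unfolding Ac_def
  by (simp add: LIMSEQ_lessThan_iff_atMost)

lemma Ac_rec: "Ac c k = (1 + c * q ^ k + q ^ (2 * k)) * Ac c (Suc k)"
proof -
  have "(\<lambda>N. (1 + c * q ^ k + q ^ (2 * k)) * (\<Prod>i<N. 1 + c * q ^ (Suc k + i) + q ^ (2 * (Suc k + i)))) \<longlonglongrightarrow> (1 + c * q ^ k + q ^ (2 * k)) * Ac c (Suc k)"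
    by (intro tendsto_intros Ac_LIMSEQ)
  moreover have "(1 + c * q ^ k + q ^ (2 * k)) * (\<Prod>i<N. 1 + c * q ^ (Suc k + i) + q ^ (2 * (Suc k + i)))
    = (\<Prod>i<Suc N. 1 + c * q ^ (k + i) + q ^ (2 * (k + i)))" for N
    unfolding prod.lessThan_Suc_shift by simp
  ultimately have "(\<lambda>N. \<Prod>i<Suc N. 1 + c * q ^ (k + i) + q ^ (2 * (k + i))) \<longlonglongrightarrow> (1 + c * q ^ k + q ^ (2 * k)) * Ac c (Suc k)"
    by (simp only:)
  then have "(\<lambda>N. \<Prod>i<N. 1 + c * q ^ (k + i) + q ^ (2 * (k + i))) \<longlonglongrightarrow> (1 + c * q ^ k + q ^ (2 * k)) * Ac c (Suc k)"
    by (rule LIMSEQ_imp_Suc)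
  with Ac_LIMSEQ show ?thesis by (rule LIMSEQ_unique)
qed

lemma Ac_factor_pos: assumes "c\<^sup>2 < 4" shows "0 < 1 + c * x + (x :: real)\<^sup>2"
proof -
  have "1 + c * x + x\<^sup>2 = (x + c / 2)\<^sup>2 + (1 - c\<^sup>2 / 4)" by (simp add: power2_eq_square algebra_simps)
  then show ?thesis using assms by (smt (verit) zero_le_power2 divide_less_eq_1_pos)
qed

lemma Ac_pos: assumes "c\<^sup>2 < 4" shows "0 < Ac c k"
proof -
  have p: "0 < 1 + c * q ^ (k + i) + q ^ (2 * (k + i))" for i
    using Ac_factor_pos[OF assms, of "q ^ (k + i)"] by (simp add: mult.commute flip: power_mult)
  then have "Ac c k \<noteq> 0" unfolding Ac_def by (intro prodinf_nonzero Ac_convergent) (metis less_irrefl)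
  moreover have "0 \<le> (\<Prod>i<N. 1 + c * q ^ (k + i) + q ^ (2 * (k + i)))" for N
    by (intro prod_nonneg) (use p less_imp_le in blast)
  then have "0 \<le> Ac c k" using LIMSEQ_le_const[OF Ac_LIMSEQ] by blast
  ultimately show ?thesis by simp
qed

lemma Ac_prod: "(\<Prod>i<k. 1 + c * q ^ i + q ^ (2 * i)) * Ac c k = Ac c 0"
proof (induction k)
  case (Suc k)
  then show ?case using Ac_rec[of c k] by (simp add: mult.assoc)
qed simp

lemma Ac_LIMSEQ_1: assumes "c\<^sup>2 < 4" shows "(\<lambda>k. Ac c k) \<longlonglongrightarrow> 1"
proof -
  have 1: "(\<lambda>k. \<Prod>i<k. 1 + c * q ^ i + q ^ (2 * i)) \<longlonglongrightarrow> Ac c 0" using Ac_LIMSEQ[of c 0] by simp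
  have "(\<lambda>k. Ac c 0 / (\<Prod>i<k. 1 + c * q ^ i + q ^ (2 * i))) \<longlonglongrightarrow> Ac c 0 / Ac c 0"
    by (intro tendsto_intros 1) (use Ac_pos[OF assms, of 0] in simp)
  moreover have "Ac c 0 / (\<Prod>i<k. 1 + c * q ^ i + q ^ (2 * i)) = Ac c k" for k
    using Ac_prod[of c k] Ac_pos[OF assms, of 0] by (metis nonzero_mult_div_cancel_left mult_zero_left less_irrefl)
  ultimately show ?thesis using Ac_pos[OF assms, of 0] by simp
qed

text \<open>The first-order term of the product as q^k tends to 0. The telescoping differences of
  \<open>Ac\<close>, divided by q^k, tend to c q^i, and Tannery's theorem sums these.\<close>

lemma Ac_slope: assumes "c\<^sup>2 < 4" shows "(\<lambda>k. (Ac c k - 1) / q ^ k) \<longlonglongrightarrow> c / (1 - q)"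
proof -
  obtain B where B: "0 < B" "\<And>k. norm (Ac c k) \<le> B"
    using convergent_imp_Bseq[OF convergentI[OF Ac_LIMSEQ_1[OF assms]]] by (auto elim: BseqE)
  define f where "f i k = (c * q ^ i + q ^ k * (q\<^sup>2) ^ i) * Ac c (k + i + 1)" for i k
  have "(\<lambda>k. suminf (\<lambda>i. f i k)) \<longlonglongrightarrow> suminf (\<lambda>i. (c * q ^ i + 0 * (q\<^sup>2) ^ i) * 1)"
  proof (rule tannerys_theorem[THEN conjunct2, THEN conjunct2])
    show "((\<lambda>k. f i k) \<longlongrightarrow> (c * q ^ i + 0 * (q\<^sup>2) ^ i) * 1) sequentially" for i
    proof -
      have a: "(\<lambda>k. q ^ k) \<longlonglongrightarrow> 0" using q_pos q_lt_1 by (intro LIMSEQ_power_zero) auto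
      have b: "(\<lambda>k. Ac c (k + i + 1)) \<longlonglongrightarrow> 1"
        using LIMSEQ_ignore_initial_segment[OF Ac_LIMSEQ_1[OF assms], of "i + 1"] by (simp add: add.assoc)
      show ?thesis unfolding f_def
        by (rule tendsto_mult[OF tendsto_add[OF tendsto_const tendsto_mult[OF a tendsto_const]] b])
    qed
    have "norm (f i k) \<le> (\<bar>c\<bar> + 1) * q ^ i * B" for i k
    proof -
      have "q ^ k * (q\<^sup>2) ^ i \<le> 1 * q ^ i"
        using q_pos q_lt_1 qs(3)[of 2] by (intro mult_mono power_mono power_le_one) auto
      then have "\<bar>c * q ^ i + q ^ k * (q\<^sup>2) ^ i\<bar> \<le> \<bar>c\<bar> * q ^ i + q ^ i"
        using q_pos abs_triangle_ineq[of "c * q ^ i" "q ^ k * (q\<^sup>2) ^ i"] by (simp add: abs_mult)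
      then have "\<bar>c * q ^ i + q ^ k * (q\<^sup>2) ^ i\<bar> * \<bar>Ac c (k + i + 1)\<bar> \<le> ((\<bar>c\<bar> + 1) * q ^ i) * B"
        using B(2)[of "k + i + 1"] q_pos by (intro mult_mono) (auto simp: algebra_simps)
      then show ?thesis by (simp add: f_def abs_mult)
    qed
    then show "\<forall>\<^sub>F (i, k) in sequentially \<times>\<^sub>F sequentially. norm (f i k) \<le> (\<bar>c\<bar> + 1) * q ^ i * B"
      by (intro always_eventually) auto
    show "summable (\<lambda>i. (\<bar>c\<bar> + 1) * q ^ i * B)" using q_pos q_lt_1
      by (intro summable_mult2 summable_mult) (auto simp: summable_geometric)
  qed simp
  moreover have "suminf (\<lambda>i. (c * q ^ i + 0 * (q\<^sup>2) ^ i) * 1) = c / (1 - q)"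
    using sums_mult[OF geometric_sums[of q], of c] q_pos q_lt_1 by (simp add: sums_iff)
  moreover have "suminf (\<lambda>i. f i k) = (Ac c k - 1) / q ^ k" for k
  proof -
    have "(\<lambda>i. Ac c (k + i)) \<longlonglongrightarrow> 1"
      using LIMSEQ_ignore_initial_segment[OF Ac_LIMSEQ_1[OF assms], of k] by (simp add: add.commute)
    from telescope_sums'[OF this] have "(\<lambda>i. Ac c (k + i) - Ac c (k + Suc i)) sums (Ac c k - 1)" by simp
    then have "(\<lambda>i. (Ac c (k + i) - Ac c (k + Suc i)) / q ^ k) sums ((Ac c k - 1) / q ^ k)" by (rule sums_divide)
    moreover have "(Ac c (k + i) - Ac c (k + Suc i)) / q ^ k = f i k" for i
    proof -
      have "Ac c (k + i) - Ac c (k + Suc i) = (c * q ^ (k + i) + q ^ (2 * (k + i))) * Ac c (k + i + 1)"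
        using Ac_rec[of c "k + i"] by (simp add: algebra_simps)
      moreover have "q ^ (k + i) = q ^ k * q ^ i" "q ^ (2 * (k + i)) = q ^ k * (q ^ k * (q\<^sup>2) ^ i)"
        by (simp_all add: power_add power_mult algebra_simps power_mult_distrib power2_eq_square)
      ultimately show ?thesis using q_pos unfolding f_def by (simp add: field_simps)
    qed
    ultimately show ?thesis by (simp add: sums_iff)
  qed
  ultimately show ?thesis by simp
qed

text \<open>\<open>q ^ tri n\<close> times the Gaussian binomial coefficient of 2N + 1 over N - n,
  the weight in the finite form of the triple product.\<close>

definition gJ :: "nat \<Rightarrow> nat \<Rightarrow> real" where
  "gJ N n = (if n \<le> N then q ^ tri n * qpoch q q (2 * N + 1) / (qpoch q q (N - n) * qpoch q q (N + n + 1)) else 0)"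

lemma qpoch_q_pos: "0 < qpoch q q n" using qpoch_pos[of 1 n] by simp

text \<open>A q-Pascal rule for raising N by one. The truncated \<open>n - 1\<close> at n = 0 is
  correct: the weight is symmetric under n \<mapsto> -1 - n, so its value at -1 is its value at
  0.\<close>

lemma gJ_rec:
  "gJ (Suc N) n = (1 + q ^ (2 * Suc N)) * gJ N n + q ^ Suc N * (gJ N (n - 1) + gJ N (Suc n))"
proof (cases "n \<le> Suc N")
  case False
  then show ?thesis by (simp add: gJ_def)
next
  case True
  then obtain m where m: "Suc N = n + m" using le_Suc_ex by auto
  define z w where "z = q ^ Suc N" and "w = q ^ n"
  have w: "w \<noteq> 0" using q_pos by (simp add: w_def)
  have zw: "q ^ m = z / w" using q_pos by (simp add: z_def w_def m power_add)
  define Kc where "Kc = q ^ tri n * qpoch q q (2 * N + 1) / (qpoch q q m * qpoch q q (N + n + 2))"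
  have g0: "gJ N n = Kc * ((1 - z / w) * (1 - z * q * w))"
  proof (cases m)
    case 0
    then have "z / w = 1" "\<not> n \<le> N" using zw m by auto
    then show ?thesis by (simp add: gJ_def)
  next
    case (Suc a)
    then have "N - n = a" "n \<le> N" "N = n + a" using m by auto
    moreover have "qpoch q q m = qpoch q q a * (1 - z / w)" unfolding zw[symmetric] Suc by (simp add: qpoch_Suc)
    moreover have "qpoch q q (N + n + 2) = qpoch q q (N + n + 1) * (1 - z * q * w)"
      by (simp add: qpoch_Suc z_def w_def power_add mult_ac)
    moreover have "1 - z / w \<noteq> 0" "1 - z * q * w \<noteq> 0"
      using calculation(4,5) qpoch_q_pos[of m] qpoch_q_pos[of "N + n + 2"] by auto
    ultimately show ?thesis by (auto simp: gJ_def Kc_def)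
  qed
  have g1: "gJ (Suc N) n = Kc * ((1 - z\<^sup>2) * (1 - z\<^sup>2 * q))"
  proof -
    have "2 * Suc N + 1 = Suc (Suc (2 * N + 1))" by simp
    then have "qpoch q q (2 * Suc N + 1) = qpoch q q (2 * N + 1) * ((1 - z\<^sup>2) * (1 - z\<^sup>2 * q))"
      by (simp add: qpoch_Suc z_def power_add power_mult power2_eq_square algebra_simps)
    moreover have "Suc N - n = m" "Suc N + n + 1 = N + n + 2" using m by auto
    ultimately show ?thesis using True by (simp add: gJ_def Kc_def)
  qed
  have g2: "gJ N (n - 1) = Kc * ((1 - z * w) * (1 - z * q * w) / w)"
  proof (cases n)
    case 0
    then have "w = 1" by (simp add: w_def)
    then show ?thesis using g0 0 by simp
  next
    case (Suc l)
    have e: "N - l = m" "N + l + 1 = N + n" "l \<le> N" using m Suc by auto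
    have "q ^ tri n = q ^ tri l * w" by (simp add: Suc w_def power_add)
    moreover have "qpoch q q (N + n + 2) = qpoch q q (N + n) * ((1 - z * w) * (1 - z * q * w))"
      by (simp add: qpoch_Suc z_def w_def power_add mult_ac)
    moreover have "1 - z * w \<noteq> 0" "1 - z * q * w \<noteq> 0"
      using calculation(2) qpoch_q_pos[of "N + n + 2"] by auto
    ultimately show ?thesis using w e by (auto simp: gJ_def Kc_def Suc)
  qed
  have g3: "gJ N (Suc n) = Kc * ((w * q - z) * (1 - z / w))"
  proof (cases "Suc n \<le> N")
    case False
    then have "m = 0 \<or> m = 1" using m by auto
    then have "z / w = 1 \<or> z / w = q" using zw by auto
    then have "(w * q - z) * (1 - z / w) = 0" using w by (auto simp: field_simps)
    then show ?thesis using False by (simp add: gJ_def)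
  next
    case True
    then have "2 \<le> m" using m by simp
    then obtain a where "m = 2 + a" using le_Suc_ex by blast
    then have a: "m = Suc (Suc a)" by simp
    then have e: "N - Suc n = a" "N + Suc n + 1 = N + n + 2" using m by auto
    have "q ^ m = q ^ Suc a * q" by (simp add: a)
    then have "q ^ Suc a = z / (w * q)" using zw q_pos by (simp only: divide_divide_eq_left[symmetric]) simp
    then have "qpoch q q m = qpoch q q a * ((1 - z / (w * q)) * (1 - z / w))"
      unfolding zw[symmetric] a by (simp add: qpoch_Suc)
    moreover have "q ^ tri (Suc n) = q ^ tri n * (w * q)" by (simp add: w_def power_add)
    moreover have "w * q - z = w * q * (1 - z / (w * q))" using w q_pos by (simp add: field_simps)
    moreover have "1 - z / (w * q) \<noteq> 0" "1 - z / w \<noteq> 0"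
      using calculation(1) qpoch_q_pos[of m] by auto
    ultimately show ?thesis using True e by (auto simp: gJ_def Kc_def)
  qed
  have "(1 - z\<^sup>2) * (1 - z\<^sup>2 * q) = (1 + z\<^sup>2) * ((1 - z / w) * (1 - z * q * w)) + z * ((1 - z * w) * (1 - z * q * w) / w + (w * q - z) * (1 - z / w))"
    using w by (simp add: field_simps power2_eq_square)
  note id = this
  have gen: "k * ((1 + Z) * A + z * (B + C)) = (1 + Z) * (k * A) + z * (k * B + k * C)" for k Z A B C z :: real
    by (simp add: algebra_simps)
  have "Kc * ((1 - z\<^sup>2) * (1 - z\<^sup>2 * q)) = (1 + z\<^sup>2) * (Kc * ((1 - z / w) * (1 - z * q * w))) + z * (Kc * ((1 - z * w) * (1 - z * q * w) / w) + Kc * ((w * q - z) * (1 - z / w)))"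
    unfolding gen[symmetric] id ..
  moreover have "q ^ (2 * Suc N) = z\<^sup>2" by (simp only: z_def power_mult[symmetric] mult.commute)
  ultimately show ?thesis unfolding g0 g1 g2 g3 by (simp only: z_def[symmetric])
qed

text \<open>The sequence d folds the indices n and -1 - n of a two-sided sum into one; its start d 1
  = c - 1 is the recurrence with d(-1) = d(0). The induction step is \<open>gJ_rec\<close> with the
  shift moved onto d.\<close>

lemma finite_triple_product:
  fixes d :: "nat \<Rightarrow> real"
  assumes d: "d 0 = 1" "d 1 = c - 1" "\<And>n. d (Suc (Suc n)) = c * d (Suc n) - d n"
  shows "(\<Prod>i<N. 1 + c * q ^ (1 + i) + q ^ (2 * (1 + i))) = (\<Sum>n\<le>N. d n * gJ N n)"
proof (induction N)
  case 0
  show ?case using d qpoch_q_pos[of 1] by (simp add: gJ_def)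
next
  case (Suc N)
  let ?z = "q ^ Suc N"
  have z: "gJ N n = 0" if "n > N" for n using that by (simp add: gJ_def)
  have 1: "(\<Sum>n\<le>Suc N. d n * gJ N n) = (\<Sum>n\<le>N. d n * gJ N n)" by (simp add: z)
  have "(\<Sum>n\<le>Suc N. d n * (gJ N (n - 1) + gJ N (Suc n)))
      = d 0 * (gJ N 0 + gJ N 1) + (\<Sum>n\<le>N. d (Suc n) * (gJ N n + gJ N (Suc (Suc n))))"
    unfolding sum.atMost_Suc_shift by simp
  also have "(\<Sum>n\<le>N. d (Suc n) * (gJ N n + gJ N (Suc (Suc n)))) = (\<Sum>n\<le>N. d (Suc n) * gJ N n) + (\<Sum>n\<le>N. d (Suc n) * gJ N (Suc (Suc n)))"
    by (simp add: distrib_left sum.distrib)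
  also have "d 0 * (gJ N 0 + gJ N 1) + \<dots> = d 0 * gJ N 0 + (\<Sum>n\<le>N. d (Suc n) * gJ N n) + (d 0 * gJ N 1 + (\<Sum>n\<le>N. d (Suc n) * gJ N (Suc (Suc n))))"
    by (simp add: algebra_simps)
  also have "d 0 * gJ N 1 + (\<Sum>n\<le>N. d (Suc n) * gJ N (Suc (Suc n))) = (\<Sum>n\<le>Suc N. d n * gJ N (Suc n))"
    unfolding sum.atMost_Suc_shift by simp
  also have "\<dots> = (\<Sum>n\<le>N. d n * gJ N (Suc n))" by (simp add: z)
  also have "d 0 * gJ N 0 + (\<Sum>n\<le>N. d (Suc n) * gJ N n) + (\<Sum>n\<le>N. d n * gJ N (Suc n)) = c * (\<Sum>n\<le>N. d n * gJ N n)"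
  proof -
    have s: "(\<Sum>n\<le>N. f (Suc n)) = (\<Sum>n\<le>N. f n) - f 0" if "f (Suc N) = 0" for f :: "nat \<Rightarrow> real"
      using that sum.atMost_Suc_shift[of f N] by simp
    \<comment> \<open>At n = 0 this reads c d 0 = d 1 + d 0, again with the reflected value.\<close>
    have e: "c * d n = d (Suc n) + d (n - 1)" for n using d by (cases n) auto
    have "(\<Sum>n\<le>N. d n * gJ N (Suc n)) = (\<Sum>n\<le>N. d (n - 1) * gJ N n) - d 0 * gJ N 0"
      using s[of "\<lambda>n. d (n - 1) * gJ N n"] z by simp
    moreover have "c * (\<Sum>n\<le>N. d n * gJ N n) = (\<Sum>n\<le>N. d (Suc n) * gJ N n) + (\<Sum>n\<le>N. d (n - 1) * gJ N n)"
      unfolding sum_distrib_left sum.distrib[symmetric] by (intro sum.cong refl) (simp add: e algebra_simps flip: mult.assoc)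
    ultimately show ?thesis by simp
  qed
  finally have 2: "(\<Sum>n\<le>Suc N. d n * (gJ N (n - 1) + gJ N (Suc n))) = c * (\<Sum>n\<le>N. d n * gJ N n)" .
  have "(\<Sum>n\<le>Suc N. d n * gJ (Suc N) n)
      = (\<Sum>n\<le>Suc N. (1 + q ^ (2 * Suc N)) * (d n * gJ N n) + ?z * (d n * (gJ N (n - 1) + gJ N (Suc n))))"
    unfolding gJ_rec by (intro sum.cong refl) (simp add: algebra_simps)
  also have "\<dots> = (1 + q ^ (2 * Suc N)) * (\<Sum>n\<le>N. d n * gJ N n) + ?z * (c * (\<Sum>n\<le>N. d n * gJ N n))"
    unfolding sum.distrib sum_distrib_left[symmetric] 1 2 ..
  finally show ?case using Suc by (simp add: algebra_simps)
qed

text \<open>Jacobi's triple product in folded real form, obtained from the finite identity by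
  Tannery's theorem. If c = y + 1/y with y different from -1, then d n = (y^(n+1) + y^(-n))/(1 +
  y).\<close>

theorem triple_product:
  fixes d :: "nat \<Rightarrow> real"
  assumes d: "d 0 = 1" "d 1 = c - 1" "\<And>n. d (Suc (Suc n)) = c * d (Suc n) - d n"
  shows "summable (\<lambda>n. \<bar>d n\<bar> * q ^ tri n)" "(\<lambda>n. d n * q ^ tri n) sums (qinf q q * Ac c 1)"
proof -
  have dle: "\<bar>d n\<bar> \<le> (1 + \<bar>c\<bar>) ^ n \<and> \<bar>d (Suc n)\<bar> \<le> (1 + \<bar>c\<bar>) ^ Suc n" for n
  proof (induction n)
    case 0
    then show ?case using d by simp
  next
    case (Suc n)
    have "\<bar>d (Suc (Suc n))\<bar> \<le> \<bar>c\<bar> * \<bar>d (Suc n)\<bar> + \<bar>d n\<bar>"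
      unfolding d(3) abs_mult[symmetric] by (rule abs_triangle_ineq4)
    also have "\<dots> \<le> \<bar>c\<bar> * (1 + \<bar>c\<bar>) ^ Suc n + (1 + \<bar>c\<bar>) ^ n"
      using Suc by (intro add_mono mult_left_mono) auto
    also have "(1 + \<bar>c\<bar>) ^ n \<le> (1 + \<bar>c\<bar>) ^ Suc n" by (intro power_increasing) auto
    finally show ?case using Suc by (simp add: algebra_simps)
  qed
  define f where "f = Abs_fps (\<lambda>n. \<bar>d n\<bar>)"
  have "gb f" unfolding gb_def f_def by (rule geo_boundedI[of _ 1 "1 + \<bar>c\<bar>"]) (use dle in auto)
  then have s: "summable (\<lambda>n. \<bar>d n\<bar> * q ^ tri n)" using Lam_summable[of f] by (simp add: f_def mult.commute)
  then show "summable (\<lambda>n. \<bar>d n\<bar> * q ^ tri n)" .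
  have L: "0 < qinf q q" "\<And>n. qinf q q \<le> qpoch q q n" "\<And>n. qpoch q q n \<le> 1"
    using qpoch_bounds[of q q] q_pos q_lt_1 by auto
  have lim: "qpoch q q \<longlonglongrightarrow> qinf q q" by (rule qpoch_LIMSEQ) (use q_pos q_lt_1 in simp)
  have "(\<lambda>N. suminf (\<lambda>n. d n * gJ N n)) \<longlonglongrightarrow> suminf (\<lambda>n. d n * (q ^ tri n * qinf q q / (qinf q q * qinf q q)))"
  proof (rule tannerys_theorem[THEN conjunct2, THEN conjunct2])
    fix n
    have "(\<lambda>N. d n * (q ^ tri n * qpoch q q (2 * (N + n) + 1) / (qpoch q q N * qpoch q q (N + n + n + 1)))) \<longlonglongrightarrow> d n * (q ^ tri n * qinf q q / (qinf q q * qinf q q))"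
    proof (intro tendsto_intros lim)
      show "(\<lambda>N. qpoch q q (2 * (N + n) + 1)) \<longlonglongrightarrow> qinf q q"
        using LIMSEQ_subseq_LIMSEQ[OF lim, of "\<lambda>N. 2 * (N + n) + 1"] by (simp add: o_def strict_mono_def)
      show "(\<lambda>N. qpoch q q (N + n + n + 1)) \<longlonglongrightarrow> qinf q q"
        using LIMSEQ_ignore_initial_segment[OF lim, of "n + n + 1"] by (simp add: add.assoc)
    qed (use L in auto)
    then have "(\<lambda>N. d n * gJ (N + n) n) \<longlonglongrightarrow> d n * (q ^ tri n * qinf q q / (qinf q q * qinf q q))" by (simp add: gJ_def)
    then show "((\<lambda>N. d n * gJ N n) \<longlongrightarrow> d n * (q ^ tri n * qinf q q / (qinf q q * qinf q q))) sequentially" by (rule LIMSEQ_offset)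
  next
    have "norm (d n * gJ N n) \<le> \<bar>d n\<bar> * q ^ tri n * (1 / (qinf q q * qinf q q))" for n N
    proof -
      have "gJ N n \<le> q ^ tri n * 1 / (qinf q q * qinf q q)" "0 \<le> gJ N n"
        unfolding gJ_def using L q_pos less_imp_le[OF qpoch_q_pos]
        by (auto intro!: frac_le mult_mono mult_nonneg_nonneg divide_nonneg_nonneg mult_left_le less_imp_le[OF L(1)])
      then have "\<bar>d n\<bar> * \<bar>gJ N n\<bar> \<le> \<bar>d n\<bar> * (q ^ tri n * 1 / (qinf q q * qinf q q))" by (intro mult_left_mono) auto
      then show ?thesis by (simp add: abs_mult)
    qed
    then show "\<forall>\<^sub>F (n, N) in sequentially \<times>\<^sub>F sequentially. norm (d n * gJ N n) \<le> \<bar>d n\<bar> * q ^ tri n * (1 / (qinf q q * qinf q q))"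
      by (intro always_eventually) auto
    show "summable (\<lambda>n. \<bar>d n\<bar> * q ^ tri n * (1 / (qinf q q * qinf q q)))" by (rule summable_mult2[OF s])
  qed simp
  moreover have "suminf (\<lambda>n. d n * gJ N n) = (\<Prod>i<N. 1 + c * q ^ (1 + i) + q ^ (2 * (1 + i)))" for N
    unfolding finite_triple_product[where d = d, OF d] by (rule suminf_finite) (auto simp: gJ_def)
  ultimately have "(\<lambda>N. \<Prod>i<N. 1 + c * q ^ (1 + i) + q ^ (2 * (1 + i))) \<longlonglongrightarrow> suminf (\<lambda>n. d n * (q ^ tri n / qinf q q))" using L by simp
  then have e: "Ac c 1 = suminf (\<lambda>n. d n * (q ^ tri n / qinf q q))" using Ac_LIMSEQ[of c 1] LIMSEQ_unique by blast
  have s2: "summable (\<lambda>n. d n * q ^ tri n)"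
    by (rule summable_norm_cancel) (use s q_pos in \<open>simp add: abs_mult\<close>)
  have "Ac c 1 = suminf (\<lambda>n. d n * q ^ tri n) / qinf q q"
    unfolding e using suminf_divide[OF s2, of "qinf q q"] by simp
  then show "(\<lambda>n. d n * q ^ tri n) sums (qinf q q * Ac c 1)" using summable_sums[OF s2] L by simp
qed

end

section \<open>The cases 7 and 7a\<close>

context small_q
begin

text \<open>A contiguous relation in T. The three series are polynomial multiples of
  \<open>H\<close>, so the claim concerns a single polynomial times \<open>H\<close>, and that
  polynomial has the form that \<open>Lam_certificate\<close> kills.\<close>

lemma H7_recurrence:
  "Lam (H7 T) = (1 + q) * (1 + q * T) * Lam (H7 (T * q\<^sup>2)) - q * (1 - q\<^sup>2 * T + q ^ 4 * T\<^sup>2) * Lam (H7 (T * q ^ 4))"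
proof -
  define t where "t = fps_const T"
  let ?R = "ei (q ^ 3) 3 * ep (- q) 1 * ep q 1"
  define H where "H = ei T 2 * ei (T * q) 2 * ?R * ep (T * q ^ 4) 1 * ep (T * q ^ 6) 2"
  define d0 where "d0 = (1 - t * X\<^sup>2) * (1 - t * Q * X\<^sup>2)"
  define d1 where "d1 = (1 - t * Q\<^sup>2 * X\<^sup>2) * (1 - t * Q ^ 3 * X\<^sup>2)"
  define n0 where "n0 = (1 + t * X) * (1 + t * Q * X) * (1 + t * Q\<^sup>2 * X\<^sup>2)"
  define n1 where "n1 = (1 + t * Q\<^sup>2 * X) * (1 + t * Q ^ 3 * X) * (1 + t * Q ^ 4 * X\<^sup>2)"
  have eiT: "ei (c * q\<^sup>2) 2 = (1 - fps_const c * X\<^sup>2) * ei c 2" for c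
    using ei_eq[of 2 c] sc_ei[of 2 c] by simp
  have ep1: "ep c 1 = (1 + fps_const c * X) * ep (c * q) 1" for c
    using ep_eq[of 1 c] sc_ep[of 1 c] by simp
  have ep2: "ep c 2 = (1 + fps_const c * X\<^sup>2) * ep (c * q\<^sup>2) 2" for c
    using ep_eq[of 2 c] sc_ep[of 2 c] by simp
  have gbH: "gb H" unfolding H_def by (intro gb_all) simp_all
  have qq: "T * q * q = T * q\<^sup>2" "T * q\<^sup>2 * q = T * q ^ 3" "T * q ^ 3 * q = T * q ^ 4" "T * q\<^sup>2 * q\<^sup>2 = T * q ^ 4" "T * q ^ 4 * q\<^sup>2 = T * q ^ 6"
    "T * q * q\<^sup>2 = T * q ^ 3" "T * q ^ 3 * q\<^sup>2 = T * q ^ 5" "T * q ^ 4 * q = T * q ^ 5"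
    by (simp_all add: power_numeral_reduce)
  have tc: "fps_const (T * q) = t * Q" "fps_const (T * q\<^sup>2) = t * Q\<^sup>2" "fps_const (T * q ^ 3) = t * Q ^ 3" "fps_const (T * q ^ 4) = t * Q ^ 4" "fps_const T = t"
    by (simp_all add: t_def)
  have E1: "ep T 1 = (1 + t * X) * ((1 + t * Q * X) * ep (T * q\<^sup>2) 1)"
    using ep1[of T] ep1[of "T * q"] unfolding qq tc by simp
  have E1': "ep (T * q\<^sup>2) 1 = (1 + t * Q\<^sup>2 * X) * ((1 + t * Q ^ 3 * X) * ep (T * q ^ 4) 1)"
    using ep1[of "T * q\<^sup>2"] ep1[of "T * q ^ 3"] unfolding qq tc by simp
  have E2: "ep (T * q\<^sup>2) 2 = (1 + t * Q\<^sup>2 * X\<^sup>2) * ep (T * q ^ 4) 2" and E2': "ep (T * q ^ 4) 2 = (1 + t * Q ^ 4 * X\<^sup>2) * ep (T * q ^ 6) 2"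
    using ep2[of "T * q\<^sup>2"] ep2[of "T * q ^ 4"] unfolding qq tc by simp_all
  have I: "ei (T * q\<^sup>2) 2 = (1 - t * X\<^sup>2) * ei T 2" "ei (T * q ^ 3) 2 = (1 - t * Q * X\<^sup>2) * ei (T * q) 2"
    using eiT[of T] eiT[of "T * q"] unfolding qq tc by simp_all
  have I': "ei (T * q ^ 4) 2 = (1 - t * Q\<^sup>2 * X\<^sup>2) * ei (T * q\<^sup>2) 2" "ei (T * q ^ 5) 2 = (1 - t * Q ^ 3 * X\<^sup>2) * ei (T * q ^ 3) 2"
    using eiT[of "T * q\<^sup>2"] eiT[of "T * q ^ 3"] unfolding qq tc by simp_all
  have H0: "H7 T = n0 * n1 * H"
    unfolding H7_def H_def n0_def n1_def E1 E1' E2 E2' by (simp add: mult_ac)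
  have H1: "H7 (T * q\<^sup>2) = n1 * d0 * H"
    unfolding H7_def H_def n1_def d0_def qq E1' E2' I by (simp add: mult_ac)
  have H2: "H7 (T * q ^ 4) = d0 * d1 * H"
    unfolding H7_def H_def d0_def d1_def qq I' I by (simp add: mult_ac)
  \<comment> \<open>The certificate. The first three factors of \<open>r'\<close> are those of
    \<open>?N\<close> before dilation, so that the dilation by q yields exactly
    \<open>?N * p\<close>.\<close>
  define p where "p = (- t * (Q + Q\<^sup>2 + Q ^ 3) + t\<^sup>2 * Q ^ 5) - t\<^sup>2 * (Q ^ 3 + Q ^ 4 + Q ^ 5 + Q ^ 6) * X + (t\<^sup>2 * Q ^ 4 - t ^ 3 * (Q ^ 6 + Q ^ 7 + Q ^ 8)) * X\<^sup>2"
  define r' where "r' = (1 + X) * (1 + t * Q ^ 3 * X) * (1 + t * Q ^ 4 * X\<^sup>2) *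
    ((- t * (1 + Q + Q\<^sup>2) + t\<^sup>2 * Q ^ 4) - t\<^sup>2 * (Q + Q\<^sup>2 + Q ^ 3 + Q ^ 4) * X + (t\<^sup>2 * Q - t ^ 3 * (Q ^ 3 + Q ^ 4 + Q ^ 5)) * X\<^sup>2)"
  let ?D = "d0 * (1 + Q * X + Q\<^sup>2 * X\<^sup>2)"
  let ?N = "(1 + Q * X) * (1 + t * Q ^ 4 * X) * (1 + t * Q ^ 6 * X\<^sup>2)"
  have D: "?D * H = ?N * sc q H"
  proof -
    have "((1 - t * X\<^sup>2) * (1 - fps_const (T * q) * X\<^sup>2) * ((1 - fps_const (q ^ 3) * X ^ 3) * 1 * 1) * 1 * 1) * H
      = (1 * 1 * (1 * (1 + fps_const (- q) * X ^ 1) * (1 + Q * X ^ 1)) * (1 + fps_const (T * q ^ 4) * X ^ 1) * (1 + fps_const (T * q ^ 6) * X\<^sup>2)) * sc q H"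
      unfolding H_def t_def by (intro qdiff_mult qdiff_ei qdiff_ep) simp_all
    moreover have "fps_const (T * q) = t * Q" "fps_const (q ^ 3) = Q ^ 3" "fps_const (- q) = - Q" "fps_const (T * q ^ 4) = t * Q ^ 4" "fps_const (T * q ^ 6) = t * Q ^ 6"
      by (simp_all add: t_def)
    ultimately have *: "(d0 * (1 - Q ^ 3 * X ^ 3)) * H = ((1 + - Q * X) * (1 + Q * X) * (1 + t * Q ^ 4 * X) * (1 + t * Q ^ 6 * X\<^sup>2)) * sc q H"
      unfolding d0_def by (simp only: mult_1 mult_1_right power_one_right)
    have f: "1 - Q ^ 3 * X ^ 3 = (1 - Q * X) * (1 + Q * X + Q\<^sup>2 * X\<^sup>2)" by algebra
    have "(1 - Q * X) * (?D * H) = (d0 * (1 - Q ^ 3 * X ^ 3)) * H" unfolding f by (simp only: mult_ac)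
    also have "\<dots> = (1 - Q * X) * (?N * sc q H)" unfolding * by (simp add: mult_ac)
    finally have "(1 - Q * X) * (?D * H) = (1 - Q * X) * (?N * sc q H)" .
    moreover have "1 - Q * X \<noteq> 0"
    proof
      assume "1 - Q * X = 0"
      then have "(1 - Q * X) $ 0 = 0" by simp
      then show False by simp
    qed
    ultimately show ?thesis by simp
  qed
  have L0: "Lam ((?D * p - K * X * (Q * r')) * H) = 0"
  proof (rule Lam_certificate[OF gbH _ _ D])
    show "gb p" "gb (Q * r')" "gb ?D" unfolding p_def r'_def d0_def t_def by (intro gb_intros)+
    show "sc q (Q * r') = ?N * p"
      unfolding r'_def p_def t_def sc_simps sc_minus unfolding t_def[symmetric] by algebra
  qed
  have E: "?D * p - K * X * (Q * r') = n0 * n1 - fps_const ((1 + q) * (1 + q * T)) * (n1 * d0) + fps_const (q * (1 - q\<^sup>2 * T + q ^ 4 * T\<^sup>2)) * (d0 * d1)"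
  proof -
    have 1: "K * X * (Q * r') = X * r'" using QK by (metis mult.assoc mult.commute mult.left_neutral)
    have 2: "fps_const ((1 + q) * (1 + q * T)) = (1 + Q) * (1 + Q * t)" "fps_const (q * (1 - q\<^sup>2 * T + q ^ 4 * T\<^sup>2)) = Q * (1 - Q\<^sup>2 * t + Q ^ 4 * t\<^sup>2)"
      by (simp_all add: t_def flip: fps_const_add fps_const_mult fps_const_sub fps_const_power del: fps_const_add fps_const_mult fps_const_sub fps_const_power)
    show ?thesis unfolding 1 2 unfolding p_def r'_def d0_def d1_def n0_def n1_def by algebra
  qed
  from L0[unfolded E] have "Lam (n0 * n1 * H - fps_const ((1 + q) * (1 + q * T)) * (n1 * d0 * H) + fps_const (q * (1 - q\<^sup>2 * T + q ^ 4 * T\<^sup>2)) * (d0 * d1 * H)) = 0"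
    by (simp only: distrib_right left_diff_distrib mult.assoc)
  then show ?thesis
    unfolding H0[symmetric] H1[symmetric] H2[symmetric]
    by (simp add: Lam_add Lam_diff Lam_const gb_intros gb_H7 del: fps_const_mult)
qed

text \<open>k = 0 and k = 1 are the cases 7 and 7a; growing k leads along the recurrence to the
  limit T = 0.\<close>

definition V :: "nat \<Rightarrow> real" where "V k = Lam (H7 (q ^ (2 * k)))"

lemma V_rec: "V k = (1 + q) * (1 + q * q ^ (2 * k)) * V (Suc k) - q * (1 - q\<^sup>2 * q ^ (2 * k) + q ^ 4 * (q ^ (2 * k))\<^sup>2) * V (Suc (Suc k))"
proof -
  have "q ^ (2 * k) * q\<^sup>2 = q ^ (2 * Suc k)" "q ^ (2 * k) * q ^ 4 = q ^ (2 * Suc (Suc k))"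
  proof -
    have "2 * Suc k = 2 * k + 2" "2 * Suc (Suc k) = 2 * k + 4" by simp_all
    then show "q ^ (2 * k) * q\<^sup>2 = q ^ (2 * Suc k)" "q ^ (2 * k) * q ^ 4 = q ^ (2 * Suc (Suc k))"
      by (simp_all only: power_add)
  qed
  then show ?thesis using H7_recurrence[of "q ^ (2 * k)"] unfolding V_def by (simp only:)
qed

text \<open>The factors of \<open>H7 T\<close> without T, that is, its limit as T tends to
  0.\<close>

definition R7 :: "real fps" where "R7 = ei (q ^ 3) 3 * ep (- q) 1 * ep q 1"

lemma gb_R7: "gb R7" unfolding R7_def by (intro gb_all) simp_all

lemma ei_nonneg: "0 \<le> c \<Longrightarrow> 1 \<le> s \<Longrightarrow> 0 \<le> ei c s $ n" and ep_nonneg: "0 \<le> c \<Longrightarrow> 1 \<le> s \<Longrightarrow> 0 \<le> ep c s $ n"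
  using qpoch_pos[of s] q_pos by (auto simp: ei_def ep_def dil_def ei0_def ep0_def less_imp_le)

lemma fps_mult_nonneg: "(\<And>n. 0 \<le> f $ n) \<Longrightarrow> (\<And>n. 0 \<le> g $ n) \<Longrightarrow> 0 \<le> (f * g) $ n" for f g :: "real fps"
  unfolding fps_mult_nth by (intro sum_nonneg mult_nonneg_nonneg) auto

lemma V_LIMSEQ: "V \<longlonglongrightarrow> Lam R7"
proof -
  define F where "F = ei 1 2 * ei q 2 * ep (q\<^sup>2) 2"
  define e where "e = ep 1 1"
  have pos: "0 \<le> F $ n" "0 \<le> e $ n" for n
    unfolding F_def e_def by (intro fps_mult_nonneg ei_nonneg ep_nonneg; use q_pos in simp)+
  have gbF: "gb F" "gb e" unfolding F_def e_def by (intro gb_all; simp)+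
  define \<mu> where "\<mu> m = Lam (X ^ m * R7)" for m
  have mu: "summable (\<lambda>m. \<bar>(F * e) $ m\<bar> * \<bar>\<mu> m\<bar>)"
  proof -
    have "gb (F * e)" by (intro gb_intros gbF)
    then obtain M L where f: "0 < M" "1 \<le> L" "\<And>n. \<bar>(F * e) $ n\<bar> \<le> M * L ^ n"
      unfolding gb_def by (rule geo_boundedE) blast
    have "0 < 1 / (2 * L)" using f by simp
    then obtain C where C: "0 < C" "\<And>m. \<bar>\<mu> m\<bar> \<le> C * (1 / (2 * L)) ^ m"
      unfolding \<mu>_def by (rule rapidE[OF rapid_Lam_shift(1)[OF gb_R7]]) blast
    have "norm (\<bar>(F * e) $ m\<bar> * \<bar>\<mu> m\<bar>) \<le> M * C * (1 / 2) ^ m" for m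
    proof -
      have "\<bar>(F * e) $ m\<bar> * \<bar>\<mu> m\<bar> \<le> (M * L ^ m) * (C * (1 / (2 * L)) ^ m)" using f C by (intro mult_mono) auto
      also have "\<dots> = M * C * (1 / 2) ^ m" using f by (simp add: power_divide power_mult_distrib)
      finally show ?thesis by simp
    qed
    note le = this
    have "summable (\<lambda>m. M * C * (1 / 2) ^ m)" by (intro summable_mult summable_geometric) simp
    then show ?thesis by (rule summable_comparison_test'[of _ 0]) (rule le)
  qed
  define B where "B = (\<Sum>m. \<bar>(F * e) $ m\<bar> * \<bar>\<mu> m\<bar>)"
  have vb: "\<bar>V k - Lam R7\<bar> \<le> q ^ k * B" for k
  proof -
    define \<tau> where "\<tau> = q ^ k"
    have \<tau>: "0 < \<tau>" "\<tau> \<le> 1" using q_pos q_lt_1 by (auto simp: \<tau>_def intro: power_le_one)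
    have T: "q ^ (2 * k) = \<tau>\<^sup>2" by (simp add: \<tau>_def mult.commute flip: power_mult)
    \<comment> \<open>With T = \<tau>^2 the factors in z^2 are dilations by \<tau>, and the factor
      in z is a dilation by \<tau>^2. All these coefficients are nonnegative, so the product is
      dominated by the dilation of \<open>F * e\<close> by \<tau>, and the error is at most a
      constant times \<tau>.\<close>
    have sce: "ei (\<tau>\<^sup>2 * c) 2 = sc \<tau> (ei c 2)" "ep (\<tau>\<^sup>2 * c) 2 = sc \<tau> (ep c 2)" for c
      by (auto simp: fps_eq_iff ei_def ep_def dil_def ei0_def ep0_def power_mult power_mult_distrib power_divide elim!: dvdE)
    have scp: "ep (\<tau>\<^sup>2) 1 = sc \<tau> (sc \<tau> e)"
      by (auto simp: fps_eq_iff e_def ep_def dil_def ep0_def power_mult_distrib power_divide power2_eq_square mult_ac)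
    define G where "G = sc \<tau> F * sc \<tau> (sc \<tau> e)"
    have "H7 (\<tau>\<^sup>2) = G * R7"
      unfolding H7_def G_def F_def R7_def sc_mult scp[symmetric] sce[symmetric] by (simp add: mult_ac)
    then have V: "(\<lambda>m. G $ m * \<mu> m) sums V k"
      unfolding V_def T \<mu>_def using Lam_mult_sums[of G R7] gb_R7 by (simp add: G_def gb_intros gbF)
    have G0: "G $ 0 = 1" by (simp add: G_def F_def e_def)
    have s1: "(\<lambda>m. G $ Suc m * \<mu> (Suc m)) sums (V k - Lam R7)"
      using V sums_Suc_iff[of "\<lambda>m. G $ m * \<mu> m" "V k - Lam R7"] by (simp add: G0 \<mu>_def)
    have b: "norm (G $ Suc m * \<mu> (Suc m)) \<le> \<tau> * (\<bar>(F * e) $ Suc m\<bar> * \<bar>\<mu> (Suc m)\<bar>)" for m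
    proof -
      have gl: "\<bar>G $ n\<bar> \<le> \<tau> ^ n * \<bar>(F * e) $ n\<bar>" for n
      proof -
        have "0 \<le> (sc \<tau> (sc \<tau> e)) $ i \<and> (sc \<tau> (sc \<tau> e)) $ i \<le> sc \<tau> e $ i" for i
        proof -
          have "\<tau> ^ i * (\<tau> ^ i * e $ i) \<le> 1 * (\<tau> ^ i * e $ i)" using \<tau> pos by (intro mult_right_mono power_le_one) auto
          then have "\<tau> ^ i * (\<tau> ^ i * e $ i) \<le> \<tau> ^ i * e $ i" by (simp only: mult_1)
          then show ?thesis unfolding sc_nth by (intro conjI mult_nonneg_nonneg) (use \<tau> pos in auto)
        qed
        then have "G $ n \<le> (sc \<tau> F * sc \<tau> e) $ n \<and> 0 \<le> G $ n"
          unfolding G_def fps_mult_nth using \<tau> pos by (auto intro!: sum_mono sum_nonneg mult_left_mono)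
        moreover have "(sc \<tau> F * sc \<tau> e) $ n = \<tau> ^ n * (F * e) $ n" by (simp flip: sc_mult)
        ultimately show ?thesis using \<tau> by (simp add: order_trans[OF _ mult_left_mono[OF abs_ge_self]])
      qed
      have "\<bar>G $ Suc m\<bar> * \<bar>\<mu> (Suc m)\<bar> \<le> (\<tau> ^ Suc m * \<bar>(F * e) $ Suc m\<bar>) * \<bar>\<mu> (Suc m)\<bar>"
        by (rule mult_right_mono[OF gl abs_ge_zero])
      also have "\<dots> \<le> (\<tau> * \<bar>(F * e) $ Suc m\<bar>) * \<bar>\<mu> (Suc m)\<bar>"
        using \<tau> power_le_one[of \<tau> m] by (intro mult_right_mono) (auto simp: mult_left_le)
      finally show ?thesis by (simp add: abs_mult mult.assoc)
    qed
    have "norm (V k - Lam R7) \<le> (\<Sum>m. \<tau> * (\<bar>(F * e) $ Suc m\<bar> * \<bar>\<mu> (Suc m)\<bar>))"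
    proof -
      have "summable (\<lambda>m. \<tau> * (\<bar>(F * e) $ Suc m\<bar> * \<bar>\<mu> (Suc m)\<bar>))"
        using mu summable_Suc_iff[of "\<lambda>m. \<bar>(F * e) $ m\<bar> * \<bar>\<mu> m\<bar>"] by (intro summable_mult) simp
      from norm_suminf_le[OF b this] show ?thesis using s1 by (simp add: sums_iff)
    qed
    also have "\<dots> = \<tau> * (\<Sum>m. \<bar>(F * e) $ Suc m\<bar> * \<bar>\<mu> (Suc m)\<bar>)"
      using mu summable_Suc_iff[of "\<lambda>m. \<bar>(F * e) $ m\<bar> * \<bar>\<mu> m\<bar>"] by (intro suminf_mult) simp
    also have "\<dots> \<le> \<tau> * B"
      unfolding B_def using \<tau> suminf_split_head[OF mu] by (intro mult_left_mono) auto
    finally show ?thesis by (simp add: \<tau>_def)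
  qed
  have q0: "(\<lambda>k. q ^ k * B) \<longlonglongrightarrow> 0"
    using tendsto_mult_left_zero[OF LIMSEQ_power_zero[of q], of B] q_pos q_lt_1 by simp
  have "(\<lambda>k. V k - Lam R7) \<longlonglongrightarrow> 0"
    by (rule Lim_null_comparison[OF _ q0]) (simp add: vb)
  then show ?thesis by (rule LIM_zero_cancel)
qed

text \<open>\<open>Lam R7\<close> is the sum of the coefficients of \<open>G\<close>, which
  satisfies a second-order equation. Splitting off \<open>E\<close>, the series of (q^2 z; q)_inf,
  leaves \<open>Kf\<close>, whose coefficients obey a two-term recurrence and are differences of the
  products \<open>Pp\<close>. Both factors are then summed at z = 1 and multiplied by Cauchy's
  rule.\<close>

lemma Lam_R7: "Lam R7 = Ac (- 1) 1 / (1 - q)"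
proof -
  have R: "(1 + Q * X + Q\<^sup>2 * X\<^sup>2) * R7 = (1 + Q * X) * sc q R7"
  proof -
    have "((1 - fps_const (q ^ 3) * X ^ 3) * 1 * 1) * R7 = (1 * (1 + fps_const (- q) * X ^ 1) * (1 + Q * X ^ 1)) * sc q R7"
      unfolding R7_def by (intro qdiff_mult qdiff_ei qdiff_ep) simp_all
    moreover have "fps_const (q ^ 3) = Q ^ 3" "fps_const (- q) = - Q" by simp_all
    ultimately have *: "(1 - Q ^ 3 * X ^ 3) * R7 = ((1 + - Q * X) * (1 + Q * X)) * sc q R7"
      by (simp only: mult_1 mult_1_right power_one_right)
    have f: "1 - Q ^ 3 * X ^ 3 = (1 - Q * X) * (1 + Q * X + Q\<^sup>2 * X\<^sup>2)" by algebra
    have "(1 - Q * X) * ((1 + Q * X + Q\<^sup>2 * X\<^sup>2) * R7) = (1 - Q * X) * ((1 + Q * X) * sc q R7)"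
      using * unfolding f by (simp add: mult_ac)
    moreover have "1 - Q * X \<noteq> 0"
    proof
      assume "1 - Q * X = 0"
      then have "(1 - Q * X) $ 0 = 0" by simp
      then show False by simp
    qed
    ultimately show ?thesis by simp
  qed
  define G where "G = Abs_fps (\<lambda>n. q ^ tri n * R7 $ n)"
  define E where "E = ep (- (q\<^sup>2)) 1"
  define Kf where "Kf = G * ei (q\<^sup>2) 1"
  have G: "G = (1 - Q\<^sup>2 * X) * sc q G + Q\<^sup>2 * X * (1 - Q ^ 3 * X) * sc q (sc q G)"
  proof -
    have Rn: "R7 $ n + q * (if n = 0 then 0 else R7 $ (n - 1)) + q\<^sup>2 * (if n \<le> 1 then 0 else R7 $ (n - 2))
      = q ^ n * R7 $ n + q * (if n = 0 then 0 else q ^ (n - 1) * R7 $ (n - 1))" for n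
    proof -
      have "R7 + fps_const q * (X * R7) + fps_const (q\<^sup>2) * (X * (X * R7)) = sc q R7 + fps_const q * (X * sc q R7)"
      proof -
        have c: "fps_const (q\<^sup>2) = Q\<^sup>2" by simp
        show ?thesis unfolding c using R by algebra
      qed
      from arg_cong[OF this, of "\<lambda>f. f $ n"] show ?thesis
        by (cases n; cases "n - 1") simp_all
    qed
    have "sc q G - fps_const (q\<^sup>2) * (X * sc q G) + fps_const (q\<^sup>2) * (X * sc q (sc q G)) - fps_const (q ^ 5) * (X * (X * sc q (sc q G))) = G"
    proof (rule fps_ext)
      fix n
      consider "n = 0" | "n = 1" | m where "n = Suc (Suc m)" by (metis One_nat_def not0_implies_Suc)
      then show "(sc q G - fps_const (q\<^sup>2) * (X * sc q G) + fps_const (q\<^sup>2) * (X * sc q (sc q G)) - fps_const (q ^ 5) * (X * (X * sc q (sc q G)))) $ n = G $ n"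
      proof cases
        case 3
        define Y t Rn' R1 R0 where "Y = q ^ m" and "t = q ^ tri m" and "Rn' = R7 $ n" and "R1 = R7 $ Suc m" and "R0 = R7 $ m"
        have r: "Rn' = q\<^sup>2 * Y * Rn' + q * (q * Y) * R1 - q * R1 - q\<^sup>2 * R0"
          using Rn[of n] by (simp add: 3 Y_def Rn'_def R1_def R0_def power2_eq_square)
        have p: "q ^ n = q\<^sup>2 * Y" "q ^ Suc m = q * Y" "G $ n = t * (Y * q) * (Y * q\<^sup>2) * Rn'" "G $ Suc m = t * (Y * q) * R1" "G $ m = t * R0" "q ^ m = Y"
          by (simp_all add: 3 power_add power2_eq_square mult_ac Y_def t_def Rn'_def R1_def R0_def G_def)
        have "(sc q G - fps_const (q\<^sup>2) * (X * sc q G) + fps_const (q\<^sup>2) * (X * sc q (sc q G)) - fps_const (q ^ 5) * (X * (X * sc q (sc q G)))) $ n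
          = q ^ n * G $ n - q\<^sup>2 * (q ^ Suc m * G $ Suc m) + q\<^sup>2 * (q ^ Suc m * (q ^ Suc m * G $ Suc m)) - q ^ 5 * (q ^ m * (q ^ m * G $ m))"
          by (simp add: 3 del: sc_sc power_Suc)
        also have "\<dots> = G $ n" unfolding p using r by algebra
        finally show ?thesis .
      next
        case 2
        then show ?thesis using Rn[of 1] by (simp add: G_def algebra_simps power2_eq_square)
      qed (simp add: G_def)
    qed
    moreover have "fps_const (q\<^sup>2) = Q\<^sup>2" "fps_const (q ^ 5) = Q ^ 5" by simp_all
    ultimately have "G = sc q G - Q\<^sup>2 * (X * sc q G) + Q\<^sup>2 * (X * sc q (sc q G)) - Q ^ 5 * (X * (X * sc q (sc q G)))" by (simp only:)
    then show ?thesis by algebra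
  qed
  have E1: "E = (1 - Q\<^sup>2 * X) * sc q E" using ep_eq[of 1 "- (q\<^sup>2)"] by (simp add: E_def flip: fps_const_neg)
  have E2: "sc q E = (1 - Q ^ 3 * X) * sc q (sc q E)"
  proof -
    have e: "Q\<^sup>2 * (Q * X) = Q ^ 3 * X" by algebra
    show ?thesis by (subst E1) (simp only: sc_simps e)
  qed
  have EI: "ei (q\<^sup>2) 1 * E = 1"
  proof (rule qdiff_unique)
    have "((1 - fps_const (q\<^sup>2) * X ^ 1) * 1) * (ei (q\<^sup>2) 1 * E) = (1 * (1 + fps_const (- (q\<^sup>2)) * X ^ 1)) * sc q (ei (q\<^sup>2) 1 * E)"
      unfolding E_def by (intro qdiff_mult qdiff_ei qdiff_ep) simp_all
    then show "(1 - fps_const (q\<^sup>2) * X) * (ei (q\<^sup>2) 1 * E) = (1 - fps_const (q\<^sup>2) * X) * sc q (ei (q\<^sup>2) 1 * E)"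
      by (simp flip: fps_const_neg)
  qed (simp_all add: E_def)
  have GK: "G = Kf * E" unfolding Kf_def using EI by (simp add: mult.assoc)
  \<comment> \<open>Once \<open>E\<close> and \<open>sc q E\<close> are expressed through
    \<open>sc q (sc q E)\<close>, the equation of \<open>G\<close> is a multiple of that series and
    of 1 - q^3 X, and both are cancelled.\<close>
  have K: "(1 - Q\<^sup>2 * X) * Kf = (1 - Q\<^sup>2 * X) * sc q Kf + Q\<^sup>2 * X * sc q (sc q Kf)"
  proof -
    have "sc q (sc q E) * ((1 - Q ^ 3 * X) * ((1 - Q\<^sup>2 * X) * Kf - ((1 - Q\<^sup>2 * X) * sc q Kf + Q\<^sup>2 * X * sc q (sc q Kf)))) = 0"
    proof -
      have "Kf * ((1 - Q\<^sup>2 * X) * ((1 - Q ^ 3 * X) * sc q (sc q E))) = (1 - Q\<^sup>2 * X) * (sc q Kf * ((1 - Q ^ 3 * X) * sc q (sc q E))) + Q\<^sup>2 * X * (1 - Q ^ 3 * X) * (sc q (sc q Kf) * sc q (sc q E))"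
        using G E1 E2 unfolding GK sc_mult by metis
      then show ?thesis by algebra
    qed
    moreover have "sc q (sc q E) \<noteq> 0" "1 - Q ^ 3 * X \<noteq> 0"
    proof
      assume "sc q (sc q E) = 0"
      then have "sc q (sc q E) $ 0 = 0" by simp
      then show False by (simp add: E_def)
    next
      show "1 - Q ^ 3 * X \<noteq> 0"
      proof
        assume "1 - Q ^ 3 * X = 0"
        then have "(1 - Q ^ 3 * X) $ 0 = 0" by simp
        then show False by (simp del: fps_const_power)
      qed
    qed
    ultimately show ?thesis by simp
  qed
  have Kn: "Kf $ Suc n * (1 - q ^ Suc n) = q\<^sup>2 * (1 - q ^ n + q ^ (2 * n)) * Kf $ n" for n
  proof -
    have "Kf - fps_const (q\<^sup>2) * (X * Kf) = sc q Kf - fps_const (q\<^sup>2) * (X * sc q Kf) + fps_const (q\<^sup>2) * (X * sc q (sc q Kf))"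
    proof -
      have c: "fps_const (q\<^sup>2) = Q\<^sup>2" by simp
      show ?thesis unfolding c using K by algebra
    qed
    from arg_cong[OF this, of "\<lambda>f. f $ Suc n"] show ?thesis
      by (simp add: algebra_simps power_mult power_mult_distrib power2_eq_square)
  qed
  \<comment> \<open>The partial sums of the coefficients of \<open>Kf\<close>; their limit is
    \<open>Ac (- 1) 1\<close> divided by (q;q)_inf.\<close>
  define Pp where "Pp n = (\<Prod>i<n. 1 + (- 1) * q ^ (1 + i) + q ^ (2 * (1 + i))) / qpoch q q n" for n
  have PpS: "Pp (Suc n) * (1 - q ^ Suc n) = Pp n * (1 - q ^ Suc n + q ^ (2 * Suc n))" for n
  proof -
    have "q * q ^ n \<noteq> 1" using q_power_less[of "Suc n"] by simp
    then show ?thesis using qpoch_q_pos[of n] by (simp add: Pp_def qpoch_Suc)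
  qed
  have KP: "Kf $ Suc n = Pp (Suc n) - Pp n" for n
  proof -
    have nz: "1 - q ^ Suc n \<noteq> 0" for n using q_power_less[of "Suc n"] by simp
    have "Kf $ Suc n * (1 - q ^ Suc n) = Pp n * q ^ (2 * Suc n)"
    proof (induction n)
      case 0
      have "Kf $ 0 = 1" by (simp add: Kf_def G_def R7_def)
      then show ?case using Kn[of 0] by (simp add: Pp_def)
    next
      case (Suc n)
      have "Kf $ Suc (Suc n) * (1 - q ^ Suc (Suc n)) * (1 - q ^ Suc n) = q\<^sup>2 * (1 - q ^ Suc n + q ^ (2 * Suc n)) * (Pp n * q ^ (2 * Suc n))"
        using Kn[of "Suc n"] Suc by (simp add: mult_ac del: power_Suc)
      also have "\<dots> = Pp (Suc n) * q ^ (2 * Suc (Suc n)) * (1 - q ^ Suc n)"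
        using PpS[of n] by (simp add: power_add mult_ac del: power_Suc) (simp add: power2_eq_square mult_ac)
      finally show ?case using nz[of n] by (metis mult_right_cancel)
    qed
    also have "\<dots> = (Pp (Suc n) - Pp n) * (1 - q ^ Suc n)" using PpS[of n] by (simp add: algebra_simps)
    finally show ?thesis using nz[of n] by (metis mult_right_cancel)
  qed
  have L: "0 < qinf q q" using qpoch_bounds(4)[of q q] q_pos q_lt_1 by simp
  have Pplim: "Pp \<longlonglongrightarrow> Ac (- 1) 1 / qinf q q"
    unfolding Pp_def by (intro tendsto_divide Ac_LIMSEQ qpoch_LIMSEQ) (use q_pos q_lt_1 L in auto)
  have "(\<lambda>n. Pp (Suc n) - Pp n) sums (Ac (- 1) 1 / qinf q q - Pp 0)" by (rule telescope_sums[OF Pplim])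
  moreover have "Kf $ 0 = 1" "Pp 0 = 1" by (simp_all add: Kf_def G_def R7_def Pp_def)
  ultimately have Ks: "(\<lambda>n. Kf $ n) sums (Ac (- 1) 1 / qinf q q)"
    using sums_Suc_iff[of "\<lambda>n. Kf $ n"] by (simp add: KP)
  have Kpos: "0 \<le> Kf $ n" for n
  proof (cases n)
    case (Suc m)
    have "q ^ Suc m < 1" using q_power_less[of "Suc m"] by simp
    moreover have "0 \<le> Pp m"
    proof -
      have "0 < 1 + (- 1) * q ^ (1 + i) + q ^ (2 * (1 + i))" for i
      proof -
        have "(q ^ (1 + i))\<^sup>2 = q ^ (2 * (1 + i))" by (simp only: power_mult[symmetric] mult.commute)
        then show ?thesis using Ac_factor_pos[of "- 1" "q ^ (1 + i)"] by simp
      qed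
      then show ?thesis unfolding Pp_def using qpoch_q_pos[of m]
        by (intro divide_nonneg_pos prod_nonneg) (auto intro: less_imp_le)
    qed
    moreover have "Kf $ Suc m * (1 - q ^ Suc m) = Pp m * q ^ (2 * Suc m)"
      unfolding KP using PpS[of m] by (simp add: algebra_simps)
    ultimately have "0 \<le> Kf $ Suc m * (1 - q ^ Suc m)" using q_pos by simp
    then show ?thesis using \<open>q ^ Suc m < 1\<close> Suc by (simp add: zero_le_mult_iff del: power_Suc)
  qed (simp add: Kf_def G_def R7_def)
  have Es: "(\<lambda>n. E $ n) sums qinf (q * q) q" "summable (\<lambda>n. norm (E $ n))"
  proof -
    have "E $ n = (- q) ^ n * q ^ tri n / qpoch q q n" for n
    proof -
      have "- (q\<^sup>2) / q = - q" using q_pos by (simp add: power2_eq_square)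
      then show ?thesis by (simp add: E_def ep_def ep0_def)
    qed
    then show "(\<lambda>n. E $ n) sums qinf (q * q) q" "summable (\<lambda>n. norm (E $ n))"
      using euler_sums(1,2)[of q q] q_pos q_lt_1 by simp_all
  qed
  have "(\<lambda>n. \<Sum>i\<le>n. Kf $ i * E $ (n - i)) sums ((\<Sum>n. Kf $ n) * (\<Sum>n. E $ n))"
    by (rule Cauchy_product_sums) (use Ks Kpos Es(2) in \<open>auto simp: sums_iff\<close>)
  then have "(\<lambda>n. G $ n) sums (Ac (- 1) 1 / qinf q q * qinf (q * q) q)"
    using Ks Es(1) by (simp add: GK fps_mult_nth atLeast0AtMost sums_iff)
  then have "Lam R7 = Ac (- 1) 1 / qinf q q * qinf (q * q) q"
    by (simp add: Lam_def G_def sums_iff)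
  moreover have "qinf q q = (1 - q) * qinf (q * q) q" by (rule qinf_rec) (use q_pos q_lt_1 in simp)
  moreover have "0 < qinf (q * q) q" using qpoch_bounds(4)[of "q * q" q] q_pos q_lt_1 q_power_less[of 2] by (simp add: power2_eq_square)
  ultimately show ?thesis by simp
qed

section \<open>The recessive solution\<close>

definition Wv :: "nat \<Rightarrow> real" where
  "Wv k = (Ac (sqrt 3) k - Ac (- sqrt 3) k) / q ^ k"

text \<open>With y = q^(k+1) the last coefficient contains 1 - y^2 + y^4, which splits into 1 + s y
  + y^2 times 1 - s y + y^2 because s^2 = 3; so both signs of sqrt 3 give solutions. Each grows like
  q^(-k), and the growth cancels in the difference \<open>Wv\<close>.\<close>

lemma Ac_W_rec:
  assumes "s\<^sup>2 = 3"
  shows "Ac s k / q ^ k = (1 + q) * (1 + q * q ^ (2 * k)) * (Ac s (Suc k) / q ^ Suc k)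
    - q * (1 - q\<^sup>2 * q ^ (2 * k) + q ^ 4 * (q ^ (2 * k))\<^sup>2) * (Ac s (Suc (Suc k)) / q ^ Suc (Suc k))"
proof -
  define x where "x = q ^ k"
  have x: "x \<noteq> 0" using q_pos by (simp add: x_def)
  define B where "B = Ac s (Suc (Suc k))"
  have A1: "Ac s (Suc k) = (1 + s * (q * x) + (q * x)\<^sup>2) * B"
  proof -
    have e: "q ^ (2 * Suc k) = (q * x)\<^sup>2"
      unfolding x_def power_Suc[symmetric] by (simp only: power_mult[symmetric] mult.commute)
    show ?thesis using Ac_rec[of s "Suc k"] unfolding e B_def[symmetric] by (simp add: x_def)
  qed
  have A0: "Ac s k = (1 + s * x + x\<^sup>2) * ((1 + s * (q * x) + (q * x)\<^sup>2) * B)"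
    using Ac_rec[of s k] A1 by (simp add: x_def mult.commute flip: power_mult)
  have xs: "q ^ (2 * k) = x\<^sup>2" "q ^ Suc k = q * x" "q ^ Suc (Suc k) = q\<^sup>2 * x"
  proof -
    show "q ^ (2 * k) = x\<^sup>2" by (simp add: x_def mult.commute flip: power_mult)
    show "q ^ Suc k = q * x" "q ^ Suc (Suc k) = q\<^sup>2 * x" by (simp_all add: x_def power2_eq_square)
  qed
  have "q * ((1 + s * x + x\<^sup>2) * (1 + s * (q * x) + (q * x)\<^sup>2))
      = (1 + q) * (1 + q * x\<^sup>2) * (1 + s * (q * x) + (q * x)\<^sup>2) - (1 - q\<^sup>2 * x\<^sup>2 + q ^ 4 * (x\<^sup>2)\<^sup>2)"
  proof -
    have f: "1 - q\<^sup>2 * x\<^sup>2 + q ^ 4 * (x\<^sup>2)\<^sup>2 = (1 + s * (q * x) + (q * x)\<^sup>2) * (1 - s * (q * x) + (q * x)\<^sup>2)"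
    proof -
      have "(1 + s * (q * x) + (q * x)\<^sup>2) * (1 - s * (q * x) + (q * x)\<^sup>2) = (1 + (q * x)\<^sup>2)\<^sup>2 - s\<^sup>2 * (q * x)\<^sup>2" by algebra
      also have "\<dots> = 1 - q\<^sup>2 * x\<^sup>2 + q ^ 4 * (x\<^sup>2)\<^sup>2" unfolding assms by algebra
      finally show ?thesis by (rule sym)
    qed
    show ?thesis unfolding f by algebra
  qed
  then have "q * ((1 + s * x + x\<^sup>2) * ((1 + s * (q * x) + (q * x)\<^sup>2) * B))
      = (1 + q) * (1 + q * x\<^sup>2) * ((1 + s * (q * x) + (q * x)\<^sup>2) * B) - (1 - q\<^sup>2 * x\<^sup>2 + q ^ 4 * (x\<^sup>2)\<^sup>2) * B"
    by algebra
  then have "q * Ac s k = (1 + q) * (1 + q * x\<^sup>2) * Ac s (Suc k) - (1 - q\<^sup>2 * x\<^sup>2 + q ^ 4 * (x\<^sup>2)\<^sup>2) * B"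
    unfolding A0 A1 .
  then have "q * Ac s k / (q * x) = ((1 + q) * (1 + q * x\<^sup>2) * Ac s (Suc k) - (1 - q\<^sup>2 * x\<^sup>2 + q ^ 4 * (x\<^sup>2)\<^sup>2) * B) / (q * x)"
    by (simp only:)
  then show ?thesis unfolding xs B_def[symmetric] x_def[symmetric] using x q_pos
    by (simp add: diff_divide_distrib power2_eq_square)
qed

lemma Wv_rec: "Wv k = (1 + q) * (1 + q * q ^ (2 * k)) * Wv (Suc k) - q * (1 - q\<^sup>2 * q ^ (2 * k) + q ^ 4 * (q ^ (2 * k))\<^sup>2) * Wv (Suc (Suc k))"
  using Ac_W_rec[of "sqrt 3" k] Ac_W_rec[of "- sqrt 3" k] unfolding Wv_def
  by (simp add: diff_divide_distrib right_diff_distrib del: power_Suc)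

lemma Wv_LIMSEQ: "Wv \<longlonglongrightarrow> 2 * sqrt 3 / (1 - q)"
proof -
  have "(\<lambda>k. (Ac (sqrt 3) k - 1) / q ^ k - (Ac (- sqrt 3) k - 1) / q ^ k) \<longlonglongrightarrow> sqrt 3 / (1 - q) - - sqrt 3 / (1 - q)"
    by (intro tendsto_diff Ac_slope) simp_all
  then show ?thesis by (simp add: Wv_def [abs_def] diff_divide_distrib)
qed

lemma Wv_pos: "0 < Wv k"
proof -
  have "(\<Prod>i<N. 1 + - sqrt 3 * q ^ (k + i) + q ^ (2 * (k + i))) \<le> (\<Prod>i<N. 1 + sqrt 3 * q ^ (k + i) + q ^ (2 * (k + i)))" for k N
  proof (rule prod_mono, safe)
    fix i show "0 \<le> 1 + - sqrt 3 * q ^ (k + i) + q ^ (2 * (k + i))"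
      using Ac_factor_pos[of "- sqrt 3" "q ^ (k + i)"] by (simp add: mult.commute flip: power_mult)
    show "1 + - sqrt 3 * q ^ (k + i) + q ^ (2 * (k + i)) \<le> 1 + sqrt 3 * q ^ (k + i) + q ^ (2 * (k + i))" using q_pos by simp
  qed
  then have le: "Ac (- sqrt 3) k \<le> Ac (sqrt 3) k" for k using LIMSEQ_le[OF Ac_LIMSEQ Ac_LIMSEQ] by blast
  have "Ac (- sqrt 3) k < Ac (sqrt 3) k"
  proof -
    have "(1 + - sqrt 3 * q ^ k + q ^ (2 * k)) * Ac (- sqrt 3) (Suc k) \<le> (1 + - sqrt 3 * q ^ k + q ^ (2 * k)) * Ac (sqrt 3) (Suc k)"
      using le[of "Suc k"] Ac_factor_pos[of "- sqrt 3" "q ^ k"] by (intro mult_left_mono) (simp_all add: mult.commute flip: power_mult)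
    also have "\<dots> < (1 + sqrt 3 * q ^ k + q ^ (2 * k)) * Ac (sqrt 3) (Suc k)"
      using Ac_pos[of "sqrt 3" "Suc k"] q_pos by (intro mult_strict_right_mono) simp_all
    finally show ?thesis using Ac_rec[of "sqrt 3" k] Ac_rec[of "- sqrt 3" k] by simp
  qed
  then show ?thesis using q_pos by (simp add: Wv_def)
qed

text \<open>The Casoratian of \<open>V\<close> and \<open>Wv\<close> vanishes, so \<open>V\<close> is the recessive solution \<open>Wv\<close> up to a constant.\<close>

lemma V_eq: "V k = Ac (- 1) 1 / (2 * sqrt 3) * Wv k"
proof -
  \<comment> \<open>The recurrences give \<Delta> k = q (1 - y + y^2) \<Delta> (k + 1) with 0 \<le>
    y \<le> 1, a factor of modulus at most q. As both sequences converge, \<Delta> is bounded and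
    therefore 0.\<close>
  define \<Delta> where "\<Delta> k = V k * Wv (Suc k) - V (Suc k) * Wv k" for k
  have \<Delta>: "\<bar>\<Delta> k\<bar> \<le> q * \<bar>\<Delta> (Suc k)\<bar>" for k
  proof -
    define y where "y = q\<^sup>2 * q ^ (2 * k)"
    have y: "0 \<le> y" "y \<le> 1"
    proof -
      have "y = q ^ (2 + 2 * k)" by (simp only: y_def power_add)
      then show "0 \<le> y" "y \<le> 1"
        using q_pos q_lt_1 power_le_one[of q "2 + 2 * k"] zero_le_power[of q "2 + 2 * k"] by simp_all
    qed
    have "\<Delta> k = q * (1 - y + y\<^sup>2) * \<Delta> (Suc k)"
    proof -
      have y2: "q ^ 4 * (q ^ (2 * k))\<^sup>2 = y\<^sup>2" by (simp add: y_def power_mult_distrib flip: power_mult)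
      show ?thesis unfolding \<Delta>_def V_rec[of k] Wv_rec[of k] y2 y_def[symmetric] by (simp add: algebra_simps)
    qed
    moreover have "y\<^sup>2 \<le> y" using y by (simp add: power2_eq_square mult_left_le)
    then have "\<bar>1 - y + y\<^sup>2\<bar> \<le> 1" using y by (simp add: abs_le_iff)
    then have "q * \<bar>1 - y + y\<^sup>2\<bar> * \<bar>\<Delta> (Suc k)\<bar> \<le> q * 1 * \<bar>\<Delta> (Suc k)\<bar>" using q_pos by (intro mult_right_mono mult_left_mono) auto
    ultimately show ?thesis using q_pos by (simp add: abs_mult)
  qed
  have it: "\<bar>\<Delta> k\<bar> \<le> q ^ n * \<bar>\<Delta> (k + n)\<bar>" for k n
  proof (induction n)
    case (Suc n)
    have "q ^ n * \<bar>\<Delta> (k + n)\<bar> \<le> q ^ n * (q * \<bar>\<Delta> (Suc (k + n))\<bar>)" using \<Delta> q_pos by (intro mult_left_mono) auto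
    then show ?case using Suc by (simp add: mult_ac)
  qed simp
  have lim: "(\<lambda>n. \<Delta> (k + n)) \<longlonglongrightarrow> Lam R7 * (2 * sqrt 3 / (1 - q)) - Lam R7 * (2 * sqrt 3 / (1 - q))" for k
    unfolding \<Delta>_def
    by (intro tendsto_diff tendsto_mult)
       (use LIMSEQ_ignore_initial_segment[OF V_LIMSEQ] LIMSEQ_ignore_initial_segment[OF Wv_LIMSEQ] in
        \<open>force simp: add.commute[of k] add_Suc_right[symmetric] simp del: add_Suc_right\<close>)+
  have "\<Delta> k = 0" for k
  proof -
    have "(\<lambda>n. q ^ n * \<bar>\<Delta> (k + n)\<bar>) \<longlonglongrightarrow> 0 * \<bar>Lam R7 * (2 * sqrt 3 / (1 - q)) - Lam R7 * (2 * sqrt 3 / (1 - q))\<bar>"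
      by (intro tendsto_mult tendsto_rabs lim LIMSEQ_power_zero) (use q_pos q_lt_1 in auto)
    then have "\<bar>\<Delta> k\<bar> \<le> 0" using it[of k] by (intro LIMSEQ_le_const) auto
    then show ?thesis by simp
  qed
  then have r: "V (Suc k) / Wv (Suc k) = V k / Wv k" for k
    using Wv_pos[of k] Wv_pos[of "Suc k"] by (simp add: \<Delta>_def field_simps)
  have "V n / Wv n = V 0 / Wv 0" for n by (induction n) (simp_all add: r)
  then have "V n / Wv n = V k / Wv k" for n k by metis
  then have "(\<lambda>n. V n / Wv n) = (\<lambda>_. V k / Wv k)" by auto
  moreover have "(\<lambda>n. V n / Wv n) \<longlonglongrightarrow> Lam R7 / (2 * sqrt 3 / (1 - q))"
    by (intro tendsto_divide V_LIMSEQ Wv_LIMSEQ) (use q_lt_1 in simp)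
  ultimately have "V k / Wv k = Lam R7 / (2 * sqrt 3 / (1 - q))" by (simp add: LIMSEQ_const_iff)
  also have "\<dots> = Ac (- 1) 1 / (2 * sqrt 3)" unfolding Lam_R7 using q_lt_1 by simp
  finally show ?thesis using Wv_pos[of k] by (simp add: divide_eq_eq)
qed

end

section \<open>Summation in the cases 5a and 6a\<close>

context small_q
begin

abbreviation N2 :: real where "N2 \<equiv> qinf (- q) q"

text \<open>By Euler's expansion the moments of 1/(z;q)_inf are products: the dilation by q^m moves
  the starting point of (-q;q)_inf, and \<open>Li m\<close> removes its first m factors.\<close>

lemma Lam_ei1: "Lam (X ^ m * ei 1 1) = N2 * q ^ tri m * Li m"
proof -
  have "(\<lambda>i. (- (- (q ^ m))) ^ i * q ^ tri i / qpoch q q i) sums qinf (- (q ^ m) * q) q"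
    by (rule euler_sums(1)) (use q_pos q_lt_1 in simp)
  moreover have "(- (- (q ^ m))) ^ i * q ^ tri i / qpoch q q i = q ^ tri i * sc (q ^ m) (ei 1 1) $ i" for i
    by (simp add: ei_def ei0_def)
  ultimately have L: "Lam (sc (q ^ m) (ei 1 1)) = qinf (- (q ^ m) * q) q" by (simp add: Lam_def sums_iff)
  have "0 < qpoch (- q) q m" unfolding qpoch_def using q_pos by (intro prod_pos) (auto intro: add_pos_pos)
  moreover have "N2 = qpoch (- q) q m * qinf (- q * q ^ m) q"
    by (rule qinf_iterate) (use q_pos q_lt_1 in simp)
  moreover have e: "qinf (- (q ^ m) * q) q = qinf (- q * q ^ m) q" by (simp add: mult.commute)
  ultimately have "qinf (- (q ^ m) * q) q = N2 * Li m" unfolding e by (simp add: Li_def)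
  then show ?thesis using L Lam_shift[OF gb_ei[OF order_refl], of m 1] by simp
qed

text \<open>Moves the quadratic exponents: apart from \<open>T3 k\<close> they depend only on n = j
  + k afterwards and can be taken out of the inner sum.\<close>

lemma a2_tri: "a2 j * q ^ tri (2 * j + 3 * k) = c2 j * T3 k * ((q ^ 6) ^ tri (j + k) / (q ^ 3) ^ (j + k))"
proof -
  have t: "2 * tri n = n * (n + 1)" for n by (induction n) auto
  have "3 * (2 * tri k) + 6 * (2 * tri (j + k)) + 2 * (2 * j)
      = 3 * (2 * (j + k)) + 2 * (2 * tri j) + 2 * tri (2 * j + 3 * k)"
    unfolding t by (simp add: algebra_simps)
  then have e: "3 * tri k + 6 * tri (j + k) + 2 * j = 3 * (j + k) + 2 * tri j + tri (2 * j + 3 * k)" by linarith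
  have "q ^ (3 * tri k) * q ^ (6 * tri (j + k)) * q ^ (2 * j) = q ^ (3 * (j + k)) * q ^ (2 * tri j) * q ^ tri (2 * j + 3 * k)"
    unfolding power_add[symmetric] e ..
  then have "(q\<^sup>2) ^ tri j / (q\<^sup>2) ^ j * q ^ tri (2 * j + 3 * k) = (q ^ 3) ^ tri k * ((q ^ 6) ^ tri (j + k) / (q ^ 3) ^ (j + k))"
    using q_pos unfolding power_mult[symmetric] by (simp add: field_simps)
  then have h1: "(q\<^sup>2) ^ tri j * q ^ tri (2 * j + 3 * k) / (q\<^sup>2) ^ j = (q ^ 3) ^ tri k * (q ^ 6) ^ tri (j + k) / (q ^ 3) ^ (j + k)"
    by (simp add: mult_ac)
  have gen: "x / (b * P) = y / (d * P)" if "x / b = y / d" for x y b d P :: real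
    using that by (metis divide_divide_eq_left)
  show ?thesis unfolding a2_def c2_def T3_def using gen[OF h1, of "qpoch (q\<^sup>2) (q\<^sup>2) j"] by (simp add: mult_ac)
qed

text \<open>The weight produced by the splitting in \<open>Lam5_sums\<close> is traded for
  \<open>wt5\<close> with the index of \<open>Li\<close> raised by one, the form to which
  \<open>S_recurrence\<close> applies.\<close>

lemma S_telescope5: "S 0 (\<lambda>u w. 1 - u + u * w) n = S 1 wt5 n"
proof -
  define A where "A j k = T3 k * Li (2 * j + 3 * k + 1) * (q * (U j * W k))" for j k
  define B where "B j k = T3 k * Li (2 * j + 3 * k + 1) * (U j * (1 + q * (U j * W k)))" for j k
  have AB: "A (Suc j) k = B j (Suc k)" for j k
  proof -
    let ?m = "2 * j + 3 * Suc k"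
    have L: "Li ?m = Li (Suc ?m) * (1 + q * (U j * W (Suc k)))" using Li_Suc[of ?m] unfolding UW .
    have "2 * Suc j + 3 * k + 1 = ?m" "2 * j + 3 * Suc k + 1 = Suc ?m" by simp_all
    then have "A (Suc j) k = T3 k * Li ?m * (q * (U (Suc j) * W k))" "B j (Suc k) = T3 (Suc k) * Li (Suc ?m) * (U j * (1 + q * (U j * W (Suc k))))"
      unfolding A_def B_def by (simp_all only:)
    then show ?thesis unfolding L T3_Suc U_Suc W_Suc power2_eq_square power3_eq_cube by (simp only: mult_ac)
  qed
  have "S 0 (\<lambda>u w. 1 - u + u * w) n - S 1 wt5 n
    = (\<Sum>j\<le>n. c2 j * b3 (n - j) * ((1 - U j) * A j (n - j) - (1 - W (n - j)) * B j (n - j)))"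
    unfolding S_def sum_subtractf[symmetric]
  proof (rule sum.cong[OF refl])
    fix j
    define k where "k = n - j"
    have L: "Li (2 * j + 3 * k + 0) = Li (2 * j + 3 * k + 1) * (1 + q * (U j * W k))"
      using Li_Suc[of "2 * j + 3 * k"] unfolding UW by simp
    have gen: "c * b * (t * (l * (1 + q * (u * w))) * (1 - u + u * w)) - c * b * (t * l * (1 + q * u\<^sup>2 * w))
      = c * b * ((1 - u) * (t * l * (q * (u * w))) - (1 - w) * (t * l * (u * (1 + q * (u * w)))))" for c b t l u w
      by algebra
    show "c2 j * b3 (n - j) * (T3 (n - j) * Li (2 * j + 3 * (n - j) + 0) * (1 - U j + U j * W (n - j)))
        - c2 j * b3 (n - j) * (T3 (n - j) * Li (2 * j + 3 * (n - j) + 1) * wt5 (U j) (W (n - j)))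
      = c2 j * b3 (n - j) * ((1 - U j) * A j (n - j) - (1 - W (n - j)) * B j (n - j))"
      unfolding k_def[symmetric] L wt5_def A_def B_def by (rule gen)
  qed
  also have "\<dots> = 0" by (rule conv_telescope[where A = A and B = B, OF AB])
  finally show ?thesis by simp
qed

lemma Lam5_sums:
  "(\<lambda>n. N2 * ((1 / q ^ 4) ^ n * (q ^ 6) ^ tri n * S 1 wt5 n)) sums
    Lam ((1 + K * X\<^sup>2 - K * X ^ 3) * (ei 1 1 * ei (1 / q) 3 * ep q 2))"
proof -
  have 1: "ep (1 / q) 2 = (1 + K * X\<^sup>2) * ep q 2"
    using ep_eq[of 2 "1 / q"] sc_ep[of 2 "1 / q"] q_pos by (simp add: power2_eq_square)
  have 2: "(1 - K * X ^ 3) * ei (1 / q) 3 = ei (q\<^sup>2) 3"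
    using ei_eq[of 3 "1 / q"] sc_ei[of 3 "1 / q"] q_pos by (simp add: power2_eq_square power3_eq_cube)
  let ?E = "ei 1 1"
  have gE: "gb ?E" by (intro gb_all)
  \<comment> \<open>The polynomial is absorbed into the parameters of the q-exponentials. The three
    resulting products contribute the three terms of the weight 1 - U + U W.\<close>
  have "(1 + K * X\<^sup>2 - K * X ^ 3) * (?E * ei (1 / q) 3 * ep q 2)
    = ep (1 / q) 2 * ei (1 / q) 3 * ?E - ep q 2 * ei (1 / q) 3 * ?E + ep q 2 * ei (q\<^sup>2) 3 * ?E"
    unfolding 1 2[symmetric] by algebra
  then have L: "Lam ((1 + K * X\<^sup>2 - K * X ^ 3) * (?E * ei (1 / q) 3 * ep q 2))
    = Lam (ep (1 / q) 2 * ei (1 / q) 3 * ?E) - Lam (ep q 2 * ei (1 / q) 3 * ?E) + Lam (ep q 2 * ei (q\<^sup>2) 3 * ?E)"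
    by (simp add: Lam_add Lam_diff gb_all)
  have s: "(\<lambda>n. (\<Sum>j\<le>n. ((1 / q) ^ j * a2 j) * ((1 / q) ^ (n - j) * b3 (n - j)) * Lam (X ^ (2 * j + 3 * (n - j)) * ?E))
     - (\<Sum>j\<le>n. (q ^ j * a2 j) * ((1 / q) ^ (n - j) * b3 (n - j)) * Lam (X ^ (2 * j + 3 * (n - j)) * ?E))
     + (\<Sum>j\<le>n. (q ^ j * a2 j) * ((q\<^sup>2) ^ (n - j) * b3 (n - j)) * Lam (X ^ (2 * j + 3 * (n - j)) * ?E)))
    sums Lam ((1 + K * X\<^sup>2 - K * X ^ 3) * (?E * ei (1 / q) 3 * ep q 2))"
    unfolding L by (intro sums_add sums_diff Lam_pairing23 gE)
  have "(\<Sum>j\<le>n. ((1 / q) ^ j * a2 j) * ((1 / q) ^ (n - j) * b3 (n - j)) * Lam (X ^ (2 * j + 3 * (n - j)) * ?E))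
     - (\<Sum>j\<le>n. (q ^ j * a2 j) * ((1 / q) ^ (n - j) * b3 (n - j)) * Lam (X ^ (2 * j + 3 * (n - j)) * ?E))
     + (\<Sum>j\<le>n. (q ^ j * a2 j) * ((q\<^sup>2) ^ (n - j) * b3 (n - j)) * Lam (X ^ (2 * j + 3 * (n - j)) * ?E))
    = N2 * ((1 / q ^ 4) ^ n * (q ^ 6) ^ tri n * S 1 wt5 n)" for n
    unfolding S_telescope5[symmetric] unfolding S_def sum_distrib_left sum_subtractf[symmetric] sum.distrib[symmetric]
  proof (rule sum.cong[OF refl], goal_cases)
    case (1 j)
    then obtain k where n: "n = j + k" using le_Suc_ex by auto
    have nk: "n - j = k" using n by simp
    have q1: "q ^ j * (1 / q) ^ k = (1 / q) ^ n * U j" "q ^ j * (q\<^sup>2) ^ k = (1 / q) ^ n * (U j * W k)" "(1 / q) ^ j * (1 / q) ^ k = (1 / q) ^ n"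
    proof -
      show "(1 / q) ^ j * (1 / q) ^ k = (1 / q) ^ n" by (simp add: n power_add)
      show "q ^ j * (1 / q) ^ k = (1 / q) ^ n * U j"
        using q_pos by (simp add: n U_def power_add power_divide mult_2)
      have "W k = q ^ k * (q\<^sup>2) ^ k" by (simp add: W_def power_mult power3_eq_cube power2_eq_square power_mult_distrib)
      then show "q ^ j * (q\<^sup>2) ^ k = (1 / q) ^ n * (U j * W k)"
        using q_pos by (simp add: n U_def power_add power_divide mult_2)
    qed
    have q4: "(1 / q) ^ n / (q ^ 3) ^ n = (1 / q ^ 4) ^ n"
      using q_pos by (simp add: power_divide power_numeral_reduce power_mult_distrib)
    have gen: "x1 * a * (x2 * b) * (N * t * l) - x3 * a * (x2 * b) * (N * t * l) + x3 * a * (x4 * b) * (N * t * l)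
      = (x1 * x2 - x3 * x2 + x3 * x4) * N * b * l * (a * t)" for x1 x2 x3 x4 a b N t l :: real
      by algebra
    have "(1 / q) ^ j * a2 j * ((1 / q) ^ k * b3 k) * (N2 * q ^ tri (2 * j + 3 * k) * Li (2 * j + 3 * k))
      - q ^ j * a2 j * ((1 / q) ^ k * b3 k) * (N2 * q ^ tri (2 * j + 3 * k) * Li (2 * j + 3 * k))
      + q ^ j * a2 j * ((q\<^sup>2) ^ k * b3 k) * (N2 * q ^ tri (2 * j + 3 * k) * Li (2 * j + 3 * k))
      = ((1 / q) ^ n - (1 / q) ^ n * U j + (1 / q) ^ n * (U j * W k)) * N2 * b3 k * Li (2 * j + 3 * k) *
          (c2 j * T3 k * ((q ^ 6) ^ tri n / (q ^ 3) ^ n))"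
      unfolding gen q1 a2_tri n[symmetric] ..
    also have "\<dots> = N2 * ((1 / q) ^ n / (q ^ 3) ^ n * (q ^ 6) ^ tri n * (c2 j * b3 k * (T3 k * Li (2 * j + 3 * k) * (1 - U j + U j * W k))))"
      by (simp add: algebra_simps)
    finally have "(1 / q) ^ j * a2 j * ((1 / q) ^ (n - j) * b3 (n - j)) * Lam (X ^ (2 * j + 3 * (n - j)) * ?E)
      - q ^ j * a2 j * ((1 / q) ^ (n - j) * b3 (n - j)) * Lam (X ^ (2 * j + 3 * (n - j)) * ?E)
      + q ^ j * a2 j * ((q\<^sup>2) ^ (n - j) * b3 (n - j)) * Lam (X ^ (2 * j + 3 * (n - j)) * ?E)
      = N2 * ((1 / q ^ 4) ^ n * (q ^ 6) ^ tri n * (c2 j * b3 (n - j) * (T3 (n - j) * Li (2 * j + 3 * (n - j) + 0) * (1 - U j + U j * W (n - j)))))"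
      unfolding nk Lam_ei1 q4 add_0_right .
    then show ?case by (simp only: mult.assoc add_0_right)
  qed
  with s show ?thesis by (simp only:)
qed

lemma Lam6_sums:
  "(\<lambda>n. N2 * ((1 / q\<^sup>2) ^ n * (q ^ 6) ^ tri n * S 2 wt6 n)) sums
    Lam (X * (1 + K - X) * (ei 1 1 * ei q 3 * ep q 2))"
proof -
  let ?E = "ei 1 1"
  have gE: "gb (X * ?E)" "gb (X\<^sup>2 * ?E)" by (intro gb_all)+
  have "X * (1 + K - X) * (?E * ei q 3 * ep q 2)
    = (ep q 2 * ei q 3 * (X * ?E)) + K * (ep q 2 * ei q 3 * (X * ?E)) - ep q 2 * ei q 3 * (X\<^sup>2 * ?E)"
    by algebra
  then have L: "Lam (X * (1 + K - X) * (?E * ei q 3 * ep q 2))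
    = Lam (ep q 2 * ei q 3 * (X * ?E)) + 1 / q * Lam (ep q 2 * ei q 3 * (X * ?E)) - Lam (ep q 2 * ei q 3 * (X\<^sup>2 * ?E))"
    by (simp add: Lam_add Lam_diff Lam_const gb_all)
  have s: "(\<lambda>n. (\<Sum>j\<le>n. (q ^ j * a2 j) * (q ^ (n - j) * b3 (n - j)) * Lam (X ^ (2 * j + 3 * (n - j)) * (X * ?E)))
     + 1 / q * (\<Sum>j\<le>n. (q ^ j * a2 j) * (q ^ (n - j) * b3 (n - j)) * Lam (X ^ (2 * j + 3 * (n - j)) * (X * ?E)))
     - (\<Sum>j\<le>n. (q ^ j * a2 j) * (q ^ (n - j) * b3 (n - j)) * Lam (X ^ (2 * j + 3 * (n - j)) * (X\<^sup>2 * ?E))))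
    sums Lam (X * (1 + K - X) * (?E * ei q 3 * ep q 2))"
    unfolding L by (intro sums_add sums_diff sums_mult Lam_pairing23 gE)
  have "(\<Sum>j\<le>n. (q ^ j * a2 j) * (q ^ (n - j) * b3 (n - j)) * Lam (X ^ (2 * j + 3 * (n - j)) * (X * ?E)))
     + 1 / q * (\<Sum>j\<le>n. (q ^ j * a2 j) * (q ^ (n - j) * b3 (n - j)) * Lam (X ^ (2 * j + 3 * (n - j)) * (X * ?E)))
     - (\<Sum>j\<le>n. (q ^ j * a2 j) * (q ^ (n - j) * b3 (n - j)) * Lam (X ^ (2 * j + 3 * (n - j)) * (X\<^sup>2 * ?E)))
    = N2 * ((1 / q\<^sup>2) ^ n * (q ^ 6) ^ tri n * S 2 wt6 n)" for n
    unfolding S_def sum_distrib_left sum_subtractf[symmetric] sum.distrib[symmetric]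
  proof (rule sum.cong[OF refl])
    fix j assume "j \<in> {..n}"
    then obtain k where n: "n = j + k" using le_Suc_ex by auto
    have nk: "n - j = k" using n by simp
    define m where "m = 2 * j + 3 * k"
    define y where "y = U j * W k"
    have y: "q ^ m = y" by (simp add: m_def y_def UW)
    have X1: "Lam (X ^ m * (X * ?E)) = N2 * (q ^ tri m * (q * y)) * (Li (m + 2) * (1 + q\<^sup>2 * y))"
    proof -
      have "X ^ m * (X * ?E) = X ^ Suc m * ?E" by simp
      moreover have "q ^ tri (Suc m) = q ^ tri m * (q * y)" by (simp add: power_add y)
      moreover have "Li (Suc m) = Li (m + 2) * (1 + q\<^sup>2 * y)"
        using Li_Suc[of "Suc m"] by (simp add: y power2_eq_square)
      ultimately show ?thesis by (simp only: Lam_ei1)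
    qed
    have X2: "Lam (X ^ m * (X\<^sup>2 * ?E)) = N2 * (q ^ tri m * (q ^ 3 * y\<^sup>2)) * Li (m + 2)"
    proof -
      have "X ^ m * (X\<^sup>2 * ?E) = X ^ (m + 2) * ?E" by (simp only: power_add mult.assoc)
      moreover have "q ^ tri (m + 2) = q ^ tri m * (q ^ 3 * y\<^sup>2)"
        by (simp add: power_add y power2_eq_square power3_eq_cube numeral_2_eq_2)
      ultimately show ?thesis by (simp only: Lam_ei1)
    qed
    have qn: "q ^ j * q ^ k = q ^ n" by (simp add: n power_add)
    have q2: "q ^ n / (q ^ 3) ^ n = (1 / q\<^sup>2) ^ n"
      using q_pos by (simp add: power_divide power_numeral_reduce power_mult_distrib)
    have gen: "x1 * a * (x2 * b) * (N * (t * (q * y)) * (l * (1 + q\<^sup>2 * y))) + i * (x1 * a * (x2 * b) * (N * (t * (q * y)) * (l * (1 + q\<^sup>2 * y))))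
        - x1 * a * (x2 * b) * (N * (t * (q ^ 3 * y\<^sup>2)) * l)
      = (x1 * x2) * N * b * l * (a * t) * (y * (q * (1 + q\<^sup>2 * y) + (q * i) * (1 + q\<^sup>2 * y) - q ^ 3 * y))" for x1 x2 a b N t l i :: real
      by algebra
    have "q ^ j * a2 j * (q ^ k * b3 k) * Lam (X ^ m * (X * ?E)) + 1 / q * (q ^ j * a2 j * (q ^ k * b3 k) * Lam (X ^ m * (X * ?E)))
        - q ^ j * a2 j * (q ^ k * b3 k) * Lam (X ^ m * (X\<^sup>2 * ?E))
      = q ^ n * N2 * b3 k * Li (m + 2) * (a2 j * q ^ tri m) * (y * (q * (1 + q\<^sup>2 * y) + (q * (1 / q)) * (1 + q\<^sup>2 * y) - q ^ 3 * y))"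
      unfolding X1 X2 gen qn ..
    also have "a2 j * q ^ tri m = c2 j * T3 k * ((q ^ 6) ^ tri n / (q ^ 3) ^ n)" unfolding m_def n by (rule a2_tri)
    also have "y * (q * (1 + q\<^sup>2 * y) + (q * (1 / q)) * (1 + q\<^sup>2 * y) - q ^ 3 * y) = wt6 (U j) (W k)"
      unfolding wt6_def y_def[symmetric] using q_pos by (simp add: algebra_simps power2_eq_square power3_eq_cube)
    also have "q ^ n * N2 * b3 k * Li (m + 2) * (c2 j * T3 k * ((q ^ 6) ^ tri n / (q ^ 3) ^ n)) * wt6 (U j) (W k)
      = N2 * (q ^ n / (q ^ 3) ^ n * (q ^ 6) ^ tri n * (c2 j * b3 k * (T3 k * Li (m + 2) * wt6 (U j) (W k))))"
      by simp
    finally show "q ^ j * a2 j * (q ^ (n - j) * b3 (n - j)) * Lam (X ^ (2 * j + 3 * (n - j)) * (X * ?E))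
        + 1 / q * (q ^ j * a2 j * (q ^ (n - j) * b3 (n - j)) * Lam (X ^ (2 * j + 3 * (n - j)) * (X * ?E)))
        - q ^ j * a2 j * (q ^ (n - j) * b3 (n - j)) * Lam (X ^ (2 * j + 3 * (n - j)) * (X\<^sup>2 * ?E))
      = N2 * ((1 / q\<^sup>2) ^ n * (q ^ 6) ^ tri n * (c2 j * b3 (n - j) * (T3 (n - j) * Li (2 * j + 3 * (n - j) + 2) * wt6 (U j) (W (n - j)))))"
      unfolding nk q2 m_def .
  qed
  with s show ?thesis by (simp only:)
qed

text \<open>The term of index k of a 2phi1 in base q^6 with numerator parameters q and q^5,
  denominator parameter \<eta> q^6 and argument e \<eta>.\<close>

definition r56 :: "real \<Rightarrow> real \<Rightarrow> nat \<Rightarrow> real" where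
  "r56 e \<eta> k = qpoch q (q ^ 6) k * qpoch (q ^ 5) (q ^ 6) k * (e * \<eta>) ^ k / (qpoch (q ^ 6) (q ^ 6) k * qpoch (\<eta> * q ^ 6) (q ^ 6) k)"

text \<open>Exchange of summations. For fixed k the sum over i = n - k is an Euler sum in base q^6,
  and the remaining sum over k is \<open>q_Bailey\<close> with x = q^6, b = q and c = \<eta>
  q^6.\<close>

lemma Bailey_transform:
  assumes e: "0 < e" and \<eta>: "0 < \<eta>" "\<eta> * q ^ 6 < 1"
    and s: "\<And>n. s n = cz * (\<Sum>k\<le>n. r56 e \<eta> k * (e ^ (n - k) / qpoch (q ^ 6) (q ^ 6) (n - k)))"
    and sums: "(\<lambda>n. N2 * ((1 / e) ^ n * (q ^ 6) ^ tri n * s n)) sums L"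
  shows "L = N2 * cz * qinf (- (q ^ 6)) (q ^ 6) * (qinf (\<eta> * q ^ 6 * q ^ 5) (q ^ 12) * qinf (\<eta> * q ^ 6 * q) (q ^ 12) / qinf (\<eta> * q ^ 6) (q ^ 6))"
proof -
  define p where "p = q ^ 6"
  define c where "c = \<eta> * p"
  have p: "0 < p" "p < 1" "p < q" "p / q = q ^ 5" "p\<^sup>2 = q ^ 12"
  proof -
    show "p < 1" using q_power_less[of 6] by (simp add: p_def)
    have "q * q ^ 5 < q * 1" using q_pos q_power_less[of 5] by (intro mult_strict_left_mono) auto
    then show "p < q" by (simp add: p_def power_numeral_reduce)
    show "p / q = q ^ 5" using q_pos by (simp add: p_def power_numeral_reduce)
  qed (use q_pos in \<open>simp_all add: p_def flip: power_mult\<close>)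
  have c: "0 < c" "c < 1" using \<eta> p by (simp_all add: c_def p_def)
  have q5: "0 \<le> q ^ 5" "q ^ 5 < 1" using q_pos q_power_less[of 5] by auto
  note B = qpoch_bounds[of q p] qpoch_bounds[of "q ^ 5" p] qpoch_bounds[of p p] qpoch_bounds[of c p]
  define \<mu> where "\<mu> n = (1 / e) ^ n * p ^ tri n" for n
  have rap: "rapid \<mu>" unfolding \<mu>_def p_def by (intro rapid_scale rapid_tri_power) simp
  have gr: "geo_bounded (r56 e \<eta>)"
  proof (rule geo_boundedI[of _ "1 / (qinf p p * qinf c p)" "e * \<eta>"])
    fix k
    have "qpoch q p k * qpoch (q ^ 5) p k * (e * \<eta>) ^ k / (qpoch p p k * qpoch c p k) \<le> 1 * 1 * (e * \<eta>) ^ k / (qinf p p * qinf c p)"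
      using B q5 q_pos q_lt_1 p c e \<eta> by (intro frac_le mult_mono) (auto intro: less_imp_le mult_nonneg_nonneg)
    moreover have "0 \<le> r56 e \<eta> k"
      unfolding r56_def p_def[symmetric] c_def[symmetric] using B q5 q_pos q_lt_1 p c e \<eta>
      by (intro divide_nonneg_nonneg mult_nonneg_nonneg) (auto intro: less_imp_le)
    ultimately show "\<bar>r56 e \<eta> k\<bar> \<le> 1 / (qinf p p * qinf c p) * (e * \<eta>) ^ k"
      by (simp add: r56_def p_def c_def)
  qed
  have ge: "geo_bounded (\<lambda>i. e ^ i / qpoch p p i)"
  proof -
    have "fps_nth (ei0 e 6) = (\<lambda>i. e ^ i / qpoch p p i)" by (rule ext) (simp add: ei0_def p_def)
    then show ?thesis using gb_ei0[of 6 e] by (simp add: gb_def)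
  qed
  have "(\<lambda>(k, i). r56 e \<eta> k * (e ^ i / qpoch p p i) * \<mu> (1 * k + 1 * i)) summable_on UNIV"
    by (rule rapid_pairs_summable[OF rap gr ge]) simp_all
  then obtain Z where Z: "((\<lambda>(k, i). r56 e \<eta> k * (e ^ i / qpoch p p i) * \<mu> (k + i)) has_sum Z) UNIV"
    by (auto simp: summable_on_def)
  have d: "(\<lambda>n. \<Sum>k\<le>n. r56 e \<eta> k * (e ^ (n - k) / qpoch p p (n - k)) * \<mu> (k + (n - k))) sums Z"
    by (rule has_sum_pairs_diagonal[OF Z])
  define t where "t n = qpoch q p n * qpoch (p / q) p n * (c / p) ^ n * p ^ tri n / (qpoch c p n * qpoch (p\<^sup>2) (p\<^sup>2) n)" for n
  have "(\<lambda>k. qinf (- p) p * t k) sums Z"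
  proof (rule has_sum_pairs_rows[OF Z])
    fix k
    have "(\<lambda>i. (- (- (p ^ k))) ^ i * p ^ tri i / qpoch p p i) sums qinf (- (p ^ k) * p) p"
      by (rule euler_sums(1)) (use p in simp)
    then have "(\<lambda>i. r56 e \<eta> k * \<mu> k * ((- (- (p ^ k))) ^ i * p ^ tri i / qpoch p p i)) sums (r56 e \<eta> k * \<mu> k * qinf (- (p ^ k) * p) p)"
      by (rule sums_mult)
    moreover have "r56 e \<eta> k * \<mu> k * ((- (- (p ^ k))) ^ i * p ^ tri i / qpoch p p i) = r56 e \<eta> k * (e ^ i / qpoch p p i) * \<mu> (k + i)" for i
    proof -
      have "(p ^ k) ^ i = (p ^ i) ^ k" by (simp add: mult.commute flip: power_mult)
      then show ?thesis using e by (simp add: \<mu>_def tri_add power_add power_mult power_divide mult_ac)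
    qed
    moreover have "r56 e \<eta> k * \<mu> k * qinf (- (p ^ k) * p) p = qinf (- p) p * t k"
    proof -
      have it: "qinf (- p) p = qpoch (- p) p k * qinf (- p * p ^ k) p" by (rule qinf_iterate) (use p in simp)
      \<comment> \<open>This supplies the denominator in base p^2 that \<open>q_Bailey\<close>
        expects.\<close>
      have pp: "qpoch p p k * qpoch (- p) p k = qpoch (p\<^sup>2) (p\<^sup>2) k"
        by (simp add: qpoch_def power2_eq_square algebra_simps power_mult_distrib flip: prod.distrib)
      have pos: "0 < qpoch (- p) p k" unfolding qpoch_def using p by (intro prod_pos) (auto intro: add_pos_pos)
      have ch: "c / p = \<eta>" using p by (simp add: c_def)
      have "- (p ^ k) * p = - p * p ^ k" by simp
      moreover have "r56 e \<eta> k * \<mu> k = qpoch q p k * qpoch (q ^ 5) p k * \<eta> ^ k * p ^ tri k / (qpoch p p k * qpoch c p k)"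
        using e by (simp add: r56_def \<mu>_def p_def[symmetric] c_def[symmetric] power_mult_distrib power_divide)
      ultimately show ?thesis unfolding t_def ch p(4) pp[symmetric] it using pos by (simp add: mult_ac)
    qed
    ultimately show "(\<lambda>i. r56 e \<eta> k * (e ^ i / qpoch p p i) * \<mu> (k + i)) sums (qinf (- p) p * t k)" by (simp only:)
  qed
  moreover have "t sums (qinf (c * p / q) (p\<^sup>2) * qinf (q * c) (p\<^sup>2) / qinf c p)"
    unfolding t_def [abs_def] by (rule q_Bailey) (use p c q_pos q_lt_1 in auto)
  then have "(\<lambda>k. qinf (- p) p * t k) sums (qinf (- p) p * (qinf (c * p / q) (p\<^sup>2) * qinf (q * c) (p\<^sup>2) / qinf c p))"
    by (rule sums_mult)
  ultimately have Zv: "Z = qinf (- p) p * (qinf (c * p / q) (p\<^sup>2) * qinf (q * c) (p\<^sup>2) / qinf c p)" by (rule sums_unique2)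
  have "(\<Sum>k\<le>n. r56 e \<eta> k * (e ^ (n - k) / qpoch p p (n - k)) * \<mu> (k + (n - k))) * (N2 * cz) = N2 * ((1 / e) ^ n * (q ^ 6) ^ tri n * s n)" for n
  proof -
    have "(\<Sum>k\<le>n. r56 e \<eta> k * (e ^ (n - k) / qpoch p p (n - k)) * \<mu> (k + (n - k))) = (\<Sum>k\<le>n. r56 e \<eta> k * (e ^ (n - k) / qpoch p p (n - k))) * \<mu> n"
      unfolding sum_distrib_right by (intro sum.cong refl) simp
    then show ?thesis unfolding s by (simp add: \<mu>_def p_def)
  qed
  then have "(\<lambda>n. N2 * ((1 / e) ^ n * (q ^ 6) ^ tri n * s n)) sums (Z * (N2 * cz))"
    using sums_mult2[OF d, of "N2 * cz"] by (simp only:)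
  then have "L = Z * (N2 * cz)" using sums sums_unique2 by blast
  moreover have "c * p / q = \<eta> * q ^ 6 * q ^ 5" using p(4) by (simp add: c_def p_def flip: times_divide_eq_right)
  ultimately show ?thesis unfolding Zv p(5) by (simp add: c_def p_def mult_ac)
qed

lemma r56_0: "r56 e \<eta> 0 = 1" by (simp add: r56_def)

lemma r56_Suc:
  assumes "0 < \<eta>" "\<eta> * q ^ 6 < 1"
  shows "r56 e \<eta> (Suc k) * ((1 - (q ^ 6) ^ Suc k) * (1 - \<eta> * (q ^ 6) ^ Suc k)) = e * \<eta> * ((1 - q * (q ^ 6) ^ k) * (1 - q ^ 5 * (q ^ 6) ^ k)) * r56 e \<eta> k"
proof -
  have p: "0 \<le> q ^ 6" "q ^ 6 < 1" using q_power_less[of 6] q_pos by auto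
  have "0 < qpoch (q ^ 6) (q ^ 6) (Suc k)" "0 < qpoch (\<eta> * q ^ 6) (q ^ 6) (Suc k)"
    using qpoch_bounds(2)[of "q ^ 6" "q ^ 6"] qpoch_bounds(2)[of "\<eta> * q ^ 6" "q ^ 6"] p assms q_pos by auto
  then have nz: "1 - q ^ 6 * (q ^ 6) ^ k \<noteq> 0" "1 - \<eta> * q ^ 6 * (q ^ 6) ^ k \<noteq> 0"
    unfolding qpoch_Suc by auto
  have gen: "A * a * (B * b) * (e * \<eta> * E) / (C * x * (D * y)) * (x * y) = e * \<eta> * (a * b) * (A * B * E / (C * D))" if "x \<noteq> 0" "y \<noteq> 0" for A a B b C x D y E :: real
    using that by simp
  have 1: "r56 e \<eta> (Suc k) = qpoch q (q ^ 6) k * (1 - q * (q ^ 6) ^ k) * (qpoch (q ^ 5) (q ^ 6) k * (1 - q ^ 5 * (q ^ 6) ^ k)) * (e * \<eta> * (e * \<eta>) ^ k)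
      / (qpoch (q ^ 6) (q ^ 6) k * (1 - q ^ 6 * (q ^ 6) ^ k) * (qpoch (\<eta> * q ^ 6) (q ^ 6) k * (1 - \<eta> * q ^ 6 * (q ^ 6) ^ k)))"
    by (simp only: r56_def qpoch_Suc power_Suc)
  have 2: "\<eta> * (q ^ 6) ^ Suc k = \<eta> * q ^ 6 * (q ^ 6) ^ k" by simp
  have 3: "(q ^ 6) ^ Suc k = q ^ 6 * (q ^ 6) ^ k" by simp
  show ?thesis unfolding 1 2 unfolding 3 unfolding gen[OF nz] r56_def by (rule refl)
qed

lemma hq_ne_1: assumes "0 < \<eta>" "\<eta> * q ^ 6 < 1" "1 \<le> n" shows "\<eta> * (q ^ 6) ^ n \<noteq> 1"
proof -
  obtain m where n: "n = Suc m" using assms(3) by (cases n) auto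
  have "(q ^ 6) ^ m \<le> 1" using q_pos q_lt_1 by (intro power_le_one) auto
  then have "\<eta> * q ^ 6 * (q ^ 6) ^ m \<le> \<eta> * q ^ 6 * 1" using assms q_pos by (intro mult_left_mono) auto
  then show ?thesis using assms(2) by (simp add: n)
qed

lemma Lam5_value:
  "Lam ((1 + K * X\<^sup>2 - K * X ^ 3) * (ei 1 1 * ei (1 / q) 3 * ep q 2))
    = N2 * qinf (- (q ^ 6)) (q ^ 6) * (qinf (q ^ 7) (q ^ 12) * qinf (q ^ 3) (q ^ 12) / qinf (q\<^sup>2) (q ^ 6))"
proof -
  \<comment> \<open>\<open>S5_rec\<close> is the recurrence with e = q^4 and h = \<eta> = 1/q^4, so
    that e h = 1.\<close>
  have \<eta>: "0 < 1 / q ^ 4" "1 / q ^ 4 * q ^ 6 < 1"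
    using q_pos q_power_less[of 2] by (auto simp: power_numeral_reduce)
  have s: "S 1 wt5 n = (\<Sum>k\<le>n. r56 (q ^ 4) (1 / q ^ 4) k * ((q ^ 4) ^ (n - k) / qpoch (q ^ 6) (q ^ 6) (n - k)))" for n
  proof (rule recurrence_solution[where h = "1 / q ^ 4"])
    fix n
    have e: "(q + q ^ 5) * q ^ 4 * (1 / q ^ 4) / q ^ 6 = 1 / q + 1 / q ^ 5" "q ^ 4 * (1 / q ^ 4) = 1" "1 / q ^ 4 * (q ^ 6) ^ n = (q ^ 6) ^ n / q ^ 4"
      "q ^ (6 * n) = (q ^ 6) ^ n"
      using q_pos by (simp_all add: power_mult field_simps power_numeral_reduce)
    show "(1 - (q ^ 6) ^ n) * (1 - 1 / q ^ 4 * (q ^ 6) ^ n) * S 1 wt5 n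
      + (- (q ^ 4 + q ^ 4 * (1 / q ^ 4)) + (q + q ^ 5) * q ^ 4 * (1 / q ^ 4) / q ^ 6 * (q ^ 6) ^ n) * (if n = 0 then 0 else S 1 wt5 (n - 1))
      + q ^ 4 * (q ^ 4 * (1 / q ^ 4)) * (if n \<le> 1 then 0 else S 1 wt5 (n - 2)) = 0"
      using S5_rec[of n] unfolding e by (simp only: add.commute[of 1 "q ^ 4"] mult_1_right)
  next
    show "r56 (q ^ 4) (1 / q ^ 4) 0 = S 1 wt5 0"
      unfolding r56_0 using q_pos by (simp add: S_def c2_def b3_def T3_def Li_def wt5_def qpoch_Suc)
  qed (use r56_Suc[OF \<eta>] hq_ne_1[OF \<eta>] in auto)
  have "h1 * q ^ 6 * q ^ 5 = q ^ 7 \<and> h1 * q ^ 6 * q = q ^ 3 \<and> h1 * q ^ 6 = q\<^sup>2" if "h1 = 1 / q ^ 4" for h1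
    using q_pos by (simp add: that power_numeral_reduce)
  note hh = this[OF refl]
  show ?thesis
    using Bailey_transform[where e = "q ^ 4" and \<eta> = "1 / q ^ 4" and cz = 1 and s = "S 1 wt5", OF _ \<eta> _ Lam5_sums] s q_pos hh by simp
qed

lemma Lam6_value:
  "Lam (X * (1 + K - X) * (ei 1 1 * ei q 3 * ep q 2))
    = N2 * ((1 + q + q\<^sup>2) / ((1 + q) * (1 + q\<^sup>2))) * qinf (- (q ^ 6)) (q ^ 6) *
      (qinf (q ^ 15) (q ^ 12) * qinf (q ^ 11) (q ^ 12) / qinf (q ^ 10) (q ^ 6))"
proof -
  \<comment> \<open>The initial value \<open>S 2 wt6 0\<close>: the weight 1 + q + q^2 at u = w = 1
    times \<open>Li 2\<close>.\<close>
  define s0 where "s0 = (1 + q + q\<^sup>2) / ((1 + q) * (1 + q\<^sup>2))"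
  have \<eta>: "0 < q ^ 4" "q ^ 4 * q ^ 6 < 1"
    using q_pos q_power_less[of 10] by (auto simp flip: power_add)
  have gen: "s * a * m = p * (s * b)" if "a * m = p * b" for s a m p b :: real
    using that by (metis mult.assoc mult.left_commute)
  have s: "S 2 wt6 n = (\<Sum>k\<le>n. s0 * r56 (q\<^sup>2) (q ^ 4) k * ((q\<^sup>2) ^ (n - k) / qpoch (q ^ 6) (q ^ 6) (n - k)))" for n
  proof (rule recurrence_solution[where h = "q ^ 4"])
    fix n
    have e: "(q + q ^ 5) * q\<^sup>2 * q ^ 4 / q ^ 6 = q + q ^ 5" "q\<^sup>2 * q ^ 4 = q ^ 6" "q\<^sup>2 * q ^ 6 = q ^ 8" "q ^ (6 * n) = (q ^ 6) ^ n"
      using q_pos by (simp_all add: power_mult power_numeral_reduce)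
    show "(1 - (q ^ 6) ^ n) * (1 - q ^ 4 * (q ^ 6) ^ n) * S 2 wt6 n
      + (- (q\<^sup>2 + q\<^sup>2 * q ^ 4) + (q + q ^ 5) * q\<^sup>2 * q ^ 4 / q ^ 6 * (q ^ 6) ^ n) * (if n = 0 then 0 else S 2 wt6 (n - 1))
      + q\<^sup>2 * (q\<^sup>2 * q ^ 4) * (if n \<le> 1 then 0 else S 2 wt6 (n - 2)) = 0"
      using S6_rec[of n] unfolding e .
  next
    show "s0 * r56 (q\<^sup>2) (q ^ 4) 0 = S 2 wt6 0"
      unfolding r56_0 using q_pos by (simp add: s0_def S_def c2_def b3_def T3_def Li_def wt6_def qpoch_Suc numeral_2_eq_2)
  next
    fix k
    show "s0 * r56 (q\<^sup>2) (q ^ 4) (Suc k) * ((1 - (q ^ 6) ^ Suc k) * (1 - q ^ 4 * (q ^ 6) ^ Suc k))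
      = q\<^sup>2 * q ^ 4 * ((1 - q * (q ^ 6) ^ k) * (1 - q ^ 5 * (q ^ 6) ^ k)) * (s0 * r56 (q\<^sup>2) (q ^ 4) k)"
      by (rule gen[OF r56_Suc[OF \<eta>]])
  qed (use hq_ne_1[OF \<eta>] in auto)
  have s': "S 2 wt6 n = s0 * (\<Sum>k\<le>n. r56 (q\<^sup>2) (q ^ 4) k * ((q\<^sup>2) ^ (n - k) / qpoch (q ^ 6) (q ^ 6) (n - k)))" for n
    unfolding s sum_distrib_left by (simp only: mult.assoc)
  have "q ^ 4 * q ^ 6 * q ^ 5 = q ^ 15" "q ^ 4 * q ^ 6 * q = q ^ 11" "q ^ 4 * q ^ 6 = q ^ 10"
    by (simp_all flip: power_add power_Suc2)
  then show ?thesis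
    using Bailey_transform[where e = "q\<^sup>2" and \<eta> = "q ^ 4", OF _ \<eta> s' Lam6_sums] q_pos unfolding s0_def by simp
qed

end

section \<open>The quintuple product\<close>

lemma has_sum_product_real:
  fixes f :: "'a \<Rightarrow> real" and g :: "'b \<Rightarrow> real"
  assumes "(f has_sum a) A" "(g has_sum b) B"
  shows "((\<lambda>(x, y). f x * g y) has_sum (a * b)) (A \<times> B)"
proof -
  have "(\<lambda>x. \<bar>f x\<bar>) summable_on A" "(\<lambda>y. \<bar>g y\<bar>) summable_on B"
    using assms summable_on_iff_abs_summable_on_real[of f A] summable_on_iff_abs_summable_on_real[of g B]
    by (auto simp: summable_on_def)
  then obtain a' b' where a': "((\<lambda>x. \<bar>f x\<bar>) has_sum a') A" and b': "((\<lambda>y. \<bar>g y\<bar>) has_sum b') B"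
    by (auto simp: summable_on_def)
  have "(\<lambda>(x, y). \<bar>f x\<bar> * \<bar>g y\<bar>) summable_on (A \<times> B)"
  proof (rule summable_on_SigmaI)
    show "((\<lambda>y. case (x, y) of (x, y) \<Rightarrow> \<bar>f x\<bar> * \<bar>g y\<bar>) has_sum \<bar>f x\<bar> * b') B" for x
      using has_sum_cmult_right[OF b'] by simp
    show "(\<lambda>x. \<bar>f x\<bar> * b') summable_on A"
      using has_sum_cmult_left[OF a'] unfolding summable_on_def by blast
  qed auto
  then have "(\<lambda>z. norm (case z of (x, y) \<Rightarrow> f x * g y)) summable_on (A \<times> B)"
    by (simp add: case_prod_unfold abs_mult)
  then have s: "(\<lambda>(x, y). f x * g y) summable_on (A \<times> B)" by (rule abs_summable_summable)
  show ?thesis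
  proof (rule has_sum_SigmaI[OF _ _ s])
    show "((\<lambda>y. case (x, y) of (x, y) \<Rightarrow> f x * g y) has_sum f x * b) B" for x
      using has_sum_cmult_right[OF assms(2)] by simp
    show "((\<lambda>x. f x * b) has_sum a * b) A" by (rule has_sum_cmult_left[OF assms(1)])
  qed
qed

lemma tri_int: "int n * (int n + 1) div 2 = int (tri n)"
proof -
  have "int n * (int n + 1) = 2 * int (tri n)" by (induction n) (simp_all add: algebra_simps)
  then show ?thesis by simp
qed

context small_q
begin

lemma tri_powers_summable: "summable (\<lambda>n. norm (z ^ n * q ^ tri n))" for z :: real
proof -
  have "(0 :: real) < 1 / 2" by simp
  then obtain C where C: "0 < C" "\<And>m. \<bar>z ^ m * q ^ tri m\<bar> \<le> C * (1 / 2) ^ m"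
    by (rule rapidE[OF rapid_scale[OF rapid_tri, of z]]) blast
  have "summable (\<lambda>m. C * (1 / 2) ^ m)" by (intro summable_mult summable_geometric) simp
  then show ?thesis
  proof (rule summable_comparison_test'[where N = 0])
    show "norm (norm (z ^ m * q ^ tri m)) \<le> C * (1 / 2) ^ m" for m
      using C(2)[of m] by (simp only: real_norm_def abs_abs)
  qed
qed

text \<open>The bilateral triple product, unfolded from \<open>triple_product\<close>: the indices m
  = n + 1 and m = -n together contribute (1 + y) d n. The division by 1 + y excludes y = -1.\<close>

lemma theta_has_sum:
  assumes y: "y \<noteq> 0" "y \<noteq> -1"
  shows "((\<lambda>m::int. y powi m * q powi (m * (m - 1) div 2)) has_sum
    (qinf (- y) q * qinf (- q / y) q * qinf q q)) UNIV"
proof -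
  let ?f = "\<lambda>m::int. y powi m * q powi (m * (m - 1) div 2)"
  define c where "c = y + 1 / y"
  define d where "d n = (y ^ Suc n + (1 / y) ^ n) / (1 + y)" for n
  have y1: "1 + y \<noteq> 0" using y(2) by (simp add: add_eq_0_iff)
  have d1: "(1 + y) * d n = y ^ Suc n + (1 / y) ^ n" for n using y1 by (simp add: d_def)
  have 1: "d 0 = 1" using y1 by (simp add: d_def add.commute)
  have "(1 + y) * d 1 = (1 + y) * (c - 1)" unfolding d1 using y(1) by (simp add: c_def field_simps)
  then have 2: "d 1 = c - 1" using y1 by simp
  have 3: "d (Suc (Suc n)) = c * d (Suc n) - d n" for n
  proof -
    define A B where "A = y ^ n" and "B = (1 / y) ^ n"
    have f: "(1 + y) * d (Suc (Suc n)) = y * y * y * A + B / y / y" "(1 + y) * d (Suc n) = y * y * A + B / y" "(1 + y) * d n = y * A + B"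
      unfolding d1 by (simp_all add: A_def B_def)
    have dd: "d n = P / (1 + y)" if "(1 + y) * d n = P" for n P
      using that y1 by (metis nonzero_mult_div_cancel_left)
    have k: "y * y * y * A + B / y / y = c * (y * y * A + B / y) - (y * A + B)"
      using y(1) by (simp add: c_def field_simps)
    show ?thesis unfolding dd[OF f(1)] dd[OF f(2)] dd[OF f(3)] k by (simp add: diff_divide_distrib)
  qed
  have Ac: "Ac c 1 = qinf (- y * q) q * qinf (- q / y) q"
  proof (rule LIMSEQ_unique[OF Ac_LIMSEQ])
    have "(1 - (- y * q) * w) * (1 - (- q / y) * w) = 1 + c * (q * w) + (q * w) * (q * w)" for w
      using y(1) by (simp add: c_def field_simps)
    moreover have "q ^ (1 + i) = q * q ^ i" "q ^ (2 * (1 + i)) = (q * q ^ i) * (q * q ^ i)" for i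
      by (simp_all add: mult_2 power_add)
    ultimately have "(\<Prod>i<N. 1 + c * q ^ (1 + i) + q ^ (2 * (1 + i))) = qpoch (- y * q) q N * qpoch (- q / y) q N" for N
      unfolding qpoch_def prod.distrib[symmetric] by (simp only:)
    then show "(\<lambda>N. \<Prod>i<N. 1 + c * q ^ (1 + i) + q ^ (2 * (1 + i))) \<longlonglongrightarrow> qinf (- y * q) q * qinf (- q / y) q"
      using tendsto_mult[OF qpoch_LIMSEQ[of q "- y * q"] qpoch_LIMSEQ[of q "- q / y"]] q_pos q_lt_1 by simp
  qed
  obtain a where a: "(\<lambda>n. y ^ n * q ^ tri n) sums a"
    using summable_norm_cancel[OF tri_powers_summable[of y]] by (auto simp: summable_def)
  obtain b where b: "(\<lambda>n. (1 / y) ^ n * q ^ tri n) sums b"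
    using summable_norm_cancel[OF tri_powers_summable[of "1 / y"]] by (auto simp: summable_def)
  have ab: "y * a + b = (1 + y) * (qinf q q * Ac c 1)"
  proof (rule sums_unique2)
    show "(\<lambda>n. y * (y ^ n * q ^ tri n) + (1 / y) ^ n * q ^ tri n) sums (y * a + b)"
      by (intro sums_add sums_mult a b)
    have e: "(1 + y) * (d n * q ^ tri n) = y * (y ^ n * q ^ tri n) + (1 / y) ^ n * q ^ tri n" for n
      unfolding mult.assoc[symmetric] d1 by (simp add: distrib_right)
    show "(\<lambda>n. y * (y ^ n * q ^ tri n) + (1 / y) ^ n * q ^ tri n) sums ((1 + y) * (qinf q q * Ac c 1))"
      using sums_mult[OF triple_product(2)[OF 1 2 3], of "1 + y"] unfolding e .
  qed
  have p: "(?f has_sum y * a) {1..}"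
  proof (rule iffD2[OF has_sum_reindex_bij_witness[where i = "\<lambda>n. int n + 1" and j = "\<lambda>m. nat (m - 1)" and T = UNIV
        and h = "\<lambda>n. y * (y ^ n * q ^ tri n)" and s' = "y * a"]])
    show "((\<lambda>n. y * (y ^ n * q ^ tri n)) has_sum y * a) UNIV"
      by (rule has_sum_cmult_right[OF norm_summable_imp_has_sum[OF tri_powers_summable a]])
    fix m :: int assume "m \<in> {1..}"
    then obtain n where "m - 1 = int n" using zero_le_imp_eq_int[of "m - 1"] by auto
    then have m: "m = int n + 1" by simp
    have e: "(int n + 1) * (int n + 1 - 1) div 2 = int (tri n)" using tri_int[of n] by (simp add: mult.commute)
    show "y * (y ^ nat (m - 1) * q ^ tri (nat (m - 1))) = ?f m"
      unfolding m e by (simp add: power_int_add y)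
  qed auto
  have n: "(?f has_sum b) {..0}"
  proof (rule iffD2[OF has_sum_reindex_bij_witness[where i = "\<lambda>n. - int n" and j = "\<lambda>m. nat (- m)" and T = UNIV
        and h = "\<lambda>n. (1 / y) ^ n * q ^ tri n" and s' = b]])
    show "((\<lambda>n. (1 / y) ^ n * q ^ tri n) has_sum b) UNIV"
      by (rule norm_summable_imp_has_sum[OF tri_powers_summable b])
    fix m :: int assume "m \<in> {..0}"
    then obtain n where "- m = int n" using zero_le_imp_eq_int[of "- m"] by auto
    then have m: "m = - int n" by simp
    have "(- int n) * (- int n - 1) = int n * (int n + 1)" by (simp add: algebra_simps)
    then have e: "(- int n) * (- int n - 1) div 2 = int (tri n)" using tri_int[of n] by simp
    show "(1 / y) ^ nat (- m) * q ^ tri (nat (- m)) = ?f m"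
      unfolding m e by (simp add: power_int_minus power_one_over inverse_eq_divide)
  qed auto
  have "qinf (- y) q = (1 + y) * qinf (- y * q) q"
    using qinf_rec[of q "- y"] q_pos q_lt_1 by simp
  then have v: "y * a + b = qinf (- y) q * qinf (- q / y) q * qinf q q"
    unfolding ab Ac by (simp add: mult_ac)
  have u: "{1..} \<union> {..0} = (UNIV :: int set)" by auto
  have "(?f has_sum (y * a + b)) ({1..} \<union> {..0})" by (rule has_sum_Un_disjoint[OF p n]) auto
  then show ?thesis unfolding u v .
qed

text \<open>The locale is closed under powers of q, which makes its results available in every base
  q^n.\<close>

lemma small_q_power: "1 \<le> n \<Longrightarrow> small_q (q ^ n)"
  using qs[of n] q_half by unfold_locales auto

text \<open>\<open>theta_has_sum\<close> in base q^(2d) with y = \<sigma> q^l; for \<sigma> = -1 the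
  condition l > 0 keeps y away from -1.\<close>

lemma theta_powers:
  assumes l: "l < 2 * d" and \<sigma>: "\<sigma> = 1 \<or> \<sigma> = - 1 \<and> 0 < l"
  shows "((\<lambda>m::int. \<sigma> powi m * q powi (int d * m * (m - 1) + int l * m)) has_sum
    (qinf (- \<sigma> * q ^ l) (q ^ (2 * d)) * qinf (- \<sigma> * q ^ (2 * d - l)) (q ^ (2 * d)) * qinf (q ^ (2 * d)) (q ^ (2 * d)))) UNIV"
proof -
  have nz: "\<sigma> * q ^ l \<noteq> 0" "\<sigma> * q ^ l \<noteq> - 1"
  proof -
    show "\<sigma> * q ^ l \<noteq> 0" using \<sigma> q_pos by auto
    from \<sigma> show "\<sigma> * q ^ l \<noteq> - 1"
    proof
      assume "\<sigma> = 1"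
      then have "\<sigma> * q ^ l = q ^ l" by simp
      then show ?thesis using qs(1)[of l] by linarith
    next
      assume "\<sigma> = - 1 \<and> 0 < l"
      then show ?thesis using qs(2)[of l] by simp
    qed
  qed
  have "q ^ (2 * d) = q ^ (2 * d - l) * q ^ l" using l by (simp flip: power_add)
  then have a: "- (q ^ (2 * d)) / (\<sigma> * q ^ l) = - \<sigma> * q ^ (2 * d - l)"
    using \<sigma> q_pos by auto
  have b: "(\<sigma> * q ^ l) powi m * (q ^ (2 * d)) powi (m * (m - 1) div 2)
      = \<sigma> powi m * q powi (int d * m * (m - 1) + int l * m)" for m
  proof -
    have pm: "(q ^ k) powi e = q powi (int k * e)" for k e
      by (simp add: power_int_mult)
    have "2 * (m * (m - 1) div 2) = m * (m - 1)" by simp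
    then have e: "int (2 * d) * (m * (m - 1) div 2) = int d * m * (m - 1)"
      by (metis mult.assoc mult.commute of_nat_mult of_nat_numeral)
    show ?thesis unfolding power_int_mult_distrib pm e using q_pos by (simp add: power_int_add)
  qed
  have "1 \<le> 2 * d" using l by simp
  from small_q.theta_has_sum[OF small_q_power[OF this] nz] show ?thesis
    unfolding b a by simp
qed

lemma dissect_24: "qinf (q ^ 24) (q ^ 24) = qinf (q ^ 24) (q ^ 72) * qinf (q ^ 48) (q ^ 72) * qinf (q ^ 72) (q ^ 72)"
proof -
  have "{..<3::nat} = {0, 1, 2}" by auto
  then show ?thesis using qinf_dissect[of "q ^ 24" 3 "q ^ 24"] qs[of 24]
    by (simp add: mult.assoc flip: power_mult power_add)
qed

text \<open>
  The product of the theta series with summation indices \<open>m\<close> and \<open>n\<close> is summed along the residue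
  of \<open>m + 2 n\<close> modulo 3; the residue class 2 contributes nothing.
\<close>

lemma quintuple_product:
  fixes r :: nat
  assumes r: "0 < r" "r < 6"
  shows "((\<lambda>(M::int, x::nat). (- 1) powi M * q powi (18 * M * M + (3 * int r - 6 + 12 * int x) * M + int r * int x)) has_sum
    (qinf (- (q ^ r)) (q ^ 12) * qinf (- (q ^ (12 - r))) (q ^ 12) * qinf (q ^ 12) (q ^ 12)
      * (qinf (q ^ (12 + 2 * r)) (q ^ 24) * qinf (q ^ (12 - 2 * r)) (q ^ 24)))) (UNIV \<times> {0, 1})"
proof -
  define J1 where "J1 m = q powi (6 * m * (m - 1) + int r * m)" for m :: int
  define J2 where "J2 n = (- 1) powi n * q powi (12 * n * (n - 1) + int (12 + 2 * r) * n)" for n :: int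
  define I where "I = qinf (q ^ 24) (q ^ 24)"
  define A where "A = qinf (- (q ^ r)) (q ^ 12) * qinf (- (q ^ (12 - r))) (q ^ 12) * qinf (q ^ 12) (q ^ 12)"
  define B where "B = qinf (q ^ (12 + 2 * r)) (q ^ 24) * qinf (q ^ (12 - 2 * r)) (q ^ 24)"
  have j1: "(J1 has_sum A) UNIV"
    using theta_powers[of r 6 1] r unfolding J1_def A_def by simp
  have j2: "(J2 has_sum B * I) UNIV"
    using theta_powers[of "12 + 2 * r" 12 "- 1"] r unfolding J2_def B_def I_def by simp
  \<comment> \<open>The change of variables: m + 2 n = 3 M + x with remainder x, and k = n -
    M.\<close>
  define i where "i = (\<lambda>((M::int, x::nat), k::int). (M + int x - 2 * k, k + M))"
  define F where "F b = (case i b of (m, n) \<Rightarrow> J1 m * J2 n)" for b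
  have ij: "i (((m + 2 * n) div 3, nat ((m + 2 * n) mod 3)), n - (m + 2 * n) div 3) = (m, n)" for m n
  proof -
    define D R where "D = (m + 2 * n) div 3" and "R = (m + 2 * n) mod 3"
    have "3 * D + R = m + 2 * n" unfolding D_def R_def by simp
    then have "D + R - 2 * (n - D) = m" "n - D + D = n" by simp_all
    note this[unfolded D_def R_def]
    moreover have "int (nat ((m + 2 * n) mod 3)) = (m + 2 * n) mod 3" by simp
    ultimately show ?thesis by (simp only: i_def prod.case)
  qed
  have "((\<lambda>(m, n). J1 m * J2 n) has_sum A * (B * I)) (UNIV \<times> UNIV) = (F has_sum A * (B * I)) (Sigma (UNIV \<times> {0, 1, 2}) (\<lambda>_. UNIV))"
  proof (rule has_sum_reindex_bij_witness[where i = i and j = "\<lambda>(m, n). (((m + 2 * n) div 3, nat ((m + 2 * n) mod 3)), n - (m + 2 * n) div 3)"], goal_cases)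
    case (1 a)
    obtain m n where a: "a = (m, n)" by force
    show ?case by (simp only: a prod.case ij)
  next
    case (2 a)
    obtain m n where a: "a = (m, n)" by force
    have "(m + 2 * n) mod 3 = 0 \<or> (m + 2 * n) mod 3 = 1 \<or> (m + 2 * n) mod 3 = 2" by presburger
    then show ?case by (auto simp: a)
  next
    case (3 b)
    obtain M x k where b: "b = ((M, x), k)" by (metis surj_pair)
    with 3 have x: "x = 0 \<or> x = 1 \<or> x = 2" by auto
    have N: "M + int x - 2 * k + 2 * (k + M) = int x + 3 * M" by simp
    have "(int x + 3 * M) div 3 = M" "(int x + 3 * M) mod 3 = int x" using x by auto
    then show ?case unfolding b i_def prod.case N by simp
  next
    case (5 a)
    obtain m n where a: "a = (m, n)" by force
    show ?case by (simp only: a prod.case ij F_def)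
  qed auto
  with has_sum_product_real[OF j1 j2] have F: "(F has_sum A * (B * I)) (Sigma (UNIV \<times> {0, 1, 2}) (\<lambda>_. UNIV))" by simp
  \<comment> \<open>The quadratic form decouples: no mixed term in M and k remains, so for each x
    the sum over k is a theta series of its own. For x = 0 and x = 1 it equals \<open>I\<close> by
    \<open>dissect_24\<close>.\<close>
  define t where "t = (\<lambda>(M::int, x::nat). (- 1) powi M * q powi (18 * M * M + (3 * int r - 6 + 12 * int x) * M + (6 * int x * int x - (6 - int r) * int x)))"
  have Feq: "F ((M, x), k) = t (M, x) * ((- 1) powi k * q powi (36 * k * k + (12 - 24 * int x) * k))" for M x k
  proof -
    have e: "(6 * (M + int x - 2 * k) * ((M + int x - 2 * k) - 1) + int r * (M + int x - 2 * k)) + (12 * (k + M) * ((k + M) - 1) + int (12 + 2 * r) * (k + M))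
      = (18 * M * M + (3 * int r - 6 + 12 * int x) * M + (6 * int x * int x - (6 - int r) * int x)) + (36 * k * k + (12 - 24 * int x) * k)"
      by (simp add: algebra_simps)
    have q0: "q \<noteq> 0" using q_pos by simp
    have "F ((M, x), k) = (- 1) powi (k + M) * (q powi (6 * (M + int x - 2 * k) * ((M + int x - 2 * k) - 1) + int r * (M + int x - 2 * k)) * q powi (12 * (k + M) * ((k + M) - 1) + int (12 + 2 * r) * (k + M)))"
      by (simp only: F_def i_def J1_def J2_def prod.case mult_ac)
    also have "\<dots> = ((- 1) powi k * (- 1) powi M) * (q powi (18 * M * M + (3 * int r - 6 + 12 * int x) * M + (6 * int x * int x - (6 - int r) * int x)) * q powi (36 * k * k + (12 - 24 * int x) * k))"
      unfolding power_int_add[of q, OF disjI1, OF q0, symmetric] e by (simp add: power_int_add)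
    finally show ?thesis by (simp add: t_def mult_ac)
  qed
  have in0: "((\<lambda>k::int. (- 1) powi k * q powi (36 * k * k + (12 - 24 * int 0) * k)) has_sum I) UNIV"
    and in1: "((\<lambda>k::int. (- 1) powi k * q powi (36 * k * k + (12 - 24 * int 1) * k)) has_sum I) UNIV"
  proof -
    have e: "36 * k * (k - 1) + 48 * k = 36 * k * k + (12 - 24 * int 0) * k" "36 * k * (k - 1) + 24 * k = 36 * k * k + (12 - 24 * int 1) * k" for k :: int
      by (simp_all add: algebra_simps)
    show "((\<lambda>k::int. (- 1) powi k * q powi (36 * k * k + (12 - 24 * int 0) * k)) has_sum I) UNIV"
      unfolding e[symmetric] I_def dissect_24 using theta_powers[of 48 36 "- 1"] by (simp add: mult_ac)
    show "((\<lambda>k::int. (- 1) powi k * q powi (36 * k * k + (12 - 24 * int 1) * k)) has_sum I) UNIV"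
      unfolding e[symmetric] I_def dissect_24 using theta_powers[of 24 36 "- 1"] by (simp add: mult_ac)
  qed
  define g where "g k = (- 1) powi k * q powi (36 * k * k + (12 - 24 * int 2) * k)" for k :: int
  \<comment> \<open>For x = 2 the substitution k \<mapsto> 1 - k changes the sign of every term, so
    the sum is its own negative. Summability comes from \<open>theta_powers\<close> with l = 0 and
    \<sigma> = 1.\<close>
  have in2: "(g has_sum 0) UNIV"
  proof -
    have e: "36 * k * (k - 1) + int 0 * k = 36 * k * k + (12 - 24 * int 2) * k" for k :: int
      by (simp add: algebra_simps)
    have "(\<lambda>k::int. q powi (36 * k * k + (12 - 24 * int 2) * k)) summable_on UNIV"
      using theta_powers[of 0 36 1] unfolding of_nat_numeral e summable_on_def power_int_1_left mult_1 by auto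
    moreover have "\<bar>g k\<bar> = q powi (36 * k * k + (12 - 24 * int 2) * k)" for k
      using q_pos by (simp add: g_def abs_mult power_int_abs)
    ultimately have "(\<lambda>k. norm (g k)) summable_on UNIV" by simp
    then obtain v where v: "(g has_sum v) UNIV" using abs_summable_summable summable_on_def by blast
    have "(g has_sum v) UNIV = ((\<lambda>k. - g k) has_sum v) UNIV"
    proof (rule has_sum_reindex_bij_witness[where i = "\<lambda>k. 1 - k" and j = "\<lambda>k. 1 - k"])
      fix k :: int
      have e1: "36 * (1 - k) * (1 - k) + (12 - 24 * int 2) * (1 - k) = 36 * k * k + (12 - 24 * int 2) * k"
        by (simp add: algebra_simps)
      have e2: "(- 1 :: real) powi (1 - k) = - ((- 1) powi k)"
        by (cases "even k") (simp_all add: power_int_minus_left)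
      show "- g (1 - k) = g k" unfolding g_def e1 e2 by simp
    qed auto
    with v have "((\<lambda>k. - g k) has_sum v) UNIV" by simp
    moreover have "((\<lambda>k. - g k) has_sum - v) UNIV" using has_sum_uminusI[OF v] .
    ultimately have "v = - v" by (rule has_sum_unique)
    with v show ?thesis by simp
  qed
  have "((\<lambda>(M, x). t (M, x) * (if x = 2 then 0 else I)) has_sum A * (B * I)) (UNIV \<times> {0, 1, 2})"
  proof (rule has_sum_SigmaD[OF F])
    fix z :: "int \<times> nat" assume "z \<in> UNIV \<times> {0, 1, 2}"
    then obtain M x where z: "z = (M, x)" and x: "x = 0 \<or> x = 1 \<or> x = 2" by auto
    have "((\<lambda>k::int. (- 1) powi k * q powi (36 * k * k + (12 - 24 * int x) * k)) has_sum (if x = 2 then 0 else I)) UNIV"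
      using x in0 in1 in2[unfolded g_def] by (elim disjE) simp_all
    from has_sum_cmult_right[OF this, of "t (M, x)"]
    show "((\<lambda>k. F (z, k)) has_sum (case z of (M, x) \<Rightarrow> t (M, x) * (if x = 2 then 0 else I))) UNIV"
      unfolding z Feq prod.case .
  qed
  also have "?this \<longleftrightarrow> ((\<lambda>(M, x). t (M, x) * I) has_sum A * (B * I)) (UNIV \<times> {0, 1})"
    by (rule has_sum_cong_neutral) auto
  finally have "((\<lambda>z. (case z of (M, x) \<Rightarrow> t (M, x) * I) * (1 / I)) has_sum A * (B * I) * (1 / I)) (UNIV \<times> {0, 1})"
    by (rule has_sum_cmult_left)
  moreover have "0 < I" unfolding I_def using qs[of 24] by (intro qinf_real_pos) auto
  ultimately have "((\<lambda>z. t z) has_sum A * B) (UNIV \<times> {0, 1})" by (simp add: case_prod_unfold)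
  also have "?this \<longleftrightarrow> ((\<lambda>(M::int, x::nat). (- 1) powi M * q powi (18 * M * M + (3 * int r - 6 + 12 * int x) * M + int r * int x)) has_sum A * B) (UNIV \<times> {0, 1})"
    by (rule has_sum_cong) (auto simp: t_def)
  finally show ?thesis unfolding A_def B_def .
qed

text \<open>Every triangular number occurs as \<open>\<nu> (\<nu> + 1) / 2\<close> for exactly two integers, \<open>\<nu>\<close> and \<open>-1 - \<nu>\<close>.\<close>

lemma fold_triangular:
  fixes a b :: nat
  assumes ab: "a < 6" "b < 6" "a \<noteq> b" "a + b \<noteq> 5"
  assumes S: "((\<lambda>(M::int, x). (- 1) powi M * q powi ((6 * M + int x) * (6 * M + int x + 1) div 2)) has_sum s) (UNIV \<times> {a, b})"
  shows "(\<lambda>n. (- 1) ^ (n div 6) * (if n mod 6 \<in> {a, b} then 1 else if n mod 6 \<in> {5 - a, 5 - b} then - 1 else 0) * q ^ tri n) sums s"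
proof -
  define f where "f n = (- 1) ^ (n div 6) * (if n mod 6 \<in> {a, b} then 1 else if n mod 6 \<in> {5 - a, 5 - b} then - 1 else 0) * q ^ tri n" for n
  define N where "N = {n. n mod 6 \<in> {a, b, 5 - a, 5 - b}}"
  \<comment> \<open>For M < 0 the index 6 M + x is replaced by its partner -1 - (6 M + x) = 6 (-M -
    1) + (5 - x), which has the same triangular number. The parity of -M - 1 differs from that of M,
    hence the values -1 in the claim.\<close>
  define i where "i = (\<lambda>(M::int, x::nat). if 0 \<le> M then 6 * nat M + x else 6 * nat (- M - 1) + (5 - x))"
  define j where "j n = (if n mod 6 \<in> {a, b} then (int (n div 6), n mod 6) else (- int (n div 6) - 1, 5 - n mod 6))" for n
  have dm: "(6 * k + x) div 6 = k" "(6 * k + x) mod 6 = x" if "x < 6" for k x :: nat using that by auto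
  have i: "i (int k, x) = 6 * k + x" "i (- int k - 1, x) = 6 * k + (5 - x)" for k x by (simp_all add: i_def)
  have opp: "5 - x \<notin> {a, b}" "5 - x \<in> {5 - a, 5 - b}" "x < 6" if "x \<in> {a, b}" for x
  proof -
    show "x < 6" "5 - x \<in> {5 - a, 5 - b}" using that ab by auto
    have "x = a \<or> x = b" using that by auto
    then have "5 - x \<noteq> a \<and> 5 - x \<noteq> b" using ab by presburger
    then show "5 - x \<notin> {a, b}" by simp
  qed
  have M: "(\<exists>k. M = int k) \<or> (\<exists>k. M = - int k - 1)" for M
  proof (cases "0 \<le> M")
    case False
    then have "M = - int (nat (- M - 1)) - 1" by simp
    then show ?thesis by blast
  qed (metis zero_le_imp_eq_int)
  have "((\<lambda>(M::int, x). (- 1) powi M * q powi ((6 * M + int x) * (6 * M + int x + 1) div 2)) has_sum s) (UNIV \<times> {a, b}) = (f has_sum s) N"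
  proof (rule has_sum_reindex_bij_witness[where i = j and j = i], goal_cases)
    case (1 z)
    then obtain M x where z: "z = (M, x)" and x: "x \<in> {a, b}" by auto
    note o = opp[OF x]
    from M[of M] show ?case
    proof (elim disjE exE)
      fix k assume "M = int k"
      then show ?thesis unfolding z j_def using i dm[OF o(3), of k] x by simp
    next
      fix k assume k: "M = - int k - 1"
      have "5 - x < 6" "5 - (5 - x) = x" using o(3) by auto
      then show ?thesis unfolding z j_def k i using dm[of "5 - x" k] o(1) by simp
    qed
  next
    case (2 z)
    then obtain M x where z: "z = (M, x)" and x: "x \<in> {a, b}" by auto
    note o = opp[OF x]
    from M[of M] show ?case
    proof (elim disjE exE)
      fix k assume "M = int k"
      then show ?thesis unfolding z N_def using i dm[OF o(3), of k] x by auto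
    next
      fix k assume k: "M = - int k - 1"
      show ?thesis unfolding z N_def k i using dm[of "5 - x" k] o(2) by simp
    qed
  next
    case (3 n)
    have "6 * (n div 6) + n mod 6 = n" "n mod 6 \<le> 5" by simp_all
    then show ?case by (simp add: j_def i)
  next
    case (4 n)
    then show ?case using ab by (auto simp: N_def j_def)
  next
    case (5 z)
    then obtain M x where z: "z = (M, x)" and x: "x \<in> {a, b}" by auto
    note o = opp[OF x]
    from M[of M] show ?case
    proof (elim disjE exE)
      fix k assume k: "M = int k"
      have "(6 * int k + int x) * (6 * int k + int x + 1) div 2 = int (tri (6 * k + x))"
        using tri_int[of "6 * k + x"] by simp
      then show ?thesis unfolding z k i f_def using dm[OF o(3), of k] x by simp
    next
      fix k assume k: "M = - int k - 1"
      define n where "n = 6 * k + (5 - x)"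
      have e: "6 * M + int x = - int n - 1" unfolding n_def k using o(3) by simp
      have "(6 * M + int x) * (6 * M + int x + 1) = int n * (int n + 1)" unfolding e by (simp add: algebra_simps)
      then have "(6 * M + int x) * (6 * M + int x + 1) div 2 = int (tri n)" by (simp only: tri_int)
      moreover have "(- 1 :: real) powi (- int k - 1) = - ((- 1) ^ k)"
        by (cases "even k") (simp_all add: power_int_minus_left)
      ultimately show ?thesis unfolding z prod.case k i f_def n_def[symmetric]
        using dm[of "5 - x" k] o(1,2) by (simp add: n_def)
    qed
  qed simp
  with S have "(f has_sum s) N" by simp
  also have "?this \<longleftrightarrow> (f has_sum s) UNIV"
    by (rule has_sum_cong_neutral) (auto simp: f_def N_def)
  finally show ?thesis unfolding f_def[symmetric] by (rule has_sum_imp_sums)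
qed

section \<open>The folded Chebyshev sequence at sqrt 3\<close>

definition chebL :: "real \<Rightarrow> nat \<Rightarrow> real" where
  "chebL s m = (if m = 0 then 1 else if m = 1 then s - 1 else if m = 2 then 2 - s
     else if m = 3 then s - 2 else if m = 4 then 1 - s else - 1)"

text \<open>The sequence d of \<open>triple_product\<close> for c = s with s^2 = 3. If s = y + 1/y,
  then y is a primitive twelfth root of unity with y^6 = -1, hence the change of sign after six
  steps.\<close>

definition cheb :: "real \<Rightarrow> nat \<Rightarrow> real" where
  "cheb s n = (- 1) ^ (n div 6) * chebL s (n mod 6)"

lemma cheb_rec:
  assumes s: "s * s = 3"
  shows "cheb s 0 = 1" "cheb s 1 = s - 1" "cheb s (Suc (Suc n)) = s * cheb s (Suc n) - cheb s n"
proof -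
  show "cheb s 0 = 1" "cheb s 1 = s - 1" by (simp_all add: cheb_def chebL_def)
  define k m where "k = n div 6" and "m = n mod 6"
  have n: "n = 6 * k + m" and m: "m < 6" by (simp_all add: k_def m_def)
  have c: "cheb s (6 * k + m) = (- 1) ^ k * chebL s m" if "m < 6" for k m
    using that by (simp add: cheb_def)
  consider "m < 4" | "m = 4" | "m = 5" using m by linarith
  then show "cheb s (Suc (Suc n)) = s * cheb s (Suc n) - cheb s n"
  proof cases
    case 1
    have "Suc n = 6 * k + (m + 1)" "Suc (Suc n) = 6 * k + (m + 2)" using n by simp_all
    then have e: "cheb s (Suc n) = (- 1) ^ k * chebL s (m + 1)" "cheb s (Suc (Suc n)) = (- 1) ^ k * chebL s (m + 2)"
      "cheb s n = (- 1) ^ k * chebL s m"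
      using c[of "m + 1" k] c[of "m + 2" k] c[of m k] 1 n by simp_all
    have "m = 0 \<or> m = 1 \<or> m = 2 \<or> m = 3" using 1 by linarith
    then have e2: "chebL s (m + 2) = s * chebL s (m + 1) - chebL s m"
      using s by (elim disjE) (simp_all add: chebL_def algebra_simps)
    show ?thesis unfolding e e2 by (simp add: algebra_simps)
  next
    case 2
    have "Suc n = 6 * k + 5" "Suc (Suc n) = 6 * Suc k + 0" using n 2 by simp_all
    then show ?thesis using c[of 5 k] c[of 0 "Suc k"] c[of 4 k] n 2 by (simp add: chebL_def algebra_simps)
  next
    case 3
    have "Suc n = 6 * Suc k + 0" "Suc (Suc n) = 6 * Suc k + 1" using n 3 by simp_all
    then show ?thesis using c[of 5 k] c[of 0 "Suc k"] c[of 1 "Suc k"] n 3 by (simp add: chebL_def algebra_simps)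
  qed
qed

lemma cheb_sums: assumes "s * s = 3" shows "(\<lambda>n. cheb s n * q ^ tri n) sums (qinf q q * Ac s 1)"
  by (rule triple_product(2)[OF cheb_rec[OF assms]])

text \<open>In the difference only the part odd in sqrt 3 survives; its coefficients are 0, 1 and -1
  with period twelve, and \<open>fold_triangular\<close> matches them with the quintuple product for
  r = 1. At k = 0 the factors 2 + sqrt 3 and 2 - sqrt 3 split off by \<open>Ac_rec\<close> enter the
  coefficients.\<close>

lemma theta_case7:
  "qinf q q * ((Ac (sqrt 3) 0 - Ac (- sqrt 3) 0) / (2 * sqrt 3))
    = qinf (- (q ^ 1)) (q ^ 12) * qinf (- (q ^ 11)) (q ^ 12) * qinf (q ^ 12) (q ^ 12)
      * (qinf (q ^ 14) (q ^ 24) * qinf (q ^ 10) (q ^ 24))" (is "_ = ?S")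
proof (rule sums_unique2)
  define s where "s = sqrt (3 :: real)"
  have s: "s * s = 3" "(- s) * (- s) = 3" "s > 0" by (simp_all add: s_def)
  have A: "Ac c 0 = (2 + c) * Ac c 1" for c using Ac_rec[of c 0] by simp
  let ?f = "\<lambda>n. (- 1) ^ (n div 6) * (if n mod 6 \<in> {0, 1} then 1 else if n mod 6 \<in> {5 - 0, 5 - 1} then - 1 else 0) * q ^ tri n"
  \<comment> \<open>The exponents agree for x = 1; for x = 0 they are 18 M^2 + 3 M against 18 M^2 -
    3 M, which M \<mapsto> -M repairs.\<close>
  have "((\<lambda>(M::int, x). (- 1) powi M * q powi ((6 * M + int x) * (6 * M + int x + 1) div 2)) has_sum ?S) (UNIV \<times> {0, 1})
    = ((\<lambda>(M::int, x::nat). (- 1) powi M * q powi (18 * M * M + (3 * int 1 - 6 + 12 * int x) * M + int 1 * int x)) has_sum ?S) (UNIV \<times> {0, 1})"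
  proof (rule has_sum_reindex_bij_witness[where i = "\<lambda>(M, x). (if x = 0 then - M else M, x)" and j = "\<lambda>(M, x). (if x = 0 then - M else M, x)"], goal_cases)
    case (5 z)
    then obtain M x where z: "z = (M, x)" and x: "x = 0 \<or> x = 1" by auto
    have "6 * M * (6 * M + 1) = 2 * (18 * M * M + 3 * M)" "(6 * M + 1) * (6 * M + 1 + 1) = 2 * (18 * M * M + 9 * M + 1)"
      by (simp_all add: algebra_simps)
    then have "6 * M * (6 * M + 1) div 2 = 18 * M * M + 3 * M" "(6 * M + 1) * (6 * M + 1 + 1) div 2 = 18 * M * M + 9 * M + 1"
      by simp_all
    moreover have "(- 1 :: real) powi (- M) = (- 1) powi M" by (cases "even M") (simp_all add: power_int_minus_left)
    ultimately show ?case using x unfolding z by (elim disjE) (simp_all add: algebra_simps)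
  qed (auto split: if_splits)
  moreover have "((\<lambda>(M::int, x::nat). (- 1) powi M * q powi (18 * M * M + (3 * int 1 - 6 + 12 * int x) * M + int 1 * int x)) has_sum ?S) (UNIV \<times> {0, 1})"
    using quintuple_product[of 1] by simp
  ultimately show "?f sums ?S" by (intro fold_triangular) simp_all
  have "(\<lambda>n. ((2 + s) * (cheb s n * q ^ tri n) - (2 + - s) * (cheb (- s) n * q ^ tri n)) / (2 * s)) sums
    (((2 + s) * (qinf q q * Ac s 1) - (2 + - s) * (qinf q q * Ac (- s) 1)) / (2 * s))"
    by (intro sums_divide sums_diff sums_mult cheb_sums s)
  moreover have "((2 + s) * (cheb s n * q ^ tri n) - (2 + - s) * (cheb (- s) n * q ^ tri n)) / (2 * s) = ?f n" for n
  proof -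
    define m where "m = n mod 6"
    have m: "m = 0 \<or> m = 1 \<or> m = 2 \<or> m = 3 \<or> m = 4 \<or> m = 5" unfolding m_def by presburger
    have "((2 + s) * chebL s m - (2 + - s) * chebL (- s) m) / (2 * s) = (if m \<in> {0, 1} then 1 else if m \<in> {5 - 0, 5 - 1} then - 1 else 0)"
      using m s by (elim disjE) (simp_all add: chebL_def algebra_simps)
    note e = this
    have "((2 + s) * (cheb s n * q ^ tri n) - (2 + - s) * (cheb (- s) n * q ^ tri n)) / (2 * s)
      = (- 1) ^ (n div 6) * (((2 + s) * chebL s m - (2 + - s) * chebL (- s) m) / (2 * s)) * q ^ tri n"
      by (simp add: cheb_def m_def algebra_simps diff_divide_distrib add_divide_distrib)
    then show ?thesis unfolding e unfolding m_def .
  qed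
  moreover have "((2 + s) * (qinf q q * Ac s 1) - (2 + - s) * (qinf q q * Ac (- s) 1)) / (2 * s)
      = qinf q q * ((Ac s 0 - Ac (- s) 0) / (2 * s))"
    unfolding A by (simp add: algebra_simps diff_divide_distrib add_divide_distrib)
  ultimately show "?f sums (qinf q q * ((Ac (sqrt 3) 0 - Ac (- sqrt 3) 0) / (2 * sqrt 3)))"
    unfolding s_def by simp
qed

text \<open>The same argument with the residues 1 and 3 and with r = 5. Each triangular number that
  occurs is one more than the corresponding exponent of the quintuple series, whence the factor
  q.\<close>

lemma theta_case7a:
  "qinf q q * ((Ac (sqrt 3) 1 - Ac (- sqrt 3) 1) / (2 * sqrt 3))
    = q * (qinf (- (q ^ 5)) (q ^ 12) * qinf (- (q ^ 7)) (q ^ 12) * qinf (q ^ 12) (q ^ 12)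
      * (qinf (q ^ 22) (q ^ 24) * qinf (q ^ 2) (q ^ 24)))" (is "_ = q * ?S")
proof (rule sums_unique2)
  define s where "s = sqrt (3 :: real)"
  have s: "s * s = 3" "(- s) * (- s) = 3" "s > 0" by (simp_all add: s_def)
  have q0: "q \<noteq> 0" using q_pos by simp
  let ?f = "\<lambda>n. (- 1) ^ (n div 6) * (if n mod 6 \<in> {1, 3} then 1 else if n mod 6 \<in> {5 - 1, 5 - 3} then - 1 else 0) * q ^ tri n"
  have "((\<lambda>(M::int, x). (- 1) powi M * q powi ((6 * M + int x) * (6 * M + int x + 1) div 2)) has_sum (q * ?S)) (UNIV \<times> {1, 3})
    = ((\<lambda>z. q * (case z of (M::int, x::nat) \<Rightarrow> (- 1) powi M * q powi (18 * M * M + (3 * int 5 - 6 + 12 * int x) * M + int 5 * int x))) has_sum (q * ?S)) (UNIV \<times> {0, 1})"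
  proof (rule has_sum_reindex_bij_witness[where i = "\<lambda>(M, x). (M, 1 + 2 * x)" and j = "\<lambda>(M, x). (M, (x - 1) div 2)"], goal_cases)
    case (5 z)
    then obtain M x where z: "z = (M, x)" and x: "x = 1 \<or> x = 3" by auto
    have "(6 * M + 1) * (6 * M + 1 + 1) = 2 * (18 * M * M + 9 * M + 1)" "(6 * M + 3) * (6 * M + 3 + 1) = 2 * (18 * M * M + 21 * M + 5 + 1)"
      by (simp_all add: algebra_simps)
    then have "(6 * M + 1) * (6 * M + 1 + 1) div 2 = 18 * M * M + 9 * M + 1" "(6 * M + 3) * (6 * M + 3 + 1) div 2 = 18 * M * M + 21 * M + 5 + 1"
      by simp_all
    note e = this
    have p: "q * q powi E = q powi (E + 1)" for E using q0 by (simp add: power_int_add)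
    from x show ?case
    proof
      assume "x = 1"
      then have "(case z of (M, x) \<Rightarrow> (- 1) powi M * q powi ((6 * M + int x) * (6 * M + int x + 1) div 2)) = (- 1) powi M * q powi ((6 * M + 1) * (6 * M + 1 + 1) div 2)"
        by (simp only: z prod.case of_nat_1)
      also have "\<dots> = (- 1) powi M * (q * q powi (18 * M * M + 9 * M))" unfolding e p ..
      finally show ?thesis using \<open>x = 1\<close> by (simp add: z mult_ac)
    next
      assume "x = 3"
      then have "(case z of (M, x) \<Rightarrow> (- 1) powi M * q powi ((6 * M + int x) * (6 * M + int x + 1) div 2)) = (- 1) powi M * q powi ((6 * M + 3) * (6 * M + 3 + 1) div 2)"
        by (simp only: z prod.case of_nat_numeral)
      also have "\<dots> = (- 1) powi M * (q * q powi (18 * M * M + 21 * M + 5))" unfolding e p ..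
      finally show ?thesis using \<open>x = 3\<close> by (simp add: z mult_ac)
    qed
  qed auto
  moreover have "((\<lambda>(M::int, x::nat). (- 1) powi M * q powi (18 * M * M + (3 * int 5 - 6 + 12 * int x) * M + int 5 * int x)) has_sum ?S) (UNIV \<times> {0, 1})"
    using quintuple_product[of 5] by simp
  note has_sum_cmult_right[OF this, of q]
  ultimately show "?f sums (q * ?S)" by (intro fold_triangular) simp_all
  have "(\<lambda>n. (cheb s n * q ^ tri n - cheb (- s) n * q ^ tri n) / (2 * s)) sums
    ((qinf q q * Ac s 1 - qinf q q * Ac (- s) 1) / (2 * s))"
    by (intro sums_divide sums_diff cheb_sums s)
  moreover have "(cheb s n * q ^ tri n - cheb (- s) n * q ^ tri n) / (2 * s) = ?f n" for n
  proof -
    define m where "m = n mod 6"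
    have m: "m = 0 \<or> m = 1 \<or> m = 2 \<or> m = 3 \<or> m = 4 \<or> m = 5" unfolding m_def by presburger
    have "(chebL s m - chebL (- s) m) / (2 * s) = (if m \<in> {1, 3} then 1 else if m \<in> {5 - 1, 5 - 3} then - 1 else 0)"
      using m s by (elim disjE) (simp_all add: chebL_def algebra_simps)
    note e = this
    have "(cheb s n * q ^ tri n - cheb (- s) n * q ^ tri n) / (2 * s)
      = (- 1) ^ (n div 6) * ((chebL s m - chebL (- s) m) / (2 * s)) * q ^ tri n"
      by (simp add: cheb_def m_def algebra_simps diff_divide_distrib add_divide_distrib)
    then show ?thesis unfolding e unfolding m_def .
  qed
  moreover have "(qinf q q * Ac s 1 - qinf q q * Ac (- s) 1) / (2 * s) = qinf q q * ((Ac s 1 - Ac (- s) 1) / (2 * s))"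
    by (simp add: algebra_simps diff_divide_distrib)
  ultimately show "?f sums (qinf q q * ((Ac (sqrt 3) 1 - Ac (- sqrt 3) 1) / (2 * sqrt 3)))"
    unfolding s_def by simp
qed

end

section \<open>Comparison of the products\<close>

text \<open>After removing the equal coefficients below n and dividing by x^n, the limit at 0 from
  the right gives the coefficient of index n. Only positive x are used, which is all that
  \<open>small_q\<close> offers.\<close>

lemma powser_eq_on_interval:
  fixes a b :: "nat \<Rightarrow> real"
  assumes \<epsilon>: "0 < \<epsilon>"
    and s: "\<And>x. 0 < x \<Longrightarrow> x < \<epsilon> \<Longrightarrow> \<exists>s. (\<lambda>n. a n * x ^ n) sums s \<and> (\<lambda>n. b n * x ^ n) sums s"
  shows "a n = b n"
proof (induction n rule: less_induct)
  case (less n)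
  define c where "c i = a (i + n) - b (i + n)" for i
  have z: "(\<lambda>i. c i * x ^ i) sums 0" if x: "0 < x" "x < \<epsilon>" for x
  proof -
    obtain s where s1: "(\<lambda>n. a n * x ^ n) sums s" and s2: "(\<lambda>n. b n * x ^ n) sums s" using s[OF x] by blast
    have "(\<lambda>i. (a i - b i) * x ^ i) sums 0" using sums_diff[OF s1 s2] by (simp add: left_diff_distrib)
    from sums_split_initial_segment[OF this, of n]
    have "(\<lambda>i. c i * x ^ (i + n)) sums 0" using less by (simp add: c_def)
    from sums_mult[OF this, of "1 / x ^ n"] show ?thesis using x(1) by (simp add: power_add mult_ac)
  qed
  have sm: "summable (\<lambda>i. c i * x ^ i)" if "norm x < \<epsilon>" for x
  proof -
    have "0 < (\<bar>x\<bar> + \<epsilon>) / 2" "(\<bar>x\<bar> + \<epsilon>) / 2 < \<epsilon>" using that \<epsilon> by auto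
    from sums_summable[OF z[OF this]] show ?thesis
      by (rule powser_inside) (use that \<epsilon> in simp)
  qed
  have "((\<lambda>x. \<Sum>i. c i * x ^ i) \<longlongrightarrow> c 0) (at 0)"
    by (rule powser_limit_0[OF \<epsilon>]) (use sm summable_sums in blast)
  then have "((\<lambda>x. \<Sum>i. c i * x ^ i) \<longlongrightarrow> c 0) (at_right 0)"
    by (rule tendsto_mono[OF at_le, rotated]) simp
  moreover have "((\<lambda>x. \<Sum>i. c i * x ^ i) \<longlongrightarrow> 0) (at_right 0)"
  proof (rule tendsto_eventually)
    show "\<forall>\<^sub>F x in at_right 0. (\<Sum>i. c i * x ^ i) = 0"
      using eventually_at_right_real[OF \<epsilon>] by eventually_elim (use z in \<open>auto simp: sums_iff\<close>)
  qed
  ultimately have "c 0 = 0" by (rule tendsto_unique[OF trivial_limit_at_right_real])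
  then show ?case by (simp add: c_def)
qed

context small_q
begin

section \<open>All products in base q^12\<close>

definition pp :: "nat \<Rightarrow> real" where "pp r = qinf (q ^ r) (q ^ 12)"

lemma pp_nonzero: assumes "1 \<le> r" shows "pp r \<noteq> 0"
proof -
  have "0 < pp r" unfolding pp_def using qs[of 12] qs(2)[OF assms] by (intro qinf_real_pos) auto
  then show ?thesis by simp
qed

lemma qinf_pp:
  assumes "b * k = 12"
  shows "qinf (q ^ a) (q ^ b) = (\<Prod>j<k. pp (a + b * j))"
proof -
  have b: "1 \<le> b" "0 < k" using assms by (cases b; cases k; simp)+
  have "qinf (q ^ a) (q ^ b) = (\<Prod>j<k. qinf (q ^ a * (q ^ b) ^ j) ((q ^ b) ^ k))"
    by (rule qinf_dissect) (use qs[of b] b in auto)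
  also have "\<dots> = (\<Prod>j<k. pp (a + b * j))"
    unfolding pp_def assms[symmetric] by (simp only: power_add power_mult)
  finally show ?thesis .
qed

lemma qinf_minus_power:
  assumes "1 \<le> a" "1 \<le> b"
  shows "qinf (- (q ^ a)) (q ^ b) = qinf (q ^ (2 * a)) (q ^ (2 * b)) / qinf (q ^ a) (q ^ b)"
proof -
  have "0 < qinf (q ^ a) (q ^ b)" using qs(1)[of b] qs(2)[OF assms(2)] qs(2)[OF assms(1)] by (intro qinf_real_pos) auto
  moreover have "qinf (q ^ a) (q ^ b) * qinf (- (q ^ a)) (q ^ b) = qinf ((q ^ a)\<^sup>2) ((q ^ b)\<^sup>2)"
    by (rule qinf_mult_minus) (use qs(1)[of b] qs(2)[OF assms(2)] in simp)
  ultimately show ?thesis by (simp add: field_simps flip: power_mult)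
qed

lemma qinf_step: assumes "1 \<le> b" shows "qinf (q ^ a) (q ^ b) = (1 - q ^ a) * qinf (q ^ (a + b)) (q ^ b)"
  using qinf_rec[of "q ^ b" "q ^ a"] qs[OF ] qs(1)[of b] qs(2)[OF assms] by (simp add: power_add)

lemma ranges: "{..<2::nat} = {0, 1}" "{..<4::nat} = {0, 1, 2, 3}" "{..<6::nat} = {0, 1, 2, 3, 4, 5}"
  "{..<12::nat} = {0, 1, 2, 3, 4, 5, 6, 7, 8, 9, 10, 11}"
  by (intro set_eqI, simp, presburger)+

lemma two: "Suc (Suc 0) = 2" by simp

lemma pp_products:
  "qinf q q = pp 1 * pp 2 * pp 3 * pp 4 * pp 5 * pp 6 * pp 7 * pp 8 * pp 9 * pp 10 * pp 11 * pp 12"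
  "qinf (q\<^sup>2) (q\<^sup>2) = pp 2 * pp 4 * pp 6 * pp 8 * pp 10 * pp 12"
  "qinf (q ^ 3) (q ^ 3) = pp 3 * pp 6 * pp 9 * pp 12"
  "qinf (q ^ 6) (q ^ 6) = pp 6 * pp 12"
  "qinf (q\<^sup>2) (q ^ 6) = pp 2 * pp 8"
  "qinf (q ^ 4) (q ^ 6) = pp 4 * pp 10"
  "qinf q (q ^ 6) = pp 1 * pp 7"
  "qinf (q ^ 5) (q ^ 6) = pp 5 * pp 11"
  using qinf_pp[of 1 12 1] qinf_pp[of 2 6 2] qinf_pp[of 3 4 3] qinf_pp[of 6 2 6] qinf_pp[of 6 2 2]
    qinf_pp[of 6 2 4] qinf_pp[of 6 2 1] qinf_pp[of 6 2 5]
  unfolding ranges by (simp_all add: mult_ac two)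

lemmas pp_nz = pp_nonzero[of 1, OF order_refl] pp_nonzero[of 2, simplified] pp_nonzero[of 3, simplified]
  pp_nonzero[of 4, simplified] pp_nonzero[of 5, simplified] pp_nonzero[of 6, simplified]
  pp_nonzero[of 7, simplified] pp_nonzero[of 8, simplified] pp_nonzero[of 9, simplified]
  pp_nonzero[of 10, simplified] pp_nonzero[of 11, simplified] pp_nonzero[of 12, simplified]

lemma pp_minus:
  "qinf (- q) q = 1 / (pp 1 * pp 3 * pp 5 * pp 7 * pp 9 * pp 11)"
  "qinf (- (q ^ 3)) (q ^ 3) = 1 / (pp 3 * pp 9)"
  "qinf (- (q ^ 6)) (q ^ 6) = 1 / pp 6"
  "qinf (- (q ^ 5)) (q ^ 6) = pp 10 / (pp 5 * pp 11)"
  "qinf (- q) (q ^ 6) = pp 2 / (pp 1 * pp 7)"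
proof -
  have 12: "qinf (q ^ 12) (q ^ 12) = pp 12" "qinf (q ^ 10) (q ^ 12) = pp 10" "qinf (q\<^sup>2) (q ^ 12) = pp 2" by (simp_all add: pp_def)
  show "qinf (- q) q = 1 / (pp 1 * pp 3 * pp 5 * pp 7 * pp 9 * pp 11)"
    using qinf_minus_power[of 1 1] pp_nz by (simp add: pp_products)
  show "qinf (- (q ^ 3)) (q ^ 3) = 1 / (pp 3 * pp 9)"
    using qinf_minus_power[of 3 3] pp_nz by (simp add: pp_products)
  show "qinf (- (q ^ 6)) (q ^ 6) = 1 / pp 6"
    using qinf_minus_power[of 6 6] pp_nz by (simp add: pp_products 12)
  show "qinf (- (q ^ 5)) (q ^ 6) = pp 10 / (pp 5 * pp 11)"
    using qinf_minus_power[of 5 6] by (simp add: pp_products 12)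
  show "qinf (- q) (q ^ 6) = pp 2 / (pp 1 * pp 7)"
    using qinf_minus_power[of 1 6] by (simp add: pp_products 12)
qed

lemma value5: "total (St pat_cond2 [[1,2,2]]) = 1 / (pp 1 * pp 2 * pp 5 * pp 6 * pp 8 * pp 9 * pp 11)"
proof -
  have "qinf (q ^ 7) (q ^ 12) = pp 7" "qinf (q ^ 3) (q ^ 12) = pp 3" by (simp_all add: pp_def)
  then show ?thesis unfolding total_case5 Lam5_value pp_products pp_minus using pp_nz by (simp add: divide_simps)
qed

lemma value6: "total (St pat_cond1 [[2],[1,2],[1,1,2]]) = 1 / (pp 1 * pp 4 * pp 5 * pp 6 * pp 7 * pp 9 * pp 10)"
proof -
  have n: "1 - q ^ 3 \<noteq> 0" "1 - q ^ 4 \<noteq> 0" "1 + q \<noteq> 0" "1 + q\<^sup>2 \<noteq> 0"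
    using qs(2)[of 3] qs(2)[of 4] q_pos by (auto simp: add_pos_pos less_imp_neq[symmetric])
  have "pp 3 = (1 - q ^ 3) * qinf (q ^ 15) (q ^ 12)" unfolding pp_def using qinf_step[of 12 3] by simp
  then have a: "qinf (q ^ 15) (q ^ 12) = pp 3 / (1 - q ^ 3)" using n by simp
  have "pp 4 * pp 10 = (1 - q ^ 4) * qinf (q ^ 10) (q ^ 6)" using qinf_step[of 6 4] pp_products(6) by simp
  then have b: "qinf (q ^ 10) (q ^ 6) = pp 4 * pp 10 / (1 - q ^ 4)" using n by simp
  have c: "qinf (q ^ 11) (q ^ 12) = pp 11" by (simp add: pp_def)
  \<comment> \<open>Multiplying numerator and denominator by 1 - q gives the two factors that bring
    q^15 and q^10 back to q^3 and q^4.\<close>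
  have d: "(1 + q + q\<^sup>2) / ((1 + q) * (1 + q\<^sup>2)) = (1 - q ^ 3) / (1 - q ^ 4)"
  proof -
    have "(1 + q + q\<^sup>2) * (1 - q ^ 4) = (1 - q ^ 3) * ((1 + q) * (1 + q\<^sup>2))" by (simp add: algebra_simps power_numeral_reduce)
    then show ?thesis using n by (simp add: frac_eq_eq)
  qed
  define u v where "u = 1 - q ^ 3" and "v = 1 - q ^ 4"
  have uv: "u \<noteq> 0" "v \<noteq> 0" using n by (simp_all add: u_def v_def)
  show ?thesis unfolding total_case6 Lam6_value pp_minus a b c d u_def[symmetric] v_def[symmetric]
    using pp_nz uv by (simp add: divide_simps)
qed

text \<open>From (1 - y + y^2)(1 + y) = 1 + y^3: the product is (-q^3;q^3)_inf divided by
  (-q;q)_inf.\<close>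

lemma Ac_minus_1: "Ac (- 1) 1 = pp 1 * pp 5 * pp 7 * pp 11"
proof -
  have id: "(1 + - 1 * y + y * y) * (1 - - y) = 1 - - (y ^ 3)" for y :: real
    by (simp add: algebra_simps power_numeral_reduce)
  have pw: "q ^ (2 * (1 + i)) = q ^ (1 + i) * q ^ (1 + i)" for i by (simp add: mult_2 power_add)
  have b: "1 - - q * q ^ i = 1 - - (q ^ (1 + i))" "1 - - (q ^ 3) * (q ^ 3) ^ i = 1 - - ((q ^ (1 + i)) ^ 3)" for i
    by (simp_all add: power_mult_distrib mult.commute flip: power_mult)
  have "(\<lambda>N. (\<Prod>i<N. 1 + - 1 * q ^ (1 + i) + q ^ (2 * (1 + i))) * qpoch (- q) q N) \<longlonglongrightarrow> Ac (- 1) 1 * qinf (- q) q"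
    by (intro tendsto_mult Ac_LIMSEQ qpoch_LIMSEQ) (use q_pos q_lt_1 in simp)
  moreover have "(\<Prod>i<N. 1 + - 1 * q ^ (1 + i) + q ^ (2 * (1 + i))) * qpoch (- q) q N = qpoch (- (q ^ 3)) (q ^ 3) N" for N
    unfolding qpoch_def prod.distrib[symmetric] b pw id ..
  ultimately have "qpoch (- (q ^ 3)) (q ^ 3) \<longlonglongrightarrow> Ac (- 1) 1 * qinf (- q) q" by simp
  then have "qinf (- (q ^ 3)) (q ^ 3) = Ac (- 1) 1 * qinf (- q) q"
    by (intro qinf_eqI) (use qs[of 3] in auto)
  then show ?thesis unfolding pp_minus using pp_nz by (simp add: divide_simps mult_ac)
qed

lemma pp_theta:
  assumes "1 \<le> r" "r < 12"
  shows "qinf (- (q ^ r)) (q ^ 12) = qinf (q ^ (2 * r)) (q ^ 24) / pp r"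
  unfolding pp_def using qinf_minus_power[of r 12] assms by simp

lemma pp_halves: "pp r = qinf (q ^ r) (q ^ 24) * qinf (q ^ (r + 12)) (q ^ 24)"
proof -
  have "pp r = (\<Prod>j<2. qinf (q ^ r * (q ^ 12) ^ j) ((q ^ 12)\<^sup>2))"
    unfolding pp_def by (rule qinf_dissect) (use qs[of 12] in auto)
  also have "\<dots> = qinf (q ^ r) ((q ^ 12)\<^sup>2) * qinf (q ^ r * q ^ 12) ((q ^ 12)\<^sup>2)" by (simp add: ranges)
  also have "(q ^ 12)\<^sup>2 = q ^ 24" by (simp flip: power_mult)
  finally show ?thesis by (simp only: power_add)
qed

lemma value7:
  "total (St pat7 [[1,1],[2,2,2],[1,2,2,2]]) = 1 / (pp 1 * pp 3 * pp 4 * pp 6 * pp 8 * pp 9 * pp 11)"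
  "total (St pat7 [[1],[2]]) = 1 / (pp 3 * pp 4 * pp 5 * pp 6 * pp 7 * pp 8 * pp 9)"
proof -
  have q12: "qinf (q ^ 12) (q ^ 12) = pp 12" by (simp add: pp_def)
  have g: "V k = Ac (- 1) 1 * ((Ac (sqrt 3) k - Ac (- sqrt 3) k) / (2 * sqrt 3)) / q ^ k" for k
    unfolding V_eq Wv_def by simp
  have q: "qinf q q \<noteq> 0" unfolding pp_products using pp_nz by simp
  define D0 D1 where "D0 = (Ac (sqrt 3) 0 - Ac (- sqrt 3) 0) / (2 * sqrt 3)" and "D1 = (Ac (sqrt 3) 1 - Ac (- sqrt 3) 1) / (2 * sqrt 3)"
  have t0: "qinf q q * D0 = pp 2 * pp 10 * pp 12 / (pp 1 * pp 11)"
    unfolding theta_case7[folded D0_def] q12 pp_halves[of 2] pp_halves[of 10] using pp_theta[of 1] pp_theta[of 11] by simp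
  have t1: "qinf q q * D1 = q * (pp 2 * pp 10 * pp 12 / (pp 5 * pp 7))"
    unfolding theta_case7a[folded D1_def] q12 pp_halves[of 2] pp_halves[of 10] using pp_theta[of 5] pp_theta[of 7] by simp
  have "total (St pat7 [[1,1],[2,2,2],[1,2,2,2]]) = V 0" unfolding total_case7 V_def by simp
  also have "\<dots> = Ac (- 1) 1 * D0" unfolding g D0_def by simp
  also have "D0 = pp 2 * pp 10 * pp 12 / (pp 1 * pp 11) / qinf q q" using t0 q by (metis nonzero_mult_div_cancel_left)
  finally show "total (St pat7 [[1,1],[2,2,2],[1,2,2,2]]) = 1 / (pp 1 * pp 3 * pp 4 * pp 6 * pp 8 * pp 9 * pp 11)"
    unfolding Ac_minus_1 pp_products using pp_nz by (simp add: divide_simps mult_ac)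
  have "total (St pat7 [[1],[2]]) = V 1" unfolding total_case7 V_def by simp
  also have "\<dots> = Ac (- 1) 1 * (D1 / q)" unfolding g D1_def by simp
  also have "D1 / q = pp 2 * pp 10 * pp 12 / (pp 5 * pp 7) / qinf q q"
  proof -
    have "D1 = q * (pp 2 * pp 10 * pp 12 / (pp 5 * pp 7)) / qinf q q" using t1 q by (metis nonzero_mult_div_cancel_left)
    then show ?thesis using q_pos by simp
  qed
  finally show "total (St pat7 [[1],[2]]) = 1 / (pp 3 * pp 4 * pp 5 * pp 6 * pp 7 * pp 8 * pp 9)"
    unfolding Ac_minus_1 pp_products using pp_nz by (simp add: divide_simps mult_ac)
qed

lemma mu8_0_pp: "mu8 0 = 1 / (pp 2 * pp 3 * pp 4 * pp 8 * pp 9 * pp 10)"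
  unfolding mu8_0 pp_minus pp_products using pp_nz by (simp add: divide_simps)

lemma value8: "total (St pat8 [[1]]) = 1 / (pp 2 * pp 3 * pp 4 * pp 5 * pp 8 * pp 9 * pp 11)"
proof -
  have "- (q\<^sup>2) * q ^ 3 = - (q ^ 5)" by (simp flip: power_add)
  then show ?thesis unfolding total_case8 F8_mu8 mu8_0_pp by (simp add: pp_minus pp_nz)
qed

lemma value8a: "total (St pat8a [[1,1],[1,2,3],[2,2,3]]) = 1 / (pp 1 * pp 3 * pp 4 * pp 7 * pp 8 * pp 9 * pp 10)"
proof -
  have e: "- (q ^ 4) * q ^ 3 = - (q ^ 7)" by (simp flip: power_add)
  have "- q * q ^ 6 = - (q ^ 7)" by (simp flip: power_Suc)
  \<comment> \<open>The factor 1 + q is the missing first factor of (-q; q^6)_inf.\<close>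
  then have "(1 + q) * qinf (- (q ^ 7)) (q ^ 6) = qinf (- q) (q ^ 6)"
    using qinf_rec[of "q ^ 6" "- q"] qs[of 6] by simp
  then have "(1 + q) * (mu8 0 * qinf (- (q ^ 7)) (q ^ 6)) = mu8 0 * qinf (- q) (q ^ 6)" by simp
  then show ?thesis unfolding total_case8a case8a_F8 F8_mu8 e mu8_0_pp pp_minus by (simp add: pp_nz)
qed

end

text \<open>The return from real q to coefficients: on the interval (0, 1/2) both counting sequences
  have convergent generating series with the same value.\<close>

lemma count_restricted_eq:
  assumes R: "\<And>p. p \<in> Par \<Longrightarrow> R p \<longleftrightarrow> p \<in> St P W"
    and S: "S \<subseteq> {1..12}"
    and t: "\<And>q. small_q q \<Longrightarrow> small_q.total q (St P W) = (\<Prod>r\<in>S. 1 / qinf (q ^ r) (q ^ 12))"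
  shows "count_restricted R n = count_residues_mod12 S n"
proof -
  have "{p \<in> partitions_of N. R p} = {p \<in> St P W. sum_list p = N}" for N
    using R by (auto simp: partitions_of_def Par_def St_def)
  then have c: "count_restricted R N = card {p \<in> St P W. sum_list p = N}" for N
    by (simp add: count_restricted_def)
  have "real (count_restricted R n) = real (count_residues_mod12 S n)"
  proof (rule powser_eq_on_interval[of "1 / 2" "\<lambda>n. real (count_restricted R n)" "\<lambda>n. real (count_residues_mod12 S n)"])
    fix q :: real assume "0 < q" "q < 1 / 2"
    then interpret small_q q by unfold_locales
    have "St P W \<subseteq> Par" by (auto simp: St_def)
    from total_card[OF this] residues_sums[OF S]
    show "\<exists>s. (\<lambda>n. real (count_restricted R n) * q ^ n) sums s \<and> (\<lambda>n. real (count_residues_mod12 S n) * q ^ n) sums s"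
      unfolding c t[OF small_q_axioms] by blast
  qed simp
  then show ?thesis by simp
qed

theorem corollary1p3:
  fixes n :: nat
  shows "(count_restricted (\<lambda>p. satisfies_condition 2 p \<and> avoids p [1, 2, 2]) n
     = count_residues_mod12 {1, 2, 5, 6, 8, 9, 11} n) \<and>
    (count_restricted (\<lambda>p. satisfies_condition 1 p \<and> 2 \<notin> set p) n
     = count_residues_mod12 {1, 4, 5, 6, 7, 9, 10} n) \<and>
    (count_restricted (\<lambda>p. avoids p [1, 1] \<and> avoids p [2, 2, 2]
        \<and> (\<forall>W\<in>{P2, P3, P4, P5, P9}. avoids_family p W)) n
     = count_residues_mod12 {1, 3, 4, 6, 8, 9, 11} n) \<and>
    (count_restricted (\<lambda>p. (\<forall>x\<in>set p. 3 \<le> x)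
        \<and> (\<forall>W\<in>{P2, P3, P4, P5, P9}. avoids_family p W)) n
     = count_residues_mod12 {3, 4, 5, 6, 7, 8, 9} n) \<and>
    (count_restricted (\<lambda>p. 1 \<notin> set p
        \<and> (\<forall>W\<in>{P1, P2, P7, P8, P11}. avoids_family p W)) n
     = count_residues_mod12 {2, 3, 4, 5, 8, 9, 11} n) \<and>
    (count_restricted (\<lambda>p. avoids p [1, 1] \<and> avoids p [1, 2, 3] \<and> avoids p [2, 2, 3]
        \<and> (\<forall>W\<in>{P1, P3, P6, P8, P10}. avoids_family p W)) n
     = count_residues_mod12 {1, 3, 4, 7, 8, 9, 10} n)"
proof (intro conjI)
  show "count_restricted (\<lambda>p. satisfies_condition 2 p \<and> avoids p [1, 2, 2]) n
     = count_residues_mod12 {1, 2, 5, 6, 8, 9, 11} n"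
    by (rule count_restricted_eq[OF restrict5], assumption, simp, simp only: small_q.value5, simp add: small_q.pp_def mult_ac)
  show "count_restricted (\<lambda>p. satisfies_condition 1 p \<and> 2 \<notin> set p) n
     = count_residues_mod12 {1, 4, 5, 6, 7, 9, 10} n"
    by (rule count_restricted_eq[OF restrict6], assumption, simp, simp only: small_q.value6, simp add: small_q.pp_def mult_ac)
  show "count_restricted (\<lambda>p. avoids p [1, 1] \<and> avoids p [2, 2, 2]
        \<and> (\<forall>W\<in>{P2, P3, P4, P5, P9}. avoids_family p W)) n
     = count_residues_mod12 {1, 3, 4, 6, 8, 9, 11} n"
    by (rule count_restricted_eq[OF restrict7], assumption, simp, simp only: small_q.value7(1), simp add: small_q.pp_def mult_ac)
  show "count_restricted (\<lambda>p. (\<forall>x\<in>set p. 3 \<le> x)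
        \<and> (\<forall>W\<in>{P2, P3, P4, P5, P9}. avoids_family p W)) n
     = count_residues_mod12 {3, 4, 5, 6, 7, 8, 9} n"
    by (rule count_restricted_eq[OF restrict7a], assumption, simp, simp only: small_q.value7(2), simp add: small_q.pp_def mult_ac)
  show "count_restricted (\<lambda>p. 1 \<notin> set p
        \<and> (\<forall>W\<in>{P1, P2, P7, P8, P11}. avoids_family p W)) n
     = count_residues_mod12 {2, 3, 4, 5, 8, 9, 11} n"
    by (rule count_restricted_eq[OF restrict8], assumption, simp, simp only: small_q.value8, simp add: small_q.pp_def mult_ac)
  show "count_restricted (\<lambda>p. avoids p [1, 1] \<and> avoids p [1, 2, 3] \<and> avoids p [2, 2, 3]
        \<and> (\<forall>W\<in>{P1, P3, P6, P8, P10}. avoids_family p W)) n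
     = count_residues_mod12 {1, 3, 4, 7, 8, 9, 10} n"
    by (rule count_restricted_eq[OF restrict8a], assumption, simp, simp only: small_q.value8a, simp add: small_q.pp_def mult_ac)
qed

end
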